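(* Let $D_p$ and $D_q$ be two checkerboard-shaded link diagrams in the plane, with VSE-state sums $p=ss(D_p)$ and $q=ss(D_q)$. If $D_p$ can be transformed into $D_q$ by planar isotopies and a finite sequence of Reidemeister moves 2 and 3 (the shading being carried along by each move), then $$\eta_\infty(p)=\eta_\infty(q).$$ That is, $\eta_\infty(ss(\cdot))$ (the VSE-invariant) is a regular isotopy invariant of links.
   Context: Shaded diagrams. The faces of a link diagram in the plane are 2-colored (shaded/white) in checkerboard fashion, so that faces sharing an edge have different colors. A Reidemeister move (inside a disc) carries the shading to the unique checkerboard shading of the new diagram that agrees with the old one outside the disc. Regular isotopy is the equivalence relation generated by planar isotopy and Reidemeister moves 2 and 3 (not move 1). Crossing types. A crossing is of type $X1$ if the region swept by rotating the overpass counterclockwise to the underpass is shaded, and of type $X2$ if this region is white. Give the edges of the diagram distinct labels. A crossing whose four edge-ends are, in counterclockwise cyclic order, $a,b,c,d$, where $a,c$ are the ends of the underpass, is encoded by the symbol $X1[a,b,c,d]$ or $X2[a,b,c,d]$ according to its type. (The two choices of starting underpass end give the same expansion below.) Expansion. Work in $\mathbb{Z}[A,B,F,X,Y,Z,M,o]$. Let $\mathrm{con}[xy]=\mathrm{con}[yx]$ be formal commuting symbols (arcs joining labels $x$ and $y$). Expand $$X1[a,b,c,d]\to MA\,\mathrm{con}[ab]\mathrm{con}[cd]+MB\,\mathrm{con}[ad]\mathrm{con}[bc]+F\,\mathrm{con}[ac]\mathrm{con}[bd],$$ $$X2[a,b,c,d]\to MX\,\mathrm{con}[ab]\mathrm{con}[cd]+MY\,\mathrm{con}[ad]\mathrm{con}[bc]+Z\,\mathrm{con}[ac]\mathrm{con}[bd],$$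 and simplify products by $\mathrm{con}[ab]\mathrm{con}[bc]\to\mathrm{con}[ac]$, $\mathrm{con}[ab]\mathrm{con}[ba]\to\mathrm{con}[aa]$, $\mathrm{con}[aa]\to o$. For a product $P$ of symbols $X1,X2,\mathrm{con}$ in which every label occurs exactly twice, this gives a polynomial $[P]\in\mathbb{Z}[A,B,F,X,Y,Z,M,o]$. The VSE-state sum $ss(D)$ of a shaded diagram $D$ is $[P]$ for $P$ the product of the symbols of all its crossings, multiplied by one factor $o$ for each crossingless component. The ideal $\mathcal{I}_\infty$. Consider the four pairs $(L,R)$: (2.1) $L=X1[a,b,f,e]\,X2[d,e,f,c]$, $R=\mathrm{con}[ad]\mathrm{con}[bc]$; (2.2) $L=X2[a,b,f,e]\,X1[d,e,f,c]$, $R=\mathrm{con}[ad]\mathrm{con}[bc]$; (3.1) $L=X1[a,b,h,g]\,X2[i,e,f,g]\,X2[h,c,d,i]$, $R=X1[a,i,h,f]\,X1[c,g,i,b]\,X2[h,g,d,e]$; (3.2) $L=X2[a,b,h,g]\,X1[i,e,f,g]\,X1[h,c,d,i]$, $R=X2[a,i,h,f]\,X2[c,g,i,b]\,X1[h,g,d,e]$. The boundary labels are $a,b,c,d$ for (2.1),(2.2) and $a,b,c,d,e,f$ for (3.1),(3.2). For each pair and each perfect matching $\epsilon$ of its boundary labels (3 matchings for the first two pairs, 15 for the last two), let $E_\epsilon=\prod_{\{x,y\}\in\epsilon}\mathrm{con}[xy]$ and take the polynomial $[L\,E_\epsilon]-[R\,E_\epsilon]$. $\mathcal{I}_\infty$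 is the ideal generated by these 36 polynomials (27 of them are distinct). Normal form. $\eta_\infty(p)$ is the normal form (remainder) of the polynomial $p$ with respect to the Gröbner basis of $\mathcal{I}_\infty$ for the lexicographic monomial order with variable order $A,B,F,X,Y,Z,M,o$, computed over the coefficient field $\mathbb{Q}$; thus $\eta_\infty(p)=\eta_\infty(q)$ iff $p-q$ lies in the ideal generated by $\mathcal{I}_\infty$ in $\mathbb{Q}[A,B,F,X,Y,Z,M,o]$. *)

theory Defs
  imports "HOL-Analysis.Analysis" "HOL-Library.Poly_Mapping"
begin

section \<open>Shaded link diagrams in the plane\<close>

text \<open>
  The plane is \<^typ>\<open>complex\<close>. A link diagram is given by finitely many closed regular \<open>C\<^sup>1\<close> curves
  (1-periodic parametrisations, numbered by \<open>{..<ncomp D}\<close>) whose only singularities are finitely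
  many transverse double points. A parameter is a pair \<open>(i, s)\<close> of a curve and a real number;
  \<open>over D\<close> tells which of the two parameters of a crossing lies on the overpass, and its values
  at other parameters carry no information. \<open>shaded D\<close> is the union of the shaded faces.
\<close>

record shaded_diagram =
  ncomp :: nat
  curve :: "nat \<Rightarrow> real \<Rightarrow> complex"
  over :: "(nat \<times> real) set"
  shaded :: "complex set"

definition params :: "shaded_diagram \<Rightarrow> (nat \<times> real) set" where
  "params D = {..<ncomp D} \<times> UNIV"

definition same_param :: "nat \<times> real \<Rightarrow> nat \<times> real \<Rightarrow> bool" where
  "same_param p q \<longleftrightarrow> fst p = fst q \<and> snd p - snd q \<in> \<int>"

definition pt :: "shaded_diagram \<Rightarrow> nat \<times> real \<Rightarrow> complex" where
  "pt D p = curve D (fst p) (snd p)"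

definition vel :: "shaded_diagram \<Rightarrow> nat \<times> real \<Rightarrow> complex" where
  "vel D p = vector_derivative (curve D (fst p)) (at (snd p))"

definition drawing :: "shaded_diagram \<Rightarrow> complex set" where
  "drawing D = pt D ` params D"

definition double_point :: "shaded_diagram \<Rightarrow> nat \<times> real \<Rightarrow> nat \<times> real \<Rightarrow> bool" where
  "double_point D p q \<longleftrightarrow>
     p \<in> params D \<and> q \<in> params D \<and> \<not> same_param p q \<and> pt D p = pt D q"

definition crossing_param :: "shaded_diagram \<Rightarrow> nat \<times> real \<Rightarrow> bool" where
  "crossing_param D p \<longleftrightarrow> (\<exists>q. double_point D p q)"

definition crossings :: "shaded_diagram \<Rightarrow> complex set" where
  "crossings D = pt D ` {p. crossing_param D p}"

text \<open>\<open>Im (cnj u * w)\<close> is the determinant of the pair of plane vectors \<open>u, w\<close>.\<close>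

definition link_diagram :: "shaded_diagram \<Rightarrow> bool" where
  "link_diagram D \<longleftrightarrow>
     (\<forall>i<ncomp D. curve D i C1_differentiable_on UNIV \<and> (\<forall>s. curve D i (s + 1) = curve D i s)) \<and>
     (\<forall>p\<in>params D. vel D p \<noteq> 0) \<and>
     finite (crossings D) \<and>
     (\<forall>p q. double_point D p q \<longrightarrow> Im (cnj (vel D p) * vel D q) \<noteq> 0) \<and>
     (\<forall>p q r. double_point D p q \<and> double_point D q r \<longrightarrow> same_param p r) \<and>
     (\<forall>i s. (i, s + 1) \<in> over D \<longleftrightarrow> (i, s) \<in> over D) \<and>
     (\<forall>p q. double_point D p q \<longrightarrow> (p \<in> over D \<longleftrightarrow> q \<notin> over D))"

text \<open>
  The faces are the connected components of the complement of the diagram. The second conjunct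
  compares the faces on the left and on the right of each edge.
\<close>

definition checkerboard :: "shaded_diagram \<Rightarrow> bool" where
  "checkerboard D \<longleftrightarrow>
     (\<exists>\<F> \<subseteq> components (- drawing D). shaded D = \<Union>\<F>) \<and>
     (\<forall>p\<in>params D. \<not> crossing_param D p \<longrightarrow>
        (\<forall>\<^sub>F \<epsilon> in at_right 0.
           (pt D p + of_real \<epsilon> * (\<i> * vel D p) \<in> shaded D) \<noteq>
           (pt D p - of_real \<epsilon> * (\<i> * vel D p) \<in> shaded D)))"

definition shaded_link_diagram :: "shaded_diagram \<Rightarrow> bool" where
  "shaded_link_diagram D \<longleftrightarrow> link_diagram D \<and> checkerboard D"


section \<open>Regular isotopy\<close>

subsection \<open>Planar isotopy\<close>

definition ambient_isotopy :: "(real \<Rightarrow> complex \<Rightarrow> complex) \<Rightarrow> bool" where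
  "ambient_isotopy H \<longleftrightarrow>
     H 0 = id \<and>
     continuous_on ({0..1} \<times> UNIV) (\<lambda>(t, z). H t z) \<and>
     (\<forall>t\<in>{0..1}. bij (H t)) \<and>
     (\<exists>H'. (\<forall>t\<in>{0..1}. \<forall>z. (H t has_derivative H' t z) (at z) \<and> bij (H' t z)) \<and>
           (\<forall>w. continuous_on ({0..1} \<times> UNIV) (\<lambda>(t, z). H' t z w)))"

text \<open>Parametrisations of a closed curve are unoriented: both signs of the degree are allowed.\<close>

definition reparametrisation :: "(real \<Rightarrow> real) \<Rightarrow> bool" where
  "reparametrisation \<phi> \<longleftrightarrow>
     (\<forall>s. \<exists>d. d \<noteq> 0 \<and> (\<phi> has_real_derivative d) (at s)) \<and>
     ((\<forall>s. \<phi> (s + 1) = \<phi> s + 1) \<or> (\<forall>s. \<phi> (s + 1) = \<phi> s - 1))"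

text \<open>The curves may be renumbered (by \<open>\<pi>\<close>) and reparametrised (by \<open>\<phi>\<close>).\<close>

definition planar_isotopic :: "shaded_diagram \<Rightarrow> shaded_diagram \<Rightarrow> bool" where
  "planar_isotopic D D' \<longleftrightarrow>
     shaded_link_diagram D \<and> shaded_link_diagram D' \<and>
     (\<exists>H \<pi> \<phi>. ambient_isotopy H \<and> bij_betw \<pi> {..<ncomp D} {..<ncomp D'} \<and>
        (\<forall>i<ncomp D. reparametrisation (\<phi> i) \<and>
           (\<forall>s. curve D' (\<pi> i) (\<phi> i s) = H 1 (curve D i s)) \<and>
           (\<forall>s. crossing_param D (i, s) \<longrightarrow>
                 ((\<pi> i, \<phi> i s) \<in> over D' \<longleftrightarrow> (i, s) \<in> over D))) \<and>
        shaded D' = H 1 ` shaded D)"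

subsection \<open>Reidemeister moves 2 and 3\<close>

text \<open>
  A move is performed in the standard closed disc \<open>square\<close>; since regular isotopy also contains
  planar isotopy, this amounts to moves in arbitrary discs. Inside the disc the diagram consists
  of \<open>m\<close> strands, which are the graphs of functions \<open>f k\<close> on \<open>[-1, 1]\<close>. The \<open>k\<close>-th strand is the
  arc of the curve \<open>fst (K k)\<close> parametrised by \<open>[a - \<bar>r\<bar>, a + \<bar>r\<bar>]\<close>, where \<open>(a, r) = snd (K k)\<close>,
  and runs from left to right or from right to left according to the sign of \<open>r\<close>. Where two
  strands cross, the one of larger height \<open>ht\<close> is the overpass.
\<close>

definition square :: "complex set" where
  "square = {z. \<bar>Re z\<bar> \<le> 1 \<and> \<bar>Im z\<bar> \<le> 1}"

definition strand_param :: "nat \<times> real \<times> real \<Rightarrow> real \<Rightarrow> nat \<times> real" where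
  "strand_param = (\<lambda>(i, a, r) x. (i, a + r * x))"

definition strands_in_square ::
    "nat \<Rightarrow> (nat \<Rightarrow> nat \<times> real \<times> real) \<Rightarrow> (nat \<Rightarrow> nat) \<Rightarrow> (nat \<Rightarrow> real \<Rightarrow> real)
      \<Rightarrow> shaded_diagram \<Rightarrow> bool" where
  "strands_in_square m K ht f D \<longleftrightarrow>
     (\<forall>k<m. fst (K k) < ncomp D \<and> snd (snd (K k)) \<noteq> 0 \<and>
        (\<forall>x\<in>{-1..1}. pt D (strand_param (K k) x) = Complex x (f k x))) \<and>
     (\<forall>k<m. \<forall>l<m. \<forall>x\<in>{-1..1}. k \<noteq> l \<and> f k x = f l x \<longrightarrow>
        (strand_param (K k) x \<in> over D \<longleftrightarrow> ht l < ht k))"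

definition local_move ::
    "nat \<Rightarrow> (nat \<Rightarrow> real \<Rightarrow> real) \<Rightarrow> (nat \<Rightarrow> real \<Rightarrow> real)
      \<Rightarrow> shaded_diagram \<Rightarrow> shaded_diagram \<Rightarrow> bool" where
  "local_move m f g D D' \<longleftrightarrow>
     shaded_link_diagram D \<and> shaded_link_diagram D' \<and> ncomp D' = ncomp D \<and>
     (\<exists>K ht. inj_on ht {..<m} \<and>
        strands_in_square m K ht f D \<and> strands_in_square m K ht g D' \<and>
        (\<forall>p\<in>params D.
           (\<exists>k<m. \<exists>x\<in>{-1..1}. same_param p (strand_param (K k) x)) \<or>
           (pt D p \<notin> square \<and> pt D' p = pt D p \<and> (p \<in> over D' \<longleftrightarrow> p \<in> over D)))) \<and>
     shaded D' - square = shaded D - square"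

text \<open>
  Move 2: the strand \<open>k = 1\<close> crosses the \<open>x\<close>-axis at \<open>x = -1/2\<close> and at \<open>x = 1/2\<close>, respectively stays
  above it. Move 3: the strand \<open>k = 2\<close> passes on either side of the crossing \<open>0\<close> of two lines; it
  meets them at \<open>x = -1/2\<close> and \<open>x = 1/2\<close>. In both moves the two pictures have the same end points
  and the same tangents there. The height functions range over all orders of the strands.
\<close>

definition bump :: "real \<Rightarrow> real" where
  "bump x = (1 - x\<^sup>2)\<^sup>2"

definition reidemeister2 :: "shaded_diagram \<Rightarrow> shaded_diagram \<Rightarrow> bool" where
  "reidemeister2 = local_move 2
     (\<lambda>k x. if k = 0 then 0 else 9/16 - bump x)
     (\<lambda>k x. if k = 0 then 0 else 9/16)"

definition reidemeister3 :: "shaded_diagram \<Rightarrow> shaded_diagram \<Rightarrow> bool" where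
  "reidemeister3 = local_move 3
     (\<lambda>k x. if k = 0 then x / 2 else if k = 1 then - (x / 2) else 4/9 * bump x)
     (\<lambda>k x. if k = 0 then x / 2 else if k = 1 then - (x / 2) else - (4/9 * bump x))"

definition regular_isotopic :: "shaded_diagram \<Rightarrow> shaded_diagram \<Rightarrow> bool" where
  "regular_isotopic =
     equivclp (\<lambda>D D'. planar_isotopic D D' \<or> reidemeister2 D D' \<or> reidemeister3 D D')"


section \<open>Polynomials\<close>

datatype vse_var = VA | VB | VF | VX | VY | VZ | VM | Vo

fun var_index :: "vse_var \<Rightarrow> nat" where
  "var_index VA = 0" | "var_index VB = 1" | "var_index VF = 2" | "var_index VX = 3"
| "var_index VY = 4" | "var_index VZ = 5" | "var_index VM = 6" | "var_index Vo = 7"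

instantiation vse_var :: linorder
begin

definition less_eq_vse_var :: "vse_var \<Rightarrow> vse_var \<Rightarrow> bool" where
  "x \<le> y \<longleftrightarrow> var_index x \<le> var_index y"

definition less_vse_var :: "vse_var \<Rightarrow> vse_var \<Rightarrow> bool" where
  "x < y \<longleftrightarrow> var_index x < var_index y"

instance
proof
  fix x y :: vse_var
  assume "x \<le> y" and "y \<le> x"
  then show "x = y"
    by (cases x; cases y) (simp_all add: less_eq_vse_var_def)
qed (auto simp: less_eq_vse_var_def less_vse_var_def)

end

text \<open>
  The order that \<^theory>\<open>HOL-Library.Poly_Mapping\<close> puts on \<open>monom\<close> compares exponents at the smallest
  variable where two monomials differ: it is the lexicographic monomial order in which
  \<open>VA\<close> is the most significant variable and \<open>Vo\<close> the least.
\<close>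

type_synonym monom = "vse_var \<Rightarrow>\<^sub>0 nat"
type_synonym 'a vse_poly = "monom \<Rightarrow>\<^sub>0 'a"

definition var :: "vse_var \<Rightarrow> int vse_poly" where
  "var v = Poly_Mapping.single (Poly_Mapping.single v 1) 1"


section \<open>Expansion\<close>

datatype 'l symb = X1 'l 'l 'l 'l | X2 'l 'l 'l 'l | Con 'l 'l

text \<open>
  The number of factors \<open>o\<close> left by a product of \<open>con\<close> symbols in which every label occurs exactly
  twice. If \<open>a \<noteq> b\<close>, the label \<open>b\<close> occurs once more, and \<open>con[ab] con[bc] \<rightarrow> con[ac]\<close> renames that
  occurrence to \<open>a\<close>.
\<close>

fun loops :: "('l \<times> 'l) list \<Rightarrow> nat" where
  "loops [] = 0"
| "loops ((a, b) # cs) =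
     (if a = b then Suc (loops cs)
      else loops (map (map_prod (\<lambda>x. if x = b then a else x) (\<lambda>x. if x = b then a else x)) cs))"

fun expand :: "('l \<times> 'l) list \<Rightarrow> 'l symb list \<Rightarrow> int vse_poly" where
  "expand cs [] = var Vo ^ loops cs"
| "expand cs (Con x y # P) = expand ((x, y) # cs) P"
| "expand cs (X1 a b c d # P) =
     var VM * var VA * expand ((a, b) # (c, d) # cs) P +
     var VM * var VB * expand ((a, d) # (b, c) # cs) P +
     var VF * expand ((a, c) # (b, d) # cs) P"
| "expand cs (X2 a b c d # P) =
     var VM * var VX * expand ((a, b) # (c, d) # cs) P +
     var VM * var VY * expand ((a, d) # (b, c) # cs) P +
     var VZ * expand ((a, c) # (b, d) # cs) P"

definition bracket :: "'l symb list \<Rightarrow> int vse_poly" where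
  "bracket P = expand [] P"


section \<open>The state sum of a shaded diagram\<close>

text \<open>
  The label of an edge is the edge itself, as an open arc in the plane: \<open>edge_out D p\<close> is the edge
  traversed after the crossing parameter \<open>p\<close>, up to the next crossing, and \<open>edge_in D p\<close> the one
  traversed before it.
\<close>

definition edge_out :: "shaded_diagram \<Rightarrow> nat \<times> real \<Rightarrow> complex set" where
  "edge_out D p = (\<lambda>t. pt D (fst p, t)) `
     {t. snd p < t \<and> (\<forall>u. snd p < u \<and> u \<le> t \<longrightarrow> \<not> crossing_param D (fst p, u))}"

definition edge_in :: "shaded_diagram \<Rightarrow> nat \<times> real \<Rightarrow> complex set" where
  "edge_in D p = (\<lambda>t. pt D (fst p, t)) `
     {t. t < snd p \<and> (\<forall>u. t \<le> u \<and> u < snd p \<longrightarrow> \<not> crossing_param D (fst p, u))}"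

definition underpass :: "shaded_diagram \<Rightarrow> complex \<Rightarrow> nat \<times> real" where
  "underpass D v = (SOME p. p \<in> params D \<and> pt D p = v \<and> p \<notin> over D)"

definition overpass :: "shaded_diagram \<Rightarrow> complex \<Rightarrow> nat \<times> real" where
  "overpass D v = (SOME p. p \<in> params D \<and> pt D p = v \<and> p \<in> over D)"

text \<open>
  With \<open>u\<close> the direction of the underpass, let \<open>w\<close> be that of the two directions of the overpass
  for which \<open>- u, w, u, - w\<close> is the counterclockwise order of the edge ends \<open>a, b, c, d\<close>. Rotating
  the overpass counterclockwise to the underpass sweeps the sector from \<open>w\<close> to \<open>u\<close>, whose direction
  is \<open>w + u\<close>, and the opposite one.
\<close>

definition crossing_symb :: "shaded_diagram \<Rightarrow> complex \<Rightarrow> complex set symb" where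
  "crossing_symb D v =
     (let p = underpass D v; q = overpass D v; u = vel D p;
          pos = (Im (cnj (- u) * vel D q) > 0);
          w = (if pos then vel D q else - vel D q);
          a = edge_in D p; c = edge_out D p;
          b = (if pos then edge_out D q else edge_in D q);
          d = (if pos then edge_in D q else edge_out D q)
      in if \<forall>\<^sub>F \<epsilon> in at_right 0. v + of_real \<epsilon> * (w + u) \<in> shaded D
         then X1 a b c d else X2 a b c d)"

definition crossingless_components :: "shaded_diagram \<Rightarrow> nat set" where
  "crossingless_components D = {i. i < ncomp D \<and> (\<forall>s. \<not> crossing_param D (i, s))}"

definition state_sum :: "shaded_diagram \<Rightarrow> int vse_poly" where
  "state_sum D =
     var Vo ^ card (crossingless_components D) *
     bracket (map (crossing_symb D) (SOME vs. distinct vs \<and> set vs = crossings D))"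


section \<open>The ideal and the normal form\<close>

definition perfect_matchings :: "'l list \<Rightarrow> ('l \<times> 'l) list set" where
  "perfect_matchings bs = {\<epsilon>. mset (concat (map (\<lambda>(x, y). [x, y]) \<epsilon>)) = mset bs}"

definition closure_relations :: "'l symb list \<Rightarrow> 'l symb list \<Rightarrow> 'l list \<Rightarrow> int vse_poly set" where
  "closure_relations L R bs =
     (\<lambda>\<epsilon>. bracket (L @ map (case_prod Con) \<epsilon>) - bracket (R @ map (case_prod Con) \<epsilon>))
       ` perfect_matchings bs"

datatype label = La | Lb | Lc | Ld | Le | Lf | Lg | Lh | Li

definition vse_relations :: "int vse_poly set" where
  "vse_relations =
     closure_relations [X1 La Lb Lf Le, X2 Ld Le Lf Lc] [Con La Ld, Con Lb Lc] [La, Lb, Lc, Ld] \<union>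
     closure_relations [X2 La Lb Lf Le, X1 Ld Le Lf Lc] [Con La Ld, Con Lb Lc] [La, Lb, Lc, Ld] \<union>
     closure_relations
       [X1 La Lb Lh Lg, X2 Li Le Lf Lg, X2 Lh Lc Ld Li]
       [X1 La Li Lh Lf, X1 Lc Lg Li Lb, X2 Lh Lg Ld Le] [La, Lb, Lc, Ld, Le, Lf] \<union>
     closure_relations
       [X2 La Lb Lh Lg, X1 Li Le Lf Lg, X1 Lh Lc Ld Li]
       [X2 La Li Lh Lf, X2 Lc Lg Li Lb, X1 Lh Lg Ld Le] [La, Lb, Lc, Ld, Le, Lf]"

definition rat_poly :: "int vse_poly \<Rightarrow> rat vse_poly" where
  "rat_poly = Poly_Mapping.map rat_of_int"

definition vse_ideal :: "rat vse_poly set" where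
  "vse_ideal = module.span (*) (rat_poly ` vse_relations)"

definition lead_monom :: "'a::zero vse_poly \<Rightarrow> monom" where
  "lead_monom f = Max (Poly_Mapping.keys f)"

definition lead_coeff_monom :: "'a::zero vse_poly \<Rightarrow> 'a" where
  "lead_coeff_monom f = Poly_Mapping.lookup f (lead_monom f)"

definition monom_dvd :: "monom \<Rightarrow> monom \<Rightarrow> bool" where
  "monom_dvd s t \<longleftrightarrow> (\<exists>u. t = s + u)"

definition groebner_basis :: "rat vse_poly set \<Rightarrow> rat vse_poly set \<Rightarrow> bool" where
  "groebner_basis G J \<longleftrightarrow>
     finite G \<and> G \<subseteq> J \<and> 0 \<notin> G \<and>
     (\<forall>f\<in>J. f \<noteq> 0 \<longrightarrow> (\<exists>g\<in>G. monom_dvd (lead_monom g) (lead_monom f)))"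

definition reduced_groebner_basis :: "rat vse_poly set \<Rightarrow> rat vse_poly set \<Rightarrow> bool" where
  "reduced_groebner_basis G J \<longleftrightarrow>
     groebner_basis G J \<and>
     (\<forall>g\<in>G. lead_coeff_monom g = 1) \<and>
     (\<forall>g\<in>G. \<forall>g'\<in>G. g' \<noteq> g \<longrightarrow> (\<forall>t\<in>Poly_Mapping.keys g. \<not> monom_dvd (lead_monom g') t))"

definition reduces_to :: "rat vse_poly set \<Rightarrow> rat vse_poly \<Rightarrow> rat vse_poly \<Rightarrow> bool" where
  "reduces_to G f f' \<longleftrightarrow>
     (\<exists>g\<in>G. \<exists>u. lead_monom g + u \<in> Poly_Mapping.keys f \<and>
        f' = f - Poly_Mapping.single u (Poly_Mapping.lookup f (lead_monom g + u) / lead_coeff_monom g) * g)"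

definition normal_form :: "rat vse_poly set \<Rightarrow> rat vse_poly \<Rightarrow> rat vse_poly" where
  "normal_form G f = (THE r. (reduces_to G)\<^sup>*\<^sup>* f r \<and> (\<nexists>r'. reduces_to G r r'))"

definition eta_inf :: "int vse_poly \<Rightarrow> rat vse_poly" where
  "eta_inf p = normal_form (THE G. reduced_groebner_basis G vse_ideal) (rat_poly p)"

end

theory Submission
  imports Defs
begin

text \<open>
  Idea. Groebner remainders depend only on the residue class, so it suffices that the moves change
  the state sum by an element of the ideal.

  Expanding all crossings turns a state sum into a sum of powers of \<open>o\<close> counting closed loops.
  Since any product of \<open>con\<close> symbols equals a perfect matching of its boundary labels up to loops,
  a relation that holds in the quotient for all closures of two tangles holds in every context.
  The generators thus give the second Reidemeister move and the third one for one crossing pattern;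
  the other patterns follow by rotating the picture, and their mirror images by first adding a
  cancelling pair of crossings.

  Geometrically, cut each component at its crossings and, inside the square of a move, also at
  marked points contributing a symbol \<open>con\<close>, chosen so that both pictures are cut at the same
  parameters: the two state sums then use the same arcs and differ only in the symbols of the square.
  The crossing types inside the square are forced by the shading on its boundary because the
  shading alternates across every strand. For a planar isotopy the labels are transported along;
  it preserves the orientation of the branches at each crossing, and hence the symbols.
\<close>

section \<open>Normal forms modulo a Groebner basis\<close>

text \<open>The statement refers to the reduced Groebner basis by a definite description, so
  existence and uniqueness of that basis are part of the work; they rest on Dickson's lemma, which
  also makes the monomial order well-founded. The labels of \<open>crossing_symb\<close> are arcs in
  the plane, and a move deforms these. Arcs are therefore represented by sets of parameters, which
  both pictures of a move share. Two degenerate cases shape the cutting. A component without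
  crossings contributes \<open>o\<close> but no symbol; its first mark turns that factor into
  con[aa]. And an edge outside the square may join two strand ends directly, so that one label would
  occupy two places on the boundary of a tangle; marks at the ends of the strands prevent this.
  Three strands at distinct heights realise six of the eight over and under patterns, and these form
  two orbits under rotation by a third of a turn, so one mirror argument is enough. That argument
  consumes labels that do not occur elsewhere in the diagram, and a label type need not have any to
  spare; hence the third move is stated for every label type and proved in one with the help of a
  larger one.\<close>

lemma poly_mapping_sum_single:
  fixes g :: "'a \<Rightarrow>\<^sub>0 'b::comm_monoid_add"
  shows "g = (\<Sum>k\<in>Poly_Mapping.keys g. Poly_Mapping.single k (Poly_Mapping.lookup g k))"
  by (rule poly_mapping_eqI)
    (simp add: lookup_sum lookup_single when_def in_keys_iff sum.delta')

lemma lookup_single_mult: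
  fixes g :: "'a::comm_ring_1 vse_poly" and c :: 'a
  shows "Poly_Mapping.lookup (Poly_Mapping.single u c * g) (u + j) = c * Poly_Mapping.lookup g j"
proof -
  have "Poly_Mapping.single u c * g =
      (\<Sum>k\<in>Poly_Mapping.keys g. Poly_Mapping.single (u + k) (c * Poly_Mapping.lookup g k))"
    by (subst (1) poly_mapping_sum_single) (simp add: sum_distrib_left mult_single)
  then show ?thesis
    by (simp add: lookup_sum lookup_single when_def in_keys_iff sum.delta')
qed

lemma keys_single_mult_subset:
  fixes g :: "'a::comm_ring_1 vse_poly" and c :: 'a
  shows "Poly_Mapping.keys (Poly_Mapping.single u c * g) \<subseteq> (+) u ` Poly_Mapping.keys g"
  using keys_mult[of "Poly_Mapping.single u c" g] by (auto split: if_splits)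

text \<open>A monotone subsequence exists. If it decreases, it is constant from a place where its
  minimum is attained, and the tail from there on is weakly increasing.\<close>

lemma incseq_subseq_nat:
  fixes s :: "nat \<Rightarrow> nat"
  shows "\<exists>r. strict_mono r \<and> incseq (\<lambda>n. s (r n))"
proof -
  obtain r where r: "strict_mono r" "monoseq (\<lambda>n. s (r n))"
    using seq_monosub by blast
  show ?thesis
  proof (cases "incseq (\<lambda>n. s (r n))")
    case False
    then have dec: "decseq (\<lambda>n. s (r n))"
      using r(2) by (auto simp: monoseq_iff)
    obtain N where N: "\<And>n. s (r N) \<le> s (r n)"
      using ex_has_least_nat[of "\<lambda>_. True" 0 "\<lambda>n. s (r n)"] by blast
    have "s (r (n + N)) = s (r N)" for n
      using N[of "n + N"] decseqD[OF dec, of N "n + N"] by simp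
    then show ?thesis
      using r(1) by (intro exI[of _ "\<lambda>n. r (n + N)"]) (auto simp: strict_mono_def)
  qed (use r in blast)
qed

text \<open>Subsequences are extracted one coordinate after the other; passing to a further
  subsequence keeps the coordinates already treated increasing.\<close>

lemma incseq_subseq_finite:
  fixes s :: "nat \<Rightarrow> 'v \<Rightarrow> nat"
  assumes "finite A"
  shows "\<exists>r. strict_mono r \<and> (\<forall>v\<in>A. incseq (\<lambda>n. s (r n) v))"
  using assms
proof (induction A)
  case empty
  show ?case using strict_mono_id by auto
next
  case (insert a A)
  then obtain r where r: "strict_mono r" "\<forall>v\<in>A. incseq (\<lambda>n. s (r n) v)" by blast
  obtain q where q: "strict_mono q" "incseq (\<lambda>n. s (r (q n)) a)"
    using incseq_subseq_nat[of "\<lambda>n. s (r n) a"] by blast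
  have "incseq (\<lambda>n. s (r (q n)) v)" if "v \<in> A" for v
    using r(2) that q(1) by (auto simp: incseq_def strict_mono_less_eq)
  then show ?case
    using r(1) q by (intro exI[of _ "\<lambda>n. r (q n)"]) (auto simp: strict_mono_def)
qed

lemma finite_UNIV_vse_var: "finite (UNIV :: vse_var set)"
proof -
  have "(UNIV :: vse_var set) = {VA, VB, VF, VX, VY, VZ, VM, Vo}"
    using vse_var.exhaust by auto
  then show ?thesis by (metis finite.emptyI finite.insertI)
qed

lemma monom_dvd_iff:
  "monom_dvd s t \<longleftrightarrow> (\<forall>v. Poly_Mapping.lookup s v \<le> Poly_Mapping.lookup t v)"
proof
  assume "\<forall>v. Poly_Mapping.lookup s v \<le> Poly_Mapping.lookup t v"
  \<comment> \<open>Subtraction of exponents is truncated, but here nothing is cut off.\<close>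
  then have "t = s + (t - s)"
    by (intro poly_mapping_eqI) (simp add: lookup_add lookup_minus)
  then show "monom_dvd s t" unfolding monom_dvd_def by blast
qed (auto simp: monom_dvd_def lookup_add)

lemma monom_dvd_refl: "monom_dvd s s"
  by (simp add: monom_dvd_iff)

lemma monom_dvd_trans: "monom_dvd s t \<Longrightarrow> monom_dvd t u \<Longrightarrow> monom_dvd s u"
  by (meson monom_dvd_iff order.trans)

lemma monom_dvd_antisym: "monom_dvd s t \<Longrightarrow> monom_dvd t s \<Longrightarrow> s = t"
  unfolding monom_dvd_iff by (intro poly_mapping_eqI order.antisym) auto

text \<open>Dickson's lemma for eight variables: along a suitable subsequence all exponents
  increase.\<close>

lemma dickson_sequence:
  fixes s :: "nat \<Rightarrow> monom"
  shows "\<exists>i j. i < j \<and> monom_dvd (s i) (s j)"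
proof -
  obtain r where r: "strict_mono r" "\<forall>v\<in>UNIV. incseq (\<lambda>n. Poly_Mapping.lookup (s (r n)) v)"
    using incseq_subseq_finite[OF finite_UNIV_vse_var, of "\<lambda>n. Poly_Mapping.lookup (s n)"] by blast
  have "monom_dvd (s (r 0)) (s (r 1))"
    using r(2) by (auto simp: monom_dvd_iff incseq_def)
  then show ?thesis using r(1) by (metis strict_mono_less zero_less_one)
qed

lemma monom_nonneg: "0 \<le> (u :: monom)"
proof -
  have "\<not> u < 0"
    by (simp add: less_poly_mapping.rep_eq less_fun_def)
  then show ?thesis by simp
qed

lemma monom_dvd_imp_le: "monom_dvd s t \<Longrightarrow> s \<le> t"
  using monom_nonneg add_left_mono[of 0 _ s] by (fastforce simp: monom_dvd_def)

text \<open>In a descending chain some earlier monomial would divide a later one and hence be at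
  most as large, since multiplication never makes a monomial smaller.\<close>

lemma wf_monom: "wf {(s, t :: monom). s < t}"
  unfolding wf_iff_no_infinite_down_chain
proof
  assume "\<exists>f. \<forall>i. (f (Suc i), f i) \<in> {(s, t :: monom). s < t}"
  then obtain f :: "nat \<Rightarrow> monom" where f: "\<And>i. f (Suc i) < f i" by blast
  obtain i j where ij: "i < j" "monom_dvd (f i) (f j)" using dickson_sequence by blast
  have "f j < f i"
  proof -
    have "f (i + Suc n) < f i" for n
      by (induction n) (use f in \<open>auto intro: order.strict_trans\<close>)
    then show ?thesis using ij(1) less_iff_Suc_add by auto
  qed
  with monom_dvd_imp_le[OF ij(2)] show False by simp
qed

lemma monom_less_induct [case_names less]:
  fixes t :: monom
  assumes "\<And>t. (\<And>s. s < t \<Longrightarrow> P s) \<Longrightarrow> P t"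
  shows "P t"
  using wf_induct_rule[OF wf_monom, of P t] assms by blast

text \<open>An infinite antichain would contain an injective sequence, to which Dickson's lemma
  applies.\<close>

lemma finite_dvd_antichain:
  fixes M :: "monom set"
  assumes "\<And>s t. s \<in> M \<Longrightarrow> t \<in> M \<Longrightarrow> monom_dvd s t \<Longrightarrow> s = t"
  shows "finite M"
proof (rule ccontr)
  assume "infinite M"
  then obtain f :: "nat \<Rightarrow> monom" where f: "inj f" "range f \<subseteq> M"
    using infinite_countable_subset by blast
  obtain i j where "i < j" "monom_dvd (f i) (f j)" using dickson_sequence by blast
  with assms f show False by (metis injD less_irrefl range_subsetD)
qed

lemma lead_monom_in_keys: "f \<noteq> 0 \<Longrightarrow> lead_monom f \<in> Poly_Mapping.keys f"
  unfolding lead_monom_def by (rule Max_in) auto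

lemma keys_le_lead_monom: "t \<in> Poly_Mapping.keys f \<Longrightarrow> t \<le> lead_monom f"
  unfolding lead_monom_def by (rule Max_ge) auto

lemma lead_coeff_monom_nonzero: "f \<noteq> 0 \<Longrightarrow> lead_coeff_monom f \<noteq> 0"
  unfolding lead_coeff_monom_def by (metis lead_monom_in_keys in_keys_iff)

lemma lead_monom_single_mult:
  fixes g :: "rat vse_poly"
  assumes "g \<noteq> 0" "c \<noteq> 0"
  shows "lead_monom (Poly_Mapping.single u c * g) = u + lead_monom g"
    and "Poly_Mapping.single u c * g \<noteq> 0"
    and "lead_coeff_monom (Poly_Mapping.single u c * g) = c * lead_coeff_monom g"
proof -
  let ?f = "Poly_Mapping.single u c * g"
  have k: "u + lead_monom g \<in> Poly_Mapping.keys ?f"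
    using assms lead_monom_in_keys[OF assms(1)] by (simp add: in_keys_iff lookup_single_mult)
  then show nz: "?f \<noteq> 0" by auto
  have "t \<le> u + lead_monom g" if "t \<in> Poly_Mapping.keys ?f" for t
    using that keys_single_mult_subset[of u c g] keys_le_lead_monom[of _ g] add_left_mono by blast
  with k show lm: "lead_monom ?f = u + lead_monom g"
    unfolding lead_monom_def[of ?f] by (intro Max_eqI) auto
  show "lead_coeff_monom ?f = c * lead_coeff_monom g"
    unfolding lead_coeff_monom_def lm by (rule lookup_single_mult)
qed

locale poly_ideal =
  fixes J :: "rat vse_poly set"
  assumes zero_mem: "0 \<in> J"
    and add_mem: "f \<in> J \<Longrightarrow> g \<in> J \<Longrightarrow> f + g \<in> J"
    and mult_mem: "f \<in> J \<Longrightarrow> h * f \<in> J"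
begin

lemma diff_mem: "f \<in> J \<Longrightarrow> g \<in> J \<Longrightarrow> f - g \<in> J"
  using add_mem[of f "- 1 * g"] mult_mem[of g "- 1"] by simp

lemma sum_mem: "(\<And>i. i \<in> A \<Longrightarrow> f i \<in> J) \<Longrightarrow> sum f A \<in> J"
  by (induction A rule: infinite_finite_induct) (auto simp: zero_mem add_mem)

text \<open>The monomials of the initial ideal. A polynomial is standard if none of its monomials
  lies here.\<close>

definition lead_monoms :: "monom set" where
  "lead_monoms = lead_monom ` (J - {0})"

text \<open>Multiplying a witness by the quotient monomial shifts its leading monomial; its leading
  coefficient is inverted in the field.\<close>

lemma lead_monoms_upward:
  assumes "s \<in> lead_monoms" "monom_dvd s t"
  obtains f where "f \<in> J" "f \<noteq> 0" "lead_monom f = t" "lead_coeff_monom f = 1"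
proof -
  obtain g where g: "g \<in> J" "g \<noteq> 0" "s = lead_monom g"
    using assms(1) by (auto simp: lead_monoms_def)
  obtain u where u: "t = s + u" using assms(2) by (auto simp: monom_dvd_def)
  let ?c = "1 / lead_coeff_monom g"
  have c: "?c \<noteq> 0" using lead_coeff_monom_nonzero[OF g(2)] by simp
  show thesis
    using that[of "Poly_Mapping.single u ?c * g"] lead_monom_single_mult[OF g(2) c, of u] g u
      lead_coeff_monom_nonzero[OF g(2)]
    by (auto simp: mult_mem add.commute)
qed

lemma lead_monoms_dvd: "s \<in> lead_monoms \<Longrightarrow> monom_dvd s t \<Longrightarrow> t \<in> lead_monoms"
  by (metis lead_monoms_upward lead_monoms_def Diff_iff empty_iff imageI insert_iff)

text \<open>The leading monomial of a nonzero difference in \<open>J\<close> would be a leading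
  monomial of \<open>J\<close> that occurs in \<open>r\<close> or in \<open>r'\<close>.\<close>

lemma standard_unique:
  assumes "r - r' \<in> J" "Poly_Mapping.keys r \<inter> lead_monoms = {}"
    "Poly_Mapping.keys r' \<inter> lead_monoms = {}"
  shows "r = r'"
proof (rule ccontr)
  assume "r \<noteq> r'"
  then have nz: "r - r' \<noteq> 0" by simp
  then have "lead_monom (r - r') \<in> lead_monoms"
    using assms(1) by (auto simp: lead_monoms_def)
  moreover have "lead_monom (r - r') \<in> Poly_Mapping.keys r \<union> Poly_Mapping.keys r'"
    using lead_monom_in_keys[OF nz] by (auto simp: in_keys_iff lookup_minus)
  ultimately show False using assms(2,3) by blast
qed

text \<open>Division by the whole ideal instead of a finite basis, so that remainders exist before
  any Groebner basis is known: a leading monomial is congruent to minus the tail of a monic element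
  of \<open>J\<close>, whose monomials are smaller and covered by the induction.\<close>

lemma standard_remainder_monom:
  "\<exists>r. Poly_Mapping.single t 1 - r \<in> J \<and> Poly_Mapping.keys r \<inter> lead_monoms = {} \<and>
     (\<forall>s\<in>Poly_Mapping.keys r. s \<le> t)"
proof (induction t rule: monom_less_induct)
  case (less t)
  show ?case
  proof (cases "t \<in> lead_monoms")
    case False
    then show ?thesis
      by (intro exI[of _ "Poly_Mapping.single t 1"]) (auto simp: zero_mem)
  next
    case True
    obtain f where f: "f \<in> J" "f \<noteq> 0" "lead_monom f = t" "lead_coeff_monom f = 1"
      using lead_monoms_upward[OF True monom_dvd_refl] .
    let ?S = "Poly_Mapping.keys f - {t}"
    have lt: "s < t" if "s \<in> ?S" for s
      using that keys_le_lead_monom[of s f] f(3) by auto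
    obtain R where R: "\<And>s. s < t \<Longrightarrow> Poly_Mapping.single s 1 - R s \<in> J \<and>
        Poly_Mapping.keys (R s) \<inter> lead_monoms = {} \<and> (\<forall>u\<in>Poly_Mapping.keys (R s). u \<le> s)"
      using less by metis
    let ?c = "\<lambda>s. Poly_Mapping.lookup f s"
    \<comment> \<open>Scalars are written as constant polynomials, since \<open>J\<close> is closed
      under multiplication by polynomials.\<close>
    let ?m = "\<lambda>s. Poly_Mapping.single (0::monom) (?c s)"
    define r where "r = - (\<Sum>s\<in>?S. ?m s * R s)"
    have tk: "t \<in> Poly_Mapping.keys f" using lead_monom_in_keys[OF f(2)] f(3) by simp
    have c1: "?c t = 1" using f(3,4) by (simp add: lead_coeff_monom_def)
    have "f = Poly_Mapping.single t 1 + (\<Sum>s\<in>?S. Poly_Mapping.single s (?c s))"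
      by (subst (1) poly_mapping_sum_single) (simp add: sum.remove[OF _ tk] c1)
    also have "(\<Sum>s\<in>?S. Poly_Mapping.single s (?c s)) = (\<Sum>s\<in>?S. ?m s * Poly_Mapping.single s 1)"
      by (simp add: mult_single)
    finally have feq: "f = Poly_Mapping.single t 1 + (\<Sum>s\<in>?S. ?m s * Poly_Mapping.single s 1)" .
    have "Poly_Mapping.single t 1 - r = f - (\<Sum>s\<in>?S. ?m s * (Poly_Mapping.single s 1 - R s))"
      unfolding r_def right_diff_distrib sum_subtractf using feq
      by (simp add: algebra_simps)
    moreover have "(\<Sum>s\<in>?S. ?m s * (Poly_Mapping.single s 1 - R s)) \<in> J"
      using R lt by (intro sum_mem mult_mem) auto
    ultimately have 1: "Poly_Mapping.single t 1 - r \<in> J" using f(1) diff_mem by simp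
    have 2: "\<exists>s\<in>?S. u \<in> Poly_Mapping.keys (R s)" if "u \<in> Poly_Mapping.keys r" for u
    proof (rule ccontr)
      assume "\<not> ?thesis"
      then have "Poly_Mapping.lookup (?m s * R s) u = 0" if "s \<in> ?S" for s
        using that lookup_single_mult[of 0 "?c s" "R s" u] by (auto simp: in_keys_iff)
      then have "Poly_Mapping.lookup r u = 0"
        by (simp add: r_def lookup_sum)
      with \<open>u \<in> Poly_Mapping.keys r\<close> show False by (simp add: in_keys_iff)
    qed
    show ?thesis
      using 1 2 R lt by (intro exI[of _ r]) (meson disjoint_iff less_imp_le order.trans)
  qed
qed

definition min_lead_monoms :: "monom set" where
  "min_lead_monoms = {m \<in> lead_monoms. \<forall>s\<in>lead_monoms. monom_dvd s m \<longrightarrow> s = m}"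

lemma finite_min_lead_monoms: "finite min_lead_monoms"
  by (rule finite_dvd_antichain) (auto simp: min_lead_monoms_def)

text \<open>Descent along divisibility ends because proper divisors are smaller in a well-founded
  order.\<close>

lemma min_lead_monoms_cover: "t \<in> lead_monoms \<Longrightarrow> \<exists>m\<in>min_lead_monoms. monom_dvd m t"
proof (induction t rule: monom_less_induct)
  case (less t)
  show ?case
  proof (cases "t \<in> min_lead_monoms")
    case False
    then obtain s where "s \<in> lead_monoms" "monom_dvd s t" "s \<noteq> t"
      using less.prems by (auto simp: min_lead_monoms_def)
    with less.IH[of s] show ?thesis
      by (metis monom_dvd_imp_le monom_dvd_trans order_le_less)
  qed (use monom_dvd_refl in blast)
qed

text \<open>The reduced basis consists of \<open>m\<close> minus its remainder, for the minimal leading monomials \<open>m\<close>.\<close>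

definition standard_remainder :: "monom \<Rightarrow> rat vse_poly" where
  "standard_remainder t = (SOME r. Poly_Mapping.single t 1 - r \<in> J \<and>
     Poly_Mapping.keys r \<inter> lead_monoms = {} \<and> (\<forall>s\<in>Poly_Mapping.keys r. s \<le> t))"

lemma standard_remainder:
  "Poly_Mapping.single t 1 - standard_remainder t \<in> J"
  "Poly_Mapping.keys (standard_remainder t) \<inter> lead_monoms = {}"
  "\<forall>s\<in>Poly_Mapping.keys (standard_remainder t). s \<le> t"
  using someI_ex[OF standard_remainder_monom[of t]] unfolding standard_remainder_def by blast+

definition the_basis :: "rat vse_poly set" where
  "the_basis = (\<lambda>m. Poly_Mapping.single m 1 - standard_remainder m) ` min_lead_monoms"

text \<open>A remainder contains no leading monomial of \<open>J\<close>, in particular not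
  \<open>m\<close>; so \<open>m\<close> survives the subtraction with coefficient 1, and it is the
  only element of \<open>lead_monoms\<close> among the monomials of \<open>g\<close>.\<close>

lemma basis_elem:
  assumes "m \<in> min_lead_monoms"
  defines "g \<equiv> Poly_Mapping.single m 1 - standard_remainder m"
  shows "g \<in> J" "g \<noteq> 0" "lead_monom g = m" "lead_coeff_monom g = 1"
    "Poly_Mapping.keys g \<inter> lead_monoms = {m}"
proof -
  note s = standard_remainder[of m]
  have m: "m \<in> lead_monoms" using assms by (simp add: min_lead_monoms_def)
  have z: "Poly_Mapping.lookup (standard_remainder m) m = 0"
    using s(2) m by (auto simp: in_keys_iff)
  have l: "Poly_Mapping.lookup g m = 1" by (simp add: g_def lookup_minus z)
  show "g \<in> J" using s(1) by (simp add: g_def)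
  show "g \<noteq> 0" using l by auto
  have k: "Poly_Mapping.keys g \<subseteq> insert m (Poly_Mapping.keys (standard_remainder m))"
    by (auto simp: g_def in_keys_iff lookup_minus lookup_single when_def split: if_splits)
  show lm: "lead_monom g = m"
    unfolding lead_monom_def using k s(3) l by (intro Max_eqI) (auto simp: in_keys_iff)
  show "lead_coeff_monom g = 1" by (simp add: lead_coeff_monom_def lm l)
  show "Poly_Mapping.keys g \<inter> lead_monoms = {m}"
    using k s(2) m l by (auto simp: in_keys_iff)
qed

text \<open>For reducedness: a monomial of a basis element that is divisible by some leading
  monomial lies in \<open>lead_monoms\<close>, so it is the minimal monomial of that element, and
  minimality makes the two elements equal.\<close>

lemma reduced_the_basis: "reduced_groebner_basis the_basis J"
  unfolding reduced_groebner_basis_def groebner_basis_def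
proof (intro conjI ballI impI allI)
  show "finite the_basis" by (simp add: the_basis_def finite_min_lead_monoms)
  show "the_basis \<subseteq> J" "0 \<notin> the_basis" using basis_elem by (auto simp: the_basis_def)
  show "lead_coeff_monom g = 1" if "g \<in> the_basis" for g
    using that basis_elem by (auto simp: the_basis_def)
  show "\<exists>g\<in>the_basis. monom_dvd (lead_monom g) (lead_monom f)" if f: "f \<in> J" "f \<noteq> 0" for f
  proof -
    have "lead_monom f \<in> lead_monoms" using f by (auto simp: lead_monoms_def)
    then obtain m where "m \<in> min_lead_monoms" "monom_dvd m (lead_monom f)"
      using min_lead_monoms_cover by blast
    then show ?thesis using basis_elem(3) by (auto simp: the_basis_def)
  qed
  fix g g' t assume g: "g \<in> the_basis" "g' \<in> the_basis" "g' \<noteq> g" "t \<in> Poly_Mapping.keys g"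
  obtain m where m: "m \<in> min_lead_monoms" "g = Poly_Mapping.single m 1 - standard_remainder m"
    using g(1) by (auto simp: the_basis_def)
  obtain m' where m': "m' \<in> min_lead_monoms" "g' = Poly_Mapping.single m' 1 - standard_remainder m'"
    using g(2) by (auto simp: the_basis_def)
  have lm': "lead_monom g' = m'" using basis_elem(3) m' by simp
  show "\<not> monom_dvd (lead_monom g') t"
  proof
    assume d: "monom_dvd (lead_monom g') t"
    then have "t \<in> lead_monoms" using lm' m'(1) lead_monoms_dvd by (auto simp: min_lead_monoms_def)
    then have "t = m" using basis_elem(5)[OF m(1)] g(4) m(2) by auto
    then have "m' = m" using d lm' m(1) m'(1) by (auto simp: min_lead_monoms_def)
    then show False using m(2) m'(2) g(3) by simp
  qed
qed

lemma groebner_lead_monoms: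
  assumes "groebner_basis G J" "t \<in> lead_monoms"
  shows "\<exists>g\<in>G. monom_dvd (lead_monom g) t"
  using assms by (auto simp: groebner_basis_def lead_monoms_def)

text \<open>Reducedness forces the leading monomial of \<open>g\<close> to be minimal and its tail
  to be standard; uniqueness of standard representatives then identifies the tail with the
  remainder.\<close>

lemma reduced_groebner_basis_subset:
  assumes "reduced_groebner_basis G J"
  shows "G \<subseteq> the_basis"
proof
  fix g assume g: "g \<in> G"
  have G: "groebner_basis G J" "g \<in> J" "g \<noteq> 0" "lead_coeff_monom g = 1"
    using assms g by (auto simp: reduced_groebner_basis_def groebner_basis_def)
  let ?m = "lead_monom g"
  have red: "\<not> monom_dvd (lead_monom g') t"
    if "g' \<in> G" "g' \<noteq> g" "t \<in> Poly_Mapping.keys g" for g' t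
    using assms g that unfolding reduced_groebner_basis_def by blast
  have mk: "?m \<in> Poly_Mapping.keys g" using lead_monom_in_keys G by blast
  have m: "?m \<in> lead_monoms" using G by (auto simp: lead_monoms_def)
  have min: "?m \<in> min_lead_monoms"
  proof -
    have "s = ?m" if s: "s \<in> lead_monoms" "monom_dvd s ?m" for s
    proof -
      obtain g' where g': "g' \<in> G" "monom_dvd (lead_monom g') s"
        using groebner_lead_monoms[OF G(1) s(1)] by blast
      then have "g' = g" using red[of g' ?m] mk s(2) monom_dvd_trans by blast
      then show ?thesis using g'(2) s(2) monom_dvd_antisym by blast
    qed
    with m show ?thesis by (auto simp: min_lead_monoms_def)
  qed
  have other: "t = ?m" if t: "t \<in> Poly_Mapping.keys g" "t \<in> lead_monoms" for t
  proof -
    obtain g' where g': "g' \<in> G" "monom_dvd (lead_monom g') t"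
      using groebner_lead_monoms[OF G(1) t(2)] by blast
    then have "g' = g" using red t(1) by blast
    then have "?m \<le> t" using g'(2) monom_dvd_imp_le by blast
    with keys_le_lead_monom[OF t(1)] show ?thesis by simp
  qed
  define r where "r = Poly_Mapping.single ?m 1 - g"
  have "Poly_Mapping.lookup r ?m = 0"
    using G(4) by (simp add: r_def lookup_minus lead_coeff_monom_def)
  then have r: "Poly_Mapping.keys r \<inter> lead_monoms = {}"
    using other by (auto simp: r_def in_keys_iff lookup_minus lookup_single when_def split: if_splits)
  have "r - standard_remainder ?m = (Poly_Mapping.single ?m 1 - standard_remainder ?m) - g"
    by (simp add: r_def)
  then have "r - standard_remainder ?m \<in> J"
    using standard_remainder(1) G(2) diff_mem by metis
  then have "r = standard_remainder ?m"
    using standard_unique r standard_remainder(2) by blast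
  then have "g = Poly_Mapping.single ?m 1 - standard_remainder ?m"
    by (simp add: r_def algebra_simps)
  with min show "g \<in> the_basis" unfolding the_basis_def by blast
qed

text \<open>For the other inclusion, some element of \<open>G\<close> has a leading monomial
  dividing the given minimal \<open>m\<close>; this element belongs to \<open>the_basis\<close>
  already, so its leading monomial is minimal too and equals \<open>m\<close>.\<close>

lemma reduced_groebner_basis_unique:
  assumes "reduced_groebner_basis G J"
  shows "G = the_basis"
proof
  show "the_basis \<subseteq> G"
  proof
    fix h assume h: "h \<in> the_basis"
    then obtain m where m: "m \<in> min_lead_monoms" "h = Poly_Mapping.single m 1 - standard_remainder m"
      by (auto simp: the_basis_def)
    have "m \<in> lead_monoms" using m by (simp add: min_lead_monoms_def)
    then obtain g where g: "g \<in> G" "monom_dvd (lead_monom g) m"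
      using groebner_lead_monoms[OF _ \<open>m \<in> lead_monoms\<close>, of G] assms
      unfolding reduced_groebner_basis_def by metis
    then obtain m' where m': "m' \<in> min_lead_monoms" "g = Poly_Mapping.single m' 1 - standard_remainder m'"
      using reduced_groebner_basis_subset[OF assms] by (auto simp: the_basis_def)
    have "m' = m"
      using g(2) m(1) m'(1) basis_elem(3)[OF m'(1)] m'(2) by (auto simp: min_lead_monoms_def)
    then show "h \<in> G" using m m' g by simp
  qed
qed (rule reduced_groebner_basis_subset[OF assms])

lemma the_reduced_groebner_basis: "(THE G. reduced_groebner_basis G J) = the_basis"
  using reduced_the_basis reduced_groebner_basis_unique by (rule the_equality)

context
  fixes G assumes G: "groebner_basis G J"
begin

lemma reduces_to_mem:
  assumes "reduces_to G f f'"
  shows "f - f' \<in> J"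
  using assms G by (auto simp: reduces_to_def groebner_basis_def intro!: mult_mem)

lemma reduces_to_rtranclp_mem:
  assumes "(reduces_to G)\<^sup>*\<^sup>* f r"
  shows "f - r \<in> J"
  using assms
proof induction
  case base
  show ?case by (simp add: zero_mem)
next
  case (step y z)
  have "f - z = (f - y) + (y - z)" by simp
  with step reduces_to_mem add_mem show ?case by metis
qed

text \<open>The Groebner property makes irreducibility depend on the ideal alone.\<close>

lemma irreducible_iff:
  "(\<nexists>r'. reduces_to G r r') \<longleftrightarrow> Poly_Mapping.keys r \<inter> lead_monoms = {}"
proof
  assume irr: "\<nexists>r'. reduces_to G r r'"
  show "Poly_Mapping.keys r \<inter> lead_monoms = {}"
  proof (rule ccontr)
    assume "\<not> ?thesis"
    then obtain t where t: "t \<in> Poly_Mapping.keys r" "t \<in> lead_monoms" by blast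
    then obtain g u where "g \<in> G" "t = lead_monom g + u"
      using groebner_lead_monoms[OF G] by (metis monom_dvd_def)
    with t(1) irr show False unfolding reduces_to_def by blast
  qed
next
  assume dis: "Poly_Mapping.keys r \<inter> lead_monoms = {}"
  show "\<nexists>r'. reduces_to G r r'"
  proof
    assume "\<exists>r'. reduces_to G r r'"
    then obtain g u where g: "g \<in> G" "lead_monom g + u \<in> Poly_Mapping.keys r"
      unfolding reduces_to_def by blast
    have "lead_monom g \<in> lead_monoms" using G g(1) by (auto simp: groebner_basis_def lead_monoms_def)
    then have "lead_monom g + u \<in> lead_monoms" using lead_monoms_dvd monom_dvd_def by blast
    with dis g(2) show False by blast
  qed
qed

text \<open>One step cancels \<open>t\<close> exactly: the multiple that is subtracted has leading
  monomial \<open>t\<close> with the coefficient of \<open>f\<close>, so everything else that it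
  introduces is smaller.\<close>

lemma reduces_to_top:
  assumes "t \<in> Poly_Mapping.keys f" "t \<in> lead_monoms"
  shows "\<exists>f'. reduces_to G f f' \<and> t \<notin> Poly_Mapping.keys f' \<and>
    (\<forall>s\<in>Poly_Mapping.keys f'. s \<in> Poly_Mapping.keys f \<or> s < t)"
proof -
  obtain g u where g: "g \<in> G" "t = lead_monom g + u"
    using groebner_lead_monoms[OF G assms(2)] by (metis monom_dvd_def)
  have g0: "g \<noteq> 0" using G g(1) by (auto simp: groebner_basis_def)
  let ?c = "Poly_Mapping.lookup f t / lead_coeff_monom g"
  let ?h = "Poly_Mapping.single u ?c * g"
  have c: "?c \<noteq> 0"
    using assms(1) lead_coeff_monom_nonzero[OF g0] by (simp add: in_keys_iff)
  note h = lead_monom_single_mult[OF g0 c, of u]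
  have lh: "lead_monom ?h = t" using h(1) g(2) by (simp add: add.commute)
  have "Poly_Mapping.lookup ?h t = ?c * lead_coeff_monom g"
    using h(3) lh by (metis lead_coeff_monom_def)
  then have ht: "Poly_Mapping.lookup ?h t = Poly_Mapping.lookup f t"
    using lead_coeff_monom_nonzero[OF g0] by simp
  have "reduces_to G f (f - ?h)"
    using g assms(1) unfolding reduces_to_def by blast
  moreover have "t \<notin> Poly_Mapping.keys (f - ?h)" by (simp add: in_keys_iff lookup_minus ht)
  moreover have "s \<in> Poly_Mapping.keys f \<or> s < t" if s: "s \<in> Poly_Mapping.keys (f - ?h)" for s
  proof (cases "s \<in> Poly_Mapping.keys ?h")
    case True
    then have "s \<le> t" using keys_le_lead_monom lh by metis
    with calculation(2) s show ?thesis by (metis order_le_less)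
  next
    case False
    with s show ?thesis by (simp add: in_keys_iff lookup_minus)
  qed
  ultimately show ?thesis by blast
qed

text \<open>Termination of the strategy that always removes the largest reducible monomial: the
  largest one left afterwards is strictly smaller.\<close>

lemma normal_form_exists_bounded:
  "\<forall>s\<in>Poly_Mapping.keys f \<inter> lead_monoms. s \<le> t \<Longrightarrow>
    \<exists>r. (reduces_to G)\<^sup>*\<^sup>* f r \<and> Poly_Mapping.keys r \<inter> lead_monoms = {}"
proof (induction t arbitrary: f rule: monom_less_induct)
  case (less t)
  let ?S = "\<lambda>f. Poly_Mapping.keys f \<inter> lead_monoms"
  show ?case
  proof (cases "?S f = {}")
    case False
    define m where "m = Max (?S f)"
    have m: "m \<in> ?S f" unfolding m_def using False by (intro Max_in) auto
    have mx: "s \<le> m" if "s \<in> ?S f" for s unfolding m_def using that by (intro Max_ge) auto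
    obtain f' where f': "reduces_to G f f'" "m \<notin> Poly_Mapping.keys f'"
      "\<forall>s\<in>Poly_Mapping.keys f'. s \<in> Poly_Mapping.keys f \<or> s < m"
      using reduces_to_top[of m f] m by blast
    have lt: "s < m" if "s \<in> ?S f'" for s
      using f'(2,3) mx[of s] that by (cases "s = m") auto
    have "\<exists>r. (reduces_to G)\<^sup>*\<^sup>* f' r \<and> ?S r = {}"
    proof (cases "?S f' = {}")
      case False
      let ?m' = "Max (?S f')"
      have "?m' \<in> ?S f'" using False by (intro Max_in) auto
      then have "?m' < m" by (rule lt)
      moreover have "m \<le> t" using m less.prems by blast
      ultimately have "?m' < t" by (rule order.strict_trans2)
      moreover have "\<forall>s\<in>?S f'. s \<le> ?m'" by (simp add: Max_ge)
      ultimately show ?thesis by (rule less.IH)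
    qed blast
    with f'(1) show ?thesis by (meson converse_rtranclp_into_rtranclp)
  qed blast
qed

text \<open>Termination and uniqueness turn the defining property of the normal form into membership
  of \<open>h - r\<close> in \<open>J\<close> with \<open>r\<close> standard; for all
  \<open>h\<close> in one residue class this is the same condition.\<close>

lemma normal_form_eqI:
  assumes "f - f' \<in> J"
  shows "normal_form G f = normal_form G f'"
proof -
  have iff: "(reduces_to G)\<^sup>*\<^sup>* h r \<and> (\<nexists>r'. reduces_to G r r') \<longleftrightarrow>
      (h - r \<in> J \<and> Poly_Mapping.keys r \<inter> lead_monoms = {})" for h r
  proof -
    have "\<exists>q. (reduces_to G)\<^sup>*\<^sup>* h q \<and> Poly_Mapping.keys q \<inter> lead_monoms = {}"
      using normal_form_exists_bounded[of h "lead_monom h"] keys_le_lead_monom by blast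
    then obtain q where q: "(reduces_to G)\<^sup>*\<^sup>* h q" "Poly_Mapping.keys q \<inter> lead_monoms = {}" by blast
    have "r = q" if "h - r \<in> J" "Poly_Mapping.keys r \<inter> lead_monoms = {}"
    proof -
      have "r - q = (h - q) - (h - r)" by simp
      then have "r - q \<in> J" using that(1) reduces_to_rtranclp_mem[OF q(1)] diff_mem by metis
      then show ?thesis using standard_unique that(2) q(2) by blast
    qed
    with q reduces_to_rtranclp_mem irreducible_iff show ?thesis by blast
  qed
  have "h' - r \<in> J" if "h - h' \<in> J" "h - r \<in> J" for h h' r
  proof -
    have "h' - r = (h - r) - (h - h')" by simp
    then show ?thesis using that diff_mem by metis
  qed
  moreover have "f' - f \<in> J" using diff_mem[OF zero_mem assms] by simp
  ultimately have "f - r \<in> J \<longleftrightarrow> f' - r \<in> J" for r using assms by blast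
  then show ?thesis unfolding normal_form_def iff by simp
qed

end

end

section \<open>The VSE ideal, and passage from integer to rational coefficients\<close>

interpretation vse_module: module "(*) :: rat vse_poly \<Rightarrow> rat vse_poly \<Rightarrow> rat vse_poly"
  by unfold_locales (simp_all add: algebra_simps)

interpretation vse_ideal: poly_ideal vse_ideal
  unfolding vse_ideal_def
  by unfold_locales (auto intro: vse_module.span_zero vse_module.span_add vse_module.span_scale)

theorem eta_inf_eqI:
  assumes "rat_poly p - rat_poly q \<in> vse_ideal"
  shows "eta_inf p = eta_inf q"
proof -
  have "groebner_basis vse_ideal.the_basis vse_ideal"
    using vse_ideal.reduced_the_basis by (simp add: reduced_groebner_basis_def)
  then show ?thesis
    unfolding eta_inf_def vse_ideal.the_reduced_groebner_basis
    using assms by (rule vse_ideal.normal_form_eqI)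
qed

lemma lookup_rat_poly: "Poly_Mapping.lookup (rat_poly p) k = rat_of_int (Poly_Mapping.lookup p k)"
  unfolding rat_poly_def by transfer (simp add: when_def)

lemma rat_poly_add: "rat_poly (p + q) = rat_poly p + rat_poly q"
  and rat_poly_diff: "rat_poly (p - q) = rat_poly p - rat_poly q"
  and rat_poly_sum: "rat_poly (sum f A) = (\<Sum>i\<in>A. rat_poly (f i))"
  and rat_poly_single: "rat_poly (Poly_Mapping.single m c) = Poly_Mapping.single m (rat_of_int c)"
  by (auto intro!: poly_mapping_eqI simp: lookup_rat_poly lookup_add lookup_minus lookup_sum lookup_single when_def)

text \<open>Extension of coefficients is additive, and multiplicative on single terms, so both
  factors are expanded into terms.\<close>

lemma rat_poly_mult: "rat_poly (p * q) = rat_poly p * rat_poly q"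
proof -
  let ?s = "\<lambda>p. \<Sum>k\<in>Poly_Mapping.keys p. Poly_Mapping.single k (Poly_Mapping.lookup p k)"
  have "rat_poly (?s p * ?s q) = rat_poly (?s p) * rat_poly (?s q)"
    by (simp add: sum_product rat_poly_sum mult_single rat_poly_single)
  then show ?thesis
    unfolding poly_mapping_sum_single[of p, symmetric] poly_mapping_sum_single[of q, symmetric] .
qed

section \<open>Expansions as component counts\<close>

fun labs :: "('l \<times> 'l) list \<Rightarrow> 'l multiset" where
  "labs [] = {#}"
| "labs ((a, b) # cs) = {#a, b#} + labs cs"

fun slabs :: "'l symb \<Rightarrow> 'l multiset" where
  "slabs (X1 a b c d) = {#a, b, c, d#}"
| "slabs (X2 a b c d) = {#a, b, c, d#}"
| "slabs (Con a b) = {#a, b#}"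

definition plabs :: "'l symb list \<Rightarrow> 'l multiset" where
  "plabs P = (\<Sum>S\<leftarrow>P. slabs S)"

lemma plabs_simps [simp]:
  "plabs [] = {#}" "plabs (S # P) = slabs S + plabs P" "plabs (P @ Q) = plabs P + plabs Q"
  by (simp_all add: plabs_def)

lemma plabs_cong_mset: "mset P = mset Q \<Longrightarrow> plabs P = plabs Q"
  unfolding plabs_def by (metis mset_map sum_mset_sum_list)

lemma labs_append [simp]: "labs (cs @ ds) = labs cs + labs ds"
  by (induction cs rule: labs.induct) auto

lemma labs_cong_mset: "mset cs = mset ds \<Longrightarrow> labs cs = labs ds"
proof (induction cs arbitrary: ds)
  case (Cons c cs)
  then obtain ds1 ds2 where ds: "ds = ds1 @ c # ds2"
    by (metis list.set_intros(1) set_mset_mset split_list)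
  then have "labs cs = labs (ds1 @ ds2)" using Cons by (intro Cons.IH) auto
  then show ?case using ds by (cases c) (simp add: ac_simps)
qed simp

lemma labs_map: "labs (map (map_prod f f) cs) = image_mset f (labs cs)"
  by (induction cs rule: labs.induct) auto

lemma slabs_map: "slabs (map_symb f S) = image_mset f (slabs S)"
  by (cases S) auto

lemma plabs_map: "plabs (map (map_symb f) P) = image_mset f (plabs P)"
  by (induction P) (auto simp: slabs_map)

lemma labs_eq_concat: "labs cs = mset (concat (map (\<lambda>(x, y). [x, y]) cs))"
  by (induction cs rule: labs.induct) auto

definition balanced :: "'l multiset \<Rightarrow> bool" where
  "balanced M \<longleftrightarrow> (\<forall>x. count M x = 0 \<or> count M x = 2)"

lemma balancedD: "balanced M \<Longrightarrow> count M x = 0 \<or> count M x = 2"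
  by (simp add: balanced_def)

definition linked :: "('l \<times> 'l) list \<Rightarrow> ('l \<times> 'l) set" where
  "linked cs = (set cs \<union> (set cs)\<inverse>)\<^sup>*"

text \<open>The number of connected components of the graph that has the labels as vertices and the
  \<open>con\<close> symbols as edges.\<close>

definition ncomps :: "('l \<times> 'l) list \<Rightarrow> nat" where
  "ncomps cs = card ((\<lambda>x. linked cs `` {x}) ` set_mset (labs cs))"

lemma linked_sym: "(x, y) \<in> linked cs \<Longrightarrow> (y, x) \<in> linked cs"
  unfolding linked_def by (meson sym_Un_converse sym_rtrancl symD)

lemma linked_trans: "(x, y) \<in> linked cs \<Longrightarrow> (y, z) \<in> linked cs \<Longrightarrow> (x, z) \<in> linked cs"
  unfolding linked_def by simp

lemma linked_refl [simp]: "(x, x) \<in> linked cs"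
  unfolding linked_def by simp

lemma linked_class_eq_iff: "linked cs `` {x} = linked cs `` {y} \<longleftrightarrow> (x, y) \<in> linked cs"
proof
  assume "linked cs `` {x} = linked cs `` {y}"
  then have "y \<in> linked cs `` {x}" by simp
  then show "(x, y) \<in> linked cs" by simp
next
  assume *: "(x, y) \<in> linked cs"
  then have "(x, z) \<in> linked cs \<longleftrightarrow> (y, z) \<in> linked cs" for z
    using linked_trans[OF *] linked_trans[OF linked_sym[OF *]] by blast
  then show "linked cs `` {x} = linked cs `` {y}" by blast
qed

lemma linkedI: "(x, y) \<in> set cs \<Longrightarrow> (x, y) \<in> linked cs"
  unfolding linked_def by blast

lemma linked_subset:
  assumes "\<And>x y. (x, y) \<in> set cs \<Longrightarrow> (x, y) \<in> linked ds"
  shows "linked cs \<subseteq> linked ds"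
proof -
  have "set cs \<union> (set cs)\<inverse> \<subseteq> linked ds" using assms linked_sym by fast
  then have "(set cs \<union> (set cs)\<inverse>)\<^sup>* \<subseteq> (linked ds)\<^sup>*" by (rule rtrancl_mono)
  then show ?thesis by (simp add: linked_def)
qed

lemma linked_mem_labs: "(x, y) \<in> linked cs \<Longrightarrow> x \<noteq> y \<Longrightarrow> x \<in># labs cs"
proof -
  have *: "(u, v) \<in> set cs \<Longrightarrow> u \<in># labs cs \<and> v \<in># labs cs" for u v
    by (induction cs rule: labs.induct) auto
  assume "(x, y) \<in> linked cs" "x \<noteq> y"
  then obtain z where "(x, z) \<in> set cs \<union> (set cs)\<inverse>"
    unfolding linked_def by (metis converse_rtranclE)
  then show ?thesis using * by blast
qed

lemma card_image_cong_kernel: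
  assumes "\<And>x y. x \<in> A \<Longrightarrow> y \<in> A \<Longrightarrow> f x = f y \<longleftrightarrow> g x = g y"
  shows "card (f ` A) = card (g ` A)"
proof (rule bij_betw_same_card)
  have *: "f (inv_into A f (f x)) = f x" "inv_into A f (f x) \<in> A" if "x \<in> A" for x
    using that by (auto intro: f_inv_into_f inv_into_into)
  then have "g (inv_into A f (f x)) = g x" if "x \<in> A" for x
    using assms that by blast
  then show "bij_betw (\<lambda>z. g (inv_into A f z)) (f ` A) (g ` A)"
    using assms by (intro bij_betw_imageI inj_onI) (auto simp: image_iff)
qed

definition ren :: "'l \<Rightarrow> 'l \<Rightarrow> 'l \<Rightarrow> 'l" where
  "ren b a x = (if x = b then a else x)"

lemma loops_Cons_neq: "a \<noteq> b \<Longrightarrow> loops ((a, b) # cs) = loops (map (map_prod (ren b a) (ren b a)) cs)"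
  by (simp add: ren_def[abs_def])

text \<open>Contraction of the edge a - b of the graph: the renaming maps links to links, and
  conversely every label is linked to its new name, since \<open>b\<close> is linked to
  \<open>a\<close>.\<close>

lemma linked_contract:
  "(x, y) \<in> linked ((a, b) # cs) \<longleftrightarrow>
   (ren b a x, ren b a y) \<in> linked (map (map_prod (ren b a) (ren b a)) cs)"
  (is "_ \<longleftrightarrow> _ \<in> linked ?ds")
proof
  let ?r = "ren b a"
  assume "(x, y) \<in> linked ((a, b) # cs)"
  then show "(?r x, ?r y) \<in> linked ?ds"
    unfolding linked_def[of "_ # _"]
  proof induction
    case (step y z)
    have "(?r y, ?r z) \<in> linked ?ds"
    proof -
      have *: "(?r u, ?r v) \<in> linked ?ds" if "(u, v) \<in> set ((a, b) # cs)" for u v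
      proof (cases "(u, v) = (a, b)")
        case True
        then show ?thesis by (auto simp: ren_def)
      next
        case False
        then have "(u, v) \<in> set cs" using that by auto
        then have "(?r u, ?r v) \<in> set ?ds" by force
        then show ?thesis by (rule linkedI)
      qed
      from step.hyps(2) show ?thesis
      proof
        assume "(y, z) \<in> set ((a, b) # cs)"
        then show ?thesis by (rule *)
      next
        assume "(y, z) \<in> (set ((a, b) # cs))\<inverse>"
        then have "(?r z, ?r y) \<in> linked ?ds" by (intro *) simp
        then show ?thesis by (rule linked_sym)
      qed
    qed
    with step.IH show ?case by (rule linked_trans)
  qed simp
next
  let ?r = "ren b a" and ?cs = "(a, b) # cs"
  assume *: "(?r x, ?r y) \<in> linked ?ds"
  have ab: "(a, b) \<in> linked ?cs" by (rule linkedI) simp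
  have r: "(u, ?r u) \<in> linked ?cs" for u
    using linked_sym[OF ab] by (simp add: ren_def)
  have "linked ?ds \<subseteq> linked ?cs"
  proof (rule linked_subset)
    fix u v assume "(u, v) \<in> set ?ds"
    then obtain c d where cd: "(c, d) \<in> set cs" "u = ?r c" "v = ?r d" by auto
    then have "(c, d) \<in> linked ?cs" by (intro linkedI) simp
    with cd r show "(u, v) \<in> linked ?cs" by (metis linked_sym linked_trans)
  qed
  with * have "(?r x, ?r y) \<in> linked ?cs" by blast
  then show "(x, y) \<in> linked ?cs"
    by (rule linked_trans[OF r linked_trans[OF _ linked_sym[OF r]]])
qed

text \<open>\<open>loops\<close> follows one particular order of contraction. The number of graph
  components refers neither to the order of the arcs nor to their orientation, so the invariance
  properties of \<open>loops\<close> can be read off from it. In a balanced list each vertex has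
  degree two, and each component is one closed curve.\<close>

lemma loops_eq_ncomps: "balanced (labs cs) \<Longrightarrow> loops cs = ncomps cs"
proof (induction cs rule: loops.induct)
  case 1
  show ?case by (simp add: ncomps_def)
next
  case (2 a b cs)
  show ?case
  proof (cases "a = b")
    case True
    have ct: "count (labs cs) x + (if x = a then 2 else 0) \<in> {0, 2}" for x
      using balancedD[OF 2(3), of x] True by (auto split: if_splits)
    have a: "a \<notin># labs cs" using ct[of a] by (simp add: not_in_iff)
    have "balanced (labs cs)"
      unfolding balanced_def
    proof
      fix x show "count (labs cs) x = 0 \<or> count (labs cs) x = 2"
        using ct[of x] a by (cases "x = a") (auto simp: not_in_iff)
    qed
    then have IH: "loops cs = ncomps cs" using 2(1) True by simp
    have l: "linked ((a, a) # cs) = linked cs"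
    proof
      show "linked ((a, a) # cs) \<subseteq> linked cs" by (rule linked_subset) (auto intro: linkedI)
      show "linked cs \<subseteq> linked ((a, a) # cs)" by (rule linked_subset) (auto intro: linkedI)
    qed
    have "linked cs `` {a} \<noteq> linked cs `` {x}" if "x \<in># labs cs" for x
      using that a linked_mem_labs[of a x cs] by (auto simp: linked_class_eq_iff)
    then have "ncomps ((a, a) # cs) = Suc (ncomps cs)"
      by (auto simp: ncomps_def l card_insert_if image_iff)
    then show ?thesis using True IH by simp
  next
    case False
    let ?r = "ren b a"
    let ?ds = "map (map_prod ?r ?r) cs"
    have ct: "count (labs cs) x + (if x = a \<or> x = b then 1 else 0) \<in> {0, 2}" for x
      using balancedD[OF 2(3), of x] False by (auto split: if_splits)
    \<comment> \<open>One occurrence of \<open>a\<close> and one of \<open>b\<close> remain; after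
      the renaming \<open>a\<close> has both and \<open>b\<close> none.\<close>
    have c1: "count (labs cs) a = 1" "count (labs cs) b = 1" using ct[of a] ct[of b] by auto
    have pre: "?r -` {x} = (if x = a then {a, b} else if x = b then {} else {x})" for x
      using False by (auto simp: ren_def split: if_splits)
    have "count (labs ?ds) x \<in> {0, 2}" for x
    proof -
      have "count (labs ?ds) x = (\<Sum>y\<in>?r -` {x} \<inter> set_mset (labs cs). count (labs cs) y)"
        by (simp add: labs_map count_image_mset)
      also have "\<dots> = (\<Sum>y\<in>?r -` {x}. count (labs cs) y)"
        by (rule sum.mono_neutral_left) (auto simp: pre not_in_iff)
      finally show ?thesis using ct[of x] c1 False by (auto simp: pre split: if_splits)
    qed
    then have bal: "balanced (labs ?ds)" unfolding balanced_def by blast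
    have "loops ((a, b) # cs) = loops ?ds" using False by (rule loops_Cons_neq)
    also have "\<dots> = ncomps ?ds"
      using 2(2)[OF False] bal by (simp add: ren_def[abs_def])
    also have "\<dots> = card ((\<lambda>x. linked ?ds `` {?r x}) ` set_mset (labs ((a, b) # cs)))"
    proof -
      have "a \<in># labs cs" using c1 by (metis count_eq_zero_iff zero_neq_one)
      then have "set_mset (labs ?ds) = ?r ` set_mset (labs ((a, b) # cs))"
        by (auto simp: labs_map ren_def)
      then show ?thesis by (simp add: ncomps_def image_image)
    qed
    also have "\<dots> = ncomps ((a, b) # cs)"
      unfolding ncomps_def
      by (rule card_image_cong_kernel) (simp add: linked_class_eq_iff linked_contract)
    finally show ?thesis .
  qed
qed

lemma loops_cong:
  assumes "balanced (labs cs)" "labs cs = labs ds" "linked cs = linked ds"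
  shows "loops cs = loops ds"
  using assms loops_eq_ncomps[of cs] loops_eq_ncomps[of ds] by (simp add: ncomps_def)

lemma loops_cong_mset:
  assumes "balanced (labs cs)" "mset cs = mset ds"
  shows "loops cs = loops ds"
  using assms mset_eq_setD[OF assms(2)] labs_cong_mset[OF assms(2)]
  by (intro loops_cong) (simp_all add: linked_def)

lemma loops_flip:
  assumes "balanced (labs ((a, b) # cs))"
  shows "loops ((a, b) # cs) = loops ((b, a) # cs)"
proof (rule loops_cong[OF assms])
  have *: "linked ((a, b) # cs) \<subseteq> linked ((b, a) # cs)" for a b :: 'a
  proof (rule linked_subset)
    fix x y assume "(x, y) \<in> set ((a, b) # cs)"
    then have "(x, y) \<in> set ((b, a) # cs) \<or> (y, x) \<in> set ((b, a) # cs)" by auto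
    then show "(x, y) \<in> linked ((b, a) # cs)" using linkedI linked_sym by metis
  qed
  then show "linked ((a, b) # cs) = linked ((b, a) # cs)" by blast
qed simp

lemma loops_map_inj:
  "inj_on f (set_mset (labs cs)) \<Longrightarrow> loops (map (map_prod f f) cs) = loops cs"
proof (induction cs rule: loops.induct)
  case (2 a b cs)
  have in_labs: "x \<in># labs cs \<and> y \<in># labs cs" if "(x, y) \<in> set cs" for x y
    using that by (induction cs rule: labs.induct) auto
  show ?case
  proof (cases "a = b")
    case True
    have "inj_on f (set_mset (labs cs))" using 2(3) by (auto simp: inj_on_def)
    then show ?thesis using 2(1)[OF True] True by simp
  next
    case False
    then have fab: "f a \<noteq> f b" using 2(3) by (auto simp: inj_on_def)
    have eq: "ren (f b) (f a) (f x) = f (ren b a x)" if "x \<in># labs cs" for x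
      using 2(3) that by (auto simp: ren_def inj_on_def)
    have "loops (map (map_prod f f) ((a, b) # cs)) =
        loops (map (map_prod (ren (f b) (f a)) (ren (f b) (f a))) (map (map_prod f f) cs))"
      using loops_Cons_neq[OF fab] by simp
    also have "map (map_prod (ren (f b) (f a)) (ren (f b) (f a))) (map (map_prod f f) cs) =
        map (map_prod f f) (map (map_prod (ren b a) (ren b a)) cs)"
      using in_labs eq by (auto simp: map_prod_def)
    also have "loops \<dots> = loops (map (map_prod (ren b a) (ren b a)) cs)"
    proof -
      have "inj_on f (set_mset (labs (map (map_prod (ren b a) (ren b a)) cs)))"
        using 2(3) by (auto simp: labs_map ren_def inj_on_def)
      then show ?thesis using 2(2)[OF False] unfolding ren_def[abs_def] by simp
    qed
    finally show ?thesis using loops_Cons_neq[OF False] by simp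
  qed
qed simp

text \<open>Equality up to \<open>n\<close> loops in every context. Only the whole is required to be
  balanced, so \<open>cs\<close> may have open ends; balance of the new whole is part of the
  definition so that steps can be chained.\<close>

definition con_equiv :: "nat \<Rightarrow> ('l \<times> 'l) list \<Rightarrow> ('l \<times> 'l) list \<Rightarrow> bool" where
  "con_equiv n cs cs' \<longleftrightarrow> (\<forall>ds. balanced (labs cs + labs ds) \<longrightarrow>
     balanced (labs cs' + labs ds) \<and> loops (cs @ ds) = n + loops (cs' @ ds))"

lemma con_equiv_trans: "con_equiv n cs cs' \<Longrightarrow> con_equiv m cs' cs'' \<Longrightarrow> con_equiv (n + m) cs cs''"
  by (auto simp: con_equiv_def)

lemma con_equiv_mset: "mset cs = mset cs' \<Longrightarrow> con_equiv 0 cs cs'"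
  unfolding con_equiv_def using labs_cong_mset[of cs cs'] by (auto intro!: loops_cong_mset)

lemma con_equiv_append:
  assumes "con_equiv n cs cs'"
  shows "con_equiv n (es @ cs) (es @ cs')"
  unfolding con_equiv_def
proof (intro allI impI conjI)
  fix ds assume b: "balanced (labs (es @ cs) + labs ds)"
  then have "balanced (labs cs + labs (es @ ds))" by (simp add: ac_simps)
  then have *: "balanced (labs cs' + labs (es @ ds))" "loops (cs @ es @ ds) = n + loops (cs' @ es @ ds)"
    using assms unfolding con_equiv_def by blast+
  then show b': "balanced (labs (es @ cs') + labs ds)" by (simp add: ac_simps)
  have "loops ((es @ cs) @ ds) = loops (cs @ es @ ds)"
    using b by (intro loops_cong_mset) (auto simp: ac_simps)
  moreover have "loops ((es @ cs') @ ds) = loops (cs' @ es @ ds)"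
    using b' by (intro loops_cong_mset) (auto simp: ac_simps)
  ultimately show "loops ((es @ cs) @ ds) = n + loops ((es @ cs') @ ds)" using * by simp
qed

lemma con_equiv_flip: "con_equiv 0 ((a, b) # cs) ((b, a) # cs)"
  unfolding con_equiv_def
proof (intro allI impI conjI)
  fix ds assume "balanced (labs ((a, b) # cs) + labs ds)"
  then show "balanced (labs ((b, a) # cs) + labs ds)" "loops (((a, b) # cs) @ ds) = 0 + loops (((b, a) # cs) @ ds)"
    using loops_flip[of a b "cs @ ds"] by (auto simp: add_mset_commute)
qed

lemma con_equiv_loop: "con_equiv 1 ((a, a) # cs) cs"
  unfolding con_equiv_def
proof (intro allI impI conjI)
  fix ds assume b: "balanced (labs ((a, a) # cs) + labs ds)"
  show "balanced (labs cs + labs ds)"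
    unfolding balanced_def
  proof
    fix x show "count (labs cs + labs ds) x = 0 \<or> count (labs cs + labs ds) x = 2"
      using balancedD[OF b, of x] by (auto split: if_splits)
  qed
qed simp

lemma count_image_ren:
  assumes "a \<noteq> b"
  shows "count (image_mset (ren b a) M) x =
    (if x = a then count M a + count M b else if x = b then 0 else count M x)"
  using assms by (induction M) (auto simp: ren_def)

lemma map_ren_id: "b \<notin># labs cs \<Longrightarrow> map (map_prod (ren b a) (ren b a)) cs = cs"
  by (induction cs rule: labs.induct) (auto simp: ren_def)

text \<open>The second occurrence of \<open>b\<close> is inside \<open>cs\<close>, so by balance the
  context has none and the renaming stays inside the list.\<close>

lemma con_equiv_contract:
  assumes ab: "a \<noteq> b" and b: "b \<in># labs cs"
  shows "con_equiv 0 ((a, b) # cs) (map (map_prod (ren b a) (ren b a)) cs)"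
  unfolding con_equiv_def
proof (intro allI impI conjI)
  fix ds assume bal: "balanced (labs ((a, b) # cs) + labs ds)"
  have "count (labs cs) b > 0" using b by simp
  moreover have "count (labs cs) b + count (labs ds) b = 1"
    using balancedD[OF bal, of b] ab by auto
  ultimately have c0: "count (labs ds) b = 0" "count (labs cs) b = 1" by linarith+
  then have bds: "b \<notin># labs ds" by (simp add: not_in_iff)
  show "loops (((a, b) # cs) @ ds) = 0 + loops (map (map_prod (ren b a) (ren b a)) cs @ ds)"
    using loops_Cons_neq[OF ab, of "cs @ ds"] map_ren_id[OF bds] by simp

  have "count (labs (map (map_prod (ren b a) (ren b a)) cs) + labs ds) x \<in> {0, 2}" for x
    using balancedD[OF bal, of x] ab c0
    by (auto simp: labs_map count_image_ren split: if_splits)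
  then show "balanced (labs (map (map_prod (ren b a) (ren b a)) cs) + labs ds)"
    unfolding balanced_def by blast
qed

text \<open>Contracting along labels that occur twice inside the list shortens it, until only arcs
  between labels of multiplicity one are left, together with a number of closed loops.\<close>

lemma con_equiv_matching:
  "(\<And>x. count (labs cs) x \<le> 2) \<Longrightarrow>
   \<exists>n \<epsilon>. con_equiv n cs \<epsilon> \<and> (\<forall>x. count (labs \<epsilon>) x = (if count (labs cs) x = 1 then 1 else 0))"
proof (induction "length cs" arbitrary: cs rule: less_induct)
  case less
  show ?case
  proof (cases cs)
    case Nil
    then show ?thesis by (intro exI[of _ 0] exI[of _ "[]"]) (simp add: con_equiv_def)
  next
    case (Cons c cs')
    obtain a b where c: "c = (a, b)" by (cases c)
    note cs = Cons[unfolded c]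
    \<comment> \<open>Proved for arbitrary names \<open>a\<close>, \<open>b\<close>, because either
      end of the first arc may be the one that occurs again.\<close>
    have contract: ?thesis
      if ab: "a \<noteq> b" and b: "b \<in># labs cs'" and e: "con_equiv 0 cs ((a, b) # cs')"
        and l: "labs cs = labs ((a, b) # cs')" for a b
    proof -
      let ?ds = "map (map_prod (ren b a) (ren b a)) cs'"
      have cb: "count (labs cs') b = 1"
        using less.prems[of b] l b ab by (auto simp: not_in_iff) (metis count_eq_zero_iff le_Suc_eq le_zero_eq)
      have ct: "count (labs ?ds) x = (if x = b then 0 else count (labs cs) x)" for x
        using ab cb l by (auto simp: labs_map count_image_ren)
      have "count (labs ?ds) x \<le> 2" for x using less.prems[of x] ct[of x] by auto
      then obtain n \<epsilon> where n: "con_equiv n ?ds \<epsilon>"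
          "\<forall>x. count (labs \<epsilon>) x = (if count (labs ?ds) x = 1 then 1 else 0)"
        using less.hyps[of ?ds] cs by auto
      have "count (labs cs) b = 2" using cb l ab by simp
      with n(2) ct have "\<forall>x. count (labs \<epsilon>) x = (if count (labs cs) x = 1 then 1 else 0)" by auto
      moreover have "con_equiv (0 + (0 + n)) cs \<epsilon>"
        by (rule con_equiv_trans[OF e con_equiv_trans[OF con_equiv_contract[OF ab b] n(1)]])
      ultimately show ?thesis by blast
    qed
    consider "a = b" | "a \<noteq> b" "b \<in># labs cs'" | "a \<noteq> b" "a \<in># labs cs'"
      | "a \<noteq> b" "a \<notin># labs cs'" "b \<notin># labs cs'" by blast
    then show ?thesis
    proof cases
      case 1
      have "count (labs cs') x \<le> 2" for x using less.prems[of x] cs by (auto split: if_splits)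
      then obtain n \<epsilon> where n: "con_equiv n cs' \<epsilon>"
          "\<forall>x. count (labs \<epsilon>) x = (if count (labs cs') x = 1 then 1 else 0)"
        using less.hyps[of cs'] cs by auto
      have "count (labs cs') a = 0" using less.prems[of a] cs 1 by simp
      then have "\<forall>x. count (labs \<epsilon>) x = (if count (labs cs) x = 1 then 1 else 0)"
        using n(2) cs 1 by auto
      moreover have "con_equiv (1 + n) cs \<epsilon>"
        using con_equiv_trans[OF con_equiv_loop n(1)] cs 1 by simp
      ultimately show ?thesis by blast
    next
      case 2
      then show ?thesis
        using contract[of a b] cs con_equiv_mset[of cs cs] by metis
    next
      case 3
      have "labs cs = labs ((b, a) # cs')" using cs by (simp add: add_mset_commute)
      with 3 show ?thesis
        using contract[of b a] con_equiv_flip[of a b cs'] unfolding cs by metis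
    next
      case 4
      have "count (labs cs') x \<le> 2" for x using less.prems[of x] cs by (auto split: if_splits)
      then obtain n \<epsilon> where n: "con_equiv n cs' \<epsilon>"
          "\<forall>x. count (labs \<epsilon>) x = (if count (labs cs') x = 1 then 1 else 0)"
        using less.hyps[of cs'] cs by auto
      have "con_equiv n cs ((a, b) # \<epsilon>)"
        using con_equiv_append[OF n(1), of "[(a, b)]"] cs by simp
      moreover have "\<forall>x. count (labs ((a, b) # \<epsilon>)) x = (if count (labs cs) x = 1 then 1 else 0)"
        using n(2) cs 4 by (auto simp: not_in_iff)
      ultimately show ?thesis by blast
    qed
  qed
qed

subsection \<open>Expanding in any order\<close>

text \<open>The weighted smoothings of a symbol, as data. With \<open>Con\<close> as a symbol that
  has a single smoothing of weight 1, \<open>expand\<close> obeys one recursion for all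
  symbols.\<close>

fun smooth :: "'l symb \<Rightarrow> (int vse_poly \<times> ('l \<times> 'l) list) list" where
  "smooth (X1 a b c d) = [(var VM * var VA, [(a, b), (c, d)]), (var VM * var VB, [(a, d), (b, c)]),
     (var VF, [(a, c), (b, d)])]"
| "smooth (X2 a b c d) = [(var VM * var VX, [(a, b), (c, d)]), (var VM * var VY, [(a, d), (b, c)]),
     (var VZ, [(a, c), (b, d)])]"
| "smooth (Con a b) = [(1, [(a, b)])]"

lemma expand_Cons: "expand cs (S # P) = (\<Sum>(w, ds)\<leftarrow>smooth S. w * expand (ds @ cs) P)"
  by (cases S) auto

declare expand.simps(2-4) [simp del]

lemma labs_smooth: "(w, ds) \<in> set (smooth S) \<Longrightarrow> labs ds = slabs S"
  by (cases S) (auto simp: add_mset_commute)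

lemma sum_list_cong_pair:
  assumes "\<And>w ds. (w, ds) \<in> set xs \<Longrightarrow> f w ds = g w ds"
  shows "(\<Sum>(w, ds)\<leftarrow>xs. f w ds) = (\<Sum>(w, ds)\<leftarrow>xs. g w ds)"
  using assms by (auto intro!: arg_cong[of _ _ sum_list])

text \<open>Smoothing a further symbol only adds arcs in front, that is, it enlarges the context,
  and \<open>con_equiv\<close> is stable under this.\<close>

lemma expand_con_equiv:
  "con_equiv n cs cs' \<Longrightarrow> balanced (labs cs + plabs P) \<Longrightarrow>
    expand cs P = var Vo ^ n * expand cs' P"
proof (induction P arbitrary: cs cs')
  case Nil
  then show ?case by (auto simp: con_equiv_def power_add dest!: spec[of _ "[]"])
next
  case (Cons S P)
  have "expand (ds @ cs) P = var Vo ^ n * expand (ds @ cs') P" if "(w, ds) \<in> set (smooth S)" for w ds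
    using Cons.prems labs_smooth[OF that]
    by (intro Cons.IH con_equiv_append) (auto simp: ac_simps)
  then have "expand cs (S # P) = (\<Sum>(w, ds)\<leftarrow>smooth S. var Vo ^ n * (w * expand (ds @ cs') P))"
    unfolding expand_Cons by (intro sum_list_cong_pair) (simp add: mult.left_commute)
  also have "\<dots> = var Vo ^ n * expand cs' (S # P)"
    unfolding expand_Cons by (simp add: sum_list_const_mult[symmetric] case_prod_unfold)
  finally show ?case .
qed

lemma expand_cong_mset_cons:
  assumes "mset cs = mset cs'" "balanced (labs cs + plabs P)"
  shows "expand cs P = expand cs' P"
  using expand_con_equiv[OF con_equiv_mset[OF assms(1)] assms(2)] by simp

lemma sum_list_swap:
  "(\<Sum>x\<leftarrow>xs. \<Sum>y\<leftarrow>ys. f x y) = (\<Sum>y\<leftarrow>ys. \<Sum>x\<leftarrow>xs. (f x y :: 'a::comm_monoid_add))"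
  by (induction xs) (simp_all add: sum_list_addf)

text \<open>Two neighbouring crossings are exchanged by interchanging two finite sums. The
  accumulated arcs are thereby permuted, which \<open>loops\<close> tolerates in balanced
  lists.\<close>

lemma expand_move_front:
  "balanced (labs cs + plabs (P @ S # Q)) \<Longrightarrow> expand cs (P @ S # Q) = expand cs (S # P @ Q)"
proof (induction P arbitrary: cs)
  case (Cons T P)
  have "expand cs ((T # P) @ S # Q) = (\<Sum>(w, ds)\<leftarrow>smooth T. w * expand (ds @ cs) (S # P @ Q))"
    unfolding append_Cons expand_Cons[of cs T]
  proof (rule sum_list_cong_pair)
    fix w ds assume "(w, ds) \<in> set (smooth T)"
    then have "balanced (labs (ds @ cs) + plabs (P @ S # Q))"
      using Cons.prems labs_smooth by (fastforce simp: ac_simps)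
    then show "w * expand (ds @ cs) (P @ S # Q) = w * expand (ds @ cs) (S # P @ Q)"
      by (simp add: Cons.IH)
  qed
  also have "\<dots> = (\<Sum>t\<leftarrow>smooth T. \<Sum>s\<leftarrow>smooth S. fst t * (fst s * expand (snd s @ snd t @ cs) (P @ Q)))"
    by (simp add: expand_Cons case_prod_unfold sum_list_const_mult)
  also have "\<dots> = (\<Sum>s\<leftarrow>smooth S. \<Sum>t\<leftarrow>smooth T. fst t * (fst s * expand (snd s @ snd t @ cs) (P @ Q)))"
    by (rule sum_list_swap)
  also have "\<dots> = (\<Sum>s\<leftarrow>smooth S. \<Sum>t\<leftarrow>smooth T. fst s * (fst t * expand (snd t @ snd s @ cs) (P @ Q)))"
  proof (intro arg_cong[of _ _ sum_list] map_cong refl)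
    fix s t assume st: "s \<in> set (smooth S)" "t \<in> set (smooth T)"
    have "labs (snd s) = slabs S" "labs (snd t) = slabs T"
      using st labs_smooth by (metis prod.collapse)+
    then have "expand (snd s @ snd t @ cs) (P @ Q) = expand (snd t @ snd s @ cs) (P @ Q)"
      using Cons.prems by (intro expand_cong_mset_cons) (auto simp: ac_simps)
    then show "fst t * (fst s * expand (snd s @ snd t @ cs) (P @ Q)) =
        fst s * (fst t * expand (snd t @ snd s @ cs) (P @ Q))"
      by (simp add: mult.left_commute)
  qed
  also have "\<dots> = expand cs (S # (T # P) @ Q)"
    by (simp add: expand_Cons case_prod_unfold sum_list_const_mult)
  finally show ?case .
qed simp

lemma expand_cong_mset:
  "mset P = mset Q \<Longrightarrow> balanced (labs cs + plabs P) \<Longrightarrow> expand cs P = expand cs Q"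
proof (induction P arbitrary: Q cs)
  case (Cons S P)
  then obtain Q1 Q2 where Q: "Q = Q1 @ S # Q2"
    by (metis list.set_intros(1) set_mset_mset split_list)
  then have PQ: "mset P = mset (Q1 @ Q2)" using Cons.prems by simp
  have "expand cs (S # P) = expand cs (S # Q1 @ Q2)"
    unfolding expand_Cons
  proof (rule sum_list_cong_pair)
    fix w ds assume "(w, ds) \<in> set (smooth S)"
    then have "balanced (labs (ds @ cs) + plabs P)"
      using Cons.prems labs_smooth by (fastforce simp: ac_simps)
    then show "w * expand (ds @ cs) P = w * expand (ds @ cs) (Q1 @ Q2)"
      using Cons.IH[OF PQ] by simp
  qed
  also have "\<dots> = expand cs Q"
    unfolding Q using Cons.prems plabs_cong_mset[OF PQ] Q
    by (intro expand_move_front[symmetric]) (auto simp: ac_simps)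
  finally show ?case .
qed simp

lemma bracket_cong_mset:
  assumes "mset P = mset Q" "balanced (plabs P)"
  shows "bracket P = bracket Q"
  unfolding bracket_def using assms by (intro expand_cong_mset) auto

lemma smooth_map: "smooth (map_symb f S) = map (map_prod id (map (map_prod f f))) (smooth S)"
  by (cases S) auto

lemma expand_map_inj:
  "inj_on f (set_mset (labs cs + plabs P)) \<Longrightarrow>
    expand (map (map_prod f f) cs) (map (map_symb f) P) = expand cs P"
proof (induction P arbitrary: cs)
  case Nil
  then show ?case by (simp add: loops_map_inj)
next
  case (Cons S P)
  have "expand (map (map_prod f f) cs) (map (map_symb f) (S # P)) =
      (\<Sum>(w, ds)\<leftarrow>smooth S. w * expand (map (map_prod f f) (ds @ cs)) (map (map_symb f) P))"
    by (simp add: expand_Cons smooth_map o_def case_prod_unfold)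
  also have "\<dots> = expand cs (S # P)"
    unfolding expand_Cons
  proof (rule sum_list_cong_pair)
    fix w ds assume "(w, ds) \<in> set (smooth S)"
    then have "inj_on f (set_mset (labs (ds @ cs) + plabs P))"
      using Cons.prems labs_smooth by (fastforce simp: Un_ac)
    then show "w * expand (map (map_prod f f) (ds @ cs)) (map (map_symb f) P) = w * expand (ds @ cs) P"
      using Cons.IH[of "ds @ cs"] by simp
  qed
  finally show ?case .
qed

lemma bracket_map_inj: "inj_on f (set_mset (plabs P)) \<Longrightarrow> bracket (map (map_symb f) P) = bracket P"
  using expand_map_inj[of f "[]" P] by (simp add: bracket_def)

lemma expand_Con: "expand cs (Con a b # P) = expand ((a, b) # cs) P"
  by (simp add: expand_Cons)

lemma expand_map_Con: "expand cs (map (case_prod Con) \<epsilon> @ P) = expand (rev \<epsilon> @ cs) P"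
  by (induction \<epsilon> arbitrary: cs) (auto simp: expand_Con)

lemma plabs_map_Con: "plabs (map (case_prod Con) \<epsilon>) = labs \<epsilon>"
  by (induction \<epsilon> rule: labs.induct) auto

text \<open>The arcs accumulated by \<open>expand\<close> have the same effect as \<open>con\<close>
  symbols that close the tangle.\<close>

lemma expand_eq_closure:
  assumes "balanced (labs \<epsilon> + plabs L)"
  shows "expand \<epsilon> L = bracket (L @ map (case_prod Con) \<epsilon>)"
proof -
  have "bracket (L @ map (case_prod Con) \<epsilon>) = bracket (map (case_prod Con) \<epsilon> @ L)"
    using assms by (intro bracket_cong_mset) (auto simp: plabs_map_Con ac_simps)
  also have "\<dots> = expand (rev \<epsilon>) L" by (simp add: bracket_def expand_map_Con)
  also have "\<dots> = expand \<epsilon> L"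
    using assms labs_cong_mset[of "rev \<epsilon>" \<epsilon>] by (intro expand_cong_mset_cons) auto
  finally show ?thesis ..
qed

section \<open>Congruence modulo the ideal; from closures to arbitrary contexts\<close>

definition veq :: "int vse_poly \<Rightarrow> int vse_poly \<Rightarrow> bool" where
  "veq p q \<longleftrightarrow> rat_poly p - rat_poly q \<in> vse_ideal"

lemma veq_refl [simp]: "veq p p"
  by (simp add: veq_def vse_ideal.zero_mem)

lemma veq_sym: "veq p q \<Longrightarrow> veq q p"
  unfolding veq_def using vse_ideal.diff_mem[OF vse_ideal.zero_mem] by fastforce

lemma veq_trans [trans]: "veq p q \<Longrightarrow> veq q r \<Longrightarrow> veq p r"
  unfolding veq_def using vse_ideal.add_mem by fastforce

lemma veq_add: "veq p q \<Longrightarrow> veq p' q' \<Longrightarrow> veq (p + p') (q + q')"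
  unfolding veq_def rat_poly_add using vse_ideal.add_mem by (fastforce simp: algebra_simps)

lemma veq_mult: "veq p q \<Longrightarrow> veq (h * p) (h * q)"
  unfolding veq_def rat_poly_mult using vse_ideal.mult_mem by (fastforce simp flip: right_diff_distrib)

lemma veq_sum_list:
  assumes "\<And>w ds. (w, ds) \<in> set xs \<Longrightarrow> veq (f w ds) (g w ds)"
  shows "veq (\<Sum>(w, ds)\<leftarrow>xs. f w ds) (\<Sum>(w, ds)\<leftarrow>xs. g w ds)"
  using assms by (induction xs) (auto intro: veq_add)

text \<open>After the expansion of the context \<open>P\<close>, the outside of the tangle is a list
  of arcs, hence a power of \<open>o\<close> times a matching of the boundary labels. The closures
  in the hypothesis therefore control every context. The map \<open>f\<close> takes the formal
  labels of a relation to labels of a diagram.\<close>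

theorem veq_tangle:
  fixes L R :: "'l symb list" and f :: "'l \<Rightarrow> 'm"
  assumes rel: "\<And>\<epsilon>. \<epsilon> \<in> perfect_matchings bs \<Longrightarrow>
      veq (bracket (L @ map (case_prod Con) \<epsilon>)) (bracket (R @ map (case_prod Con) \<epsilon>))"
    and bs: "distinct bs"
    and L: "balanced (plabs L + mset bs)" and R: "balanced (plabs R + mset bs)"
    and inj: "inj_on f (set_mset (plabs L + plabs R))"
    and PL: "balanced (plabs (map (map_symb f) L) + plabs P)"
    and PR: "balanced (plabs (map (map_symb f) R) + plabs P)"
  shows "veq (bracket (map (map_symb f) L @ P)) (bracket (map (map_symb f) R @ P))"
proof -
  let ?L = "map (map_symb f) L" and ?R = "map (map_symb f) R"
  have bL: "x \<in># plabs L" "count (plabs L) x = 1" if "x \<in> set bs" for x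
  proof -
    show "count (plabs L) x = 1"
      using balancedD[OF L, of x] bs that by (auto simp: distinct_count_atmost_1)
    then show "x \<in># plabs L" by (metis not_in_iff zero_neq_one)
  qed
  have bR: "x \<in># plabs R" if "x \<in> set bs" for x
  proof -
    have "count (plabs R) x = 1"
      using balancedD[OF R, of x] bs that by (auto simp: distinct_count_atmost_1)
    then show ?thesis by (metis not_in_iff zero_neq_one)
  qed
  have injL: "inj_on f (set_mset (plabs L))" and injR: "inj_on f (set_mset (plabs R))"
    using inj by (auto simp: inj_on_def)
  have cfL: "count (plabs ?L) (f x) = count (plabs L) x" if "x \<in># plabs L" for x
  proof -
    have "f -` {f x} \<inter> set_mset (plabs L) = {x}" using injL that by (auto simp: inj_on_def)
    then show ?thesis by (simp add: plabs_map count_image_mset)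
  qed
  \<comment> \<open>The images of the boundary labels are exactly the labels that the tangle leaves
    open; by balance the arcs outside have the same open labels.\<close>
  have one: "count (plabs ?L) y = 1 \<longleftrightarrow> y \<in> f ` set bs" for y
  proof (cases "y \<in># plabs ?L")
    case True
    then obtain x where x: "x \<in># plabs L" "y = f x" by (auto simp: plabs_map)
    have "x \<in> set bs" if "y \<in> f ` set bs"
      using that x bL(1) injL by (auto simp: inj_on_def)
    moreover have "count (plabs L) x = 2" if "x \<notin> set bs"
    proof -
      have "count (mset bs) x = 0" using that by (simp add: count_mset_0_iff)
      moreover have "count (plabs L) x \<noteq> 0" using x(1) by (metis count_eq_zero_iff)
      ultimately show ?thesis using balancedD[OF L, of x] unfolding count_union by linarith
    qed
    ultimately show ?thesis using cfL[OF x(1)] x(2) bL(2) by fastforce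
  next
    case False
    then have "y \<notin> f ` set bs" using bL(1) by (auto simp: plabs_map)
    then show ?thesis using False by (simp add: not_in_iff)
  qed
  \<comment> \<open>The case in which the context consists of arcs only.\<close>
  have base: "veq (expand cs ?L) (expand cs ?R)"
    if cL: "balanced (labs cs + plabs ?L)" and cR: "balanced (labs cs + plabs ?R)" for cs
  proof -
    have "count (labs cs) x \<le> 2" for x using balancedD[OF cL, of x] by auto
    then obtain n \<epsilon> where n: "con_equiv n cs \<epsilon>"
        "\<forall>x. count (labs \<epsilon>) x = (if count (labs cs) x = 1 then 1 else 0)"
      using con_equiv_matching by blast
    have c1: "count (labs cs) x = 1 \<longleftrightarrow> x \<in> f ` set bs" for x
      using balancedD[OF cL, of x] one[of x] by auto
    \<comment> \<open>The matching found in the diagram is pulled back along \<open>f\<close> to the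
      formal labels, where the hypothesis applies.\<close>
    define g where "g = inv_into (set bs) f"
    have injb: "inj_on f (set bs)" using bL(1) injL by (auto simp: inj_on_def)
    have gf: "g (f x) = x" if "x \<in> set bs" for x
      using injb that by (simp add: g_def)
    have mem: "x \<in># labs \<epsilon> \<longleftrightarrow> x \<in> f ` set bs" for x
      using n(2) c1[of x] by (metis count_eq_zero_iff zero_neq_one)
    define \<epsilon>0 where "\<epsilon>0 = map (map_prod g g) \<epsilon>"
    have pm: "labs \<epsilon> = image_mset f (mset bs)"
    proof (rule multiset_eqI)
      fix x
      have "image_mset f (mset bs) = mset (map f bs)" by simp
      moreover have "distinct (map f bs)" using bs injb by (simp add: distinct_map)
      ultimately show "count (labs \<epsilon>) x = count (image_mset f (mset bs)) x"
        using n(2) c1[of x] by (simp add: distinct_count_atmost_1)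
    qed
    have "labs \<epsilon>0 = image_mset (\<lambda>x. g (f x)) (mset bs)"
      by (simp add: \<epsilon>0_def labs_map pm multiset.map_comp o_def)
    also have "\<dots> = image_mset (\<lambda>x. x) (mset bs)"
      by (intro image_mset_cong) (simp add: gf)
    finally have l0: "labs \<epsilon>0 = mset bs" by simp
    then have e0: "\<epsilon>0 \<in> perfect_matchings bs"
      by (simp add: perfect_matchings_def labs_eq_concat)
    have in_labs: "x \<in># labs es \<and> y \<in># labs es" if "(x, y) \<in> set es" for x y and es :: "('m \<times> 'm) list"
      using that by (induction es rule: labs.induct) auto
    have "map (map_prod f f) \<epsilon>0 = map (\<lambda>x. x) \<epsilon>"
      unfolding \<epsilon>0_def map_map
    proof (rule map_cong[OF refl])
      fix z assume "z \<in> set \<epsilon>"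
      then show "(map_prod f f \<circ> map_prod g g) z = z"
        using in_labs[of "fst z" "snd z" \<epsilon>] mem gf by (auto simp: prod_eq_iff)
    qed
    then have e: "map (map_prod f f) \<epsilon>0 = \<epsilon>" by simp
    have "expand cs ?L = var Vo ^ n * bracket (L @ map (case_prod Con) \<epsilon>0)"
    proof -
      have "expand cs ?L = var Vo ^ n * expand \<epsilon> ?L" using expand_con_equiv[OF n(1)] cL by simp
      also have "expand \<epsilon> ?L = expand \<epsilon>0 L"
        unfolding e[symmetric] using injL bL(1) l0 by (intro expand_map_inj) (auto simp: inj_on_def)
      also have "\<dots> = bracket (L @ map (case_prod Con) \<epsilon>0)"
        using L l0 by (intro expand_eq_closure) (simp add: ac_simps)
      finally show ?thesis .
    qed
    moreover have "expand cs ?R = var Vo ^ n * bracket (R @ map (case_prod Con) \<epsilon>0)"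
    proof -
      have "expand cs ?R = var Vo ^ n * expand \<epsilon> ?R" using expand_con_equiv[OF n(1)] cR by simp
      also have "expand \<epsilon> ?R = expand \<epsilon>0 R"
        unfolding e[symmetric] using injR bR l0 by (intro expand_map_inj) (auto simp: inj_on_def)
      also have "\<dots> = bracket (R @ map (case_prod Con) \<epsilon>0)"
        using R l0 by (intro expand_eq_closure) (simp add: ac_simps)
      finally show ?thesis .
    qed
    ultimately show ?thesis using veq_mult[OF rel[OF e0]] by simp
  qed
  \<comment> \<open>The context is placed in front, so that it is expanded before the
    tangle.\<close>
  have "veq (expand cs (Q @ ?L)) (expand cs (Q @ ?R))"
    if "balanced (labs cs + plabs Q + plabs ?L)" "balanced (labs cs + plabs Q + plabs ?R)" for cs Q
    using that
  proof (induction Q arbitrary: cs)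
    case (Cons S Q)
    show ?case
      unfolding append_Cons expand_Cons
    proof (intro veq_sum_list veq_mult)
      fix w ds assume "(w, ds) \<in> set (smooth S)"
      then have "labs ds = slabs S" by (rule labs_smooth)
      then show "veq (expand (ds @ cs) (Q @ ?L)) (expand (ds @ cs) (Q @ ?R))"
        using Cons.prems by (intro Cons.IH) (simp_all add: ac_simps)
    qed
  qed (simp add: base)
  from this[of "[]" P] have "veq (bracket (P @ ?L)) (bracket (P @ ?R))"
    using PL PR by (simp add: bracket_def ac_simps)
  moreover have "bracket (P @ ?L) = bracket (?L @ P)" "bracket (P @ ?R) = bracket (?R @ P)"
    using PL PR by (intro bracket_cong_mset; simp add: ac_simps)+
  ultimately show ?thesis by simp
qed

section \<open>Reidemeister moves of symbol lists\<close>

text \<open>The encoding of the same crossing from the other end of its underpass.\<close>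

fun rot2 :: "'l symb \<Rightarrow> 'l symb" where
  "rot2 (X1 a b c d) = X1 c d a b"
| "rot2 (X2 a b c d) = X2 c d a b"
| "rot2 (Con a b) = Con b a"

definition req :: "'l symb \<Rightarrow> 'l symb \<Rightarrow> bool" where
  "req S T \<longleftrightarrow> T = S \<or> T = rot2 S"

lemma rot2_rot2 [simp]: "rot2 (rot2 S) = S"
  by (cases S) auto

lemma req_refl [simp]: "req S S"
  by (simp add: req_def)

lemma req_rot2 [simp]: "req S (rot2 S)" "req (rot2 S) S"
  by (simp_all add: req_def)

lemma req_sym: "req S T \<Longrightarrow> req T S"
  by (auto simp: req_def)

lemma req_trans: "req S T \<Longrightarrow> req T U \<Longrightarrow> req S U"
  by (auto simp: req_def)

lemma slabs_rot2 [simp]: "slabs (rot2 S) = slabs S"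
  by (cases S) (auto simp: add_mset_commute)

lemma slabs_req: "req S T \<Longrightarrow> slabs S = slabs T"
  by (auto simp: req_def)

lemma plabs_req: "list_all2 req P Q \<Longrightarrow> plabs P = plabs Q"
  by (induction rule: list_all2_induct) (auto simp: slabs_req)

lemma map_symb_rot2: "map_symb f (rot2 S) = rot2 (map_symb f S)"
  by (cases S) auto

text \<open>Reordering and reversing arcs changes neither the labels nor the symmetric edge
  relation.\<close>

lemma con_equiv_linked:
  assumes "labs cs = labs cs'" "set cs \<union> (set cs)\<inverse> = set cs' \<union> (set cs')\<inverse>"
  shows "con_equiv 0 cs cs'"
  unfolding con_equiv_def
proof (intro allI impI conjI)
  fix ds assume b: "balanced (labs cs + labs ds)"
  then show "balanced (labs cs' + labs ds)" using assms by simp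
  have "set (cs @ ds) \<union> (set (cs @ ds))\<inverse> = set (cs' @ ds) \<union> (set (cs' @ ds))\<inverse>"
    using assms(2) by (simp add: converse_Un Un_ac) (metis (no_types, lifting) Un_assoc Un_commute)
  then show "loops (cs @ ds) = 0 + loops (cs' @ ds)"
    using loops_cong[of "cs @ ds" "cs' @ ds"] b assms(1) by (simp add: linked_def)
qed

text \<open>The three smoothings agree with the old ones up to the order and the orientation of
  their arcs.\<close>

lemma expand_rot2:
  assumes "balanced (labs cs + plabs (S # P))"
  shows "expand cs (rot2 S # P) = expand cs (S # P)"
proof -
  have *: "expand (ds @ cs) P = expand (ds' @ cs) P"
    if "labs ds = slabs S" "labs ds' = slabs S" "set ds \<union> (set ds)\<inverse> = set ds' \<union> (set ds')\<inverse>" for ds ds'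
  proof -
    have "con_equiv 0 (cs @ ds) (cs @ ds')"
      using that by (intro con_equiv_append con_equiv_linked) auto
    moreover have "con_equiv 0 (ds @ cs) (cs @ ds)" "con_equiv 0 (cs @ ds') (ds' @ cs)"
      by (intro con_equiv_mset; simp)+
    ultimately have "con_equiv 0 (ds @ cs) (ds' @ cs)"
      using con_equiv_trans by (metis add_0)
    from expand_con_equiv[OF this, of P] assms that(1) show ?thesis by (simp add: ac_simps)
  qed
  show ?thesis
  proof (cases S)
    case (X1 a b c d)
    have "expand ([(c, d), (a, b)] @ cs) P = expand ([(a, b), (c, d)] @ cs) P"
      "expand ([(c, b), (d, a)] @ cs) P = expand ([(a, d), (b, c)] @ cs) P"
      "expand ([(c, a), (d, b)] @ cs) P = expand ([(a, c), (b, d)] @ cs) P"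
      by (rule *; use X1 in \<open>auto simp: add_mset_commute\<close>)+
    with X1 show ?thesis by (simp add: expand_Cons)
  next
    case (X2 a b c d)
    have "expand ([(c, d), (a, b)] @ cs) P = expand ([(a, b), (c, d)] @ cs) P"
      "expand ([(c, b), (d, a)] @ cs) P = expand ([(a, d), (b, c)] @ cs) P"
      "expand ([(c, a), (d, b)] @ cs) P = expand ([(a, c), (b, d)] @ cs) P"
      by (rule *; use X2 in \<open>auto simp: add_mset_commute\<close>)+
    with X2 show ?thesis by (simp add: expand_Cons)
  next
    case (Con a b)
    have "expand ([(b, a)] @ cs) P = expand ([(a, b)] @ cs) P"
      by (rule *; use Con in \<open>auto simp: add_mset_commute\<close>)
    with Con show ?thesis by (simp add: expand_Cons)
  qed
qed

lemma expand_req: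
  "list_all2 req P Q \<Longrightarrow> balanced (labs cs + plabs P) \<Longrightarrow> expand cs P = expand cs Q"
proof (induction arbitrary: cs rule: list_all2_induct)
  case (Cons S P T Q)
  have "expand cs (S # P) = expand cs (T # P)"
    using Cons(1) expand_rot2[OF Cons.prems] by (auto simp: req_def)
  also have "\<dots> = expand cs (T # Q)"
    unfolding expand_Cons
  proof (rule sum_list_cong_pair)
    fix w ds assume "(w, ds) \<in> set (smooth T)"
    then have "balanced (labs (ds @ cs) + plabs P)"
      using Cons.prems labs_smooth[of w ds T] slabs_req[OF Cons(1)] by (simp add: ac_simps)
    then show "w * expand (ds @ cs) P = w * expand (ds @ cs) Q" using Cons.IH by simp
  qed
  finally show ?case .
qed simp

lemma set_symb_slabs: "set_symb S = set_mset (slabs S)"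
  by (cases S) auto

lemma map_symb_ident_on: "(\<And>x. x \<in># slabs S \<Longrightarrow> f x = x) \<Longrightarrow> map_symb f S = S"
  using symb.map_cong0[of S f id] by (auto simp: set_symb_slabs symb.map_id)

lemma map_map_symb_ident_on: "(\<And>x. x \<in># plabs P \<Longrightarrow> f x = x) \<Longrightarrow> map (map_symb f) P = P"
  by (induction P) (auto intro: map_symb_ident_on)

text \<open>A \<open>con\<close> symbol may be absorbed before the crossings are resolved, by
  renaming one of its labels throughout.\<close>

lemma expand_contract:
  assumes ab: "a \<noteq> b"
  shows "balanced (labs ((a, b) # cs) + plabs P) \<Longrightarrow>
    expand ((a, b) # cs) P = expand (map (map_prod (ren b a) (ren b a)) cs) (map (map_symb (ren b a)) P)"
proof (induction P arbitrary: cs)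
  case Nil
  then show ?case using loops_Cons_neq[OF ab] by simp
next
  case (Cons S P)
  let ?r = "map (map_prod (ren b a) (ren b a))"
  have "expand ((a, b) # cs) (S # P) =
      (\<Sum>(w, ds)\<leftarrow>smooth S. w * expand (?r (ds @ cs)) (map (map_symb (ren b a)) P))"
    unfolding expand_Cons
  proof (rule sum_list_cong_pair)
    fix w ds assume "(w, ds) \<in> set (smooth S)"
    then have b: "balanced (labs ((a, b) # ds @ cs) + plabs P)"
      using Cons.prems labs_smooth[of w ds S] by (simp add: ac_simps)
    then have "expand (ds @ (a, b) # cs) P = expand ((a, b) # ds @ cs) P"
      by (intro expand_cong_mset_cons) (simp_all add: ac_simps)
    then show "w * expand (ds @ (a, b) # cs) P = w * expand (?r (ds @ cs)) (map (map_symb (ren b a)) P)"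
      using Cons.IH[OF b] by simp
  qed
  also have "\<dots> = expand (?r cs) (map (map_symb (ren b a)) (S # P))"
    by (simp add: expand_Cons smooth_map o_def case_prod_unfold)
  finally show ?case .
qed

lemma bracket_contract:
  "a \<noteq> b \<Longrightarrow> balanced (plabs (Con a b # P)) \<Longrightarrow> bracket (Con a b # P) = bracket (map (map_symb (ren b a)) P)"
  using expand_contract[of a b "[]" P] by (simp add: bracket_def expand_Con)

lemma bracket_loop:
  "balanced (plabs (Con a a # P)) \<Longrightarrow> bracket (Con a a # P) = var Vo * bracket P"
  using expand_con_equiv[OF con_equiv_loop, of a "[]" P] by (simp add: bracket_def expand_Con)

text \<open>Congruence together with balance of both sides, so that a chain of rewriting steps
  carries along the hypothesis that each step has.\<close>

definition sim :: "'l symb list \<Rightarrow> 'l symb list \<Rightarrow> bool" where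
  "sim P Q \<longleftrightarrow> balanced (plabs P) \<and> balanced (plabs Q) \<and> veq (bracket P) (bracket Q)"

lemma sim_trans [trans]: "sim P Q \<Longrightarrow> sim Q R \<Longrightarrow> sim P R"
  by (auto simp: sim_def intro: veq_trans)

lemma sim_sym: "sim P Q \<Longrightarrow> sim Q P"
  by (auto simp: sim_def intro: veq_sym)

lemma sim_mset: "mset P = mset Q \<Longrightarrow> balanced (plabs P) \<Longrightarrow> sim P Q"
  using bracket_cong_mset[of P Q] plabs_cong_mset[of P Q] by (simp add: sim_def)

lemma sim_req: "list_all2 req P Q \<Longrightarrow> balanced (plabs P) \<Longrightarrow> sim P Q"
  using expand_req[of P Q "[]"] plabs_req[of P Q] by (simp add: sim_def bracket_def)

lemma sim_contract:
  assumes ab: "a \<noteq> b" and bal: "balanced (plabs (Con a b # P))"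
  shows "sim (Con a b # P) (map (map_symb (ren b a)) P)"
proof -
  have "count (plabs (map (map_symb (ren b a)) P)) x \<in> {0, 2}" for x
    using balancedD[OF bal, of x] balancedD[OF bal, of a] balancedD[OF bal, of b] ab
    by (auto simp: plabs_map count_image_ren split: if_splits)
  then have "balanced (plabs (map (map_symb (ren b a)) P))" unfolding balanced_def by blast
  with bracket_contract[OF ab bal] bal show ?thesis by (simp add: sim_def)
qed

text \<open>Serves to enlarge the type of labels when fresh ones are wanted, and to return
  afterwards.\<close>

lemma map_symb_inj_sim_iff:
  assumes "inj f"
  shows "sim (map (map_symb f) P) (map (map_symb f) Q) \<longleftrightarrow> sim P Q"
proof -
  have "balanced (image_mset f M) \<longleftrightarrow> balanced M" for M
  proof -
    have c: "count (image_mset f M) (f x) = count M x" for x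
    proof -
      have "f -` {f x} \<inter> set_mset M = (if x \<in># M then {x} else {})"
        using assms by (auto simp: inj_def)
      then show ?thesis by (simp add: count_image_mset not_in_iff[symmetric])
    qed
    show ?thesis
      unfolding balanced_def
    proof safe
      fix x assume *: "\<forall>x. count M x = 0 \<or> count M x = 2" "count (image_mset f M) x \<noteq> 2"
      show "count (image_mset f M) x = 0"
      proof (cases "x \<in> range f")
        case True
        then show ?thesis using * c by auto
      next
        case False
        then show ?thesis by (auto simp: not_in_iff[symmetric])
      qed
    qed (use c in metis)
  qed
  moreover have "inj_on f A" for A using assms by (rule inj_on_subset) simp
  ultimately show ?thesis by (simp add: sim_def plabs_map bracket_map_inj)
qed

lemma balanced_drop: "balanced (add_mset e (add_mset e M)) \<Longrightarrow> balanced M"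
  unfolding balanced_def by (metis count_add_mset add_2_eq_Suc' le_Suc_eq nat.inject zero_neq_numeral
    One_nat_def add_is_0 numeral_2_eq_2 old.nat.distinct(2))

text \<open>
  \<open>p1, q1, p2, q2\<close> are the edge ends in counterclockwise order, \<open>pover\<close> says that the strand
  \<open>p1, p2\<close> is the overpass, and \<open>sh\<close> that the sector between \<open>p1\<close> and \<open>q1\<close> is shaded.
\<close>

definition cr :: "'l \<Rightarrow> 'l \<Rightarrow> 'l \<Rightarrow> 'l \<Rightarrow> bool \<Rightarrow> bool \<Rightarrow> 'l symb" where
  "cr p1 q1 p2 q2 pover sh =
     (if pover then (if sh then X1 else X2) q1 p2 q2 p1
      else (if \<not> sh then X1 else X2) p1 q1 p2 q2)"

lemma slabs_cr [simp]: "slabs (cr p1 q1 p2 q2 pover sh) = {#p1, q1, p2, q2#}"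
  by (simp add: cr_def add_mset_commute)

lemma map_symb_cr [simp]:
  "map_symb f (cr p1 q1 p2 q2 pover sh) = cr (f p1) (f q1) (f p2) (f q2) pover sh"
  by (simp add: cr_def)

lemma req_cr2: "req (cr p1 q1 p2 q2 pover sh) (cr p2 q2 p1 q1 pover sh)"
  by (simp add: cr_def req_def)

text \<open>A quarter turn of the viewpoint: the other strand comes first, and the sector is
  replaced by its neighbour, which has the opposite shade.\<close>

lemma req_cr1: "req (cr p1 q1 p2 q2 pover sh) (cr q1 p2 q2 p1 (\<not> pover) (\<not> sh))"
  by (simp add: cr_def req_def)

lemma closure_veq:
  assumes "closure_relations L R bs \<subseteq> vse_relations" "\<epsilon> \<in> perfect_matchings bs"
  shows "veq (bracket (L @ map (case_prod Con) \<epsilon>)) (bracket (R @ map (case_prod Con) \<epsilon>))"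
proof -
  have "bracket (L @ map (case_prod Con) \<epsilon>) - bracket (R @ map (case_prod Con) \<epsilon>) \<in> vse_relations"
    using assms by (auto simp: closure_relations_def)
  then show ?thesis
    unfolding veq_def vse_ideal_def rat_poly_diff[symmetric] by (intro vse_module.span_base imageI)
qed

fun label_map :: "'l \<Rightarrow> 'l \<Rightarrow> 'l \<Rightarrow> 'l \<Rightarrow> 'l \<Rightarrow> 'l \<Rightarrow> 'l \<Rightarrow> 'l \<Rightarrow> 'l \<Rightarrow> label \<Rightarrow> 'l" where
  "label_map a b c d e f g h i La = a"
| "label_map a b c d e f g h i Lb = b"
| "label_map a b c d e f g h i Lc = c"
| "label_map a b c d e f g h i Ld = d"
| "label_map a b c d e f g h i Le = e"
| "label_map a b c d e f g h i Lf = f"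
| "label_map a b c d e f g h i Lg = g"
| "label_map a b c d e f g h i Lh = h"
| "label_map a b c d e f g h i Li = i"

lemma sim_closure_relations:
  fixes f :: "label \<Rightarrow> 'm"
  assumes "closure_relations L R bs \<subseteq> vse_relations" "distinct bs"
    "balanced (plabs L + mset bs)" "balanced (plabs R + mset bs)"
    "inj_on f (set_mset (plabs L + plabs R))"
    "balanced (plabs (map (map_symb f) L @ P))" "balanced (plabs (map (map_symb f) R @ P))"
  shows "sim (map (map_symb f) L @ P) (map (map_symb f) R @ P)"
  using veq_tangle[OF closure_veq[OF assms(1)] assms(2-5), of P] assms(6,7) by (simp add: sim_def)

lemma balanced_insert2: "a \<notin># M \<Longrightarrow> balanced M \<Longrightarrow> balanced (add_mset a (add_mset a M))"
  by (auto simp: balanced_def not_in_iff)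

lemma balanced_empty [simp]: "balanced {#}"
  by (simp add: balanced_def)

text \<open>The strand a - d passes under the strand b - c, and \<open>s\<close> is the shade of the
  bigon between them; its two values give the first two families of generators.\<close>

lemma sim_R2_under:
  assumes d: "distinct [a, b, c, d, e, f]"
    and bal: "balanced (plabs ([cr a b f e False s, cr c d e f True s] @ P))"
  shows "sim ([cr a b f e False s, cr c d e f True s] @ P) ([Con a d, Con b c] @ P)"
proof -
  have *: "plabs ([cr a b f e False s, cr c d e f True s] @ P) =
      add_mset e (add_mset e (add_mset f (add_mset f (plabs ([Con a d, Con b c] @ P)))))"
    by (simp add: ac_simps add_mset_commute)
  have bal': "balanced (plabs ([Con a d, Con b c] @ P))"
    using bal unfolding * by (rule balanced_drop[OF balanced_drop])
  \<comment> \<open>This relation has six labels; the remaining three formal labels receive an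
    arbitrary value.\<close>
  let ?f = "label_map a b c d e f a a a"
  have inj: "inj_on ?f {La, Lb, Lc, Ld, Le, Lf}" using d by (auto simp: inj_on_def)
  let ?bs = "[La, Lb, Lc, Ld]"
  have "balanced (add_mset La (add_mset La (add_mset Lb (add_mset Lb (add_mset Lc (add_mset Lc
      (add_mset Ld (add_mset Ld (add_mset Le (add_mset Le (add_mset Lf (add_mset Lf {#}))))))))))))"
    "balanced (add_mset La (add_mset La (add_mset Lb (add_mset Lb (add_mset Lc (add_mset Lc
      (add_mset Ld (add_mset Ld {#}))))))))"
    by (intro balanced_insert2; simp)+
  note b = this
  show ?thesis
  proof (cases s)
    case False
    have "sim (map (map_symb ?f) [X1 La Lb Lf Le, X2 Ld Le Lf Lc] @ P)
        (map (map_symb ?f) [Con La Ld, Con Lb Lc] @ P)"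
    proof (rule sim_closure_relations[of _ _ ?bs])
      show "closure_relations [X1 La Lb Lf Le, X2 Ld Le Lf Lc] [Con La Ld, Con Lb Lc] ?bs \<subseteq> vse_relations"
        unfolding vse_relations_def by blast
      show "inj_on ?f (set_mset (plabs [X1 La Lb Lf Le, X2 Ld Le Lf Lc] + plabs [Con La Ld, Con Lb Lc]))"
        by (rule inj_on_subset[OF inj]) auto
    qed (use bal bal' b False in \<open>simp_all add: cr_def add_mset_commute\<close>)
    then show ?thesis using False by (simp add: cr_def)
  next
    case True
    have "sim (map (map_symb ?f) [X2 La Lb Lf Le, X1 Ld Le Lf Lc] @ P)
        (map (map_symb ?f) [Con La Ld, Con Lb Lc] @ P)"
    proof (rule sim_closure_relations[of _ _ ?bs])
      show "closure_relations [X2 La Lb Lf Le, X1 Ld Le Lf Lc] [Con La Ld, Con Lb Lc] ?bs \<subseteq> vse_relations"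
        unfolding vse_relations_def by blast
      show "inj_on ?f (set_mset (plabs [X2 La Lb Lf Le, X1 Ld Le Lf Lc] + plabs [Con La Ld, Con Lb Lc]))"
        by (rule inj_on_subset[OF inj]) auto
    qed (use bal bal' b True in \<open>simp_all add: cr_def add_mset_commute\<close>)
    then show ?thesis using True by (simp add: cr_def)
  qed
qed

text \<open>When the strand a - d is on top, the same picture read from its second crossing is the
  case already treated, with the strands exchanged.\<close>

theorem sim_R2:
  assumes d: "distinct [a, b, c, d, e, f]"
    and bal: "balanced (plabs ([cr a b f e pover s, cr c d e f (\<not> pover) s] @ P))"
  shows "sim ([cr a b f e pover s, cr c d e f (\<not> pover) s] @ P) ([Con a d, Con b c] @ P)"
proof (cases pover)
  case False
  then show ?thesis using sim_R2_under[OF d, of s P] bal by simp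
next
  case True
  have "sim ([cr a b f e True s, cr c d e f False s] @ P) ([cr c d e f False s, cr a b f e True s] @ P)"
    using bal True by (intro sim_mset) auto
  also have "sim \<dots> ([Con c b, Con d a] @ P)"
    using d bal True by (intro sim_R2_under) (auto simp: add_mset_commute)
  finally have *: "sim ([cr a b f e True s, cr c d e f False s] @ P) ([Con c b, Con d a] @ P)" .
  have "balanced (plabs ([Con c b, Con d a] @ P))" using * by (simp add: sim_def)
  then have "sim ([Con c b, Con d a] @ P) ([Con d a, Con c b] @ P)"
    by (intro sim_mset) auto
  moreover have "sim ([Con d a, Con c b] @ P) ([Con a d, Con b c] @ P)"
    using calculation by (intro sim_req) (auto simp: sim_def req_def intro: list_all2_refl)
  ultimately have "sim ([cr a b f e True s, cr c d e f False s] @ P) ([Con a d, Con b c] @ P)"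
    using * sim_trans by blast
  then show ?thesis using True by simp
qed

text \<open>
  Strands \<open>a - d\<close>, \<open>b - e\<close>, \<open>c - f\<close>; the flags tell whether the first is over the second
  (\<open>o12\<close>), the third over the first (\<open>o31\<close>) and the second over the third (\<open>o23\<close>).
\<close>

definition triangle_L where
  "triangle_L a b c d e f g h i o12 o31 o23 s =
     [cr a b h g o12 s, cr c d i h o31 s, cr e f g i o23 s]"

text \<open>On this side the crossings face the boundary sectors f - a, b - c, d - e, which lie
  between the sectors used for \<open>triangle_L\<close>; the shading alternates along the boundary,
  whence \<open>\<not> s\<close>.\<close>

definition triangle_R where
  "triangle_R a b c d e f g h i o12 o31 o23 s =
     [cr f a i h o31 (\<not> s), cr b c g i o23 (\<not> s), cr d e h g o12 (\<not> s)]"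

lemma plabs_triangle:
  "plabs (triangle_L a b c d e f g h i o12 o31 o23 s) = {#a, b, c, d, e, f, g, g, h, h, i, i#}"
  "plabs (triangle_R a b c d e f g h i o12 o31 o23 s) = {#a, b, c, d, e, f, g, g, h, h, i, i#}"
  by (simp_all add: triangle_L_def triangle_R_def add_mset_commute)

text \<open>Indexed by the type of labels, because the mirror argument derives the instance for one
  type from that for a larger type.\<close>

definition R3_holds :: "'l itself \<Rightarrow> bool \<Rightarrow> bool \<Rightarrow> bool \<Rightarrow> bool" where
  "R3_holds _ o12 o31 o23 \<longleftrightarrow> (\<forall>(a::'l) b c d e f g h i s P.
     distinct [a, b, c, d, e, f, g, h, i] \<longrightarrow>
     balanced (plabs (triangle_L a b c d e f g h i o12 o31 o23 s @ P)) \<longrightarrow>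
     sim (triangle_L a b c d e f g h i o12 o31 o23 s @ P) (triangle_R a b c d e f g h i o12 o31 o23 s @ P))"

lemma R3_holdsD:
  fixes a b c d e f g h i :: 'l
  assumes "R3_holds TYPE('l) o12 o31 o23" "distinct [a, b, c, d, e, f, g, h, i]"
    "balanced (plabs (triangle_L a b c d e f g h i o12 o31 o23 s @ P))"
  shows "sim (triangle_L a b c d e f g h i o12 o31 o23 s @ P)
    (triangle_R a b c d e f g h i o12 o31 o23 s @ P)"
  using assms(1)[unfolded R3_holds_def, rule_format, OF assms(2,3)] .

text \<open>The other two families of generators, one for each value of \<open>s\<close>. In this
  pattern the second strand is on top and the first at the bottom.\<close>

lemma R3_holds_base: "R3_holds TYPE('l) False True True"
  unfolding R3_holds_def
proof (intro allI impI)
  fix a b c d e f g h i :: 'l and s P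
  assume d: "distinct [a, b, c, d, e, f, g, h, i]"
    and bal: "balanced (plabs (triangle_L a b c d e f g h i False True True s @ P))"
  let ?f = "label_map a b c d e f g h i"
  let ?bs = "[La, Lb, Lc, Ld, Le, Lf]"
  have inj: "inj_on ?f UNIV"
  proof (rule inj_onI)
    fix x y assume "?f x = ?f y"
    then show "x = y" using d by (cases x; cases y) auto
  qed
  have balR: "balanced (plabs (triangle_R a b c d e f g h i False True True s @ P))"
    using bal by (simp add: plabs_triangle)
  have b: "balanced (add_mset La (add_mset La (add_mset Lb (add_mset Lb (add_mset Lc (add_mset Lc
      (add_mset Ld (add_mset Ld (add_mset Le (add_mset Le (add_mset Lf (add_mset Lf
      (add_mset Lg (add_mset Lg (add_mset Lh (add_mset Lh (add_mset Li (add_mset Li {#}))))))))))))))))))"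
    by (intro balanced_insert2; simp)
  \<comment> \<open>\<open>L\<close> and \<open>R\<close> are the two products of a generator;
    \<open>L'\<close> lists the crossings of \<open>L\<close> in the order of
    \<open>triangle_L\<close>, with which it is compared up to rotation of the single
    symbols.\<close>
  have *: "sim (triangle_L a b c d e f g h i False True True s @ P) (triangle_R a b c d e f g h i False True True s @ P)"
    if rel: "closure_relations L R ?bs \<subseteq> vse_relations"
      and l: "plabs L = {#La, Lb, Lc, Ld, Le, Lf, Lg, Lg, Lh, Lh, Li, Li#}" "plabs R = plabs L"
      and rL: "list_all2 req (triangle_L a b c d e f g h i False True True s) (map (map_symb ?f) L')"
      and L': "mset L' = mset L"
      and rR: "list_all2 req (map (map_symb ?f) R) (triangle_R a b c d e f g h i False True True s)"
    for L L' R
  proof -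
    have l1: "sim (triangle_L a b c d e f g h i False True True s @ P) (map (map_symb ?f) L' @ P)"
      using rL bal by (intro sim_req) (auto simp: list_all2_appendI list_all2_refl)
    have l2: "sim (map (map_symb ?f) L' @ P) (map (map_symb ?f) L @ P)"
      using L' l1 by (intro sim_mset) (auto simp: sim_def)
    have r: "balanced (plabs (map (map_symb ?f) R @ P))"
      using plabs_req[OF rR] balR by simp
    have m: "sim (map (map_symb ?f) L @ P) (map (map_symb ?f) R @ P)"
    proof (rule sim_closure_relations[OF rel])
      show "inj_on ?f (set_mset (plabs L + plabs R))" by (rule inj_on_subset[OF inj]) simp
      show "balanced (plabs L + mset ?bs)" "balanced (plabs R + mset ?bs)"
        using b l by (simp_all add: add_mset_commute)
    qed (use l2 r in \<open>auto simp: sim_def\<close>)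
    have "sim (map (map_symb ?f) R @ P) (triangle_R a b c d e f g h i False True True s @ P)"
      using rR r by (intro sim_req) (auto simp: list_all2_appendI list_all2_refl)
    with l1 l2 m show ?thesis using sim_trans by blast
  qed
  show "sim (triangle_L a b c d e f g h i False True True s @ P) (triangle_R a b c d e f g h i False True True s @ P)"
  proof (cases s)
    case False
    show ?thesis
    proof (rule *[of "[X1 La Lb Lh Lg, X2 Li Le Lf Lg, X2 Lh Lc Ld Li]"
          "[X1 La Li Lh Lf, X1 Lc Lg Li Lb, X2 Lh Lg Ld Le]"
          "[X1 La Lb Lh Lg, X2 Lh Lc Ld Li, X2 Li Le Lf Lg]"])
      show "closure_relations [X1 La Lb Lh Lg, X2 Li Le Lf Lg, X2 Lh Lc Ld Li]
          [X1 La Li Lh Lf, X1 Lc Lg Li Lb, X2 Lh Lg Ld Le] ?bs \<subseteq> vse_relations"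
        unfolding vse_relations_def by blast
    qed (use False in \<open>simp_all add: triangle_L_def triangle_R_def cr_def req_def add_mset_commute\<close>)
  next
    case True
    show ?thesis
    proof (rule *[of "[X2 La Lb Lh Lg, X1 Li Le Lf Lg, X1 Lh Lc Ld Li]"
          "[X2 La Li Lh Lf, X2 Lc Lg Li Lb, X1 Lh Lg Ld Le]"
          "[X2 La Lb Lh Lg, X1 Lh Lc Ld Li, X1 Li Le Lf Lg]"])
      show "closure_relations [X2 La Lb Lh Lg, X1 Li Le Lf Lg, X1 Lh Lc Ld Li]
          [X2 La Li Lh Lf, X2 Lc Lg Li Lb, X1 Lh Lg Ld Le] ?bs \<subseteq> vse_relations"
        unfolding vse_relations_def by blast
    qed (use True in \<open>simp_all add: triangle_L_def triangle_R_def cr_def req_def add_mset_commute\<close>)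
  qed
qed

text \<open>Turning the picture by a third of a full turn shifts the six boundary labels by two
  places and maps each triangle to one of the same form.\<close>

lemma R3_holds_rotate:
  assumes "R3_holds TYPE('l) o12 o31 o23"
  shows "R3_holds TYPE('l) o23 o12 o31"
  unfolding R3_holds_def
proof (intro allI impI)
  fix a b c d e f g h i :: 'l and s P
  assume d: "distinct [a, b, c, d, e, f, g, h, i]"
    and bal: "balanced (plabs (triangle_L a b c d e f g h i o23 o12 o31 s @ P))"
  let ?L = "triangle_L a b c d e f g h i o23 o12 o31 s" and ?R = "triangle_R a b c d e f g h i o23 o12 o31 s"
  let ?L' = "triangle_L c d e f a b h i g o12 o31 o23 s" and ?R' = "triangle_R c d e f a b h i g o12 o31 o23 s"
  have "sim (?L @ P) (?L' @ P)"
    using bal by (intro sim_mset) (auto simp: triangle_L_def)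
  also have "sim (?L' @ P) (?R' @ P)"
    using assms d bal unfolding R3_holds_def by (auto simp: plabs_triangle add_mset_commute)
  also have "sim (?R' @ P) (?R @ P)"
    using bal by (intro sim_mset) (auto simp: triangle_R_def plabs_triangle add_mset_commute)
  finally show "sim (?L @ P) (?R @ P)" .
qed

text \<open>The labels that disappear are absent from the context, so only \<open>S\<close> is
  renamed.\<close>

lemma sim_contract2:
  assumes "distinct [a, b, c, d]" "balanced (plabs ([Con a b, Con c d] @ S @ P))"
    "b \<notin># plabs P" "d \<notin># plabs P"
  shows "sim ([Con a b, Con c d] @ S @ P) (map (map_symb (ren d c \<circ> ren b a)) S @ P)"
proof -
  have P: "map (map_symb (ren b a)) P = P" "map (map_symb (ren d c)) P = P"
    using assms(3,4) by (auto intro!: map_map_symb_ident_on simp: ren_def)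
  have "sim ([Con a b, Con c d] @ S @ P) (map (map_symb (ren b a)) ([Con c d] @ S @ P))"
    using assms sim_contract[of a b "[Con c d] @ S @ P"] by simp
  also have "map (map_symb (ren b a)) ([Con c d] @ S @ P) = Con c d # map (map_symb (ren b a)) S @ P"
    using assms(1) by (auto simp: P ren_def)
  finally have *: "sim ([Con a b, Con c d] @ S @ P) (Con c d # map (map_symb (ren b a)) S @ P)" .
  have "sim (Con c d # map (map_symb (ren b a)) S @ P)
      (map (map_symb (ren d c)) (map (map_symb (ren b a)) S @ P))"
    using * assms(1) by (intro sim_contract) (auto simp: sim_def)
  also have "map (map_symb (ren d c)) (map (map_symb (ren b a)) S @ P) =
      map (map_symb (ren d c \<circ> ren b a)) S @ P"
    by (simp add: P symb.map_comp)
  finally show ?thesis using * sim_trans by blast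
qed

lemma balanced_count_0:
  assumes "balanced (M + N)" "count M x = 2"
  shows "x \<notin># N"
  using balancedD[OF assms(1), of x] assms(2) by (auto simp: not_in_iff)

lemma sim_rename:
  assumes "balanced (plabs (S @ P))" "balanced (plabs (map (map_symb f) S @ P))"
    and "inj_on f (set_mset (plabs (S @ P)))" "\<And>x. x \<in># plabs P \<Longrightarrow> f x = x"
  shows "sim (S @ P) (map (map_symb f) S @ P)"
proof -
  have "map (map_symb f) P = P" using assms(4) by (rule map_map_symb_ident_on)
  then show ?thesis using bracket_map_inj[OF assms(3)] assms(1,2) by (simp add: sim_def)
qed

text \<open>
  The mirror image of a known move: add a cancelling pair of crossings of the strands \<open>b - e\<close> and
  \<open>c - f\<close>, move \<open>a - d\<close> across the new crossing, and cancel the other two.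
\<close>

lemma R3_mirror_chain:
  fixes a b c d e f h x y u v :: 'l
  assumes R3: "R3_holds TYPE('l) True False True"
    and dis: "distinct [a, b, c, d, e, f, g, h, i, x, y, u, v]"
    and bal: "balanced (plabs (triangle_L a b c d e f g h i True False False s @ P))"
    and fresh: "x \<notin># plabs P" "y \<notin># plabs P" "u \<notin># plabs P" "v \<notin># plabs P"
  shows "sim (triangle_L a b c d e f g h i True False False s @ P)
    (triangle_R a b c d e f v h u True False False s @ P)"
proof -
  have g: "count (plabs P) g = 0" "count (plabs P) h = 0" "count (plabs P) i = 0"
    using balanced_count_0[of "plabs (triangle_L a b c d e f g h i True False False s)" "plabs P"] bal dis
    by (auto simp: plabs_triangle not_in_iff[symmetric])
  have cP: "count (plabs P) z = (if z \<in> {a, b, c, d, e, f} then 1 else count (plabs P) z)" for z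
    using balancedD[OF bal, of z] dis by (auto simp: plabs_triangle split: if_splits)
  \<comment> \<open>Every intermediate picture has the six boundary labels once and its inner
    labels, collected in \<open>N\<close>, twice.\<close>
  have balI: "balanced (plabs S + plabs P)"
    if "plabs S = {#a, b, c, d, e, f#} + N + N" "\<And>z. z \<in># N \<Longrightarrow> z \<in> {g, h, i, x, y, u, v}" "\<And>z. count N z \<le> 1"
    for S :: "'l symb list" and N
    unfolding balanced_def
  proof
    fix z
    have P2: "count (plabs P) z = 0 \<or> count (plabs P) z = 2" if "z \<notin> {a, b, c, d, e, f}"
      using balancedD[OF bal, of z] that g by (auto simp: plabs_triangle split: if_splits)
    show "count (plabs S + plabs P) z = 0 \<or> count (plabs S + plabs P) z = 2"
    proof (cases "z \<in># N")
      case True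
      then have "count N z > 0" by simp
      with that(3)[of z] have "count N z = 1" by linarith
      moreover have z: "z \<in> {g, h, i, x, y, u, v}" using that(2) True by blast
      moreover from z have "count (plabs P) z = 0"
        using g fresh by (auto simp: not_in_iff)
      ultimately show ?thesis using dis by (auto simp: that(1))
    next
      case False
      then show ?thesis
        using cP[of z] P2 dis by (auto simp: that(1) not_in_iff)
    qed
  qed
  \<comment> \<open>The strands of \<open>b\<close> and \<open>c\<close> are cut once more, at
    \<open>x\<close> and \<open>y\<close>, before they reach the triangle.\<close>
  let ?S1 = "[cr a x h g True s, cr y d i h False s, cr e f g i False s]"
  have "sim ([Con b x, Con c y] @ ?S1 @ P) (map (map_symb (ren y c \<circ> ren x b)) ?S1 @ P)"
  proof (rule sim_contract2)
    have "balanced (plabs ([Con b x, Con c y] @ ?S1) + plabs P)"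
      by (rule balI[of _ "{#x, y, g, h, i#}"]) (use dis in \<open>auto simp: add_mset_commute\<close>)
    then show "balanced (plabs ([Con b x, Con c y] @ ?S1 @ P))" by simp
  qed (use dis fresh in auto)
  also have "map (map_symb (ren y c \<circ> ren x b)) ?S1 = triangle_L a b c d e f g h i True False False s"
    using dis by (auto simp: triangle_L_def ren_def)
  finally have 1: "sim ([Con b x, Con c y] @ ?S1 @ P) (triangle_L a b c d e f g h i True False False s @ P)" .
  \<comment> \<open>The new pair of crossings between the two cut strands, with inner edges
    \<open>u\<close> and \<open>v\<close>; the second move read backwards inserts it.\<close>
  let ?S2 = "[cr b c v u False (\<not> s), cr y x u v True (\<not> s)]"
  have 2: "sim (?S2 @ ?S1 @ P) ([Con b x, Con c y] @ ?S1 @ P)"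
  proof (rule sim_R2[of b c y x u v False, simplified not_False_eq_True])
    have "balanced (plabs (?S2 @ ?S1) + plabs P)"
      by (rule balI[of _ "{#x, y, u, v, g, h, i#}"]) (use dis in \<open>auto simp: add_mset_commute\<close>)
    then show "balanced (plabs (?S2 @ ?S1 @ P))" by simp
  qed (use dis in auto)
  let ?C = "[cr b c v u False (\<not> s), cr e f g i False s]"
  \<comment> \<open>Three of the five crossings form the right side of a known third move;
    \<open>?C\<close> holds the other two.\<close>
  have 3: "sim (?S2 @ ?S1 @ P) (triangle_R a u v d i g y h x True False True s @ ?C @ P)"
  proof -
    let ?Q = "[cr a x h g True s, cr u v y x True (\<not> s), cr y d i h False s]"
    have "sim (?S2 @ ?S1 @ P) ([cr a x h g True s, cr y x u v True (\<not> s), cr y d i h False s] @ ?C @ P)"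
      using 2 by (intro sim_mset) (auto simp: sim_def)
    also have "sim \<dots> (triangle_R a u v d i g y h x True False True s @ ?C @ P)"
    proof (rule sim_req)
      show "balanced (plabs ([cr a x h g True s, cr y x u v True (\<not> s), cr y d i h False s] @ ?C @ P))"
        using calculation by (simp add: sim_def)
      have "req (cr a x h g True s) (cr g a x h False (\<not> s))"
        using req_sym[OF req_cr1[of g a x h False "\<not> s"]] by simp
      moreover have "req (cr y x u v True (\<not> s)) (cr u v y x True (\<not> s))" by (rule req_cr2)
      moreover have "req (cr y d i h False s) (cr d i h y True (\<not> s))"
        using req_cr1[of y d i h False s] by simp
      ultimately show "list_all2 req ([cr a x h g True s, cr y x u v True (\<not> s), cr y d i h False s] @ ?C @ P)
          (triangle_R a u v d i g y h x True False True s @ ?C @ P)"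
        by (simp add: triangle_R_def list_all2_refl)
    qed
    finally show ?thesis .
  qed
  have 4: "sim (triangle_L a u v d i g y h x True False True s @ ?C @ P)
      (triangle_R a u v d i g y h x True False True s @ ?C @ P)"
  proof -
    have "balanced (plabs (triangle_L a u v d i g y h x True False True s @ ?C @ P))"
      using 3 by (simp add: sim_def plabs_triangle)
    then show ?thesis using R3 dis unfolding R3_holds_def by auto
  qed
  \<comment> \<open>After the move, the old crossing of the strands of \<open>b\<close> and
    \<open>c\<close> and one of the two new ones bound a bigon and cancel; \<open>?S5\<close> is
    what remains.\<close>
  let ?S5 = "[cr a u h y True s, cr v d x h False s, cr b c v u False (\<not> s)]"
  have 5: "sim (triangle_L a u v d i g y h x True False True s @ ?C @ P)
      ([Con e x, Con f y] @ ?S5 @ P)"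
  proof -
    have "sim (triangle_L a u v d i g y h x True False True s @ ?C @ P)
        ([cr e f g i False s, cr i g y x True s] @ ?S5 @ P)"
      using 4 by (intro sim_mset) (auto simp: sim_def triangle_L_def)
    also have "sim \<dots> ([cr e f g i False s, cr y x i g True s] @ ?S5 @ P)"
      using calculation by (intro sim_req) (auto simp: sim_def list_all2_refl req_cr2)
    also have "sim \<dots> ([Con e x, Con f y] @ ?S5 @ P)"
      using calculation dis by (intro sim_R2[of e f y x i g False, simplified not_False_eq_True]) (auto simp: sim_def)
    finally show ?thesis .
  qed
  have "sim ([Con e x, Con f y] @ ?S5 @ P) (map (map_symb (ren y f \<circ> ren x e)) ?S5 @ P)"
    using 5 dis fresh by (intro sim_contract2) (auto simp: sim_def)
  also have "map (map_symb (ren y f \<circ> ren x e)) ?S5 =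
      [cr a u h f True s, cr v d e h False s, cr b c v u False (\<not> s)]"
    using dis by (auto simp: ren_def)
  finally have 6: "sim ([Con e x, Con f y] @ ?S5 @ P)
      ([cr a u h f True s, cr v d e h False s, cr b c v u False (\<not> s)] @ P)" .
  have 7: "sim ([cr a u h f True s, cr v d e h False s, cr b c v u False (\<not> s)] @ P)
      (triangle_R a b c d e f v h u True False False s @ P)"
  proof -
    have "sim ([cr a u h f True s, cr v d e h False s, cr b c v u False (\<not> s)] @ P)
        ([cr f a u h False (\<not> s), cr d e h v True (\<not> s), cr b c v u False (\<not> s)] @ P)"
      using 6 req_sym[OF req_cr1[of f a u h False "\<not> s"]] req_cr1[of v d e h False s]
      by (intro sim_req) (auto simp: sim_def list_all2_refl)
    also have "sim \<dots> (triangle_R a b c d e f v h u True False False s @ P)"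
      using calculation by (intro sim_mset) (auto simp: sim_def triangle_R_def)
    finally show ?thesis .
  qed
  from 1 2 3 4 5 6 7 show ?thesis using sim_trans sim_sym by meson
qed

definition sw :: "'l \<Rightarrow> 'l \<Rightarrow> 'l \<Rightarrow> 'l \<Rightarrow> 'l \<Rightarrow> 'l \<Rightarrow> 'l \<Rightarrow> 'l" where
  "sw g h i g' h' i' z = (if z = g then g' else if z = h then h' else if z = i then i' else z)"

text \<open>Balance keeps the inner labels out of the context, so all three can be renamed at
  once.\<close>

lemma R3_rename_internal:
  fixes a b c d e f g h i :: 'l
  assumes d: "distinct [a, b, c, d, e, f, g, h, i]" "distinct [a, b, c, d, e, f, g', h', i']"
    and bal: "balanced (plabs (triangle_R a b c d e f g h i o12 o31 o23 s @ P))"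
      "balanced (plabs (triangle_R a b c d e f g' h' i' o12 o31 o23 s @ P))"
  shows "sim (triangle_R a b c d e f g h i o12 o31 o23 s @ P)
    (triangle_R a b c d e f g' h' i' o12 o31 o23 s @ P)"
proof -
  let ?f = "sw g h i g' h' i'"
  have n: "g \<notin># plabs P" "h \<notin># plabs P" "i \<notin># plabs P"
    using bal(1) d(1) balanced_count_0[of "plabs (triangle_R a b c d e f g h i o12 o31 o23 s)" "plabs P"]
    by (auto simp: plabs_triangle)
  have n': "g' \<notin># plabs P" "h' \<notin># plabs P" "i' \<notin># plabs P"
    using bal(2) d(2) balanced_count_0[of "plabs (triangle_R a b c d e f g' h' i' o12 o31 o23 s)" "plabs P"]
    by (auto simp: plabs_triangle)
  have m: "map (map_symb ?f) (triangle_R a b c d e f g h i o12 o31 o23 s) =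
      triangle_R a b c d e f g' h' i' o12 o31 o23 s"
    using d(1) by (auto simp: triangle_R_def sw_def)
  have "sim (triangle_R a b c d e f g h i o12 o31 o23 s @ P)
    (map (map_symb ?f) (triangle_R a b c d e f g h i o12 o31 o23 s) @ P)"
  proof (rule sim_rename)
    show "inj_on ?f (set_mset (plabs (triangle_R a b c d e f g h i o12 o31 o23 s @ P)))"
      using d n n' by (auto simp: plabs_triangle inj_on_def sw_def)
    show "?f x = x" if "x \<in># plabs P" for x using n that by (auto simp: sw_def)
  qed (use bal m in auto)
  then show ?thesis using m by simp
qed

text \<open>The chain above uses four labels that do not occur in \<open>P\<close>. The sum with
  \<open>nat\<close> supplies them as \<open>Inr 0\<close> to \<open>Inr 3\<close>; two of them
  remain as inner labels and are renamed before the return to the smaller type.\<close>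

lemma R3_holds_mirror:
  assumes R3: "R3_holds TYPE('l + nat) True False True"
  shows "R3_holds TYPE('l) True False False"
  unfolding R3_holds_def
proof (intro allI impI)
  fix a b c d e f g h i :: 'l and s P
  assume d: "distinct [a, b, c, d, e, f, g, h, i]"
    and bal: "balanced (plabs (triangle_L a b c d e f g h i True False False s @ P))"
  let ?P = "map (map_symb Inl) P :: ('l + nat) symb list"
  let ?L = "triangle_L a b c d e f g h i True False False s"
  let ?R = "triangle_R a b c d e f g h i True False False s"
  have L: "map (map_symb Inl) ?L =
      triangle_L (Inl a) (Inl b) (Inl c) (Inl d) (Inl e) (Inl f) (Inl g) (Inl h) (Inl i) True False False s"
    by (simp add: triangle_L_def)
  have R: "map (map_symb Inl) ?R =
      triangle_R (Inl a) (Inl b) (Inl c) (Inl d) (Inl e) (Inl f) (Inl g) (Inl h) (Inl i) True False False s"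
    by (simp add: triangle_R_def)
  have inj: "inj (Inl :: 'l \<Rightarrow> 'l + nat)" by simp
  have bL: "balanced (plabs (map (map_symb (Inl :: 'l \<Rightarrow> 'l + nat)) ?L @ ?P))"
    using map_symb_inj_sim_iff[OF inj, of "?L @ P" "?L @ P"] bal by (simp add: sim_def)
  have bR: "balanced (plabs (map (map_symb (Inl :: 'l \<Rightarrow> 'l + nat)) ?R @ ?P))"
    using bL unfolding L R by (simp add: plabs_triangle)
  have 1: "sim (map (map_symb Inl) ?L @ ?P) (triangle_R (Inl a) (Inl b) (Inl c) (Inl d) (Inl e) (Inl f)
      (Inr 3) (Inl h) (Inr 2) True False False s @ ?P)"
    unfolding L using d bL[unfolded L]
    by (intro R3_mirror_chain[OF R3, of _ _ _ _ _ _ _ _ _ "Inr 0" "Inr 1"]) (auto simp: plabs_map)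
  have 2: "sim (triangle_R (Inl a) (Inl b) (Inl c) (Inl d) (Inl e) (Inl f)
      (Inr 3) (Inl h) (Inr 2) True False False s @ ?P) (map (map_symb Inl) ?R @ ?P)"
    unfolding R using d 1 bR[unfolded R] by (intro R3_rename_internal) (auto simp: sim_def)
  have "sim (map (map_symb (Inl :: 'l \<Rightarrow> 'l + nat)) (?L @ P)) (map (map_symb Inl) (?R @ P))"
    using sim_trans[OF 1 2] by simp
  then show "sim (?L @ P) (?R @ P)" using map_symb_inj_sim_iff[OF inj] by blast
qed

text \<open>The two constant patterns would put the strands cyclically above one another. The other
  six are the three rotations of the pattern of the generators and the three rotations of its mirror
  image.\<close>

lemma R3_holds_all:
  assumes "\<not> (o12 = o31 \<and> o31 = o23)"
  shows "R3_holds TYPE('l) o12 o31 o23"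
proof -
  note b = R3_holds_base[where 'l = 'l]
  note b' = R3_holds_mirror[OF R3_holds_rotate[OF R3_holds_base[where 'l = "'l + nat"]]]
  note all = b R3_holds_rotate[OF b] R3_holds_rotate[OF R3_holds_rotate[OF b]]
    b' R3_holds_rotate[OF b'] R3_holds_rotate[OF R3_holds_rotate[OF b']]
  show ?thesis using assms all by (cases o12; cases o31; cases o23) simp_all
qed

theorem sim_R3:
  assumes d: "distinct [a, b, c, d, e, f, g, h, i]" "distinct [a, b, c, d, e, f, g', h', i']"
    and o: "\<not> (o12 = o31 \<and> o31 = o23)"
    and bal: "balanced (plabs (triangle_L a b c d e f g h i o12 o31 o23 s @ P))"
      "balanced (plabs (triangle_R a b c d e f g' h' i' o12 o31 o23 s @ P))"
  shows "sim (triangle_L a b c d e f g h i o12 o31 o23 s @ P)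
    (triangle_R a b c d e f g' h' i' o12 o31 o23 s @ P)"
proof -
  have "sim (triangle_L a b c d e f g h i o12 o31 o23 s @ P)
      (triangle_R a b c d e f g h i o12 o31 o23 s @ P)"
    using R3_holdsD[OF R3_holds_all[OF o] d(1) bal(1)] .
  moreover have "sim (triangle_R a b c d e f g h i o12 o31 o23 s @ P)
      (triangle_R a b c d e f g' h' i' o12 o31 o23 s @ P)"
    using calculation d bal by (intro R3_rename_internal) (auto simp: sim_def)
  ultimately show ?thesis by (rule sim_trans)
qed

section \<open>Local structure of a diagram\<close>

lemma same_param_refl [simp]: "same_param p p"
  by (simp add: same_param_def)

lemma same_param_sym: "same_param p q \<Longrightarrow> same_param q p"
  unfolding same_param_def by (metis Ints_minus minus_diff_eq)

lemma same_param_trans: "same_param p q \<Longrightarrow> same_param q r \<Longrightarrow> same_param p r"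
  unfolding same_param_def using Ints_add[of "snd p - snd q" "snd q - snd r"] by simp

lemma same_param_shift: "same_param (i, s) (i, s + of_int n)" "same_param (i, s + of_int n) (i, s)"
  by (simp_all add: same_param_def)

lemma same_paramE:
  assumes "same_param p q"
  obtains n where "q = (fst p, snd p + of_int n)"
proof -
  obtain n where "snd p - snd q = of_int n" using assms by (auto simp: same_param_def Ints_def)
  then have "q = (fst p, snd p + of_int (- n))"
    using assms by (auto simp: same_param_def prod_eq_iff)
  then show thesis by (rule that)
qed

lemma periodic_of_int:
  fixes f :: "real \<Rightarrow> 'a"
  assumes "\<And>s. f (s + 1) = f s"
  shows "f (s + of_int n) = f s"
proof (induction n rule: int_induct[where k = 0])
  case (step1 n)
  then show ?case using assms[of "s + of_int n"] by (simp add: add.assoc)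
next
  case (step2 n)
  then show ?case using assms[of "s + of_int (n - 1)"] by (simp add: add.assoc)
qed simp

definition cdet :: "complex \<Rightarrow> complex \<Rightarrow> real" where
  "cdet u w = Im (cnj u * w)"

lemma cdet_simps [simp]:
  "cdet u u = 0" "cdet u 0 = 0" "cdet 0 u = 0"
  "cdet (u + v) w = cdet u w + cdet v w" "cdet u (v + w) = cdet u v + cdet u w"
  "cdet (u - v) w = cdet u w - cdet v w" "cdet u (v - w) = cdet u v - cdet u w"
  "cdet (- u) w = - cdet u w" "cdet u (- w) = - cdet u w"
  "cdet (of_real r * u) w = r * cdet u w" "cdet u (of_real r * w) = r * cdet u w"
  "cdet (r *\<^sub>R u) w = r * cdet u w" "cdet u (r *\<^sub>R w) = r * cdet u w"
  by (simp_all add: cdet_def algebra_simps)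

lemma cdet_anti: "cdet w u = - cdet u w"
  by (simp add: cdet_def)

lemma abs_cdet_le: "\<bar>cdet u w\<bar> \<le> norm u * norm w"
  using abs_Im_le_cmod[of "cnj u * w"] by (simp add: cdet_def norm_mult)

lemma cdet_ii: "cdet u (\<i> * u) = (norm u)\<^sup>2"
  by (simp add: cdet_def cmod_power2) (simp add: power2_eq_square)

lemma finite_uniform_pos:
  fixes P :: "'a \<Rightarrow> real \<Rightarrow> bool"
  assumes "finite F" "\<And>r. r \<in> F \<Longrightarrow> \<exists>\<kappa>>0. P r \<kappa>"
    and mono: "\<And>r \<kappa> \<kappa>'. P r \<kappa> \<Longrightarrow> 0 < \<kappa>' \<Longrightarrow> \<kappa>' \<le> \<kappa> \<Longrightarrow> P r \<kappa>'"
  shows "\<exists>\<kappa>>0. \<forall>r\<in>F. P r \<kappa>"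
  using assms(1,2)
proof (induction F)
  case empty
  show ?case by (intro exI[of _ 1]) simp
next
  case (insert a F)
  then obtain \<kappa> where \<kappa>: "\<kappa> > 0" "\<forall>r\<in>F. P r \<kappa>" by blast
  obtain \<kappa>' where "\<kappa>' > 0" "P a \<kappa>'" using insert.prems by blast
  with \<kappa> show ?case using mono by (intro exI[of _ "min \<kappa> \<kappa>'"]) (auto intro: mono)
qed

locale diagram =
  fixes D :: shaded_diagram
  assumes link_diagram: "link_diagram D"
begin

lemma curve_C1: "i < ncomp D \<Longrightarrow> curve D i C1_differentiable_on UNIV"
  and curve_periodic: "i < ncomp D \<Longrightarrow> curve D i (s + 1) = curve D i s"
  and vel_nonzero: "p \<in> params D \<Longrightarrow> vel D p \<noteq> 0"
  and finite_crossings: "finite (crossings D)"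
  and double_point_transversal: "double_point D p q \<Longrightarrow> cdet (vel D p) (vel D q) \<noteq> 0"
  and no_triple_point: "double_point D p q \<Longrightarrow> double_point D q r \<Longrightarrow> same_param p r"
  and over_periodic: "(i, s + 1) \<in> over D \<longleftrightarrow> (i, s) \<in> over D"
  and over_iff: "double_point D p q \<Longrightarrow> p \<in> over D \<longleftrightarrow> q \<notin> over D"
  using link_diagram unfolding link_diagram_def cdet_def by blast+

lemma params_iff: "p \<in> params D \<longleftrightarrow> fst p < ncomp D"
  by (cases p) (auto simp: params_def)

lemma params_same: "same_param p q \<Longrightarrow> p \<in> params D \<longleftrightarrow> q \<in> params D"
  by (simp add: params_iff same_param_def)

lemma curve_of_int: "i < ncomp D \<Longrightarrow> curve D i (s + of_int n) = curve D i s"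
  using periodic_of_int[of "curve D i"] curve_periodic by blast

lemma pt_same: "p \<in> params D \<Longrightarrow> same_param p q \<Longrightarrow> pt D q = pt D p"
  by (erule same_paramE) (simp add: pt_def curve_of_int params_iff)

lemma over_same: "same_param p q \<Longrightarrow> q \<in> over D \<longleftrightarrow> p \<in> over D"
  using periodic_of_int[of "\<lambda>s. (fst p, s) \<in> over D" "snd p"] over_periodic
  by (auto elim!: same_paramE)

lemma has_vel:
  assumes "i < ncomp D"
  shows "(curve D i has_vector_derivative vel D (i, s)) (at s)"
  using curve_C1[OF assms] by (auto simp: C1_differentiable_on_eq vector_derivative_works vel_def)

lemma has_vel_pt: "i < ncomp D \<Longrightarrow> ((\<lambda>t. pt D (i, t)) has_vector_derivative vel D (i, s)) (at s)"
  using has_vel by (simp add: pt_def[abs_def])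

lemma continuous_vel: "i < ncomp D \<Longrightarrow> continuous_on UNIV (\<lambda>s. vel D (i, s))"
  using curve_C1[of i] by (simp add: C1_differentiable_on_eq vel_def)

lemma continuous_pt: "i < ncomp D \<Longrightarrow> continuous_on UNIV (\<lambda>s. pt D (i, s))"
  by (intro continuous_at_imp_continuous_on ballI has_vector_derivative_continuous[OF has_vel_pt])

lemma vel_same:
  assumes "p \<in> params D" "same_param p q"
  shows "vel D q = vel D p"
proof -
  obtain n where q: "q = (fst p, snd p + of_int n)" using assms(2) by (rule same_paramE)
  have i: "fst p < ncomp D" using assms(1) by (simp add: params_iff)
  have "((\<lambda>x. x + of_int n :: real) has_vector_derivative 1) (at (snd p))"
    by (auto intro!: derivative_eq_intros)
  from vector_diff_chain_at[OF this has_vel[OF i, of "snd p + of_int n"]]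
  have "((curve D (fst p) \<circ> (\<lambda>x. x + of_int n)) has_vector_derivative vel D q) (at (snd p))"
    by (simp add: q)
  also have "curve D (fst p) \<circ> (\<lambda>x. x + of_int n) = curve D (fst p)"
    using curve_of_int[OF i] by auto
  finally show ?thesis
    using has_vel[OF i, of "snd p"] vector_derivative_unique_at by fastforce
qed

lemma double_point_sym: "double_point D p q \<Longrightarrow> double_point D q p"
  by (auto simp: double_point_def dest: same_param_sym)

lemma double_point_same:
  assumes "double_point D p q" "same_param p p'"
  shows "double_point D p' q"
  using assms params_same[OF assms(2)] pt_same[OF _ assms(2)] same_param_trans
  unfolding double_point_def by metis

lemma crossing_param_same: "same_param p q \<Longrightarrow> crossing_param D q \<longleftrightarrow> crossing_param D p"
  using double_point_same same_param_sym unfolding crossing_param_def by metis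

lemma double_point_fiber:
  assumes "double_point D p q" "r \<in> params D" "pt D r = pt D p"
  shows "same_param p r \<or> same_param q r"
proof (rule ccontr)
  assume *: "\<not> ?thesis"
  then have "double_point D q r"
    using assms unfolding double_point_def by auto
  then show False using no_triple_point[OF assms(1)] * by blast
qed

lemma noncrossing_fiber:
  "\<lbrakk>p \<in> params D; \<not> crossing_param D p; r \<in> params D; pt D r = pt D p\<rbrakk> \<Longrightarrow> same_param p r"
  unfolding crossing_param_def double_point_def by metis

lemma finite_fiber_reps:
  "\<exists>F. finite F \<and> F \<subseteq> params D \<and> (\<forall>r\<in>F. pt D r = v) \<and>
     (\<forall>r\<in>params D. pt D r = v \<longrightarrow> (\<exists>r0\<in>F. same_param r0 r))"
proof (cases "\<exists>p\<in>params D. pt D p = v")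
  case True
  then obtain p where p: "p \<in> params D" "pt D p = v" by blast
  show ?thesis
  proof (cases "crossing_param D p")
    case True
    then obtain q where q: "double_point D p q" by (auto simp: crossing_param_def)
    with p double_point_fiber[OF q] show ?thesis
      by (intro exI[of _ "{p, q}"]) (auto simp: double_point_def)
  next
    case False
    with p noncrossing_fiber[OF p(1) False] show ?thesis
      by (intro exI[of _ "{p}"]) auto
  qed
qed (intro exI[of _ "{}"], simp)

text \<open>By periodicity the parameter may be taken in [0,1]. The part of this interval away from
  the preimages of \<open>v\<close> is compact, and there the distance to \<open>v\<close> has a
  positive minimum.\<close>

lemma near_preimage:
  assumes e: "e > 0"
  shows "\<exists>\<delta>>0. \<forall>r\<in>params D. dist (pt D r) v < \<delta> \<longrightarrow>
     (\<exists>s. pt D (fst r, s) = v \<and> \<bar>snd r - s\<bar> < e)"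
proof -
  have "\<exists>\<delta>>0. \<forall>i\<in>{..<ncomp D}. \<forall>s\<in>{0..1}. dist (pt D (i, s)) v < \<delta> \<longrightarrow>
     (\<exists>s0. pt D (i, s0) = v \<and> \<bar>s - s0\<bar> < e)"
  proof (rule finite_uniform_pos)
    fix i assume "i \<in> {..<ncomp D}"
    then have i: "i < ncomp D" by simp
    define K where "K = {0..1} \<inter> (\<Inter>s0\<in>{s0. pt D (i, s0) = v}. {s. e \<le> \<bar>s - s0\<bar>})"
    have cl: "closed {s. e \<le> \<bar>s - s0\<bar>}" for s0 :: real
      by (intro closed_Collect_le continuous_intros)
    have comp: "compact K" unfolding K_def
      by (intro compact_Int_closed closed_INT ballI cl) simp
    have cont: "continuous_on K (\<lambda>s. dist (pt D (i, s)) v)"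
      by (intro continuous_intros continuous_on_subset[OF continuous_pt[OF i]]) simp
    have pos: "dist (pt D (i, s)) v > 0" if "s \<in> K" for s
      using that e by (auto simp: K_def)
    have "\<exists>\<delta>>0. \<forall>s\<in>K. \<delta> \<le> dist (pt D (i, s)) v"
    proof (cases "K = {}")
      case False
      then obtain x where x: "x \<in> K" "\<forall>y\<in>K. dist (pt D (i, x)) v \<le> dist (pt D (i, y)) v"
        using continuous_attains_inf[OF comp _ cont] by blast
      then show ?thesis using pos by (intro exI[of _ "dist (pt D (i, x)) v"]) simp
    qed (auto intro: exI[of _ 1])
    then obtain \<delta> where "\<delta> > 0" "\<forall>s\<in>K. \<delta> \<le> dist (pt D (i, s)) v" by blast
    then show "\<exists>\<delta>>0. \<forall>s\<in>{0..1}. dist (pt D (i, s)) v < \<delta> \<longrightarrow> (\<exists>s0. pt D (i, s0) = v \<and> \<bar>s - s0\<bar> < e)"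
      by (intro exI[of _ \<delta>]) (force simp: K_def)
  qed (auto intro: less_le_trans)
  then obtain \<delta> where \<delta>: "\<delta> > 0" "\<And>i s. i < ncomp D \<Longrightarrow> s \<in> {0..1} \<Longrightarrow> dist (pt D (i, s)) v < \<delta> \<Longrightarrow>
     \<exists>s0. pt D (i, s0) = v \<and> \<bar>s - s0\<bar> < e" by auto
  show ?thesis
  proof (rule exI[of _ \<delta>], intro conjI ballI impI)
    fix r assume r: "r \<in> params D" "dist (pt D r) v < \<delta>"
    \<comment> \<open>The parameter is moved into one period, and the preimage found there is moved
      back.\<close>
    let ?n = "\<lfloor>snd r\<rfloor>"
    have i: "fst r < ncomp D" using r(1) by (simp add: params_iff)
    have "pt D (fst r, frac (snd r)) = pt D r"
      using curve_of_int[OF i, of "frac (snd r)" ?n] by (simp add: pt_def frac_def)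
    then obtain s0 where s0: "pt D (fst r, s0) = v" "\<bar>frac (snd r) - s0\<bar> < e"
      using \<delta>(2)[OF i, of "frac (snd r)"] r(2) frac_lt_1[of "snd r"] frac_ge_0[of "snd r"] by auto
    have "pt D (fst r, s0 + of_int ?n) = v" using s0(1) curve_of_int[OF i] by (simp add: pt_def)
    moreover have "\<bar>snd r - (s0 + of_int ?n)\<bar> < e" using s0(2) by (simp add: frac_def algebra_simps)
    ultimately show "\<exists>s. pt D (fst r, s) = v \<and> \<bar>snd r - s\<bar> < e" by blast
  qed (rule \<delta>(1))
qed

text \<open>Only branches through \<open>v\<close> come close to \<open>v\<close>. With
  \<open>F\<close> empty this also shows that the drawing is closed.\<close>

lemma near_fiber:
  assumes F: "\<And>r. r \<in> params D \<Longrightarrow> pt D r = v \<Longrightarrow> \<exists>r0\<in>F. same_param r0 r" and e: "e > 0"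
  shows "\<exists>\<delta>>0. \<forall>z\<in>drawing D. dist z v < \<delta> \<longrightarrow>
     (\<exists>r0\<in>F. \<exists>s. z = pt D (fst r0, s) \<and> \<bar>s - snd r0\<bar> < e)"
proof -
  obtain \<delta> where \<delta>: "\<delta> > 0" "\<forall>r\<in>params D. dist (pt D r) v < \<delta> \<longrightarrow>
     (\<exists>s. pt D (fst r, s) = v \<and> \<bar>snd r - s\<bar> < e)" using near_preimage[OF e] by blast
  show ?thesis
  proof (intro exI[of _ \<delta>] conjI ballI impI)
    fix z assume z: "z \<in> drawing D" "dist z v < \<delta>"
    then obtain r where r: "r \<in> params D" "z = pt D r" by (auto simp: drawing_def)
    then obtain s where s: "pt D (fst r, s) = v" "\<bar>snd r - s\<bar> < e" using \<delta>(2) z(2) by blast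
    have "(fst r, s) \<in> params D" using r(1) by (simp add: params_iff)
    then obtain r0 where r0: "r0 \<in> F" "same_param r0 (fst r, s)" using F s(1) by blast
    from r0(2) obtain n where n: "(fst r, s) = (fst r0, snd r0 + of_int n)" by (rule same_paramE)
    have "fst r0 < ncomp D" using r(1) n by (simp add: params_iff)
    from curve_of_int[OF this, of "snd r - of_int n" n] n r(2)
    have "z = pt D (fst r0, snd r - of_int n)" by (simp add: pt_def)
    moreover have "\<bar>(snd r - of_int n) - snd r0\<bar> < e" using s(2) n by (simp add: algebra_simps)
    ultimately show "\<exists>r0\<in>F. \<exists>s. z = pt D (fst r0, s) \<and> \<bar>s - snd r0\<bar> < e" using r0(1) by blast
  qed (rule \<delta>(1))
qed

lemma closed_drawing: "closed (drawing D)"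
proof -
  have "open (- drawing D)"
    unfolding open_dist
  proof
    fix v assume v: "v \<in> - drawing D"
    obtain \<delta> where "\<delta> > 0" "\<forall>z\<in>drawing D. dist z v < \<delta> \<longrightarrow> False"
      using near_fiber[of v "{}" 1] v by (auto simp: drawing_def)
    then show "\<exists>e>0. \<forall>y. dist y v < e \<longrightarrow> y \<in> - drawing D" by auto
  qed
  then show ?thesis by (simp add: closed_def)
qed

text \<open>Strict differentiability, from continuity of the velocity: both \<open>s\<close> and
  \<open>t\<close> vary, so the estimate also separates two points of the same branch.\<close>

lemma strict_deriv:
  assumes "p \<in> params D" "\<theta> > 0"
  shows "\<exists>e>0. \<forall>s t. \<bar>s - snd p\<bar> < e \<longrightarrow> \<bar>t - snd p\<bar> < e \<longrightarrow>
    norm (pt D (fst p, s) - pt D (fst p, t) - (s - t) *\<^sub>R vel D p) \<le> \<theta> * \<bar>s - t\<bar>"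
proof -
  have i: "fst p < ncomp D" using assms(1) by (simp add: params_iff)
  have "isCont (\<lambda>s. vel D (fst p, s)) (snd p)"
    using continuous_vel[OF i] by (simp add: continuous_on_eq_continuous_at)
  then obtain e where e: "e > 0" "\<And>s. \<bar>s - snd p\<bar> < e \<Longrightarrow> norm (vel D (fst p, s) - vel D p) < \<theta>"
    using assms(2) unfolding continuous_at_eps_delta by (auto simp: dist_norm)
  show ?thesis
  proof (intro exI[of _ e] conjI allI impI)
    fix s t assume st: "\<bar>s - snd p\<bar> < e" "\<bar>t - snd p\<bar> < e"
    have "norm (pt D (fst p, s) - pt D (fst p, t) - (s - t) *\<^sub>R vel D (fst p, snd p)) \<le> norm (s - t) * \<theta>"
    proof (rule vector_differentiable_bound_linearization[where S = "ball (snd p) e"])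
      show "((\<lambda>t. pt D (fst p, t)) has_vector_derivative vel D (fst p, x)) (at x within ball (snd p) e)" for x
        using has_vel_pt[OF i] by (rule has_vector_derivative_at_within)
      show "closed_segment t s \<subseteq> ball (snd p) e"
        using st by (intro closed_segment_subset) (auto simp: dist_real_def)
      show "norm (vel D (fst p, x) - vel D (fst p, snd p)) \<le> \<theta>" if "x \<in> ball (snd p) e" for x
        using e(2)[of x] that by (auto simp: dist_real_def abs_minus_commute)
    qed (use e in auto)
    then show "norm (pt D (fst p, s) - pt D (fst p, t) - (s - t) *\<^sub>R vel D p) \<le> \<theta> * \<bar>s - t\<bar>"
      by (simp add: mult.commute)
  qed (rule e(1))
qed

definition transversal :: "complex \<Rightarrow> complex \<Rightarrow> bool" where
  "transversal v d \<longleftrightarrow> (\<forall>r\<in>params D. pt D r = v \<longrightarrow> cdet (vel D r) d \<noteq> 0)"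

text \<open>Points of a thin cone around \<open>d\<close> have a determinant of order
  \<open>\<epsilon>\<close> against the tangent of the branch, whereas the branch deviates from its
  tangent line by much less.\<close>

lemma free_cone_branch:
  assumes r: "r \<in> params D" "pt D r = v" and L: "cdet (vel D r) d \<noteq> 0"
  shows "\<exists>\<kappa>>0. \<forall>\<epsilon> z s. 0 < \<epsilon> \<longrightarrow> \<epsilon> < \<kappa> \<longrightarrow> norm (z - of_real \<epsilon> * d) \<le> \<kappa> * \<epsilon> \<longrightarrow>
    \<bar>s - snd r\<bar> < \<kappa> \<longrightarrow> v + z \<noteq> pt D (fst r, s)"
proof -
  let ?u = "vel D r"
  define L where "L = \<bar>cdet ?u d\<bar>"
  define a where "a = norm ?u"
  have pos: "L > 0" "a > 0" using assms(3) vel_nonzero[OF r(1)] by (auto simp: L_def a_def)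
  \<comment> \<open>The bound \<open>a / 2\<close> makes the distance of parameters comparable to
    \<open>\<epsilon>\<close>; with the second bound and the choice of \<open>\<kappa>\<close> each
    of the two errors is at most a quarter of \<open>\<epsilon> * L\<close>.\<close>
  define \<theta> where "\<theta> = min (a / 2) (L / (8 * (norm d + 1)))"
  have "norm d + 1 > 0" by (simp add: add_nonneg_pos)
  have \<theta>: "\<theta> > 0" "\<theta> \<le> a / 2" "\<theta> * (8 * (norm d + 1)) \<le> L"
  proof -
    have "0 < 8 * (norm d + 1)" using \<open>norm d + 1 > 0\<close> by simp
    moreover have "\<theta> \<le> L / (8 * (norm d + 1))" by (simp add: \<theta>_def)
    ultimately show "\<theta> * (8 * (norm d + 1)) \<le> L" using pos_le_divide_eq by blast
    show "\<theta> > 0" using pos \<open>0 < 8 * (norm d + 1)\<close> by (simp add: \<theta>_def)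
    show "\<theta> \<le> a / 2" unfolding \<theta>_def by (rule min.cobounded1)
  qed
  obtain e where e: "e > 0" "\<And>s. \<bar>s - snd r\<bar> < e \<Longrightarrow>
      norm (pt D (fst r, s) - v - (s - snd r) *\<^sub>R ?u) \<le> \<theta> * \<bar>s - snd r\<bar>"
    using strict_deriv[OF r(1) \<theta>(1)] r(2) by (metis abs_zero diff_self prod.collapse)
  define \<kappa> where "\<kappa> = min e (min 1 (L / (4 * a)))"
  have \<kappa>: "\<kappa> > 0" "\<kappa> \<le> e" "\<kappa> \<le> 1" "\<kappa> * (4 * a) \<le> L"
  proof -
    have "0 < 4 * a" using pos by simp
    moreover have "\<kappa> \<le> L / (4 * a)" by (simp add: \<kappa>_def)
    ultimately show "\<kappa> * (4 * a) \<le> L" using pos_le_divide_eq by blast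
    show "\<kappa> > 0" "\<kappa> \<le> e" "\<kappa> \<le> 1" using e(1) pos by (simp_all add: \<kappa>_def)
  qed
  show ?thesis
  proof (intro exI[of _ \<kappa>] conjI allI impI notI)
    fix \<epsilon> z s assume \<epsilon>: "0 < \<epsilon>" "\<epsilon> < \<kappa>" and z: "norm (z - of_real \<epsilon> * d) \<le> \<kappa> * \<epsilon>"
      and s: "\<bar>s - snd r\<bar> < \<kappa>" and eq: "v + z = pt D (fst r, s)"
    define t where "t = s - snd r"
    have zt: "norm (z - t *\<^sub>R ?u) \<le> \<theta> * \<bar>t\<bar>"
      using e(2)[of s] s \<kappa>(2) by (simp add: eq[symmetric] t_def)
    have nz: "norm z \<le> \<epsilon> * (norm d + 1)"
    proof -
      have "norm z \<le> norm (z - of_real \<epsilon> * d) + norm (of_real \<epsilon> * d)"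
        by (metis diff_add_cancel norm_triangle_ineq)
      also have "\<dots> \<le> \<kappa> * \<epsilon> + \<epsilon> * norm d" using z \<epsilon>(1) by (simp add: norm_mult)
      also have "\<dots> \<le> 1 * \<epsilon> + \<epsilon> * norm d" using \<kappa>(3) \<epsilon>(1) by (simp add: mult_right_mono)
      finally show ?thesis by (simp add: algebra_simps)
    qed
    have "\<bar>t\<bar> * a \<le> norm (z - t *\<^sub>R ?u) + norm z"
      using norm_triangle_ineq[of "t *\<^sub>R ?u - z" z] by (simp add: a_def norm_minus_commute)
    moreover have "\<theta> * \<bar>t\<bar> \<le> a / 2 * \<bar>t\<bar>" using \<theta>(2) by (rule mult_right_mono) simp
    ultimately have ta: "\<bar>t\<bar> * a \<le> 2 * (\<epsilon> * (norm d + 1))" using zt nz by (simp add: mult.commute)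
    have "\<epsilon> * L = \<bar>cdet ?u (of_real \<epsilon> * d)\<bar>" using \<epsilon>(1) by (simp add: L_def abs_mult)
    also have "of_real \<epsilon> * d = (of_real \<epsilon> * d - z) + (z - t *\<^sub>R ?u) + t *\<^sub>R ?u" by simp
    also have "\<bar>cdet ?u \<dots>\<bar> \<le> \<bar>cdet ?u (of_real \<epsilon> * d - z)\<bar> + \<bar>cdet ?u (z - t *\<^sub>R ?u)\<bar>"
      unfolding cdet_simps(5) by simp
    also have "\<dots> \<le> a * (\<kappa> * \<epsilon>) + a * (\<theta> * \<bar>t\<bar>)"
      using abs_cdet_le[of ?u "of_real \<epsilon> * d - z"] abs_cdet_le[of ?u "z - t *\<^sub>R ?u"] z zt pos(2)
      by (intro add_mono) (auto simp: a_def norm_minus_commute intro: order.trans mult_left_mono)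
    also have "a * (\<theta> * \<bar>t\<bar>) = \<theta> * (\<bar>t\<bar> * a)" by simp
    also have "\<theta> * (\<bar>t\<bar> * a) \<le> \<theta> * (2 * (\<epsilon> * (norm d + 1)))" using ta \<theta>(1) by (intro mult_left_mono) auto
    also have "\<dots> = (\<theta> * (8 * (norm d + 1))) * \<epsilon> / 4" by simp
    also have "\<dots> \<le> L * \<epsilon> / 4" using \<theta>(3) \<epsilon>(1) by (simp add: mult_right_mono)
    also have "a * (\<kappa> * \<epsilon>) = (\<kappa> * (4 * a)) * \<epsilon> / 4" by simp
    also have "\<dots> \<le> L * \<epsilon> / 4" using \<kappa>(4) \<epsilon>(1) by (simp add: mult_right_mono)
    finally have "\<epsilon> * L \<le> L * \<epsilon> / 4 + L * \<epsilon> / 4" by simp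
    moreover have "\<epsilon> * L > 0" using \<epsilon>(1) pos(1) by simp
    ultimately show False by (simp add: mult.commute)
  qed (rule \<kappa>(1))
qed

lemma free_cone:
  assumes "transversal v d"
  shows "\<exists>\<kappa>>0. \<forall>\<epsilon> z. 0 < \<epsilon> \<longrightarrow> \<epsilon> < \<kappa> \<longrightarrow> norm (z - of_real \<epsilon> * d) \<le> \<kappa> * \<epsilon> \<longrightarrow> v + z \<notin> drawing D"
proof -
  obtain F where F: "finite F" "F \<subseteq> params D" "\<forall>r\<in>F. pt D r = v"
     "\<forall>r\<in>params D. pt D r = v \<longrightarrow> (\<exists>r0\<in>F. same_param r0 r)"
    using finite_fiber_reps[of v] by metis
  have "\<exists>\<kappa>>0. \<forall>r\<in>F. \<forall>\<epsilon> z s. 0 < \<epsilon> \<longrightarrow> \<epsilon> < \<kappa> \<longrightarrow> norm (z - of_real \<epsilon> * d) \<le> \<kappa> * \<epsilon> \<longrightarrow>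
    \<bar>s - snd r\<bar> < \<kappa> \<longrightarrow> v + z \<noteq> pt D (fst r, s)"
  proof (rule finite_uniform_pos[OF F(1)])
    fix r assume "r \<in> F"
    then show "\<exists>\<kappa>>0. \<forall>\<epsilon> z s. 0 < \<epsilon> \<longrightarrow> \<epsilon> < \<kappa> \<longrightarrow> norm (z - of_real \<epsilon> * d) \<le> \<kappa> * \<epsilon> \<longrightarrow>
      \<bar>s - snd r\<bar> < \<kappa> \<longrightarrow> v + z \<noteq> pt D (fst r, s)"
      using F(2,3) assms by (intro free_cone_branch) (auto simp: transversal_def)
  next
    fix r and \<kappa> \<kappa>' :: real
    assume *: "\<forall>\<epsilon> z s. 0 < \<epsilon> \<longrightarrow> \<epsilon> < \<kappa> \<longrightarrow> norm (z - of_real \<epsilon> * d) \<le> \<kappa> * \<epsilon> \<longrightarrow>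
      \<bar>s - snd r\<bar> < \<kappa> \<longrightarrow> v + z \<noteq> pt D (fst r, s)" "\<kappa>' \<le> \<kappa>"
    show "\<forall>\<epsilon> z s. 0 < \<epsilon> \<longrightarrow> \<epsilon> < \<kappa>' \<longrightarrow> norm (z - of_real \<epsilon> * d) \<le> \<kappa>' * \<epsilon> \<longrightarrow>
      \<bar>s - snd r\<bar> < \<kappa>' \<longrightarrow> v + z \<noteq> pt D (fst r, s)"
    proof (intro allI impI)
      fix \<epsilon> z s assume h: "0 < \<epsilon>" "\<epsilon> < \<kappa>'" "norm (z - of_real \<epsilon> * d) \<le> \<kappa>' * \<epsilon>" "\<bar>s - snd r\<bar> < \<kappa>'"
      have "norm (z - of_real \<epsilon> * d) \<le> \<kappa> * \<epsilon>"
        using h(1,3) *(2) mult_right_mono[of \<kappa>' \<kappa> \<epsilon>] by linarith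
      then show "v + z \<noteq> pt D (fst r, s)" using h *(1)[rule_format, of \<epsilon> z s] *(2) by linarith
    qed
  qed
  then obtain \<kappa> where \<kappa>: "\<kappa> > 0" "\<And>r \<epsilon> z s. r \<in> F \<Longrightarrow> 0 < \<epsilon> \<Longrightarrow> \<epsilon> < \<kappa> \<Longrightarrow>
    norm (z - of_real \<epsilon> * d) \<le> \<kappa> * \<epsilon> \<Longrightarrow> \<bar>s - snd r\<bar> < \<kappa> \<Longrightarrow> v + z \<noteq> pt D (fst r, s)"
    by blast
  obtain \<delta> where \<delta>: "\<delta> > 0" "\<forall>z\<in>drawing D. dist z v < \<delta> \<longrightarrow>
     (\<exists>r0\<in>F. \<exists>s. z = pt D (fst r0, s) \<and> \<bar>s - snd r0\<bar> < \<kappa>)"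
    using near_fiber[of v F \<kappa>] F(4) \<kappa>(1) by blast
  have dpos: "norm d + 1 > 0" by (simp add: add_nonneg_pos)
  \<comment> \<open>The third bound keeps the points of the cone within the distance
    \<open>\<delta>\<close> at which only branches through \<open>v\<close> are met.\<close>
  define \<rho> where "\<rho> = min \<kappa> (min 1 (\<delta> / (norm d + 1)))"
  have \<rho>: "\<rho> > 0" "\<rho> \<le> \<kappa>" "\<rho> \<le> 1" "\<rho> * (norm d + 1) \<le> \<delta>"
  proof -
    have "\<rho> \<le> \<delta> / (norm d + 1)" by (simp add: \<rho>_def)
    then show "\<rho> * (norm d + 1) \<le> \<delta>" using dpos pos_le_divide_eq by blast
    show "\<rho> > 0" "\<rho> \<le> \<kappa>" "\<rho> \<le> 1" using \<kappa>(1) \<delta>(1) dpos by (simp_all add: \<rho>_def)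
  qed
  show ?thesis
  proof (intro exI[of _ \<rho>] conjI allI impI notI)
    fix \<epsilon> z assume \<epsilon>: "0 < \<epsilon>" "\<epsilon> < \<rho>" and z: "norm (z - of_real \<epsilon> * d) \<le> \<rho> * \<epsilon>"
      and dr: "v + z \<in> drawing D"
    have "norm z \<le> norm (z - of_real \<epsilon> * d) + norm (of_real \<epsilon> * d)"
      by (metis diff_add_cancel norm_triangle_ineq)
    also have "\<dots> \<le> \<rho> * \<epsilon> + \<epsilon> * norm d" using z \<epsilon>(1) by (simp add: norm_mult)
    also have "\<dots> \<le> 1 * \<epsilon> + \<epsilon> * norm d" using \<rho>(3) \<epsilon>(1) by (simp add: mult_right_mono)
    also have "\<dots> = \<epsilon> * (norm d + 1)" by (simp add: algebra_simps)
    also have "\<dots> < \<rho> * (norm d + 1)" using \<epsilon>(2) dpos by (rule mult_strict_right_mono)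
    finally have "norm z < \<delta>" using \<rho>(4) by simp
    then obtain r0 s where r0: "r0 \<in> F" "v + z = pt D (fst r0, s)" "\<bar>s - snd r0\<bar> < \<kappa>"
      using \<delta>(2) dr by (auto simp: dist_norm)
    have "\<rho> * \<epsilon> \<le> \<kappa> * \<epsilon>" using \<rho>(2) \<epsilon>(1) by (simp add: mult_right_mono)
    then have "norm (z - of_real \<epsilon> * d) \<le> \<kappa> * \<epsilon>" using z by simp
    then show False using \<kappa>(2)[OF r0(1) \<epsilon>(1) _ _ r0(3)] r0(2) \<epsilon>(2) \<rho>(2) by auto
  qed (rule \<rho>(1))
qed

end

text \<open>The shade of the sector at \<open>v\<close> that contains the direction
  \<open>d\<close>, in the form in which it enters \<open>crossing_symb\<close>.\<close>

definition dsh :: "shaded_diagram \<Rightarrow> complex \<Rightarrow> complex \<Rightarrow> bool" where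
  "dsh D v d \<longleftrightarrow> (\<forall>\<^sub>F \<epsilon> in at_right 0. v + of_real \<epsilon> * d \<in> shaded D)"

locale checkered = diagram +
  assumes checkerboard: "checkerboard D"
begin

lemma shaded_connected:
  assumes "connected S" "S \<inter> drawing D = {}" "x \<in> S" "y \<in> S"
  shows "x \<in> shaded D \<longleftrightarrow> y \<in> shaded D"
proof -
  obtain \<F> where F: "\<F> \<subseteq> components (- drawing D)" "shaded D = \<Union>\<F>"
    using checkerboard by (auto simp: checkerboard_def)
  have *: "b \<in> shaded D" if ab: "a \<in> S" "b \<in> S" "a \<in> shaded D" for a b
  proof -
    obtain C where C: "C \<in> \<F>" "a \<in> C" using ab(3) F(2) by auto
    have "S \<subseteq> C"
      using C F(1) assms(1,2) ab(1) by (intro components_maximal[of C "- drawing D"]) auto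
    then show ?thesis using C(1) F(2) ab(2) by auto
  qed
  show ?thesis using *[OF assms(3,4)] *[OF assms(4,3)] by blast
qed

text \<open>The thin cone that is free of the drawing is convex, so it lies in a single
  face.\<close>

lemma cone_shade:
  assumes "transversal v d"
  shows "\<exists>\<kappa>>0. \<forall>\<epsilon> z. 0 < \<epsilon> \<longrightarrow> \<epsilon> < \<kappa> \<longrightarrow> norm (z - of_real \<epsilon> * d) \<le> \<kappa> * \<epsilon> \<longrightarrow>
    (v + z \<in> shaded D \<longleftrightarrow> dsh D v d)"
proof -
  obtain \<kappa> where \<kappa>: "\<kappa> > 0" "\<forall>\<epsilon> z. 0 < \<epsilon> \<longrightarrow> \<epsilon> < \<kappa> \<longrightarrow> norm (z - of_real \<epsilon> * d) \<le> \<kappa> * \<epsilon> \<longrightarrow> v + z \<notin> drawing D"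
    using free_cone[OF assms] by blast
  \<comment> \<open>\<open>\<epsilon>\<close> varies over the whole interval; for convexity the
    parameters of two points are averaged along with the points.\<close>
  define C where "C = {w. \<exists>\<epsilon>. 0 < \<epsilon> \<and> \<epsilon> < \<kappa> \<and> norm (w - v - of_real \<epsilon> * d) \<le> \<kappa> * \<epsilon>}"
  have "convex C"
  proof (rule convexI)
    fix x y a b assume x: "x \<in> C" and y: "y \<in> C" and ab: "0 \<le> a" "0 \<le> b" "a + b = (1::real)"
    obtain \<epsilon>1 where 1: "0 < \<epsilon>1" "\<epsilon>1 < \<kappa>" "norm (x - v - of_real \<epsilon>1 * d) \<le> \<kappa> * \<epsilon>1" using x by (auto simp: C_def)
    obtain \<epsilon>2 where 2: "0 < \<epsilon>2" "\<epsilon>2 < \<kappa>" "norm (y - v - of_real \<epsilon>2 * d) \<le> \<kappa> * \<epsilon>2" using y by (auto simp: C_def)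
    let ?e = "a * \<epsilon>1 + b * \<epsilon>2"
    have e: "0 < ?e \<and> ?e < \<kappa>"
      using convexD[OF convex_real_interval(8)[of 0 \<kappa>], of \<epsilon>1 \<epsilon>2 a b] 1 2 ab by simp
    have b: "of_real b = (1 - of_real a :: complex)" using ab(3) by (metis add_diff_cancel_left' of_real_1 of_real_diff)
    have "a *\<^sub>R x + b *\<^sub>R y - v - of_real ?e * d =
        a *\<^sub>R (x - v - of_real \<epsilon>1 * d) + b *\<^sub>R (y - v - of_real \<epsilon>2 * d)"
      by (simp add: scaleR_conv_of_real b algebra_simps)
    also have "norm \<dots> \<le> a * (\<kappa> * \<epsilon>1) + b * (\<kappa> * \<epsilon>2)"
      using 1(3) 2(3) ab by (intro norm_triangle_le add_mono) (auto simp: mult_left_mono)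
    also have "\<dots> = \<kappa> * ?e" by (simp add: algebra_simps)
    finally show "a *\<^sub>R x + b *\<^sub>R y \<in> C" using e unfolding C_def by blast
  qed
  then have conn: "connected C" by (rule convex_connected)
  have free: "C \<inter> drawing D = {}"
  proof -
    have "w \<notin> drawing D" if "w \<in> C" for w
      using that \<kappa>(2)[rule_format, of _ "w - v"] by (auto simp: C_def)
    then show ?thesis by blast
  qed
  define b where "b \<longleftrightarrow> v + of_real (\<kappa> / 2) * d \<in> shaded D"
  have all: "v + z \<in> shaded D \<longleftrightarrow> b" if "0 < \<epsilon>" "\<epsilon> < \<kappa>" "norm (z - of_real \<epsilon> * d) \<le> \<kappa> * \<epsilon>" for \<epsilon> z
  proof -
    have "v + z \<in> C" unfolding C_def using that by (auto intro!: exI[of _ \<epsilon>])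
    moreover have "v + of_real (\<kappa> / 2) * d \<in> C"
      unfolding C_def using \<kappa>(1) by (auto intro!: exI[of _ "\<kappa> / 2"])
    ultimately show ?thesis unfolding b_def using shaded_connected[OF conn free] by blast
  qed
  have "\<forall>\<^sub>F \<epsilon> in at_right 0. v + of_real \<epsilon> * d \<in> shaded D \<longleftrightarrow> b"
    unfolding eventually_at_right_field using \<kappa>(1) all by (intro exI[of _ \<kappa>]) auto
  then have "dsh D v d \<longleftrightarrow> (\<forall>\<^sub>F \<epsilon> in at_right (0::real). b)"
    unfolding dsh_def by (rule eventually_subst)
  then have "dsh D v d \<longleftrightarrow> b" by (simp add: eventually_const_iff)
  then show ?thesis using \<kappa>(1) all by blast
qed

text \<open>A curve that leaves \<open>v\<close> with tangent \<open>d\<close> enters every cone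
  around \<open>d\<close>, so it sees the same shade as the ray.\<close>

lemma dsh_curve:
  assumes "transversal v d" "((\<lambda>\<epsilon>. (\<gamma> \<epsilon> - v) /\<^sub>R \<epsilon>) \<longlongrightarrow> d) (at_right 0)"
  shows "\<forall>\<^sub>F \<epsilon> in at_right 0. \<gamma> \<epsilon> \<in> shaded D \<longleftrightarrow> dsh D v d"
proof -
  obtain \<kappa> where \<kappa>: "\<kappa> > 0" "\<And>\<epsilon> z. 0 < \<epsilon> \<Longrightarrow> \<epsilon> < \<kappa> \<Longrightarrow> norm (z - of_real \<epsilon> * d) \<le> \<kappa> * \<epsilon> \<Longrightarrow>
    (v + z \<in> shaded D \<longleftrightarrow> dsh D v d)" using cone_shade[OF assms(1)] by blast
  have "\<forall>\<^sub>F \<epsilon> in at_right 0. dist ((\<gamma> \<epsilon> - v) /\<^sub>R \<epsilon>) d < \<kappa>"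
    using assms(2) \<kappa>(1) by (rule tendstoD)
  moreover have "\<forall>\<^sub>F \<epsilon> in at_right (0::real). 0 < \<epsilon> \<and> \<epsilon> < \<kappa>"
    using \<kappa>(1) by (auto simp: eventually_at_right_field)
  ultimately show ?thesis
  proof eventually_elim
    case (elim \<epsilon>)
    have "\<gamma> \<epsilon> - v - of_real \<epsilon> * d = \<epsilon> *\<^sub>R ((\<gamma> \<epsilon> - v) /\<^sub>R \<epsilon> - d)"
      using elim by (simp add: scaleR_conv_of_real algebra_simps)
    also have "norm \<dots> \<le> \<epsilon> * \<kappa>"
      using elim by (simp add: dist_norm)
    finally show ?case using \<kappa>(2)[of \<epsilon> "\<gamma> \<epsilon> - v"] elim by (simp add: mult.commute)
  qed
qed

lemma dsh_eventually:
  assumes "transversal v d"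
  shows "\<forall>\<^sub>F \<epsilon> in at_right 0. v + of_real \<epsilon> * d \<in> shaded D \<longleftrightarrow> dsh D v d"
proof (rule dsh_curve[OF assms])
  have "\<forall>\<^sub>F \<epsilon> in at_right (0::real). (v + of_real \<epsilon> * d - v) /\<^sub>R \<epsilon> = d"
    by (auto simp: eventually_at_right_field scaleR_conv_of_real intro!: exI[of _ 1])
  then show "((\<lambda>\<epsilon>. (v + of_real \<epsilon> * d - v) /\<^sub>R \<epsilon>) \<longlongrightarrow> d) (at_right 0)"
    by (rule tendsto_eventually)
qed

text \<open>On transversal directions the shade is locally constant, because neighbouring rays start
  in one cone; the segment of directions is connected.\<close>

lemma dsh_segment:
  assumes "\<And>\<tau>. 0 \<le> \<tau> \<Longrightarrow> \<tau> \<le> 1 \<Longrightarrow> transversal v ((1 - \<tau>) *\<^sub>R d0 + \<tau> *\<^sub>R d1)"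
  shows "dsh D v d0 \<longleftrightarrow> dsh D v d1"
proof -
  have loc: "\<exists>\<kappa>>0. \<forall>d'. norm (d' - d) \<le> \<kappa> \<longrightarrow> (dsh D v d' \<longleftrightarrow> dsh D v d)" if t: "transversal v d" for d
  proof -
    obtain \<kappa> where \<kappa>: "\<kappa> > 0" "\<And>\<epsilon> z. 0 < \<epsilon> \<Longrightarrow> \<epsilon> < \<kappa> \<Longrightarrow> norm (z - of_real \<epsilon> * d) \<le> \<kappa> * \<epsilon> \<Longrightarrow>
      (v + z \<in> shaded D \<longleftrightarrow> dsh D v d)" using cone_shade[OF t] by blast
    have "dsh D v d' \<longleftrightarrow> dsh D v d" if d': "norm (d' - d) \<le> \<kappa>" for d'
    proof -
      have "v + of_real \<epsilon> * d' \<in> shaded D \<longleftrightarrow> dsh D v d" if "0 < \<epsilon>" "\<epsilon> < \<kappa>" for \<epsilon>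
      proof (rule \<kappa>(2)[OF that])
        have "norm (of_real \<epsilon> * d' - of_real \<epsilon> * d) = \<epsilon> * norm (d' - d)"
          using that by (simp flip: right_diff_distrib add: norm_mult)
        also have "\<dots> \<le> \<epsilon> * \<kappa>" using d' that by (intro mult_left_mono) auto
        finally show "norm (of_real \<epsilon> * d' - of_real \<epsilon> * d) \<le> \<kappa> * \<epsilon>" by (simp add: mult.commute)
      qed
      then have "\<forall>\<^sub>F \<epsilon> in at_right 0. v + of_real \<epsilon> * d' \<in> shaded D \<longleftrightarrow> dsh D v d"
        unfolding eventually_at_right_field using \<kappa>(1) by (intro exI[of _ \<kappa>]) auto
      then have "dsh D v d' \<longleftrightarrow> (\<forall>\<^sub>F \<epsilon> in at_right (0::real). dsh D v d)"
        unfolding dsh_def[of D v d'] by (rule eventually_subst)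
      then show ?thesis by (simp add: eventually_const_iff)
    qed
    then show ?thesis using \<kappa>(1) by blast
  qed
  let ?d = "\<lambda>\<tau>. (1 - \<tau>) *\<^sub>R d0 + \<tau> *\<^sub>R d1"
  have "dsh D v (?d 0) \<longleftrightarrow> dsh D v (?d 1)"
  proof (rule connected_equivalence_relation[of "{0..1::real}" 0 1 "\<lambda>s t. dsh D v (?d s) \<longleftrightarrow> dsh D v (?d t)"])
    fix a :: real assume a: "a \<in> {0..1}"
    obtain \<kappa> where \<kappa>: "\<kappa> > 0" "\<And>d'. norm (d' - ?d a) \<le> \<kappa> \<Longrightarrow> (dsh D v d' \<longleftrightarrow> dsh D v (?d a))"
      using loc[OF assms[of a]] a by auto
    have "open (?d -` ball (?d a) \<kappa>)"
      by (intro open_vimage) (auto intro!: continuous_intros)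
    then have "openin (top_of_set {0..1}) ({0..1} \<inter> ?d -` ball (?d a) \<kappa>)" by (rule openin_open_Int)
    moreover have "dsh D v (?d a) \<longleftrightarrow> dsh D v (?d x)" if "x \<in> {0..1} \<inter> ?d -` ball (?d a) \<kappa>" for x
      using that \<kappa>(2)[of "?d x"] by (auto simp: dist_norm norm_minus_commute)
    ultimately show "\<exists>T. openin (top_of_set {0..1}) T \<and> a \<in> T \<and>
        (\<forall>x\<in>T. dsh D v (?d a) \<longleftrightarrow> dsh D v (?d x))"
      using a \<kappa>(1) by (intro exI[of _ "{0..1} \<inter> ?d -` ball (?d a) \<kappa>"]) auto
  qed auto
  then show ?thesis by simp
qed

lemma transversal_noncrossing:
  assumes "p \<in> params D" "\<not> crossing_param D p"
  shows "transversal (pt D p) d \<longleftrightarrow> cdet (vel D p) d \<noteq> 0"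
proof -
  have "vel D r = vel D p" if "r \<in> params D" "pt D r = pt D p" for r
    using noncrossing_fiber[OF assms that] vel_same[OF assms(1)] by blast
  then show ?thesis using assms(1) unfolding transversal_def by metis
qed

text \<open>The checkerboard condition is stated for the normals only. The directions on one side of
  the tangent form a convex set of transversal vectors, so it extends to all of them.\<close>

lemma side_shade:
  assumes p: "p \<in> params D" "\<not> crossing_param D p"
    and d: "cdet (vel D p) d > 0" "cdet (vel D p) d' < 0"
  shows "dsh D (pt D p) d \<longleftrightarrow> \<not> dsh D (pt D p) d'"
proof -
  let ?v = "pt D p" and ?u = "vel D p"
  have pos: "cdet ?u (\<i> * ?u) > 0" using vel_nonzero[OF p(1)] by (simp add: cdet_ii)
  have conv: "dsh D ?v d0 \<longleftrightarrow> dsh D ?v d1"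
    if "cdet ?u d0 * c > 0" "cdet ?u d1 * c > 0" for d0 d1 c
  proof (rule dsh_segment)
    fix \<tau> :: real assume t: "0 \<le> \<tau>" "\<tau> \<le> 1"
    have "0 < (1 - \<tau>) * (cdet ?u d0 * c) + \<tau> * (cdet ?u d1 * c)"
      using convexD[OF convex_real_interval(3)[of 0], of "cdet ?u d0 * c" "cdet ?u d1 * c" "1 - \<tau>" \<tau>] that t by simp
    also have "\<dots> = cdet ?u ((1 - \<tau>) *\<^sub>R d0 + \<tau> *\<^sub>R d1) * c" by (simp add: algebra_simps)
    finally have "cdet ?u ((1 - \<tau>) *\<^sub>R d0 + \<tau> *\<^sub>R d1) \<noteq> 0" by (simp only: zero_less_mult_iff) linarith
    then show "transversal ?v ((1 - \<tau>) *\<^sub>R d0 + \<tau> *\<^sub>R d1)"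
      unfolding transversal_noncrossing[OF p] .
  qed
  have "dsh D ?v d \<longleftrightarrow> dsh D ?v (\<i> * ?u)"
    by (rule conv[of _ 1]) (use d pos in simp_all)
  moreover have "dsh D ?v d' \<longleftrightarrow> dsh D ?v (- (\<i> * ?u))"
    by (rule conv[of _ "- 1"]) (use d pos in simp_all)
  moreover have "dsh D ?v (\<i> * ?u) \<longleftrightarrow> \<not> dsh D ?v (- (\<i> * ?u))"
  proof -
    have "transversal ?v (\<i> * ?u)" "transversal ?v (- (\<i> * ?u))"
      using transversal_noncrossing[OF p] pos by auto
    note this[THEN dsh_eventually]
    moreover have "\<forall>\<^sub>F \<epsilon> in at_right 0. (?v + of_real \<epsilon> * (\<i> * ?u) \<in> shaded D) \<noteq>
        (?v - of_real \<epsilon> * (\<i> * ?u) \<in> shaded D)"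
      using checkerboard p by (auto simp: checkerboard_def)
    ultimately have "\<forall>\<^sub>F \<epsilon> in at_right (0::real). dsh D ?v (\<i> * ?u) \<longleftrightarrow> \<not> dsh D ?v (- (\<i> * ?u))"
      by eventually_elim auto
    then show ?thesis by (simp add: eventually_const_iff)
  qed
  ultimately show ?thesis by blast
qed

lemma transversal_crossing:
  assumes "double_point D p q"
  shows "transversal (pt D p) d \<longleftrightarrow> cdet (vel D p) d \<noteq> 0 \<and> cdet (vel D q) d \<noteq> 0"
proof -
  have p: "p \<in> params D" "q \<in> params D" "pt D q = pt D p"
    using assms by (auto simp: double_point_def)
  have "vel D r = vel D p \<or> vel D r = vel D q" if "r \<in> params D" "pt D r = pt D p" for r
    using double_point_fiber[OF assms that] vel_same p by blast
  then show ?thesis using p unfolding transversal_def by metis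
qed

lemma dsh_same_sector:
  assumes dp: "double_point D p q" and "x * x' > 0" "y * y' > 0"
  shows "dsh D (pt D p) (x *\<^sub>R vel D p + y *\<^sub>R vel D q) \<longleftrightarrow> dsh D (pt D p) (x' *\<^sub>R vel D p + y' *\<^sub>R vel D q)"
proof (rule dsh_segment)
  fix \<tau> :: real assume t: "0 \<le> \<tau>" "\<tau> \<le> 1"
  let ?u = "vel D p" and ?w = "vel D q"
  have nz: "(1 - \<tau>) * a + \<tau> * b \<noteq> 0" if "a * b > 0" for a b :: real
  proof (cases "a > 0")
    case True
    then have "b > 0" using that by (simp add: zero_less_mult_iff)
    then show ?thesis
      using convexD[OF convex_real_interval(3)[of 0], of a b "1 - \<tau>" \<tau>] True t by simp
  next
    case False
    then have "a < 0" "b < 0" using that by (auto simp: zero_less_mult_iff)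
    then show ?thesis
      using convexD[OF convex_real_interval(4)[of 0], of a b "1 - \<tau>" \<tau>] t by simp
  qed
  have "(1 - \<tau>) *\<^sub>R (x *\<^sub>R ?u + y *\<^sub>R ?w) + \<tau> *\<^sub>R (x' *\<^sub>R ?u + y' *\<^sub>R ?w) =
      ((1 - \<tau>) * x + \<tau> * x') *\<^sub>R ?u + ((1 - \<tau>) * y + \<tau> * y') *\<^sub>R ?w"
    by (simp add: algebra_simps)
  then show "transversal (pt D p) ((1 - \<tau>) *\<^sub>R (x *\<^sub>R ?u + y *\<^sub>R ?w) + \<tau> *\<^sub>R (x' *\<^sub>R ?u + y' *\<^sub>R ?w))"
    using nz[OF assms(2)] nz[OF assms(3)] double_point_transversal[OF dp] cdet_anti[of ?w ?u]
    unfolding transversal_crossing[OF dp] by simp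
qed

text \<open>The other crossings, being finitely many, stay at a distance from \<open>pt D p\<close>,
  and the branch leaves \<open>pt D p\<close> itself at once because its velocity is
  nonzero.\<close>

lemma eventually_noncrossing:
  assumes p: "p \<in> params D"
  shows "\<forall>\<^sub>F t in at (snd p). \<not> crossing_param D (fst p, t)"
proof -
  have i: "fst p < ncomp D" using p by (simp add: params_iff)
  have "isCont (\<lambda>t. pt D (fst p, t)) (snd p)"
    using continuous_pt[OF i] by (simp add: continuous_on_eq_continuous_at)
  then have cont: "((\<lambda>t. pt D (fst p, t)) \<longlongrightarrow> pt D p) (at (snd p))" by (simp add: isCont_def)
  have "finite (crossings D - {pt D p})" using finite_crossings by simp
  then have "open (- (crossings D - {pt D p}))" by (intro open_Compl finite_imp_closed)
  then have 1: "\<forall>\<^sub>F t in at (snd p). pt D (fst p, t) \<in> - (crossings D - {pt D p})"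
    using topological_tendstoD[OF cont] by blast
  have a: "norm (vel D p) > 0" using vel_nonzero[OF p] by simp
  then obtain e where e: "e > 0" "\<And>s t. \<bar>s - snd p\<bar> < e \<Longrightarrow> \<bar>t - snd p\<bar> < e \<Longrightarrow>
    norm (pt D (fst p, s) - pt D (fst p, t) - (s - t) *\<^sub>R vel D p) \<le> norm (vel D p) / 2 * \<bar>s - t\<bar>"
    using strict_deriv[OF p, of "norm (vel D p) / 2"] by auto
  have 2: "\<forall>\<^sub>F t in at (snd p). pt D (fst p, t) \<noteq> pt D p"
    unfolding eventually_at
  proof (intro exI[of _ e] conjI ballI impI notI)
    fix t assume t: "t \<noteq> snd p \<and> dist t (snd p) < e" and eq: "pt D (fst p, t) = pt D p"
    have "\<bar>t - snd p\<bar> * norm (vel D p) \<le> norm (vel D p) / 2 * \<bar>t - snd p\<bar>"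
      using e(2)[of t "snd p"] e(1) t eq by (simp add: dist_real_def)
    moreover have "\<bar>t - snd p\<bar> * norm (vel D p) > 0" using a t by simp
    ultimately show False by (simp add: mult.commute)
  qed (rule e(1))
  from 1 2 show ?thesis
  proof eventually_elim
    case (elim t)
    then show ?case by (auto simp: crossings_def)
  qed
qed

text \<open>From a point of the branch of \<open>p\<close> one can go in the direction of the other
  branch without meeting the drawing. A hit on the branch of \<open>p\<close> would make the
  direction of \<open>q\<close> almost tangent to it; a hit on the branch of \<open>q\<close> would
  make the step along \<open>p\<close> almost parallel to \<open>q\<close>.\<close>

lemma free_transverse_segment:
  assumes dp: "double_point D p q"
  shows "\<exists>e>0. \<forall>t y. 0 < \<bar>t\<bar> \<longrightarrow> \<bar>t\<bar> < e \<longrightarrow> 0 < \<bar>y\<bar> \<longrightarrow> \<bar>y\<bar> \<le> \<bar>t\<bar> \<longrightarrow>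
    pt D (fst p, snd p + t) + y *\<^sub>R vel D q \<notin> drawing D"
proof -
  let ?u = "vel D p" and ?w = "vel D q" and ?v = "pt D p"
  have p: "p \<in> params D" "q \<in> params D" "pt D q = ?v"
    using dp by (auto simp: double_point_def)
  define L where "L = \<bar>cdet ?u ?w\<bar>"
  define a where "a = norm ?u"
  define b where "b = norm ?w"
  have pos: "L > 0" "a > 0" "b > 0"
    using double_point_transversal[OF dp] vel_nonzero p by (auto simp: L_def a_def b_def)
  have ipos: "i < ncomp D" if "i = fst p" for i using p(1) that by (simp add: params_iff)
  \<comment> \<open>Large enough for three estimates: \<open>1 + a + b\<close> for the distance from
    the crossing, \<open>b\<close> for the first case, and \<open>2 + 2 * a + 3 * b\<close> for the
    second.\<close>
  define M where "M = 3 * a + 3 * b + 2"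
  define \<theta> where "\<theta> = min (min 1 (b / 2)) (L / (2 * M))"
  have M: "M > 0" using pos by (simp add: M_def)
  have \<theta>: "\<theta> > 0" "\<theta> \<le> 1" "\<theta> \<le> b / 2" "\<theta> * (2 * M) \<le> L"
  proof -
    have "0 < 2 * M" using M by simp
    moreover have "\<theta> \<le> L / (2 * M)" by (simp add: \<theta>_def)
    ultimately show "\<theta> * (2 * M) \<le> L" using pos_le_divide_eq by blast
    show "\<theta> > 0" using pos \<open>0 < 2 * M\<close> by (simp add: \<theta>_def)
    show "\<theta> \<le> 1" "\<theta> \<le> b / 2" unfolding \<theta>_def by linarith+
  qed
  obtain e1 where e1: "e1 > 0" "\<And>s t. \<bar>s - snd p\<bar> < e1 \<Longrightarrow> \<bar>t - snd p\<bar> < e1 \<Longrightarrow>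
    norm (pt D (fst p, s) - pt D (fst p, t) - (s - t) *\<^sub>R ?u) \<le> \<theta> * \<bar>s - t\<bar>"
    using strict_deriv[OF p(1) \<theta>(1)] by blast
  obtain e2 where e2: "e2 > 0" "\<And>s t. \<bar>s - snd q\<bar> < e2 \<Longrightarrow> \<bar>t - snd q\<bar> < e2 \<Longrightarrow>
    norm (pt D (fst q, s) - pt D (fst q, t) - (s - t) *\<^sub>R ?w) \<le> \<theta> * \<bar>s - t\<bar>"
    using strict_deriv[OF p(2) \<theta>(1)] by blast
  obtain \<delta> where \<delta>: "\<delta> > 0" "\<forall>z\<in>drawing D. dist z ?v < \<delta> \<longrightarrow>
     (\<exists>r0\<in>{p, q}. \<exists>s. z = pt D (fst r0, s) \<and> \<bar>s - snd r0\<bar> < min e1 e2)"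
    using near_fiber[of ?v "{p, q}" "min e1 e2"] double_point_fiber[OF dp] e1(1) e2(1) by auto
  define e where "e = min e1 (\<delta> / M)"
  have e: "e > 0" "e \<le> e1" "e * M \<le> \<delta>"
  proof -
    have "e \<le> \<delta> / M" by (simp add: e_def)
    then show "e * M \<le> \<delta>" using M pos_le_divide_eq by blast
    show "e > 0" "e \<le> e1" using e1(1) \<delta>(1) M by (simp_all add: e_def)
  qed
  show ?thesis
  proof (intro exI[of _ e] conjI allI impI notI)
    fix t y :: real
    assume t: "0 < \<bar>t\<bar>" "\<bar>t\<bar> < e" and y: "0 < \<bar>y\<bar>" "\<bar>y\<bar> \<le> \<bar>t\<bar>"
      and dr: "pt D (fst p, snd p + t) + y *\<^sub>R ?w \<in> drawing D"
    define z where "z = pt D (fst p, snd p + t) - ?v"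
    have z: "norm (z - t *\<^sub>R ?u) \<le> \<theta> * \<bar>t\<bar>"
      using e1(2)[of "snd p + t" "snd p"] t e(2) e1(1) by (simp add: z_def)
    have "norm (z + y *\<^sub>R ?w) \<le> norm (z - t *\<^sub>R ?u) + norm (t *\<^sub>R ?u) + norm (y *\<^sub>R ?w)"
      by (smt (verit) diff_add_cancel norm_triangle_ineq)
    also have "\<dots> \<le> \<theta> * \<bar>t\<bar> + a * \<bar>t\<bar> + b * \<bar>t\<bar>"
      using z y(2) pos by (intro add_mono) (auto simp: a_def b_def mult.commute mult_right_mono)
    also have "\<dots> \<le> 1 * \<bar>t\<bar> + a * \<bar>t\<bar> + b * \<bar>t\<bar>"
      using \<theta>(2) by (intro add_mono mult_right_mono) auto
    also have "\<dots> \<le> M * \<bar>t\<bar>"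
      using pos by (simp add: M_def algebra_simps)
    also have "\<dots> < M * e" using t(2) M by (rule mult_strict_left_mono)
    finally have "dist (pt D (fst p, snd p + t) + y *\<^sub>R ?w) ?v < \<delta>"
      using e(3) by (simp add: z_def dist_norm mult.commute algebra_simps)
    then obtain r0 s where r0: "r0 \<in> {p, q}" "pt D (fst p, snd p + t) + y *\<^sub>R ?w = pt D (fst r0, s)"
        "\<bar>s - snd r0\<bar> < min e1 e2"
      using \<delta>(2) dr by blast
    from r0(1) consider "r0 = p" | "r0 = q" by blast
    then show False
    proof cases
      case 1
      define s' where "s' = s - (snd p + t)"
      have *: "norm (y *\<^sub>R ?w - s' *\<^sub>R ?u) \<le> \<theta> * \<bar>s'\<bar>"
        using e1(2)[of s "snd p + t"] r0(3) t e(2) r0(2)[symmetric] 1 by (simp add: s'_def)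
      have "\<bar>s'\<bar> * L = \<bar>cdet ?w (y *\<^sub>R ?w - s' *\<^sub>R ?u)\<bar>"
        using cdet_anti[of ?w ?u] by (simp add: L_def abs_mult)
      also have "\<dots> \<le> b * (\<theta> * \<bar>s'\<bar>)"
        using abs_cdet_le[of ?w "y *\<^sub>R ?w - s' *\<^sub>R ?u"] * pos(3)
        by (auto simp: b_def intro: order.trans mult_left_mono)
      also have "\<dots> = (\<theta> * b) * \<bar>s'\<bar>" by simp
      also have "\<dots> \<le> (\<theta> * M) * \<bar>s'\<bar>"
        using \<theta>(1) pos by (intro mult_right_mono mult_left_mono) (auto simp: M_def)
      also have "\<dots> \<le> (L / 2) * \<bar>s'\<bar>" using \<theta>(4) by (intro mult_right_mono) auto
      finally have "\<bar>s'\<bar> * (L / 2) \<le> 0" by (simp add: algebra_simps)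
      then have "s' = 0" using pos(1) by (simp add: mult_le_0_iff)
      then have "\<bar>y\<bar> * b \<le> 0" using * by (simp add: b_def)
      then show False using y(1) pos(3) by (simp add: mult_le_0_iff)
    next
      case 2
      define s' where "s' = s - snd q"
      have "norm (z + y *\<^sub>R ?w - s' *\<^sub>R ?w) \<le> \<theta> * \<bar>s'\<bar>"
        using e2(2)[of s "snd q"] r0(3) r0(2)[symmetric] 2 p(3) e2(1)
        by (simp add: s'_def z_def algebra_simps)
      then have "norm ((z + y *\<^sub>R ?w - s' *\<^sub>R ?w) - (z - t *\<^sub>R ?u)) \<le> \<theta> * (\<bar>s'\<bar> + \<bar>t\<bar>)"
        using z norm_triangle_ineq4[of "z + y *\<^sub>R ?w - s' *\<^sub>R ?w" "z - t *\<^sub>R ?u"]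
        unfolding distrib_left by linarith
      also have "(z + y *\<^sub>R ?w - s' *\<^sub>R ?w) - (z - t *\<^sub>R ?u) = t *\<^sub>R ?u + (y - s') *\<^sub>R ?w"
        by (simp add: algebra_simps)
      finally have *: "norm (t *\<^sub>R ?u + (y - s') *\<^sub>R ?w) \<le> \<theta> * (\<bar>s'\<bar> + \<bar>t\<bar>)" .
      have "\<bar>s'\<bar> * b \<le> norm (t *\<^sub>R ?u + (y - s') *\<^sub>R ?w) + norm (t *\<^sub>R ?u) + norm (y *\<^sub>R ?w)"
      proof -
        have "s' *\<^sub>R ?w = t *\<^sub>R ?u + y *\<^sub>R ?w - (t *\<^sub>R ?u + (y - s') *\<^sub>R ?w)"
          by (simp add: algebra_simps)
        then have "\<bar>s'\<bar> * b = norm (t *\<^sub>R ?u + y *\<^sub>R ?w - (t *\<^sub>R ?u + (y - s') *\<^sub>R ?w))"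
          by (metis b_def norm_scaleR)
        then show ?thesis
          using norm_triangle_ineq4[of "t *\<^sub>R ?u + y *\<^sub>R ?w" "t *\<^sub>R ?u + (y - s') *\<^sub>R ?w"]
            norm_triangle_ineq[of "t *\<^sub>R ?u" "y *\<^sub>R ?w"] by linarith
      qed
      also have "\<dots> \<le> \<theta> * (\<bar>s'\<bar> + \<bar>t\<bar>) + a * \<bar>t\<bar> + b * \<bar>t\<bar>"
        using * y(2) pos by (intro add_mono) (auto simp: a_def b_def mult.commute mult_right_mono)
      also have "\<dots> \<le> b / 2 * \<bar>s'\<bar> + (1 + a + b) * \<bar>t\<bar>"
        using \<theta>(2,3) mult_right_mono[of \<theta> "b / 2" "\<bar>s'\<bar>"] mult_right_mono[of \<theta> 1 "\<bar>t\<bar>"]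
        by (simp add: algebra_simps)
      finally have s': "\<bar>s'\<bar> * b \<le> 2 * (1 + a + b) * \<bar>t\<bar>" by (simp add: algebra_simps)
      have "\<bar>t\<bar> * L = \<bar>cdet ?w (t *\<^sub>R ?u + (y - s') *\<^sub>R ?w)\<bar>"
        using cdet_anti[of ?w ?u] by (simp add: L_def abs_mult)
      also have "\<dots> \<le> b * (\<theta> * (\<bar>s'\<bar> + \<bar>t\<bar>))"
        using abs_cdet_le[of ?w "t *\<^sub>R ?u + (y - s') *\<^sub>R ?w"] * pos(3)
        by (auto simp: b_def intro: order.trans mult_left_mono)
      also have "\<dots> = \<theta> * (\<bar>s'\<bar> * b + b * \<bar>t\<bar>)" by (simp add: algebra_simps)
      also have "\<dots> \<le> \<theta> * (2 * (1 + a + b) * \<bar>t\<bar> + b * \<bar>t\<bar>)"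
        using s' \<theta>(1) by (intro mult_left_mono) auto
      also have "\<dots> \<le> \<theta> * (M * \<bar>t\<bar>)"
        using \<theta>(1) pos by (intro mult_left_mono) (auto simp: M_def algebra_simps)
      also have "\<dots> \<le> L / 2 * \<bar>t\<bar>"
        using \<theta>(4) mult_right_mono[of "\<theta> * M" "L / 2" "\<bar>t\<bar>"] by simp
      finally have "\<bar>t\<bar> * (L / 2) \<le> 0" by (simp add: algebra_simps)
      then show False using pos(1) t(1) by (simp add: mult_le_0_iff)
    qed
  qed (rule e(1))
qed

text \<open>The checkerboard condition says nothing at crossings. It is applied at a nearby point of
  the branch of \<open>p\<close>, and the two sides of that point are joined to the two sectors by
  segments along plus and minus the velocity of \<open>q\<close>.\<close>

lemma dsh_across:
  assumes dp: "double_point D p q" and sg: "sg = 1 \<or> sg = (- 1 :: real)"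
  shows "dsh D (pt D p) (sg *\<^sub>R vel D p + vel D q) \<longleftrightarrow> \<not> dsh D (pt D p) (sg *\<^sub>R vel D p - vel D q)"
proof -
  let ?u = "vel D p" and ?w = "vel D q" and ?v = "pt D p"
  let ?r = "\<lambda>\<tau>. (fst p, snd p + sg * \<tau>)"
  have p: "p \<in> params D" "q \<in> params D" "pt D q = ?v"
    using dp by (auto simp: double_point_def)
  have i: "fst p < ncomp D" using p(1) by (simp add: params_iff)
  have rp: "?r \<tau> \<in> params D" for \<tau> using i by (simp add: params_iff)
  obtain e where e: "e > 0" "\<And>t y. 0 < \<bar>t\<bar> \<Longrightarrow> \<bar>t\<bar> < e \<Longrightarrow> 0 < \<bar>y\<bar> \<Longrightarrow> \<bar>y\<bar> \<le> \<bar>t\<bar> \<Longrightarrow>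
    pt D (fst p, snd p + t) + y *\<^sub>R ?w \<notin> drawing D"
    using free_transverse_segment[OF dp] by blast
  have lim0: "filterlim (\<lambda>\<tau>. snd p + sg * \<tau>) (at (snd p)) (at_right 0)"
    using sg by (auto simp: filterlim_at eventually_at_filter intro!: tendsto_eq_intros)
  have ev_nc: "\<forall>\<^sub>F \<tau> in at_right 0. \<not> crossing_param D (?r \<tau>)"
    using eventually_compose_filterlim[OF eventually_noncrossing[OF p(1)] lim0] .
  have "((\<lambda>\<tau>. cdet (vel D (?r \<tau>)) ?w) \<longlongrightarrow> cdet ?u ?w) (at_right 0)"
  proof -
    have "isCont (\<lambda>s. vel D (fst p, s)) (snd p)"
      using continuous_vel[OF i] by (simp add: continuous_on_eq_continuous_at)
    then have "((\<lambda>s. vel D (fst p, s)) \<longlongrightarrow> ?u) (at (snd p))" by (simp add: isCont_def)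
    from filterlim_compose[OF this lim0] show ?thesis
      unfolding cdet_def by (intro tendsto_intros)
  qed
  then have "((\<lambda>\<tau>. cdet (vel D (?r \<tau>)) ?w * cdet ?u ?w) \<longlongrightarrow> cdet ?u ?w * cdet ?u ?w) (at_right 0)"
    by (intro tendsto_intros)
  moreover have "cdet ?u ?w * cdet ?u ?w > 0"
    using double_point_transversal[OF dp] by (simp add: zero_less_mult_iff linorder_neq_iff) linarith
  ultimately have ev_tr: "\<forall>\<^sub>F \<tau> in at_right 0. cdet (vel D (?r \<tau>)) ?w * cdet ?u ?w > 0"
    by (rule order_tendstoD(1))
  have pt_lim: "((\<lambda>\<tau>. (pt D (?r \<tau>) - ?v) /\<^sub>R \<tau>) \<longlongrightarrow> sg *\<^sub>R ?u) (at_right 0)"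
  proof -
    show ?thesis
    proof (rule tendstoI)
      fix \<eta> :: real assume "\<eta> > 0"
      then obtain e' where e': "e' > 0" "\<And>s t. \<bar>s - snd p\<bar> < e' \<Longrightarrow> \<bar>t - snd p\<bar> < e' \<Longrightarrow>
        norm (pt D (fst p, s) - pt D (fst p, t) - (s - t) *\<^sub>R ?u) \<le> \<eta> / 2 * \<bar>s - t\<bar>"
        using strict_deriv[OF p(1), of "\<eta> / 2"] by auto
      have "dist ((pt D (?r \<tau>) - ?v) /\<^sub>R \<tau>) (sg *\<^sub>R ?u) < \<eta>" if "0 < \<tau>" "\<tau> < e'" for \<tau>
      proof -
        have "norm (pt D (?r \<tau>) - ?v - (sg * \<tau>) *\<^sub>R ?u) \<le> \<eta> / 2 * \<tau>"
          using e'(2)[of "snd p + sg * \<tau>" "snd p"] that e'(1) sg by (auto simp: abs_mult)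
        moreover have "(pt D (?r \<tau>) - ?v) /\<^sub>R \<tau> - sg *\<^sub>R ?u = (pt D (?r \<tau>) - ?v - (sg * \<tau>) *\<^sub>R ?u) /\<^sub>R \<tau>"
          using that by (simp add: scaleR_right_diff_distrib)
        ultimately have "norm ((pt D (?r \<tau>) - ?v) /\<^sub>R \<tau> - sg *\<^sub>R ?u) \<le> \<eta> / 2"
          using that by (simp add: divide_simps mult.commute)
        then show ?thesis using \<open>\<eta> > 0\<close> by (simp add: dist_norm)
      qed
      then show "\<forall>\<^sub>F \<tau> in at_right 0. dist ((pt D (?r \<tau>) - ?v) /\<^sub>R \<tau>) (sg *\<^sub>R ?u) < \<eta>"
        unfolding eventually_at_right_field using e'(1) by auto
    qed
  qed
  \<comment> \<open>The far ends of these segments move with \<open>\<tau>\<close> along curves with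
    tangents \<open>sg *\<^sub>R ?u + c *\<^sub>R ?w\<close>, so they lie in the sectors in
    question.\<close>
  have ev_sh: "\<forall>\<^sub>F \<tau> in at_right 0. pt D (?r \<tau>) + (c * \<tau>) *\<^sub>R ?w \<in> shaded D \<longleftrightarrow> dsh D ?v (sg *\<^sub>R ?u + c *\<^sub>R ?w)"
    if c: "c = 1 \<or> c = - 1" for c :: real
  proof (rule dsh_curve)
    show "transversal ?v (sg *\<^sub>R ?u + c *\<^sub>R ?w)"
      using c sg double_point_transversal[OF dp] cdet_anti[of ?w ?u]
      unfolding transversal_crossing[OF dp] by auto
    have "((\<lambda>\<tau>. (pt D (?r \<tau>) - ?v) /\<^sub>R \<tau> + c *\<^sub>R ?w) \<longlongrightarrow> sg *\<^sub>R ?u + c *\<^sub>R ?w) (at_right 0)"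
      by (intro tendsto_add tendsto_const pt_lim)
    moreover have "\<forall>\<^sub>F \<tau> in at_right (0::real). (pt D (?r \<tau>) - ?v) /\<^sub>R \<tau> + c *\<^sub>R ?w =
        (pt D (?r \<tau>) + (c * \<tau>) *\<^sub>R ?w - ?v) /\<^sub>R \<tau>"
      unfolding eventually_at_right_field by (intro exI[of _ 1]) (auto simp: algebra_simps)
    ultimately show "((\<lambda>\<tau>. (pt D (?r \<tau>) + (c * \<tau>) *\<^sub>R ?w - ?v) /\<^sub>R \<tau>) \<longlongrightarrow> sg *\<^sub>R ?u + c *\<^sub>R ?w) (at_right 0)"
      by (rule Lim_transform_eventually)
  qed
  have "\<forall>\<^sub>F \<tau> in at_right (0::real). 0 < \<tau> \<and> \<tau> < e"
    using e(1) by (auto simp: eventually_at_right_field)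
  then have "\<forall>\<^sub>F \<tau> in at_right (0::real). dsh D ?v (sg *\<^sub>R ?u + 1 *\<^sub>R ?w) \<longleftrightarrow> \<not> dsh D ?v (sg *\<^sub>R ?u + (- 1) *\<^sub>R ?w)"
    using ev_nc ev_tr ev_sh[of 1, OF disjI1[OF refl]] ev_sh[of "- 1", OF disjI2[OF refl]]
  proof eventually_elim
    case (elim \<tau>)
    let ?z = "pt D (?r \<tau>)"
    have tr: "transversal ?z (c *\<^sub>R ?w)" if "c \<noteq> 0" for c
      unfolding transversal_noncrossing[OF rp elim(2)] using elim(3) that by auto
    \<comment> \<open>The half-open segment avoids the drawing, so its far end has the shade seen
      immediately beside the curve.\<close>
    have side: "?z + (c * \<tau>) *\<^sub>R ?w \<in> shaded D \<longleftrightarrow> dsh D ?z (c *\<^sub>R ?w)" if c: "c = 1 \<or> c = - 1" for c :: real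
    proof -
      have "\<forall>\<^sub>F \<epsilon> in at_right 0. ?z + of_real \<epsilon> * (c *\<^sub>R ?w) \<in> shaded D \<longleftrightarrow> dsh D ?z (c *\<^sub>R ?w)"
        using c by (intro dsh_eventually tr) auto
      moreover have "\<forall>\<^sub>F \<epsilon> in at_right (0::real). 0 < \<epsilon> \<and> \<epsilon> < \<tau>"
        using elim(1) by (auto simp: eventually_at_right_field)
      ultimately have "\<forall>\<^sub>F \<epsilon> in at_right (0::real). ?z + (c * \<tau>) *\<^sub>R ?w \<in> shaded D \<longleftrightarrow> dsh D ?z (c *\<^sub>R ?w)"
      proof eventually_elim
        case (elim \<epsilon>)
        let ?S = "(\<lambda>y. ?z + y *\<^sub>R (c *\<^sub>R ?w)) ` {0<..\<tau>}"
        have "connected ?S"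
          by (intro connected_continuous_image continuous_intros) simp
        moreover have "?S \<inter> drawing D = {}"
        proof -
          have "?z + y *\<^sub>R (c *\<^sub>R ?w) \<notin> drawing D" if "0 < y" "y \<le> \<tau>" for y
            using e(2)[of "sg * \<tau>" "y * c"] that c sg \<open>0 < \<tau> \<and> \<tau> < e\<close> by (auto simp: abs_mult)
          then show ?thesis by auto
        qed
        moreover have "?z + of_real \<epsilon> * (c *\<^sub>R ?w) \<in> ?S"
          using elim by (auto simp: image_iff scaleR_conv_of_real intro!: bexI[of _ \<epsilon>])
        moreover have "?z + (c * \<tau>) *\<^sub>R ?w \<in> ?S"
          using \<open>0 < \<tau> \<and> \<tau> < e\<close> by (auto simp: image_iff mult.commute intro!: bexI[of _ \<tau>])
        ultimately show ?case using shaded_connected elim by blast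
      qed
      then show ?thesis by (simp add: eventually_const_iff)
    qed
    have "dsh D ?z ?w \<longleftrightarrow> \<not> dsh D ?z (- ?w)"
    proof (cases "cdet (vel D (?r \<tau>)) ?w > 0")
      case True
      then show ?thesis using side_shade[OF rp elim(2), of ?w "- ?w"] by simp
    next
      case False
      then have "cdet (vel D (?r \<tau>)) ?w < 0" using elim(3) by (auto simp: zero_less_mult_iff)
      then show ?thesis using side_shade[OF rp elim(2), of "- ?w" ?w] by auto
    qed
    then show ?case using side[of 1] side[of "- 1"] elim(4,5) by auto
  qed
  then show ?thesis by (simp add: eventually_const_iff)
qed

text \<open>Crossing either branch changes the shade, so the shade depends only on the product of
  the two signs.\<close>

lemma dsh_sector:
  assumes dp: "double_point D p q" and xy: "x \<noteq> 0" "y \<noteq> 0"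
  shows "dsh D (pt D p) (x *\<^sub>R vel D p + y *\<^sub>R vel D q) \<longleftrightarrow>
    (dsh D (pt D p) (vel D p + vel D q) \<longleftrightarrow> x * y > 0)"
proof -
  let ?d = "\<lambda>x y. dsh D (pt D p) (x *\<^sub>R vel D p + y *\<^sub>R vel D q)"
  have v: "pt D q = pt D p" using dp by (simp add: double_point_def)
  have a: "?d 1 1 \<longleftrightarrow> \<not> ?d 1 (- 1)" "?d (- 1) 1 \<longleftrightarrow> \<not> ?d (- 1) (- 1)"
    using dsh_across[OF dp, of 1] dsh_across[OF dp, of "- 1"] by simp_all
  have b: "?d 1 1 \<longleftrightarrow> \<not> ?d (- 1) 1"
    using dsh_across[OF double_point_sym[OF dp], of 1] v by (simp add: add.commute)
  consider "x > 0" "y > 0" | "x > 0" "y < 0" | "x < 0" "y > 0" | "x < 0" "y < 0"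
    using xy by linarith
  then show ?thesis
  proof cases
    case 1
    then have "x * y > 0" by simp
    with 1 show ?thesis using dsh_same_sector[OF dp, of x 1 y 1] by simp
  next
    case 2
    then have "\<not> x * y > 0" by (simp add: zero_less_mult_iff)
    with 2 show ?thesis using dsh_same_sector[OF dp, of x 1 y "- 1"] a by simp
  next
    case 3
    then have "\<not> x * y > 0" by (simp add: zero_less_mult_iff)
    with 3 show ?thesis using dsh_same_sector[OF dp, of x "- 1" y 1] b by simp
  next
    case 4
    then have "x * y > 0" by (simp add: zero_less_mult_iff)
    with 4 show ?thesis using dsh_same_sector[OF dp, of x "- 1" y "- 1"] a b by simp
  qed
qed

end

subsection \<open>The symbol of a crossing\<close>

text \<open>\<open>crossing_symb\<close> with the labelling as a parameter, so that arcs of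
  parameters can take the place of edges in the plane.\<close>

definition gsymb :: "shaded_diagram \<Rightarrow> (bool \<Rightarrow> nat \<times> real \<Rightarrow> 'l) \<Rightarrow> complex \<Rightarrow> 'l symb" where
  "gsymb D lab v =
     (let p = underpass D v; q = overpass D v; u = vel D p;
          pos = (Im (cnj (- u) * vel D q) > 0);
          w = (if pos then vel D q else - vel D q)
      in if \<forall>\<^sub>F \<epsilon> in at_right 0. v + of_real \<epsilon> * (w + u) \<in> shaded D
         then X1 (lab False p) (lab pos q) (lab True p) (lab (\<not> pos) q)
         else X2 (lab False p) (lab pos q) (lab True p) (lab (\<not> pos) q))"

lemma crossing_symb_eq_gsymb:
  "crossing_symb D v = gsymb D (\<lambda>fwd. if fwd then edge_out D else edge_in D) v"
  unfolding crossing_symb_def gsymb_def Let_def by auto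

lemma map_symb_gsymb: "map_symb f (gsymb D lab v) = gsymb D (\<lambda>s p. f (lab s p)) v"
  by (simp add: gsymb_def Let_def)

definition dir :: "shaded_diagram \<Rightarrow> bool \<Rightarrow> nat \<times> real \<Rightarrow> complex" where
  "dir D fwd p = (if fwd then vel D p else - vel D p)"

context checkered
begin

text \<open>The two branches at a crossing are told apart by \<open>over D\<close>, so the chosen
  representatives are determined up to integer shifts.\<close>

lemma underpass_overpass:
  assumes dp: "double_point D p q" and o: "p \<notin> over D"
  shows "same_param p (underpass D (pt D p))" "same_param q (overpass D (pt D p))"
proof -
  have p: "p \<in> params D" "q \<in> params D" "pt D q = pt D p"
    using dp by (auto simp: double_point_def)
  have q: "q \<in> over D" using over_iff[OF dp] o by simp
  have "underpass D (pt D p) \<in> params D \<and> pt D (underpass D (pt D p)) = pt D p \<and> underpass D (pt D p) \<notin> over D"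
    unfolding underpass_def by (rule someI[of _ p]) (use p o in auto)
  then show "same_param p (underpass D (pt D p))"
    using double_point_fiber[OF dp] over_same q by blast
  have "overpass D (pt D p) \<in> params D \<and> pt D (overpass D (pt D p)) = pt D p \<and> overpass D (pt D p) \<in> over D"
    unfolding overpass_def by (rule someI[of _ q]) (use p q in auto)
  then show "same_param q (overpass D (pt D p))"
    using double_point_fiber[OF dp] over_same o by blast
qed

text \<open>Removes the dependence on how the curves are parametrised: \<open>\<sigma>\<close> and
  \<open>\<sigma>'\<close> may select any directions of the two branches that form a positive pair,
  and \<open>d\<close> is any vector in the sector between them.\<close>

lemma gsymb_cr:
  assumes dp: "double_point D p q"
    and lab: "\<And>\<sigma> r r'. crossing_param D r \<Longrightarrow> same_param r r' \<Longrightarrow> lab \<sigma> r' = lab \<sigma> r"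
    and pos: "cdet (dir D \<sigma> p) (dir D \<sigma>' q) > 0"
    and xy: "x > 0" "y > 0" "d = x *\<^sub>R dir D \<sigma> p + y *\<^sub>R dir D \<sigma>' q"
  shows "req (gsymb D lab (pt D p))
    (cr (lab \<sigma> p) (lab \<sigma>' q) (lab (\<not> \<sigma>) p) (lab (\<not> \<sigma>') q) (p \<in> over D) (dsh D (pt D p) d))"
proof -
  let ?u = "vel D p" and ?w = "vel D q" and ?v = "pt D p"
  have p: "p \<in> params D" "q \<in> params D" "pt D q = ?v"
    using dp by (auto simp: double_point_def)
  have cp: "crossing_param D p" "crossing_param D q"
    using dp double_point_sym[OF dp] unfolding crossing_param_def by blast+
  \<comment> \<open>The four sectors alternate, so this single truth value determines all their
    shades.\<close>
  define S where "S \<longleftrightarrow> dsh D ?v (?u + ?w)"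
  have sector: "dsh D ?v (x *\<^sub>R ?u + y *\<^sub>R ?w) \<longleftrightarrow> (S \<longleftrightarrow> x * y > 0)" if "x \<noteq> 0" "y \<noteq> 0" for x y
    using dsh_sector[OF dp that] by (simp add: S_def)
  have s1: "dsh D ?v (?u + ?w) = S" "dsh D ?v (?w + ?u) = S" "dsh D ?v (?u - ?w) = (\<not> S)"
    "dsh D ?v (- ?w + ?u) = (\<not> S)" "dsh D ?v (?w - ?u) = (\<not> S)" "dsh D ?v (- ?u + ?w) = (\<not> S)"
    using sector[of 1 1] sector[of 1 "- 1"] sector[of "- 1" 1] by (simp_all add: add.commute)
  have sh: "dsh D ?v d = (S = (\<sigma> = \<sigma>'))"
    using sector[of "if \<sigma> then x else - x" "if \<sigma>' then y else - y"] xy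
    by (auto simp: dir_def mult_less_0_iff zero_less_mult_iff)
  have sg: "(cdet ?u ?w > 0) = (\<sigma> = \<sigma>')"
    using pos by (cases \<sigma>; cases \<sigma>') (simp_all add: dir_def)
  have anti: "cdet ?w ?u = - cdet ?u ?w" by (rule cdet_anti)
  have nz: "cdet ?u ?w \<noteq> 0" by (rule double_point_transversal[OF dp])
  show ?thesis
  proof (cases "p \<in> over D")
    case True
    then have q: "q \<notin> over D" using over_iff[OF dp] by simp
    have uo: "same_param q (underpass D ?v)" "same_param p (overpass D ?v)"
      using underpass_overpass[OF double_point_sym[OF dp] q] p(3) by simp_all
    have l: "lab \<sigma> (underpass D ?v) = lab \<sigma> q" "lab \<sigma> (overpass D ?v) = lab \<sigma> p" for \<sigma>
      using lab uo cp by blast+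
    have v: "vel D (underpass D ?v) = ?w" "vel D (overpass D ?v) = ?u"
      using vel_same uo p by blast+
    show ?thesis
      unfolding gsymb_def Let_def l v dsh_def[symmetric] cdet_def[symmetric] sh
      using True sg anti nz by (cases \<sigma>; cases \<sigma>') (auto simp: s1 cr_def req_def)
  next
    case False
    have uo: "same_param p (underpass D ?v)" "same_param q (overpass D ?v)"
      using underpass_overpass[OF dp False] by simp_all
    have l: "lab \<sigma> (underpass D ?v) = lab \<sigma> p" "lab \<sigma> (overpass D ?v) = lab \<sigma> q" for \<sigma>
      using lab uo cp by blast+
    have v: "vel D (underpass D ?v) = ?u" "vel D (overpass D ?v) = ?w"
      using vel_same uo p by blast+
    show ?thesis
      unfolding gsymb_def Let_def l v dsh_def[symmetric] cdet_def[symmetric] sh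
      using False sg nz by (cases \<sigma>; cases \<sigma>') (auto simp: s1 cr_def req_def)
  qed
qed

end

section \<open>Cutting the components into arcs\<close>

text \<open>Arcs are sets of parameters, closed under integer shifts, so that they survive changes
  of the curves and can be compared between two diagrams.\<close>

definition arc :: "(nat \<times> real) set \<Rightarrow> bool \<Rightarrow> nat \<times> real \<Rightarrow> (nat \<times> real) set" where
  "arc C fwd p = {r. \<exists>t. same_param (fst p, t) r \<and>
     (if fwd then snd p < t \<and> (\<forall>u. snd p < u \<and> u \<le> t \<longrightarrow> (fst p, u) \<notin> C)
      else t < snd p \<and> (\<forall>u. t \<le> u \<and> u < snd p \<longrightarrow> (fst p, u) \<notin> C))}"

definition open_arc :: "nat \<Rightarrow> real \<Rightarrow> real \<Rightarrow> (nat \<times> real) set" where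
  "open_arc i s c = {r. \<exists>t. s < t \<and> t < c \<and> same_param (i, t) r}"

locale cut_set =
  fixes C :: "(nat \<times> real) set"
  assumes cut_same: "same_param p q \<Longrightarrow> p \<in> C \<Longrightarrow> q \<in> C"
    and finite_cuts: "finite {s. (i, s) \<in> C \<and> a \<le> s \<and> s \<le> b}"
begin

definition consecutive :: "nat \<Rightarrow> real \<Rightarrow> real \<Rightarrow> bool" where
  "consecutive i s c \<longleftrightarrow> (i, s) \<in> C \<and> (i, c) \<in> C \<and> s < c \<and> (\<forall>u. s < u \<and> u < c \<longrightarrow> (i, u) \<notin> C)"

lemma cut_shift: "(i, s + of_int n) \<in> C \<longleftrightarrow> (i, s) \<in> C"
  using cut_same same_param_shift by blast

lemma consecutive_le: "consecutive i s c \<Longrightarrow> c \<le> s + 1"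
proof (rule ccontr)
  assume c: "consecutive i s c" "\<not> c \<le> s + 1"
  then have "s < s + 1" "s + 1 < c" by simp_all
  then show False using c(1) cut_shift[of i s 1] unfolding consecutive_def by auto
qed

lemma consecutive_shift: "consecutive i s c \<Longrightarrow> consecutive i (s + of_int n) (c + of_int n)"
proof -
  assume c: "consecutive i s c"
  have "(i, u) \<notin> C" if "s + of_int n < u" "u < c + of_int n" for u
    using c that cut_shift[of i "u - of_int n" n] by (auto simp: consecutive_def)
  with c show ?thesis by (auto simp: consecutive_def cut_shift)
qed

lemma next_cut:
  assumes "(i, s) \<in> C"
  obtains c where "consecutive i s c"
proof -
  let ?S = "{c. (i, c) \<in> C \<and> s < c \<and> c \<le> s + 1}"
  have fin: "finite ?S" by (rule finite_subset[OF _ finite_cuts[of i s "s + 1"]]) auto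
  have "s + 1 \<in> ?S" using assms cut_shift[of i s 1] by simp
  then have ne: "?S \<noteq> {}" by blast
  have m: "Min ?S \<in> ?S" using Min_in[OF fin ne] .
  have "(i, u) \<notin> C" if u: "s < u" "u < Min ?S" for u
  proof
    assume "(i, u) \<in> C"
    then have "u \<in> ?S" using u m by auto
    then show False using Min_le[OF fin, of u] u(2) by simp
  qed
  with m assms have "consecutive i s (Min ?S)" unfolding consecutive_def by blast
  then show thesis by (rule that)
qed

lemma prev_cut:
  assumes "(i, c) \<in> C"
  obtains s where "consecutive i s c"
proof -
  let ?S = "{s. (i, s) \<in> C \<and> c - 1 \<le> s \<and> s < c}"
  have fin: "finite ?S" by (rule finite_subset[OF _ finite_cuts[of i "c - 1" c]]) auto
  have "c - 1 \<in> ?S" using assms cut_shift[of i "c - 1" 1] by simp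
  then have ne: "?S \<noteq> {}" by blast
  have m: "Max ?S \<in> ?S" using Max_in[OF fin ne] .
  have "(i, u) \<notin> C" if u: "Max ?S < u" "u < c" for u
  proof
    assume "(i, u) \<in> C"
    then have "u \<in> ?S" using u m by auto
    then show False using Max_ge[OF fin, of u] u(1) by simp
  qed
  with m assms have "consecutive i (Max ?S) c" unfolding consecutive_def by blast
  then show thesis by (rule that)
qed

lemma arc_consecutive:
  assumes "consecutive i s c"
  shows "arc C True (i, s) = open_arc i s c" "arc C False (i, c) = open_arc i s c"
proof -
  have "(s < t \<and> (\<forall>u. s < u \<and> u \<le> t \<longrightarrow> (i, u) \<notin> C)) \<longleftrightarrow> (s < t \<and> t < c)" for t
    using assms unfolding consecutive_def by (meson linorder_not_le order.strict_trans1)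
  then show "arc C True (i, s) = open_arc i s c" by (auto simp: arc_def open_arc_def)
  have "(t < c \<and> (\<forall>u. t \<le> u \<and> u < c \<longrightarrow> (i, u) \<notin> C)) \<longleftrightarrow> (s < t \<and> t < c)" for t
    using assms unfolding consecutive_def by (meson linorder_not_le order.strict_trans2)
  then show "arc C False (i, c) = open_arc i s c" by (auto simp: arc_def open_arc_def)
qed

lemma open_arc_shift: "open_arc i (s + of_int n) (c + of_int n) = open_arc i s c"
proof -
  have *: "open_arc i s c \<subseteq> open_arc i (s + of_int n) (c + of_int n)" for s c n
  proof
    fix r assume "r \<in> open_arc i s c"
    then obtain t where t: "s < t" "t < c" "same_param (i, t) r" by (auto simp: open_arc_def)
    have "same_param (i, t + of_int n) r"
      using same_param_shift(2) t(3) by (rule same_param_trans)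
    with t show "r \<in> open_arc i (s + of_int n) (c + of_int n)"
      unfolding open_arc_def by (auto intro!: exI[of _ "t + of_int n"])
  qed
  have "open_arc i (s + of_int n) (c + of_int n) \<subseteq> open_arc i s c"
    using *[of "s + of_int n" "c + of_int n" "- n"] by simp
  with *[of s c n] show ?thesis by blast
qed

lemma arc_same:
  assumes "p \<in> C" "same_param p q"
  shows "arc C f q = arc C f p"
proof -
  obtain n where q: "q = (fst p, snd p + of_int n)" using assms(2) by (rule same_paramE)
  have p: "(fst p, snd p) \<in> C" using assms(1) by simp
  show ?thesis
  proof (cases f)
    case True
    obtain c where c: "consecutive (fst p) (snd p) c" using next_cut[OF p] .
    show ?thesis
      using arc_consecutive(1)[OF c] arc_consecutive(1)[OF consecutive_shift[OF c, of n]] True q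
      by (simp add: open_arc_shift)
  next
    case False
    obtain s where s: "consecutive (fst p) s (snd p)" using prev_cut[OF p] .
    show ?thesis
      using arc_consecutive(2)[OF s] arc_consecutive(2)[OF consecutive_shift[OF s, of n]] False q
      by (simp add: open_arc_shift)
  qed
qed

lemma arc_notin: "r \<in> arc C f p \<Longrightarrow> r \<notin> C"
proof
  assume r: "r \<in> arc C f p" "r \<in> C"
  then obtain t where t: "same_param (fst p, t) r" "(fst p, t) \<notin> C"
    by (auto simp: arc_def split: if_splits)
  show False using cut_same[OF same_param_sym[OF t(1)] r(2)] t(2) by simp
qed

text \<open>Two gaps between neighbouring cuts that share a parameter, here the midpoint of one of
  them, coincide up to an integer shift.\<close>

lemma open_arc_eqD:
  assumes c: "consecutive i s c" and c': "consecutive i' s' c'"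
    and eq: "open_arc i s c = open_arc i' s' c'"
  shows "same_param (i, s) (i', s')" "same_param (i, c) (i', c')"
proof -
  let ?t = "(s + c) / 2"
  have sc: "s < c" using c by (simp add: consecutive_def)
  then have t: "s < ?t" "?t < c" by simp_all
  then have "(i, ?t) \<in> open_arc i s c" unfolding open_arc_def using same_param_refl by blast
  then obtain t' where t': "s' < t'" "t' < c'" "same_param (i', t') (i, ?t)"
    unfolding eq by (auto simp: open_arc_def)
  obtain n where n: "(i, ?t) = (fst (i', t'), snd (i', t') + of_int n)"
    using t'(3) by (rule same_paramE)
  then have i: "i' = i" and tn: "?t = t' + of_int n" by auto
  have d: "consecutive i (s' + of_int n) (c' + of_int n)"
    using consecutive_shift[OF c'] i by simp
  have lt: "s' + of_int n < ?t" "?t < c' + of_int n" using t'(1,2) tn by simp_all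
  have "s = s' + of_int n" "c = c' + of_int n"
    using c d t lt unfolding consecutive_def
    by (metis (no_types, opaque_lifting) linorder_less_linear order.strict_trans)+
  then show "same_param (i, s) (i', s')" "same_param (i, c) (i', c')"
    using i by (simp_all add: same_param_def)
qed

lemma arc_eqD:
  assumes "p \<in> C" "q \<in> C" "arc C f p = arc C f q"
  shows "same_param p q"
proof (cases f)
  case True
  obtain c c' where "consecutive (fst p) (snd p) c" "consecutive (fst q) (snd q) c'"
    using next_cut assms(1,2) by (metis prod.collapse)
  then show ?thesis
    using open_arc_eqD(1) arc_consecutive(1) assms(3) True by (metis prod.collapse)
next
  case False
  obtain c c' where "consecutive (fst p) c (snd p)" "consecutive (fst q) c' (snd q)"
    using prev_cut assms(1,2) by (metis prod.collapse)
  then show ?thesis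
    using open_arc_eqD(2) arc_consecutive(2) assms(3) False by (metis prod.collapse)
qed

lemma arc_other_end:
  assumes "p \<in> C"
  obtains q where "q \<in> C" "arc C (\<not> f) q = arc C f p"
proof (cases f)
  case True
  obtain c where "consecutive (fst p) (snd p) c" using next_cut assms by (metis prod.collapse)
  then show ?thesis
    using that[of "(fst p, c)"] arc_consecutive[of "fst p" "snd p" c] True by (auto simp: consecutive_def)
next
  case False
  obtain s where "consecutive (fst p) s (snd p)" using prev_cut assms by (metis prod.collapse)
  then show ?thesis
    using that[of "(fst p, s)"] arc_consecutive[of "fst p" s "snd p"] False by (auto simp: consecutive_def)
qed

definition representatives :: "(nat \<times> real) list \<Rightarrow> bool" where
  "representatives ps \<longleftrightarrow> set ps \<subseteq> C \<and> (\<forall>p\<in>C. \<exists>q\<in>set ps. same_param q p) \<and>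
     distinct ps \<and> (\<forall>p\<in>set ps. \<forall>q\<in>set ps. same_param p q \<longrightarrow> p = q)"

text \<open>Up to integer shifts each arc leaves exactly one cut and arrives at exactly one; the two
  coincide when its component is cut only once.\<close>

lemma balanced_ends:
  assumes "representatives ps"
  shows "balanced (\<Sum>p\<leftarrow>ps. {#arc C True p, arc C False p#})"
proof -
  have c: "count (\<Sum>p\<leftarrow>ps. {#arc C True p, arc C False p#}) x =
      card {p\<in>set ps. arc C True p = x} + card {p\<in>set ps. arc C False p = x}" for x
    using assms unfolding representatives_def
  proof -
    have "distinct ps \<Longrightarrow> count (\<Sum>p\<leftarrow>ps. {#arc C True p, arc C False p#}) x =
      card {p\<in>set ps. arc C True p = x} + card {p\<in>set ps. arc C False p = x}"
    proof (induction ps)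
      case (Cons a ps)
      have "{p\<in>set (a # ps). P p} = (if P a then insert a {p\<in>set ps. P p} else {p\<in>set ps. P p})" for P
        by auto
      then show ?case using Cons by simp
    qed simp
    then show ?thesis using assms unfolding representatives_def by blast
  qed
  have one: "card {p\<in>set ps. arc C f p = x} = (if \<exists>p\<in>set ps. arc C f p = x then 1 else 0)" for f x
  proof (cases "\<exists>p\<in>set ps. arc C f p = x")
    case True
    then obtain p where p: "p \<in> set ps" "arc C f p = x" by blast
    have "q = p" if "q \<in> set ps" "arc C f q = x" for q
      using arc_eqD[of q p f] that p assms unfolding representatives_def by blast
    then have "{p\<in>set ps. arc C f p = x} = {p}" using p by blast
    then show ?thesis using True by simp
  next
    case False
    then have "{p\<in>set ps. arc C f p = x} = {}" by blast
    then show ?thesis using False by (simp only: card.empty if_False)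
  qed
  have other: "\<exists>q\<in>set ps. arc C (\<not> f) q = x" if "\<exists>p\<in>set ps. arc C f p = x" for f x
  proof -
    from that obtain p where p: "p \<in> set ps" "arc C f p = x" by blast
    then have "p \<in> C" using assms by (auto simp: representatives_def)
    then obtain q where q: "q \<in> C" "arc C (\<not> f) q = x" using arc_other_end p(2) by blast
    obtain q' where "q' \<in> set ps" "same_param q' q"
      using assms q(1) unfolding representatives_def by blast
    then show ?thesis using arc_same[OF q(1) same_param_sym] q(2) by metis
  qed
  show ?thesis
    unfolding balanced_def c one using other[of True] other[of False] by auto
qed

end

definition param_class :: "nat \<times> real \<Rightarrow> (nat \<times> real) set" where
  "param_class q = {p. same_param q p}"

lemma cut_set_insert:
  assumes "cut_set C"
  shows "cut_set (C \<union> param_class q)"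
proof -
  interpret cut_set C by fact
  show ?thesis
  proof
    fix i a b
    have "{s. (i, s) \<in> param_class q \<and> a \<le> s \<and> s \<le> b} \<subseteq>
        (\<lambda>n. snd q + of_int n) ` {\<lfloor>a - snd q\<rfloor>..\<lceil>b - snd q\<rceil>}"
    proof
      fix s assume s: "s \<in> {s. (i, s) \<in> param_class q \<and> a \<le> s \<and> s \<le> b}"
      then have "same_param q (i, s)" by (simp add: param_class_def)
      then obtain n where n: "(i, s) = (fst q, snd q + of_int n)" by (rule same_paramE)
      then have "a - snd q \<le> of_int n" "of_int n \<le> b - snd q" using s by auto
      then have "n \<in> {\<lfloor>a - snd q\<rfloor>..\<lceil>b - snd q\<rceil>}" by (simp add: floor_le_iff le_ceiling_iff)
      then show "s \<in> (\<lambda>n. snd q + of_int n) ` {\<lfloor>a - snd q\<rfloor>..\<lceil>b - snd q\<rceil>}" using n by blast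
    qed
    then have "finite {s. (i, s) \<in> param_class q \<and> a \<le> s \<and> s \<le> b}"
      by (rule finite_subset) simp
    then have "finite ({s. (i, s) \<in> C \<and> a \<le> s \<and> s \<le> b} \<union> {s. (i, s) \<in> param_class q \<and> a \<le> s \<and> s \<le> b})"
      using finite_cuts by simp
    then show "finite {s. (i, s) \<in> C \<union> param_class q \<and> a \<le> s \<and> s \<le> b}"
      by (rule rev_finite_subset) auto
  qed (auto simp: param_class_def intro: cut_same same_param_trans)
qed

section \<open>Inserting one more cut\<close>

locale added_cut = cut_set C for C :: "(nat \<times> real) set" +
  fixes q :: "nat \<times> real"
  assumes q_notin: "q \<notin> C"
begin

abbreviation "C' \<equiv> C \<union> param_class q"

sublocale new: cut_set C'
  by (rule cut_set_insert) unfold_locales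

lemma class_notin: "same_param q p \<Longrightarrow> p \<notin> C"
  using cut_same same_param_sym q_notin by blast

lemma q_mem: "q \<in> C'"
  by (simp add: param_class_def)

lemma consecutive_old:
  assumes c: "consecutive i s c" and none: "\<And>x. s < x \<Longrightarrow> x < c \<Longrightarrow> \<not> same_param q (i, x)"
  shows "new.consecutive i s c"
  using assms unfolding new.consecutive_def consecutive_def by (auto simp: param_class_def)

text \<open>A gap between neighbouring cuts is at most one period long, so the class of
  \<open>q\<close> meets its interior only once.\<close>

lemma consecutive_split:
  assumes c: "consecutive i s c" and x: "s < x" "x < c" "same_param q (i, x)"
  shows "new.consecutive i s x" "new.consecutive i x c"
proof -
  have u: "u = x" if "s < u" "u < c" "same_param q (i, u)" for u
  proof -
    have "same_param (i, u) (i, x)" using that(3) x(3) same_param_sym same_param_trans by blast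
    then obtain n where n: "x = u + of_int n" by (auto elim: same_paramE)
    moreover have "\<bar>x - u\<bar> < 1" using consecutive_le[OF c] that x by linarith
    ultimately have "\<bar>real_of_int n\<bar> < 1" by simp
    then have "n = 0" by linarith
    then show ?thesis using n by simp
  qed
  have "(i, u) \<notin> C'" if "s < u" "u < c" "u \<noteq> x" for u
    using c that u[of u] by (auto simp: consecutive_def param_class_def)
  then show "new.consecutive i s x" "new.consecutive i x c"
    using c x unfolding new.consecutive_def consecutive_def by (auto simp: param_class_def)
qed

text \<open>The old arc that contains \<open>q\<close>, provided that \<open>C\<close> has a cut on
  the component of \<open>q\<close>.\<close>

definition merged :: "(nat \<times> real) set" where
  "merged = arc C' False q \<union> param_class q \<union> arc C' True q"

definition merge :: "(nat \<times> real) set \<Rightarrow> (nat \<times> real) set" where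
  "merge A = (if A = arc C' False q \<or> A = arc C' True q then merged else A)"

lemma arc_merge_consecutive:
  assumes c: "consecutive i s c"
  shows "open_arc i s c = merge (arc C' True (i, s))" "open_arc i s c = merge (arc C' False (i, c))"
proof -
  have "open_arc i s c = merge (arc C' True (i, s)) \<and> open_arc i s c = merge (arc C' False (i, c))"
  proof (cases "\<exists>x. s < x \<and> x < c \<and> same_param q (i, x)")
    case True
    then obtain x where x: "s < x" "x < c" "same_param q (i, x)" by blast
    note sp = consecutive_split[OF c x]
    have a: "arc C' False q = open_arc i s x" "arc C' True q = open_arc i x c"
      using new.arc_same[OF q_mem x(3)] new.arc_consecutive(2)[OF sp(1)] new.arc_consecutive(1)[OF sp(2)]
      by simp_all
    have e: "arc C' True (i, s) = open_arc i s x" "arc C' False (i, c) = open_arc i x c"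
      using new.arc_consecutive(1)[OF sp(1)] new.arc_consecutive(2)[OF sp(2)] by simp_all
    have "open_arc i s c = merged"
    proof
      show "open_arc i s c \<subseteq> merged"
      proof
        fix r assume "r \<in> open_arc i s c"
        then obtain t where t: "s < t" "t < c" "same_param (i, t) r" by (auto simp: open_arc_def)
        consider "t < x" | "t = x" | "t > x" by linarith
        then show "r \<in> merged"
        proof cases
          case 2
          then have "same_param q r" using same_param_trans[OF x(3)] t(3) by blast
          then show ?thesis by (simp add: merged_def param_class_def)
        qed (use t in \<open>auto simp: merged_def a open_arc_def\<close>)
      qed
      show "merged \<subseteq> open_arc i s c"
      proof
        fix r assume "r \<in> merged"
        then consider "r \<in> open_arc i s x" | "same_param q r" | "r \<in> open_arc i x c"
          unfolding merged_def a by (auto simp: param_class_def)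
        then show "r \<in> open_arc i s c"
        proof cases
          case 2
          then have "same_param (i, x) r" using x(3) same_param_sym same_param_trans by blast
          then show ?thesis using x(1,2) by (auto simp: open_arc_def)
        qed (use x in \<open>auto simp: open_arc_def intro: order.strict_trans\<close>)
      qed
    qed
    then show ?thesis by (simp add: merge_def a e)
  next
    case False
    then have n: "new.consecutive i s c" using consecutive_old[OF c] by blast
    note e = new.arc_consecutive[OF n]
    have q': "(fst q, snd q) \<in> C'" using q_mem by simp
    have "open_arc i s c \<noteq> arc C' True q"
    proof
      assume "open_arc i s c = arc C' True q"
      then have "same_param (i, s) q"
        using e(1) n q_mem by (intro new.arc_eqD[of _ _ True]) (auto simp: new.consecutive_def)
      then show False using class_notin[OF same_param_sym] c by (auto simp: consecutive_def)
    qed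
    moreover have "open_arc i s c \<noteq> arc C' False q"
    proof
      assume "open_arc i s c = arc C' False q"
      then have "same_param (i, c) q"
        using e(2) n q_mem by (intro new.arc_eqD[of _ _ False]) (auto simp: new.consecutive_def)
      then show False using class_notin[OF same_param_sym] c by (auto simp: consecutive_def)
    qed
    ultimately show ?thesis by (simp add: merge_def e)
  qed
  then show "open_arc i s c = merge (arc C' True (i, s))" "open_arc i s c = merge (arc C' False (i, c))"
    by blast+
qed

lemma arc_merge:
  assumes "p \<in> C"
  shows "arc C f p = merge (arc C' f p)"
proof (cases f)
  case True
  obtain c where c: "consecutive (fst p) (snd p) c" using next_cut assms by (metis prod.collapse)
  show ?thesis using arc_merge_consecutive(1)[OF c] arc_consecutive(1)[OF c] True by simp
next
  case False
  obtain c where c: "consecutive (fst p) c (snd p)" using prev_cut assms by (metis prod.collapse)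
  show ?thesis using arc_merge_consecutive(2)[OF c] arc_consecutive(2)[OF c] False by simp
qed

text \<open>Separates merging into the renaming that a \<open>con\<close> symbol performs and a new
  name for the one label that remains.\<close>

lemma merge_eq_ren:
  "merge A = (\<lambda>B. if B = arc C' False q then merged else B) (ren (arc C' True q) (arc C' False q) A)"
  by (auto simp: merge_def ren_def)

text \<open>If both sides of \<open>q\<close> belong to one arc, the next cut after \<open>q\<close>
  is \<open>q\<close> itself one period later, which leaves no place for a cut of \<open>C\<close>
  on this component.\<close>

lemma ends_eq_iff: "arc C' True q = arc C' False q \<longleftrightarrow> (\<forall>s. (fst q, s) \<notin> C)"
proof
  assume eq: "arc C' True q = arc C' False q"
  obtain c where c: "new.consecutive (fst q) (snd q) c"
    using new.next_cut q_mem by (metis prod.collapse)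
  have "same_param (fst q, c) q"
    using new.arc_consecutive[OF c] eq c q_mem
    by (intro new.arc_eqD[of _ _ False]) (auto simp: new.consecutive_def)
  then obtain n where n: "c = snd q + of_int n"
    using same_param_sym same_paramE by (metis snd_conv)
  have "snd q < c" "c \<le> snd q + 1" using c new.consecutive_le[OF c] by (auto simp: new.consecutive_def)
  \<comment> \<open>The distance to the next cut is a positive integer and at most one.\<close>
  then have c1: "c = snd q + 1" using n by (metis add_le_cancel_left less_add_same_cancel1
        of_int_0_less_iff of_int_le_1_iff order_antisym int_one_le_iff_zero_less of_int_1)
  show "\<forall>s. (fst q, s) \<notin> C"
  proof (intro allI notI)
    fix s assume s: "(fst q, s) \<in> C"
    \<comment> \<open>The given cut is shifted into the period that starts at
      \<open>q\<close>.\<close>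
    define s' where "s' = s + of_int (- \<lfloor>s - snd q\<rfloor>)"
    have s': "(fst q, s') \<in> C" unfolding s'_def cut_shift by (rule s)
    have "snd q \<le> s'" "s' < snd q + 1" unfolding s'_def by linarith+
    moreover have "s' \<noteq> snd q" using s' q_notin by auto
    ultimately show False using c c1 s' by (auto simp: new.consecutive_def)
  qed
next
  assume none: "\<forall>s. (fst q, s) \<notin> C"
  have "new.consecutive (fst q) (snd q) (snd q + of_int 1)"
    unfolding new.consecutive_def new.cut_shift
  proof (intro conjI allI impI notI)
    fix u assume u: "snd q < u \<and> u < snd q + of_int 1" "(fst q, u) \<in> C'"
    then have "same_param q (fst q, u)" using none by (auto simp: param_class_def)
    then obtain n where "u = snd q + of_int n" by (auto elim: same_paramE)
    then have "0 < n" "n < 1" using u(1) by auto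
    then show False by simp
  qed (use q_mem in auto)
  then have "arc C' True q = arc C' False (fst q, snd q + of_int 1)"
    using new.arc_consecutive by (metis prod.collapse)
  also have "\<dots> = arc C' False q"
    using new.arc_same[OF q_mem, of "(fst q, snd q + of_int 1)"] same_param_shift(1)[of "fst q" "snd q" 1]
    by simp
  finally show "arc C' True q = arc C' False q" .
qed

end

subsection \<open>State sums with marked points\<close>

definition cuts :: "shaded_diagram \<Rightarrow> (nat \<times> real) list \<Rightarrow> (nat \<times> real) set" where
  "cuts D qs = {p. crossing_param D p} \<union> (\<Union>q\<in>set qs. param_class q)"

definition marked_symbols :: "shaded_diagram \<Rightarrow> complex list \<Rightarrow> (nat \<times> real) list \<Rightarrow> (nat \<times> real) set symb list" where
  "marked_symbols D vs qs = map (gsymb D (arc (cuts D qs))) vs @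
     map (\<lambda>q. Con (arc (cuts D qs) False q) (arc (cuts D qs) True q)) qs"

definition uncut :: "shaded_diagram \<Rightarrow> (nat \<times> real) set \<Rightarrow> nat set" where
  "uncut D C = {i. i < ncomp D \<and> (\<forall>s. (i, s) \<notin> C)}"

definition marks :: "shaded_diagram \<Rightarrow> (nat \<times> real) list \<Rightarrow> bool" where
  "marks D qs \<longleftrightarrow> (\<forall>q\<in>set qs. q \<in> params D \<and> \<not> crossing_param D q) \<and> distinct qs \<and>
     (\<forall>p\<in>set qs. \<forall>q\<in>set qs. same_param p q \<longrightarrow> p = q)"

context checkered
begin

lemma crossing_paramD: "crossing_param D p \<Longrightarrow> p \<in> params D"
  by (auto simp: crossing_param_def double_point_def)

text \<open>Crossing parameters are isolated, so a bounded interval cannot contain infinitely many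
  of them.\<close>

lemma finite_crossing_params: "finite {s. crossing_param D (i, s) \<and> a \<le> s \<and> s \<le> b}" (is "finite ?S")
proof (rule ccontr)
  assume inf: "infinite ?S"
  then obtain s where "crossing_param D (i, s)" by (metis (mono_tags, lifting) Collect_empty_eq finite.emptyI)
  then have i: "i < ncomp D" using crossing_paramD by (fastforce simp: params_iff)
  have "?S \<subseteq> {a..b}" by auto
  then obtain x where "x islimpt ?S"
    using Heine_Borel_imp_Bolzano_Weierstrass[OF compact_Icc inf] by blast
  moreover have "\<forall>\<^sub>F t in at x. \<not> crossing_param D (i, t)"
    using eventually_noncrossing[of "(i, x)"] i by (simp add: params_iff)
  then have "\<forall>\<^sub>F t in at x. t \<notin> ?S" by (rule eventually_mono) simp
  ultimately show False unfolding islimpt_iff_eventually by blast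
qed

lemma cut_set_cuts: "cut_set (cuts D qs)"
proof (induction qs)
  case Nil
  show ?case
    by unfold_locales (auto simp: cuts_def crossing_param_same finite_crossing_params)
next
  case (Cons q qs)
  have "cuts D (q # qs) = cuts D qs \<union> param_class q" by (auto simp: cuts_def)
  with cut_set_insert[OF Cons] show ?case by simp
qed

lemma crossing_reps:
  assumes "v \<in> crossings D"
  shows "double_point D (underpass D v) (overpass D v)" "pt D (underpass D v) = v"
    "underpass D v \<notin> over D" "overpass D v \<in> over D"
proof -
  obtain p q where pq: "double_point D p q" "pt D p = v"
    using assms by (auto simp: crossings_def crossing_param_def)
  have ex: "\<exists>p q. double_point D p q \<and> pt D p = v \<and> p \<notin> over D"
  proof (cases "p \<in> over D")
    case True
    then show ?thesis using pq double_point_sym[OF pq(1)] over_iff[OF pq(1)]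
      by (intro exI[of _ q] exI[of _ p]) (auto simp: double_point_def)
  qed (use pq in blast)
  then obtain p q where d: "double_point D p q" "pt D p = v" "p \<notin> over D" by blast
  note u = underpass_overpass[OF d(1,3), unfolded d(2)]
  have "double_point D (underpass D v) q" by (rule double_point_same[OF d(1) u(1)])
  from double_point_same[OF double_point_sym[OF this] u(2)]
  show "double_point D (underpass D v) (overpass D v)" by (rule double_point_sym)
  show "pt D (underpass D v) = v" using pt_same[OF _ u(1)] d by (auto simp: double_point_def)
  show "underpass D v \<notin> over D" using over_same[OF u(1)] d(3) by blast
  show "overpass D v \<in> over D" using over_same[OF u(2)] over_iff[OF d(1)] d(3) by blast
qed

text \<open>Up to integer shifts, each crossing is passed once by its underpass and once by its
  overpass, and no mark is a crossing parameter.\<close>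

lemma representatives_cuts:
  assumes vs: "distinct vs" "set vs = crossings D" and qs: "marks D qs"
  shows "cut_set.representatives (cuts D qs) (concat (map (\<lambda>v. [underpass D v, overpass D v]) vs) @ qs)"
proof -
  interpret cut_set "cuts D qs" by (rule cut_set_cuts)
  let ?cs = "concat (map (\<lambda>v. [underpass D v, overpass D v]) vs)"
  have d: "double_point D (underpass D v) (overpass D v)" if "v \<in> set vs" for v
    using crossing_reps(1) vs(2) that by blast
  have ptv: "pt D (underpass D v) = v" "pt D (overpass D v) = v" if "v \<in> set vs" for v
    using crossing_reps(1,2)[of v] vs(2) that by (auto simp: double_point_def)
  have set_cs: "set ?cs = underpass D ` set vs \<union> overpass D ` set vs" by auto
  have cp: "crossing_param D p" if "p \<in> set ?cs" for p
    using that d double_point_sym unfolding set_cs crossing_param_def by blast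
  have par: "p \<in> params D" if "p \<in> set ?cs" for p using cp that crossing_paramD by blast
  have cover: "\<exists>q\<in>set ?cs. same_param q p" if "crossing_param D p" for p
  proof -
    have v: "pt D p \<in> set vs" using that vs(2) by (auto simp: crossings_def)
    have "same_param (underpass D (pt D p)) p \<or> same_param (overpass D (pt D p)) p"
      using double_point_fiber[OF d[OF v]] ptv[OF v] crossing_paramD[OF that] by simp
    then show ?thesis using v unfolding set_cs by blast
  qed
  have inj: "p = q" if pq: "p \<in> set ?cs" "q \<in> set ?cs" "same_param p q" for p q
  proof -
    obtain v w where v: "v \<in> set vs" "p = underpass D v \<or> p = overpass D v"
      and w: "w \<in> set vs" "q = underpass D w \<or> q = overpass D w"
      using pq(1,2) unfolding set_cs by blast
    have "pt D p = v" "pt D q = w" using v w ptv by blast+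
    then have "v = w" using pt_same[OF par[OF pq(1)] pq(3)] by simp
    moreover have "\<not> same_param (underpass D v) (overpass D v)"
      using d[OF v(1)] by (simp add: double_point_def)
    ultimately show ?thesis using v w pq(3) same_param_sym by blast
  qed
  have dist: "distinct ?cs"
  proof -
    have "distinct (concat (map (\<lambda>v. [underpass D v, overpass D v]) ws))"
      if "distinct ws" "set ws \<subseteq> set vs" for ws
      using that
    proof (induction ws)
      case (Cons w ws)
      have w: "w \<in> set vs" using Cons.prems by simp
      have uo: "underpass D w \<noteq> overpass D w"
        using d[OF w] same_param_refl unfolding double_point_def by metis
      have "pt D x \<noteq> w" if "x \<in> set (concat (map (\<lambda>v. [underpass D v, overpass D v]) ws))" for x
        using that Cons.prems ptv by (auto simp: subset_iff)
      then have "underpass D w \<notin> set (concat (map (\<lambda>v. [underpass D v, overpass D v]) ws))"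
        "overpass D w \<notin> set (concat (map (\<lambda>v. [underpass D v, overpass D v]) ws))"
        using ptv[OF w] by blast+
      moreover have "distinct (concat (map (\<lambda>v. [underpass D v, overpass D v]) ws))"
        using Cons by simp
      ultimately show ?case using uo by simp
    qed simp
    then show ?thesis using vs(1) by blast
  qed
  have x: "\<not> same_param p q" "\<not> same_param q p" if "p \<in> set ?cs" "q \<in> set qs" for p q
    using cp[OF that(1)] crossing_param_same that(2) qs unfolding marks_def by blast+
  show ?thesis
    unfolding representatives_def
  proof (intro conjI)
    show "set (?cs @ qs) \<subseteq> cuts D qs"
      using cp by (auto simp: cuts_def param_class_def)
    show "\<forall>p\<in>cuts D qs. \<exists>q\<in>set (?cs @ qs). same_param q p"
      using cover unfolding cuts_def param_class_def set_append by blast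
    show "distinct (?cs @ qs)"
    proof -
      have "set ?cs \<inter> set qs = {}" using x(1) same_param_refl by blast
      then show ?thesis using dist qs unfolding marks_def distinct_append by simp
    qed
    show "\<forall>p\<in>set (?cs @ qs). \<forall>q\<in>set (?cs @ qs). same_param p q \<longrightarrow> p = q"
      using inj x qs unfolding marks_def set_append by blast
  qed
qed

lemma slabs_gsymb: "slabs (gsymb D lab v) =
  {#lab True (underpass D v), lab False (underpass D v), lab True (overpass D v), lab False (overpass D v)#}"
  by (cases "Im (cnj (- vel D (underpass D v)) * vel D (overpass D v)) > 0")
    (auto simp: gsymb_def Let_def add_mset_commute)

lemma balanced_marked_symbols:
  assumes vs: "distinct vs" "set vs = crossings D" and qs: "marks D qs"
  shows "balanced (plabs (marked_symbols D vs qs))"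
proof -
  interpret cut_set "cuts D qs" by (rule cut_set_cuts)
  let ?e = "\<lambda>p. {#arc (cuts D qs) True p, arc (cuts D qs) False p#}"
  have "plabs (map (gsymb D (arc (cuts D qs))) ws) =
      (\<Sum>p\<leftarrow>concat (map (\<lambda>v. [underpass D v, overpass D v]) ws). ?e p)" for ws
    by (induction ws) (auto simp: slabs_gsymb)
  moreover have "plabs (map (\<lambda>q. Con (arc (cuts D qs) False q) (arc (cuts D qs) True q)) ws) =
      (\<Sum>p\<leftarrow>ws. ?e p)" for ws
    by (induction ws) (auto simp: add_mset_commute)
  ultimately show ?thesis
    using balanced_ends[OF representatives_cuts[OF assms]] by (simp add: marked_symbols_def)
qed

lemma gsymb_cong:
  assumes "v \<in> crossings D" "\<And>f p. crossing_param D p \<Longrightarrow> lab f p = lab' f p"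
  shows "gsymb D lab v = gsymb D lab' v"
proof -
  have "crossing_param D (underpass D v)" "crossing_param D (overpass D v)"
    using crossing_reps(1)[OF assms(1)] double_point_sym unfolding crossing_param_def by blast+
  then show ?thesis using assms(2) by (simp add: gsymb_def Let_def)
qed

text \<open>A mark on a component with other cuts divides an arc, and contraction of its
  \<open>con\<close> symbol restores it. A mark on an uncut component yields con[aa], whose factor
  \<open>o\<close> makes up for the component no longer counted as uncut.\<close>

lemma marked_bracket_step:
  assumes vs: "distinct vs" "set vs = crossings D" and qs: "marks D (q # qs)"
  shows "var Vo ^ card (uncut D (cuts D (q # qs))) * bracket (marked_symbols D vs (q # qs)) =
    var Vo ^ card (uncut D (cuts D qs)) * bracket (marked_symbols D vs qs)"
proof -
  let ?C = "cuts D qs" and ?C' = "cuts D (q # qs)"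
  have C': "?C' = ?C \<union> param_class q" by (auto simp: cuts_def)
  have qs': "marks D qs" using qs by (auto simp: marks_def)
  have qn: "q \<notin> ?C"
  proof
    assume "q \<in> ?C"
    then obtain p where "p \<in> set qs" "same_param p q"
      using qs by (auto simp: cuts_def marks_def param_class_def)
    then show False using qs by (auto simp: marks_def)
  qed
  interpret added_cut ?C q
    using cut_set_cuts qn by (simp add: added_cut_def added_cut_axioms_def)
  let ?a = "arc ?C' False q" and ?b = "arc ?C' True q"
  define Q where "Q = map (gsymb D (arc ?C')) vs @ map (\<lambda>q. Con (arc ?C' False q) (arc ?C' True q)) qs"
  have bal': "balanced (plabs (marked_symbols D vs (q # qs)))"
    by (rule balanced_marked_symbols[OF vs qs])
  have ms: "mset (marked_symbols D vs (q # qs)) = mset (Con ?a ?b # Q)"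
    by (simp add: marked_symbols_def Q_def)
  then have br: "bracket (marked_symbols D vs (q # qs)) = bracket (Con ?a ?b # Q)"
    using bal' by (rule bracket_cong_mset)
  have balQ: "balanced (plabs (Con ?a ?b # Q))" using bal' plabs_cong_mset[OF ms] by simp
  \<comment> \<open>Dropping the cut amounts to applying \<open>merge\<close> to all labels.\<close>
  have old: "marked_symbols D vs qs = map (map_symb merge) Q"
  proof -
    have "gsymb D (arc ?C) v = map_symb merge (gsymb D (arc ?C') v)" if "v \<in> set vs" for v
      unfolding map_symb_gsymb
      using that vs(2) arc_merge C' by (intro gsymb_cong) (auto simp: cuts_def)
    moreover have "arc ?C f p = merge (arc ?C' f p)" if "p \<in> set qs" for f p
    proof -
      have "p \<in> ?C" using that same_param_refl[of p] unfolding cuts_def param_class_def by blast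
      from arc_merge[OF this, of f] show ?thesis using C' by simp
    qed
    ultimately show ?thesis by (simp add: marked_symbols_def Q_def)
  qed
  have q_params: "fst q < ncomp D" using qs by (auto simp: marks_def params_iff)
  show ?thesis
  proof (cases "?a = ?b")
    case True
    then have none: "\<forall>s. (fst q, s) \<notin> ?C" using ends_eq_iff C' by simp
    have "uncut D ?C = insert (fst q) (uncut D ?C')" "fst q \<notin> uncut D ?C'"
    proof -
      have "(fst q, snd q) \<in> ?C'" by (simp add: C' param_class_def)
      then show "fst q \<notin> uncut D ?C'" unfolding uncut_def by blast
      have "(i, s) \<notin> param_class q" if "i \<noteq> fst q" for i s
        using that by (auto simp: param_class_def same_param_def)
      then show "uncut D ?C = insert (fst q) (uncut D ?C')"
        using none q_params by (auto simp: uncut_def C')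
    qed
    moreover have "finite (uncut D ?C')" by (simp add: uncut_def)
    ultimately have card: "card (uncut D ?C) = Suc (card (uncut D ?C'))" by simp
    \<comment> \<open>Both occurrences of the label \<open>?a\<close> are in con[aa], so merging
      does not affect the other symbols.\<close>
    have "map (map_symb merge) Q = Q"
    proof (rule map_map_symb_ident_on)
      fix A assume "A \<in># plabs Q"
      moreover have "count (plabs Q) ?a = 0"
        using balancedD[OF balQ, of ?a] True by auto
      ultimately have "A \<noteq> ?a" by (metis not_in_iff)
      then show "merge A = A" using True C' by (auto simp: merge_def)
    qed
    then have "bracket (marked_symbols D vs (q # qs)) = var Vo * bracket (marked_symbols D vs qs)"
      using br bracket_loop[of ?a Q] balQ True old by simp
    then show ?thesis using card by (simp add: mult_ac)
  next
    case False
    have "\<exists>s. (fst q, s) \<in> ?C" using ends_eq_iff False C' by auto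
    then have "uncut D ?C' = uncut D ?C"
      using C' by (auto simp: uncut_def param_class_def same_param_def)
    moreover have "bracket (marked_symbols D vs (q # qs)) = bracket (marked_symbols D vs qs)"
    proof -
      let ?j = "\<lambda>B. if B = ?a then merged else B"
      let ?R = "map (map_symb (ren ?b ?a)) Q"
      have "merge = ?j \<circ> ren ?b ?a" using merge_eq_ren C' by auto
      then have "marked_symbols D vs qs = map (map_symb ?j) ?R"
        by (simp add: old symb.map_comp)
      then have br': "bracket (marked_symbols D vs qs) = bracket (map (map_symb ?j) ?R)" by (rule arg_cong)
      \<comment> \<open>Unlike \<open>merged\<close>, no label of the contracted product contains
        the cut \<open>q\<close>, so giving this name to one of them cannot produce a
        collision.\<close>
      have inj: "inj_on ?j (set_mset (plabs ?R))"
      proof -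
        have lab: "q \<notin> A" if A: "A \<in># plabs ?R" for A
        proof -
          have "A \<in># plabs (Con ?a ?b # Q)" using A by (auto simp: plabs_map ren_def)
          then have "\<exists>f p. A = arc ?C' f p"
            unfolding Q_def plabs_def by (auto simp: slabs_gsymb simp del: split_paired_Ex)
          then obtain f p where "A = arc C' f p" using C' by auto
          then show ?thesis using new.arc_notin q_mem by blast
        qed
        have "q \<in> merged" by (simp add: merged_def param_class_def)
        then show ?thesis using lab by (auto simp: inj_on_def)
      qed
      have "bracket (map (map_symb ?j) ?R) = bracket ?R" by (rule bracket_map_inj[OF inj])
      with br' have "bracket (marked_symbols D vs qs) = bracket ?R" by (rule trans)
      then show ?thesis using br bracket_contract[OF False balQ] by simp
    qed
    ultimately show ?thesis by simp
  qed
qed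

lemma edge_eq_arc:
  assumes "p \<in> params D"
  shows "(if f then edge_out D else edge_in D) p = pt D ` arc {p. crossing_param D p} f p"
proof -
  have i: "fst p < ncomp D" using assms by (simp add: params_iff)
  have *: "(\<lambda>t. pt D (fst p, t)) ` T = pt D ` {r. \<exists>t. same_param (fst p, t) r \<and> t \<in> T}" for T
  proof -
    have "pt D r = pt D (fst p, t)" if "same_param (fst p, t) r" for r t
      using pt_same[OF _ that] i by (simp add: params_iff)
    then show ?thesis by (auto simp: image_iff) (metis same_param_refl)
  qed
  show ?thesis
    unfolding edge_out_def edge_in_def arc_def by (cases f) (auto simp: *)
qed

text \<open>Induction on the marks; the case without marks is the passage from plane edges to arcs
  of parameters.\<close>

theorem state_sum_marked:
  assumes vs: "distinct vs" "set vs = crossings D" and qs: "marks D qs"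
  shows "state_sum D = var Vo ^ card (uncut D (cuts D qs)) * bracket (marked_symbols D vs qs)"
  using qs
proof (induction qs)
  case Nil
  interpret cut_set "cuts D []" by (rule cut_set_cuts)
  let ?X = "cuts D []" and ?ws = "SOME vs. distinct vs \<and> set vs = crossings D"
  have X: "?X = {p. crossing_param D p}" by (simp add: cuts_def)
  have ws: "distinct ?ws" "set ?ws = crossings D"
  proof -
    have "\<exists>vs. distinct vs \<and> set vs = crossings D"
      using finite_distinct_list[OF finite_crossings] by blast
    from someI_ex[OF this] show "distinct ?ws" "set ?ws = crossings D" by blast+
  qed
  have gs: "crossing_symb D v = map_symb (image (pt D)) (gsymb D (arc ?X) v)" if "v \<in> crossings D" for v
    unfolding crossing_symb_eq_gsymb map_symb_gsymb
  proof (rule gsymb_cong[OF that])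
    fix f p assume "crossing_param D p"
    then show "(if f then edge_out D else edge_in D) p = pt D ` arc ?X f p"
      using edge_eq_arc crossing_paramD X by metis
  qed
  have bal: "balanced (plabs (map (gsymb D (arc ?X)) ?ws))"
    using balanced_marked_symbols[OF ws, of "[]"] by (simp add: marks_def marked_symbols_def)
  \<comment> \<open>Arcs avoid the crossing parameters. Away from these \<open>pt D\<close> is
    injective up to integer shifts, and arcs are closed under such shifts, so different arcs have
    different images.\<close>
  have inj: "inj_on (image (pt D)) (set_mset (plabs (map (gsymb D (arc ?X)) ?ws)))"
  proof -
    have sub: "A \<subseteq> B" if A: "A \<in># plabs (map (gsymb D (arc ?X)) ?ws)"
      and B: "B \<in># plabs (map (gsymb D (arc ?X)) ?ws)" and eq: "pt D ` A = pt D ` B" for A B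
    proof -
      have form: "\<exists>f p. crossing_param D p \<and> E = arc ?X f p"
        if "E \<in># plabs (map (gsymb D (arc ?X)) ?ws)" for E
      proof -
        from that obtain v where v: "v \<in> set ?ws" "E \<in># slabs (gsymb D (arc ?X) v)"
          by (auto simp: plabs_def)
        have "crossing_param D (underpass D v)" "crossing_param D (overpass D v)"
          using crossing_reps(1)[of v] v(1) ws(2) double_point_sym unfolding crossing_param_def by blast+
        moreover have "E = arc ?X True (underpass D v) \<or> E = arc ?X False (underpass D v) \<or>
            E = arc ?X True (overpass D v) \<or> E = arc ?X False (overpass D v)"
          using v(2) by (auto simp: slabs_gsymb)
        ultimately show ?thesis by blast
      qed
      have nc: "r \<in> params D \<and> \<not> crossing_param D r"
        if Er: "E \<in># plabs (map (gsymb D (arc ?X)) ?ws)" "r \<in> E" for E r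
      proof -
        obtain f p where p: "crossing_param D p" "E = arc ?X f p" using form Er(1) by blast
        have "fst r = fst p" using Er(2) p(2) by (auto simp: arc_def same_param_def)
        then show ?thesis
          using arc_notin Er(2) p crossing_paramD[OF p(1)] X by (auto simp: params_iff)
      qed
      obtain f p where Bf: "B = arc ?X f p" using form B by blast
      show "A \<subseteq> B"
      proof
        fix r assume r: "r \<in> A"
        then obtain r' where r': "r' \<in> B" "pt D r' = pt D r" using eq by (metis imageE imageI)
        have "same_param r' r"
          using noncrossing_fiber nc[OF A r] nc[OF B r'(1)] r'(2) same_param_sym by metis
        then show "r \<in> B" using r'(1) same_param_trans unfolding Bf arc_def by blast
      qed
    qed
    show ?thesis
    proof (rule inj_onI)
      fix A B assume "A \<in># plabs (map (gsymb D (arc ?X)) ?ws)" "B \<in># plabs (map (gsymb D (arc ?X)) ?ws)"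
        "pt D ` A = pt D ` B"
      then show "A = B" using sub[of A B] sub[of B A] by simp
    qed
  qed
  have "bracket (map (crossing_symb D) ?ws) = bracket (map (map_symb (image (pt D))) (map (gsymb D (arc ?X)) ?ws))"
    using gs ws(2) by (intro arg_cong[of _ _ bracket]) simp
  also have "\<dots> = bracket (map (gsymb D (arc ?X)) ?ws)" by (rule bracket_map_inj[OF inj])
  also have "\<dots> = bracket (map (gsymb D (arc ?X)) vs)"
  proof (rule bracket_cong_mset[OF _ bal])
    have "mset ?ws = mset vs" using ws vs by (metis set_eq_iff_mset_eq_distinct)
    then show "mset (map (gsymb D (arc ?X)) ?ws) = mset (map (gsymb D (arc ?X)) vs)"
      by (simp only: mset_map)
  qed
  finally have "bracket (map (crossing_symb D) ?ws) = bracket (marked_symbols D vs [])"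
    by (simp add: marked_symbols_def)
  moreover have "crossingless_components D = uncut D ?X"
    by (simp add: crossingless_components_def uncut_def X)
  ultimately show ?case by (simp add: state_sum_def)
next
  case (Cons q qs)
  then have "marks D qs" by (auto simp: marks_def)
  with Cons marked_bracket_step[OF vs Cons.prems] show ?case by simp
qed

end

section \<open>Planar isotopy\<close>

lemma cdet_zero_imp_multiple:
  assumes "u \<noteq> 0" "cdet u w = 0"
  obtains r :: real where "w = of_real r * u"
proof -
  have "cnj u * w = of_real (Re (cnj u * w))"
    using assms(2) by (simp add: cdet_def complex_eq_iff)
  moreover have "u * cnj u = of_real ((norm u)\<^sup>2)" by (rule complex_norm_square[symmetric])
  ultimately have "of_real ((norm u)\<^sup>2) * w = of_real (Re (cnj u * w)) * u"
    by (metis mult.assoc mult.commute)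
  then have "w = of_real (Re (cnj u * w) / (norm u)\<^sup>2) * u"
    using assms(1) by (simp add: field_simps)
  then show thesis by (rule that)
qed

text \<open>The factor is the determinant of \<open>A\<close> in the basis 1,
  \<open>\<i>\<close>.\<close>

lemma cdet_linear:
  assumes "linear A"
  shows "cdet (A u) (A w) = cdet (A 1) (A \<i>) * cdet u w"
proof -
  have e: "A u = Re u *\<^sub>R A 1 + Im u *\<^sub>R A \<i>" for u
  proof -
    have "u = Re u *\<^sub>R 1 + Im u *\<^sub>R \<i>" by (simp add: complex_eq_iff)
    then show ?thesis using assms by (metis linear_add linear_scale)
  qed
  have a: "cdet (A \<i>) (A 1) = - cdet (A 1) (A \<i>)" by (rule cdet_anti)
  have c: "cdet u w = Re u * Im w - Im u * Re w" by (simp add: cdet_def)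
  show ?thesis
    unfolding c e[of u] e[of w] by (simp add: a algebra_simps)
qed

text \<open>For fixed \<open>z\<close> the determinant of the derivative is continuous in
  \<open>t\<close>, equals 1 at \<open>t = 0\<close> and never vanishes, so it is positive at
  \<open>t = 1\<close>. This positivity keeps the counterclockwise order at crossings.\<close>

lemma ambient_isotopy_orientation:
  assumes "ambient_isotopy H"
  shows "\<exists>A. \<forall>z. (H 1 has_derivative A z) (at z) \<and> (\<exists>k>0. \<forall>u w. cdet (A z u) (A z w) = k * cdet u w)"
proof -
  obtain H' where H': "\<And>t z. t \<in> {0..1} \<Longrightarrow> (H t has_derivative H' t z) (at z)"
    "\<And>t z. t \<in> {0..1} \<Longrightarrow> bij (H' t z)"
    "\<And>w. continuous_on ({0..1} \<times> UNIV) (\<lambda>(t, z). H' t z w)"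
    using assms unfolding ambient_isotopy_def by blast
  have H0: "H 0 = id" using assms by (simp add: ambient_isotopy_def)
  have pos: "0 < cdet (H' 1 z 1) (H' 1 z \<i>)" for z
  proof (rule ccontr)
    assume neg: "\<not> ?thesis"
    define g where "g t = cdet (H' t z 1) (H' t z \<i>)" for t
    have cont: "continuous_on {0..1} (\<lambda>t. H' t z w)" for w
    proof -
      have "continuous_on {0..1} (\<lambda>t::real. (t, z))" by (intro continuous_intros)
      from continuous_on_compose2[OF H'(3)[of w] this] show ?thesis by auto
    qed
    have "continuous_on {0..1} g"
      unfolding g_def cdet_def by (intro continuous_intros cont)
    moreover have "g 0 = 1"
    proof -
      have "(id has_derivative H' 0 z) (at z)" using H'(1)[of 0 z] H0 by simp
      then have "H' 0 z = id" using has_derivative_unique has_derivative_id by blast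
      then show ?thesis by (simp add: g_def cdet_def)
    qed
    moreover have "g 1 \<le> 0" using neg by (simp add: g_def)
    ultimately obtain t where t: "0 \<le> t" "t \<le> 1" "g t = 0"
      using IVT2'[of g 1 0 0] by auto
    have lin: "linear (H' t z)" using H'(1)[of t z] t by (auto intro: has_derivative_linear)
    have inj: "inj (H' t z)" using H'(2)[of t z] t by (auto simp: bij_def)
    have "H' t z 1 \<noteq> 0" using inj lin by (metis injD linear_0 zero_neq_one)
    then obtain r :: real where r: "H' t z \<i> = of_real r * H' t z 1"
      using cdet_zero_imp_multiple t(3) unfolding g_def by blast
    have "H' t z (r *\<^sub>R 1) = of_real r * H' t z 1"
      using linear_scale[OF lin, of r 1] unfolding scaleR_conv_of_real[of r "H' t z 1"] .
    from trans[OF r sym[OF this]] have "H' t z \<i> = H' t z (r *\<^sub>R 1)" .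
    then have "\<i> = r *\<^sub>R 1" using inj by (rule injD[rotated])
    then show False by (simp add: complex_eq_iff)
  qed
  have lin: "linear (H' 1 z)" for z using H'(1)[of 1 z] by (auto intro: has_derivative_linear)
  show ?thesis
  proof (intro exI[of _ "H' 1"] allI conjI)
    fix z
    show "(H 1 has_derivative H' 1 z) (at z)" by (rule H'(1)) simp
    show "\<exists>k>0. \<forall>u w. cdet (H' 1 z u) (H' 1 z w) = k * cdet u w"
      using pos[of z] cdet_linear[OF lin[of z]] by blast
  qed
qed

text \<open>Rolle's theorem makes the map injective, hence monotone. The sign in its law under
  shifts by 1 determines the direction, which \<open>up\<close> records, and makes the map unbounded
  both ways, hence surjective.\<close>

lemma reparametrisation_monotone:
  assumes "reparametrisation \<phi>"
  obtains up where "\<And>s t. \<phi> s < \<phi> t \<longleftrightarrow> (if up then s < t else t < s)"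
    "\<And>s n. \<phi> (s + of_int n) = \<phi> s + of_int (if up then n else - n)" "surj \<phi>"
    "\<And>s. \<exists>d>0. (\<phi> has_real_derivative (if up then d else - d)) (at s)"
proof -
  have der: "\<exists>d. d \<noteq> 0 \<and> (\<phi> has_real_derivative d) (at s)" for s
    using assms by (simp add: reparametrisation_def)
  have cont: "continuous_on A \<phi>" for A
    using der by (meson DERIV_isCont continuous_at_imp_continuous_on)
  have neq: "\<phi> s \<noteq> \<phi> t" if st: "s < t" for s t
  proof
    assume eq: "\<phi> s = \<phi> t"
    have "\<phi> differentiable (at x)" for x using der real_differentiable_def by blast
    then obtain z where "s < z" "z < t" "(\<phi> has_real_derivative 0) (at z)"
      using Rolle[OF st eq cont] by blast
    then show False using der DERIV_unique by metis
  qed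
  have inj: "inj_on \<phi> A" for A
    by (rule inj_onI) (metis neq linorder_less_linear)
  obtain up where up: "\<And>s. \<phi> (s + 1) = \<phi> s + (if up then 1 else - 1)"
  proof (cases "\<forall>s. \<phi> (s + 1) = \<phi> s + 1")
    case True
    then show thesis using that[of True] by simp
  next
    case False
    then have "\<forall>s. \<phi> (s + 1) = \<phi> s - 1" using assms by (auto simp: reparametrisation_def)
    then show thesis using that[of False] by simp
  qed
  let ?g = "\<lambda>s. \<phi> s - (if up then s else - s)"
  have "?g (s + of_int n) = ?g s" for s n
    by (rule periodic_of_int) (simp add: up)
  then have shift: "\<phi> (s + of_int n) = \<phi> s + of_int (if up then n else - n)" for s n
    by (simp add: algebra_simps split: if_splits) (smt (verit))+
  have lt: "if up then \<phi> s < \<phi> t else \<phi> t < \<phi> s" if "s < t" for s t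
  proof -
    \<comment> \<open>With \<open>t\<close> between \<open>s\<close> and
      \<open>s + of_int n\<close>, the known difference of the values at these two points decides
      the sense of monotonicity.\<close>
    define n where "n = \<lceil>t - s\<rceil> + 1"
    have n: "t < s + of_int n" "n > 0" unfolding n_def using that by linarith+
    have "(\<phi> s < \<phi> t \<and> \<phi> t < \<phi> (s + of_int n)) \<or> (\<phi> (s + of_int n) < \<phi> t \<and> \<phi> t < \<phi> s)"
      using that n(1) cont inj by (intro continuous_inj_imp_mono) auto
    then show ?thesis using shift[of s n] n(2) by (auto split: if_splits)
  qed
  have less: "\<phi> s < \<phi> t \<longleftrightarrow> (if up then s < t else t < s)" for s t
    using lt[of s t] lt[of t s] by (cases s t rule: linorder_cases) (auto split: if_splits)
  have "surj \<phi>"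
  proof -
    have "\<exists>s. \<phi> s = y" for y
    proof -
      define n where "n = \<lceil>\<bar>y - \<phi> 0\<bar>\<rceil> + 1"
      define a where "a = (if up then - n else n)"
      have n: "\<bar>y - \<phi> 0\<bar> \<le> of_int n" "n > 0" unfolding n_def by linarith+
      have *: "\<phi> (of_int a) \<le> y" "y \<le> \<phi> (of_int (- a))"
        using shift[of 0 a] shift[of 0 "- a"] n by (auto simp: a_def split: if_splits)
      show ?thesis
      proof (cases up)
        case True
        then show ?thesis using IVT'[of \<phi> "of_int a" y "of_int (- a)"] * cont n(2) by (auto simp: a_def)
      next
        case False
        then show ?thesis using IVT2'[of \<phi> "of_int a" y "of_int (- a)"] * cont n(2) by (auto simp: a_def)
      qed
    qed
    then show ?thesis by (metis surjI)
  qed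
  moreover have "\<exists>d>0. (\<phi> has_real_derivative (if up then d else - d)) (at s)" for s
  proof -
    obtain d where d: "d \<noteq> 0" "(\<phi> has_real_derivative d) (at s)" using der by blast
    have "if up then d > 0 else d < 0"
    proof (cases up)
      case True
      have "\<not> d < 0"
      proof
        assume "d < 0"
        then obtain e where "e > 0" "\<forall>h>0. h < e \<longrightarrow> \<phi> (s + h) < \<phi> s"
          using DERIV_neg_dec_right[OF d(2)] by blast
        then have "\<phi> (s + e / 2) < \<phi> s" by simp
        then show False using less[of "s + e / 2" s] True \<open>e > 0\<close> by simp
      qed
      then show ?thesis using d(1) True by simp
    next
      case False
      have "\<not> d > 0"
      proof
        assume "d > 0"
        then obtain e where "e > 0" "\<forall>h>0. h < e \<longrightarrow> \<phi> s < \<phi> (s + h)"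
          using DERIV_pos_inc_right[OF d(2)] by blast
        then have "\<phi> s < \<phi> (s + e / 2)" by simp
        then show False using less[of s "s + e / 2"] False \<open>e > 0\<close> by simp
      qed
      then show ?thesis using d(1) False by simp
    qed
    then show ?thesis using d(2) by (intro exI[of _ "\<bar>d\<bar>"]) (auto split: if_splits)
  qed
  ultimately show thesis using that[of up] less shift by blast
qed

lemma map_symb_req: "req S T \<Longrightarrow> req (map_symb f S) (map_symb f T)"
  by (auto simp: req_def map_symb_rot2)

text \<open>Of the ambient isotopy only its end \<open>h\<close> and the derivative \<open>A\<close>
  enter here, the isotopy having made \<open>A\<close> orientation preserving. \<open>up i\<close>
  tells whether curve \<open>i\<close> keeps its direction.\<close>

locale isotopy = old: checkered D + new: checkered D' for D D' +
  fixes h :: "complex \<Rightarrow> complex" and A :: "complex \<Rightarrow> complex \<Rightarrow> complex"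
    and \<pi> :: "nat \<Rightarrow> nat" and \<phi> :: "nat \<Rightarrow> real \<Rightarrow> real" and up :: "nat \<Rightarrow> bool"
  assumes h_bij: "bij h"
    and h_deriv: "(h has_derivative A z) (at z)"
    and A_pos: "\<exists>k>0. \<forall>u w. cdet (A z u) (A z w) = k * cdet u w"
    and \<pi>_bij: "bij_betw \<pi> {..<ncomp D} {..<ncomp D'}"
    and \<phi>_less: "i < ncomp D \<Longrightarrow> \<phi> i s < \<phi> i t \<longleftrightarrow> (if up i then s < t else t < s)"
    and \<phi>_shift: "i < ncomp D \<Longrightarrow> \<phi> i (s + of_int n) = \<phi> i s + of_int (if up i then n else - n)"
    and \<phi>_surj: "i < ncomp D \<Longrightarrow> surj (\<phi> i)"
    and \<phi>_deriv: "i < ncomp D \<Longrightarrow> \<exists>d>0. (\<phi> i has_real_derivative (if up i then d else - d)) (at s)"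
    and curve_eq: "i < ncomp D \<Longrightarrow> curve D' (\<pi> i) (\<phi> i s) = h (curve D i s)"
    and over_eq: "i < ncomp D \<Longrightarrow> crossing_param D (i, s) \<Longrightarrow>
      (\<pi> i, \<phi> i s) \<in> over D' \<longleftrightarrow> (i, s) \<in> over D"
    and shaded_eq: "shaded D' = h ` shaded D"
begin

definition \<Phi> :: "nat \<times> real \<Rightarrow> nat \<times> real" where
  "\<Phi> p = (\<pi> (fst p), \<phi> (fst p) (snd p))"

lemma \<phi>_inj: "i < ncomp D \<Longrightarrow> \<phi> i s = \<phi> i t \<longleftrightarrow> s = t"
  using \<phi>_less[of i s t] \<phi>_less[of i t s] by (cases s t rule: linorder_cases) (auto split: if_splits)

lemma \<pi>_less: "i < ncomp D \<Longrightarrow> \<pi> i < ncomp D'"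
  using \<pi>_bij by (auto simp: bij_betw_def)

lemma \<pi>_inj: "i < ncomp D \<Longrightarrow> j < ncomp D \<Longrightarrow> \<pi> i = \<pi> j \<longleftrightarrow> i = j"
  using \<pi>_bij by (auto simp: bij_betw_def inj_on_def)

lemma \<Phi>_params: "p \<in> params D \<Longrightarrow> \<Phi> p \<in> params D'"
  by (simp add: old.params_iff new.params_iff \<Phi>_def \<pi>_less)

lemma \<Phi>_surj:
  assumes "p' \<in> params D'"
  obtains p where "p \<in> params D" "p' = \<Phi> p"
proof -
  have "fst p' \<in> \<pi> ` {..<ncomp D}"
    using assms \<pi>_bij by (simp add: new.params_iff bij_betw_def)
  then obtain i where i: "i < ncomp D" "fst p' = \<pi> i" by auto
  obtain s where "snd p' = \<phi> i s" using \<phi>_surj[OF i(1)] by (metis surjD)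
  then show thesis using that[of "(i, s)"] i by (simp add: old.params_iff \<Phi>_def prod_eq_iff)
qed

lemma pt_\<Phi>: "p \<in> params D \<Longrightarrow> pt D' (\<Phi> p) = h (pt D p)"
  by (simp add: pt_def \<Phi>_def curve_eq old.params_iff)

lemma same_param_\<Phi>:
  assumes p: "p \<in> params D" "q \<in> params D"
  shows "same_param (\<Phi> p) (\<Phi> q) \<longleftrightarrow> same_param p q"
proof
  assume "same_param p q"
  then obtain n where q: "q = (fst p, snd p + of_int n)" by (rule same_paramE)
  have "\<Phi> q = (fst (\<Phi> p), snd (\<Phi> p) + of_int (if up (fst p) then n else - n))"
    using p by (simp add: \<Phi>_def q \<phi>_shift old.params_iff)
  then show "same_param (\<Phi> p) (\<Phi> q)" using same_param_shift by (metis prod.collapse)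
next
  assume s: "same_param (\<Phi> p) (\<Phi> q)"
  then obtain n where n: "\<Phi> q = (fst (\<Phi> p), snd (\<Phi> p) + of_int n)" by (rule same_paramE)
  have i: "fst q = fst p" "fst p < ncomp D"
    using n p by (auto simp: \<Phi>_def \<pi>_inj old.params_iff)
  have "\<phi> (fst p) (snd q) = \<phi> (fst p) (snd p + of_int (if up (fst p) then n else - n))"
    using n i by (simp add: \<Phi>_def \<phi>_shift)
  then have "snd q = snd p + of_int (if up (fst p) then n else - n)" using \<phi>_inj i(2) by blast
  then show "same_param p q" using i(1) same_param_shift by (metis prod.collapse)
qed

lemma double_point_\<Phi>:
  assumes "p \<in> params D" "q \<in> params D"
  shows "double_point D' (\<Phi> p) (\<Phi> q) \<longleftrightarrow> double_point D p q"
proof -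
  have "h (pt D p) = h (pt D q) \<longleftrightarrow> pt D p = pt D q"
    using h_bij by (auto simp: bij_def dest: injD)
  then show ?thesis
    using assms by (simp add: double_point_def \<Phi>_params same_param_\<Phi> pt_\<Phi>)
qed

lemma crossing_param_\<Phi>:
  assumes "p \<in> params D"
  shows "crossing_param D' (\<Phi> p) \<longleftrightarrow> crossing_param D p"
proof
  assume "crossing_param D' (\<Phi> p)"
  then obtain q' where q': "double_point D' (\<Phi> p) q'" by (auto simp: crossing_param_def)
  then have "q' \<in> params D'" by (simp add: double_point_def)
  then obtain q where "q \<in> params D" "q' = \<Phi> q" by (rule \<Phi>_surj)
  then show "crossing_param D p" using q' double_point_\<Phi>[OF assms] unfolding crossing_param_def by blast
next
  assume "crossing_param D p"
  then obtain q where q: "double_point D p q" by (auto simp: crossing_param_def)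
  then have "double_point D' (\<Phi> p) (\<Phi> q)" using double_point_\<Phi>[OF assms] by (simp add: double_point_def)
  then show "crossing_param D' (\<Phi> p)" unfolding crossing_param_def by blast
qed

lemma crossings_eq: "crossings D' = h ` crossings D"
proof
  show "h ` crossings D \<subseteq> crossings D'"
  proof
    fix w assume "w \<in> h ` crossings D"
    then obtain p where p: "crossing_param D p" "w = h (pt D p)" by (auto simp: crossings_def)
    then have "crossing_param D' (\<Phi> p)" "w = pt D' (\<Phi> p)"
      using crossing_param_\<Phi> pt_\<Phi> old.crossing_paramD[OF p(1)] by simp_all
    then show "w \<in> crossings D'" unfolding crossings_def by blast
  qed
  show "crossings D' \<subseteq> h ` crossings D"
  proof
    fix v assume "v \<in> crossings D'"
    then obtain p' where p': "crossing_param D' p'" "v = pt D' p'" by (auto simp: crossings_def)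
    obtain p where p: "p \<in> params D" "p' = \<Phi> p"
      using new.crossing_paramD[OF p'(1)] by (rule \<Phi>_surj)
    then show "v \<in> h ` crossings D"
      using p' crossing_param_\<Phi> pt_\<Phi> unfolding crossings_def by blast
  qed
qed

text \<open>A reversed parametrisation exchanges the two directions of a branch, which is expressed
  by \<open>f = up (fst p)\<close>.\<close>

lemma dir_\<Phi>:
  assumes p: "p \<in> params D"
  obtains d where "d > 0" "A (pt D p) (dir D f p) = d *\<^sub>R dir D' (f = up (fst p)) (\<Phi> p)"
proof -
  let ?i = "fst p" and ?s = "snd p"
  have i: "?i < ncomp D" using p by (simp add: old.params_iff)
  obtain d where d: "d > 0" "(\<phi> ?i has_real_derivative (if up ?i then d else - d)) (at ?s)"
    using \<phi>_deriv[OF i] by blast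
  let ?e = "if up ?i then d else - d"
  have "(\<phi> ?i has_vector_derivative ?e) (at ?s)"
    using d(2) by (simp add: has_real_derivative_iff_has_vector_derivative)
  from vector_diff_chain_at[OF this new.has_vel[OF \<pi>_less[OF i], of "\<phi> ?i ?s"]]
  have 1: "((curve D' (\<pi> ?i) \<circ> \<phi> ?i) has_vector_derivative ?e *\<^sub>R vel D' (\<Phi> p)) (at ?s)"
    by (simp add: \<Phi>_def)
  have lin: "linear (A (pt D p))" using h_deriv by (rule has_derivative_linear)
  have "(h has_derivative A (pt D p)) (at (curve D ?i ?s))" using h_deriv by (simp add: pt_def)
  from diff_chain_at[OF old.has_vel[OF i, of ?s, unfolded has_vector_derivative_def] this]
  have "((h \<circ> curve D ?i) has_derivative (\<lambda>x. A (pt D p) (x *\<^sub>R vel D p))) (at ?s)"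
    by (simp add: o_def)
  then have 2: "((h \<circ> curve D ?i) has_vector_derivative A (pt D p) (vel D p)) (at ?s)"
    using lin by (simp add: has_vector_derivative_def linear_scale)
  have "curve D' (\<pi> ?i) \<circ> \<phi> ?i = h \<circ> curve D ?i" using curve_eq[OF i] by auto
  then have "A (pt D p) (vel D p) = ?e *\<^sub>R vel D' (\<Phi> p)"
    using 1 2 vector_derivative_unique_at by metis
  then have "A (pt D p) (dir D f p) = d *\<^sub>R dir D' (f = up ?i) (\<Phi> p)"
    using lin by (auto simp: dir_def linear_neg)
  then show thesis using d(1) that by blast
qed

lemma arc_\<Phi>:
  assumes p: "p \<in> params D"
  shows "arc {q. crossing_param D' q} (f = up (fst p)) (\<Phi> p) = \<Phi> ` arc {q. crossing_param D q} f p"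
proof -
  let ?i = "fst p" and ?s = "snd p"
  have i: "?i < ncomp D" using p by (simp add: old.params_iff)
  let ?P = "\<lambda>t. if f then ?s < t \<and> (\<forall>u. ?s < u \<and> u \<le> t \<longrightarrow> \<not> crossing_param D (?i, u))
      else t < ?s \<and> (\<forall>u. t \<le> u \<and> u < ?s \<longrightarrow> \<not> crossing_param D (?i, u))"
  let ?P' = "\<lambda>t. if f = up ?i then \<phi> ?i ?s < t \<and> (\<forall>u. \<phi> ?i ?s < u \<and> u \<le> t \<longrightarrow> \<not> crossing_param D' (\<pi> ?i, u))
      else t < \<phi> ?i ?s \<and> (\<forall>u. t \<le> u \<and> u < \<phi> ?i ?s \<longrightarrow> \<not> crossing_param D' (\<pi> ?i, u))"
  have le: "\<phi> ?i s \<le> \<phi> ?i t \<longleftrightarrow> (if up ?i then s \<le> t else t \<le> s)" for s t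
    using \<phi>_less[OF i, of t s] by (auto simp: not_less[symmetric])
  have all: "(\<forall>u. Q u) \<longleftrightarrow> (\<forall>u. Q (\<phi> ?i u))" for Q using \<phi>_surj[OF i] by (metis surjD)
  have ex: "(\<exists>u. Q u) \<longleftrightarrow> (\<exists>u. Q (\<phi> ?i u))" for Q using \<phi>_surj[OF i] by (metis surjD)
  have cr: "crossing_param D' (\<pi> ?i, \<phi> ?i u) \<longleftrightarrow> crossing_param D (?i, u)" for u
    using crossing_param_\<Phi>[of "(?i, u)"] i by (simp add: \<Phi>_def old.params_iff)
  have P: "?P' (\<phi> ?i t) \<longleftrightarrow> ?P t" for t
    by (subst (1 2) all) (auto simp: \<phi>_less[OF i] le cr)
  have sm: "same_param (\<pi> ?i, \<phi> ?i t) (\<Phi> r) \<longleftrightarrow> same_param (?i, t) r" if "r \<in> params D" for t r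
    using same_param_\<Phi>[of "(?i, t)" r] i that by (simp add: \<Phi>_def old.params_iff)
  have "r' \<in> arc {q. crossing_param D' q} (f = up ?i) (\<Phi> p) \<longleftrightarrow>
      (\<exists>t. same_param (\<pi> ?i, t) r' \<and> ?P' t)" for r'
    by (simp add: arc_def \<Phi>_def)
  also have "(\<exists>t. same_param (\<pi> ?i, t) r' \<and> ?P' t) \<longleftrightarrow> (\<exists>t. same_param (\<pi> ?i, \<phi> ?i t) r' \<and> ?P' (\<phi> ?i t))" for r'
    by (rule ex)
  also have "\<dots> r' \<longleftrightarrow> (\<exists>t. same_param (\<pi> ?i, \<phi> ?i t) r' \<and> ?P t)" for r'
    unfolding P ..
  also have "\<dots> r' \<longleftrightarrow> r' \<in> \<Phi> ` arc {q. crossing_param D q} f p" for r'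
  proof
    assume "\<exists>t. same_param (\<pi> ?i, \<phi> ?i t) r' \<and> ?P t"
    then obtain t where t: "same_param (\<pi> ?i, \<phi> ?i t) r'" "?P t" by blast
    have "r' \<in> params D'" using new.params_same[OF t(1)] \<pi>_less[OF i] by (simp add: new.params_iff)
    then obtain r where r: "r \<in> params D" "r' = \<Phi> r" by (rule \<Phi>_surj)
    then have "same_param (?i, t) r" using sm t(1) by simp
    then have "r \<in> arc {q. crossing_param D q} f p" using t(2) by (auto simp: arc_def)
    then show "r' \<in> \<Phi> ` arc {q. crossing_param D q} f p" using r(2) by blast
  next
    assume "r' \<in> \<Phi> ` arc {q. crossing_param D q} f p"
    then obtain r t where r: "r' = \<Phi> r" "same_param (?i, t) r" "?P t" by (auto simp: arc_def split: if_splits)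
    have "r \<in> params D" using old.params_same[OF r(2)] i by (simp add: old.params_iff)
    then show "\<exists>t. same_param (\<pi> ?i, \<phi> ?i t) r' \<and> ?P t" using r sm by blast
  qed
  finally show ?thesis by blast
qed

text \<open>The image of a ray under \<open>h\<close> is a curve with tangent
  \<open>A (pt D p) d\<close>, and shades may be read along curves.\<close>

lemma dsh_image:
  assumes dp: "double_point D p q" and d: "cdet (vel D p) d \<noteq> 0" "cdet (vel D q) d \<noteq> 0"
  shows "dsh D' (h (pt D p)) (A (pt D p) d) \<longleftrightarrow> dsh D (pt D p) d"
proof -
  let ?v = "pt D p"
  have p: "p \<in> params D" "q \<in> params D" "pt D q = ?v"
    using dp by (auto simp: double_point_def)
  obtain k where k: "k > 0" "\<And>u w. cdet (A ?v u) (A ?v w) = k * cdet u w" using A_pos by blast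
  have tr: "cdet (vel D' (\<Phi> r)) (A ?v d) \<noteq> 0"
    if r: "r \<in> params D" "pt D r = ?v" "cdet (vel D r) d \<noteq> 0" for r
  proof -
    obtain e where e: "A (pt D r) (dir D True r) = e *\<^sub>R dir D' (True = up (fst r)) (\<Phi> r)"
      using dir_\<Phi>[OF r(1), of True] by blast
    have "cdet (A ?v (dir D True r)) (A ?v d) \<noteq> 0" using k r(3) by (simp add: dir_def)
    then show ?thesis unfolding r(2)[symmetric] e by (auto simp: dir_def split: if_splits)
  qed
  have "double_point D' (\<Phi> p) (\<Phi> q)" using double_point_\<Phi> p dp by simp
  from new.transversal_crossing[OF this, of "A ?v d"]
  have T: "new.transversal (h ?v) (A ?v d)"
    using tr[OF p(1) refl d(1)] tr[OF p(2,3) d(2)] pt_\<Phi>[OF p(1)] by simp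
  have bl: "bounded_linear (A ?v)" using h_deriv by (rule has_derivative_bounded_linear)
  have "((\<lambda>\<epsilon>. (h (?v + of_real \<epsilon> * d) - h ?v) /\<^sub>R \<epsilon>) \<longlongrightarrow> A ?v d) (at_right 0)"
  proof -
    have "((\<lambda>\<epsilon>. ?v + of_real \<epsilon> * d) has_derivative (\<lambda>\<epsilon>. of_real \<epsilon> * d)) (at 0)"
      by (auto intro!: derivative_eq_intros)
    moreover have "(h has_derivative A ?v) (at (?v + of_real 0 * d))" using h_deriv by simp
    ultimately have "(h \<circ> (\<lambda>\<epsilon>. ?v + of_real \<epsilon> * d) has_derivative A ?v \<circ> (\<lambda>\<epsilon>. of_real \<epsilon> * d)) (at 0)"
      by (rule diff_chain_at)
    moreover have "A ?v \<circ> (\<lambda>\<epsilon>. of_real \<epsilon> * d) = (\<lambda>\<epsilon>. \<epsilon> *\<^sub>R A ?v d)"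
      using bl by (auto simp: scaleR_conv_of_real[symmetric] linear_scale bounded_linear.linear)
    ultimately have "((\<lambda>\<epsilon>. h (?v + of_real \<epsilon> * d)) has_vector_derivative A ?v d) (at 0)"
      by (simp add: has_vector_derivative_def o_def)
    then have "((\<lambda>\<epsilon>. (h (?v + of_real \<epsilon> * d) - h (?v + of_real 0 * d) - (\<epsilon> - 0) *\<^sub>R A ?v d) /\<^sub>R norm (\<epsilon> - 0))
        \<longlongrightarrow> 0) (at 0)"
      by (simp add: has_vector_derivative_def has_derivative_at_within)
    then have "((\<lambda>\<epsilon>. (h (?v + of_real \<epsilon> * d) - h ?v - \<epsilon> *\<^sub>R A ?v d) /\<^sub>R \<bar>\<epsilon>\<bar>) \<longlongrightarrow> 0) (at_right 0)"
      by (auto intro: tendsto_mono at_le)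
    moreover have "\<forall>\<^sub>F \<epsilon> in at_right (0::real). (h (?v + of_real \<epsilon> * d) - h ?v - \<epsilon> *\<^sub>R A ?v d) /\<^sub>R \<bar>\<epsilon>\<bar> =
        (h (?v + of_real \<epsilon> * d) - h ?v) /\<^sub>R \<epsilon> - A ?v d"
      unfolding eventually_at_right_field by (intro exI[of _ 1]) (auto simp: scaleR_right_diff_distrib)
    ultimately have "((\<lambda>\<epsilon>. (h (?v + of_real \<epsilon> * d) - h ?v) /\<^sub>R \<epsilon> - A ?v d) \<longlongrightarrow> 0) (at_right 0)"
      by (rule Lim_transform_eventually)
    then show ?thesis by (simp add: LIM_zero_iff)
  qed
  from new.dsh_curve[OF T this]
  have e1: "\<forall>\<^sub>F \<epsilon> in at_right 0. h (?v + of_real \<epsilon> * d) \<in> shaded D' \<longleftrightarrow> dsh D' (h ?v) (A ?v d)" .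
  have hs: "h z \<in> shaded D' \<longleftrightarrow> z \<in> shaded D" for z
    using h_bij by (auto simp: shaded_eq bij_def dest: injD)
  have "\<forall>\<^sub>F \<epsilon> in at_right 0. ?v + of_real \<epsilon> * d \<in> shaded D \<longleftrightarrow> dsh D ?v d"
    using old.transversal_crossing[OF dp] d by (intro old.dsh_eventually) simp
  with e1 have "\<forall>\<^sub>F \<epsilon> in at_right (0::real). dsh D' (h ?v) (A ?v d) \<longleftrightarrow> dsh D ?v d"
    by eventually_elim (simp add: hs)
  then show ?thesis by (simp add: eventually_const_iff)
qed

text \<open>Both symbols are written as \<open>cr\<close> with respect to corresponding branches;
  positivity of the pair of directions carries over because \<open>A\<close> preserves
  orientation.\<close>

lemma gsymb_\<Phi>:
  assumes v: "v \<in> crossings D"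
  shows "req (map_symb (image \<Phi>) (gsymb D (arc {q. crossing_param D q}) v))
    (gsymb D' (arc {q. crossing_param D' q}) (h v))"
proof -
  let ?X = "{q. crossing_param D q}" and ?X' = "{q. crossing_param D' q}"
  obtain p q where dp: "double_point D p q" and pv: "pt D p = v"
    using old.crossing_reps[OF v] by blast
  have p: "p \<in> params D" "q \<in> params D" "pt D q = v"
    using dp pv by (auto simp: double_point_def)
  have cp: "crossing_param D p" using dp unfolding crossing_param_def by blast
  \<comment> \<open>Chosen so that the directions of \<open>p\<close> and \<open>q\<close> form a
    positive pair.\<close>
  define \<sigma> where "\<sigma> \<longleftrightarrow> cdet (vel D p) (vel D q) > 0"
  have nz: "cdet (vel D p) (vel D q) \<noteq> 0" using old.double_point_transversal[OF dp] .
  then have pos: "cdet (dir D True p) (dir D \<sigma> q) > 0" by (auto simp: dir_def \<sigma>_def)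
  let ?d = "1 *\<^sub>R dir D True p + 1 *\<^sub>R dir D \<sigma> q"
  obtain a where a: "a > 0" "A v (dir D True p) = a *\<^sub>R dir D' (True = up (fst p)) (\<Phi> p)"
    using dir_\<Phi>[OF p(1), of True] pv by blast
  obtain b where b: "b > 0" "A v (dir D \<sigma> q) = b *\<^sub>R dir D' (\<sigma> = up (fst q)) (\<Phi> q)"
    using dir_\<Phi>[OF p(2), of \<sigma>] p(3) by blast
  have lin: "linear (A v)" using h_deriv by (rule has_derivative_linear)
  obtain k where k: "k > 0" "\<And>u w. cdet (A v u) (A v w) = k * cdet u w" using A_pos by blast
  have dp': "double_point D' (\<Phi> p) (\<Phi> q)" using double_point_\<Phi> p dp by simp
  have lab: "arc ?X f r' = arc ?X f r" if r: "crossing_param D r" "same_param r r'" for f r r'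
  proof -
    have c: "cuts D [] = ?X" by (simp add: cuts_def)
    have "r \<in> cuts D []" using r(1) c by simp
    from cut_set.arc_same[OF old.cut_set_cuts this r(2), of f] show ?thesis unfolding c .
  qed
  have lab': "arc ?X' f r' = arc ?X' f r" if r: "crossing_param D' r" "same_param r r'" for f r r'
  proof -
    have c: "cuts D' [] = ?X'" by (simp add: cuts_def)
    have "r \<in> cuts D' []" using r(1) c by simp
    from cut_set.arc_same[OF new.cut_set_cuts this r(2), of f] show ?thesis unfolding c .
  qed
  have 1: "req (gsymb D (arc ?X) (pt D p)) (cr (arc ?X True p) (arc ?X \<sigma> q) (arc ?X (\<not> True) p) (arc ?X (\<not> \<sigma>) q)
      (p \<in> over D) (dsh D (pt D p) ?d))"
    by (rule old.gsymb_cr[OF dp lab pos _ _ refl]) auto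
  have "0 < k * cdet (dir D True p) (dir D \<sigma> q)" using k(1) pos by simp
  also have "\<dots> = (a * b) * cdet (dir D' (True = up (fst p)) (\<Phi> p)) (dir D' (\<sigma> = up (fst q)) (\<Phi> q))"
    unfolding k(2)[symmetric] a b by simp
  finally have pos': "cdet (dir D' (True = up (fst p)) (\<Phi> p)) (dir D' (\<sigma> = up (fst q)) (\<Phi> q)) > 0"
    using mult_pos_pos[OF a(1) b(1)] by (simp add: zero_less_mult_iff not_less[symmetric])
  have Ad: "A v ?d = a *\<^sub>R dir D' (True = up (fst p)) (\<Phi> p) + b *\<^sub>R dir D' (\<sigma> = up (fst q)) (\<Phi> q)"
    using lin a b by (simp add: linear_add)
  have 2: "req (gsymb D' (arc ?X') (pt D' (\<Phi> p)))
      (cr (arc ?X' (True = up (fst p)) (\<Phi> p)) (arc ?X' (\<sigma> = up (fst q)) (\<Phi> q))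
        (arc ?X' (\<not> (True = up (fst p))) (\<Phi> p)) (arc ?X' (\<not> (\<sigma> = up (fst q))) (\<Phi> q))
        (\<Phi> p \<in> over D') (dsh D' (pt D' (\<Phi> p)) (A v ?d)))"
    by (rule new.gsymb_cr[OF dp' lab' pos' a(1) b(1) Ad])
  have not: "(\<not> (f = up j)) = ((\<not> f) = up j)" for f j by auto
  have dsh: "dsh D' (pt D' (\<Phi> p)) (A v ?d) \<longleftrightarrow> dsh D (pt D p) ?d"
  proof -
    have "cdet (vel D p) ?d \<noteq> 0" "cdet (vel D q) ?d \<noteq> 0"
      using nz cdet_anti[of "vel D q" "vel D p"] by (auto simp: dir_def)
    from dsh_image[OF dp this] show ?thesis using pt_\<Phi>[OF p(1)] pv by simp
  qed
  have ov: "\<Phi> p \<in> over D' \<longleftrightarrow> p \<in> over D"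
    using over_eq[of "fst p" "snd p"] cp p(1) by (simp add: \<Phi>_def old.params_iff)
  have "req (map_symb (image \<Phi>) (gsymb D (arc ?X) v))
      (map_symb (image \<Phi>) (cr (arc ?X True p) (arc ?X \<sigma> q) (arc ?X (\<not> True) p) (arc ?X (\<not> \<sigma>) q)
      (p \<in> over D) (dsh D (pt D p) ?d)))"
    using map_symb_req[OF 1] pv by simp
  moreover have "req (cr (arc ?X' (True = up (fst p)) (\<Phi> p)) (arc ?X' (\<sigma> = up (fst q)) (\<Phi> q))
        (arc ?X' (\<not> (True = up (fst p))) (\<Phi> p)) (arc ?X' (\<not> (\<sigma> = up (fst q))) (\<Phi> q))
        (\<Phi> p \<in> over D') (dsh D' (pt D' (\<Phi> p)) (A v ?d))) (gsymb D' (arc ?X') (h v))"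
    using req_sym[OF 2] pt_\<Phi>[OF p(1)] pv by simp
  ultimately show ?thesis
    unfolding map_symb_cr not arc_\<Phi>[OF p(1)] arc_\<Phi>[OF p(2)] dsh ov by (rule req_trans)
qed

text \<open>The state sum itself is preserved, not only its residue class: labels are transported by
  the injective map \<open>\<Phi>\<close>, and uncut components correspond under
  \<open>\<pi>\<close>.\<close>

theorem state_sum_isotopy: "state_sum D' = state_sum D"
proof -
  let ?X = "{q. crossing_param D q}" and ?X' = "{q. crossing_param D' q}"
  have cuts: "cuts D [] = ?X" "cuts D' [] = ?X'" by (auto simp: cuts_def)
  obtain vs where vs: "set vs = crossings D" "distinct vs"
    using finite_distinct_list[OF old.finite_crossings] by blast
  have h_inj: "inj h" using h_bij by (simp add: bij_def)
  have vs': "set (map h vs) = crossings D'" "distinct (map h vs)"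
    using vs crossings_eq h_inj by (auto simp: distinct_map intro: inj_on_subset)
  have marks: "marks D []" "marks D' []" by (simp_all add: marks_def)
  let ?S = "marked_symbols D vs []" and ?S' = "marked_symbols D' (map h vs) []"
  have bal: "balanced (plabs ?S)" by (rule old.balanced_marked_symbols[OF vs(2,1) marks(1)])
  have "?S = map (gsymb D (arc ?X)) vs" "?S' = map (\<lambda>v. gsymb D' (arc ?X') (h v)) vs"
    by (simp_all add: marked_symbols_def cuts)
  moreover have "list_all2 req (map (map_symb (image \<Phi>)) (map (gsymb D (arc ?X)) ws))
      (map (\<lambda>v. gsymb D' (arc ?X') (h v)) ws)" if "set ws \<subseteq> crossings D" for ws
    using that by (induction ws) (auto intro: gsymb_\<Phi>)
  ultimately have req: "list_all2 req (map (map_symb (image \<Phi>)) ?S) ?S'" using vs(1) by simp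
  have par: "E \<subseteq> params D" if "E \<in># plabs ?S" for E
  proof -
    from that obtain v where v: "v \<in> set vs" "E \<in># slabs (gsymb D (arc ?X) v)"
      by (auto simp: marked_symbols_def cuts plabs_def)
    have "underpass D v \<in> params D" "overpass D v \<in> params D"
      using old.crossing_reps(1)[of v] v(1) vs(1) by (auto simp: double_point_def)
    moreover have "E = arc ?X True (underpass D v) \<or> E = arc ?X False (underpass D v) \<or>
        E = arc ?X True (overpass D v) \<or> E = arc ?X False (overpass D v)"
      using v(2) by (auto simp: old.slabs_gsymb)
    ultimately have "\<exists>f p. p \<in> params D \<and> E = arc ?X f p" by blast
    then show ?thesis by (auto simp: arc_def old.params_iff same_param_def)
  qed
  have "inj_on \<Phi> (params D)"
  proof (rule inj_onI)
    fix p q assume *: "p \<in> params D" "q \<in> params D" "\<Phi> p = \<Phi> q"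
    then have "fst p = fst q" using \<pi>_inj by (simp add: \<Phi>_def old.params_iff)
    with * show "p = q" using \<phi>_inj by (auto simp: \<Phi>_def old.params_iff prod_eq_iff)
  qed
  then have inj: "inj_on (image \<Phi>) (set_mset (plabs ?S))"
    using par by (intro inj_onI) (meson inj_on_image_eq_iff)
  have bal2: "balanced (plabs (map (map_symb (image \<Phi>)) ?S))"
    using plabs_req[OF req] new.balanced_marked_symbols[OF vs'(2,1) marks(2)] by simp
  have "bracket ?S' = bracket (map (map_symb (image \<Phi>)) ?S)"
    using expand_req[OF req, of "[]"] bal2 by (simp add: bracket_def)
  also have "\<dots> = bracket ?S" by (rule bracket_map_inj[OF inj])
  finally have br: "bracket ?S' = bracket ?S" .
  have "uncut D' ?X' = \<pi> ` uncut D ?X"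
  proof -
    have c: "(\<forall>s. \<not> crossing_param D' (\<pi> i, s)) \<longleftrightarrow> (\<forall>s. \<not> crossing_param D (i, s))" if "i < ncomp D" for i
    proof -
      have "(\<forall>s. \<not> crossing_param D' (\<pi> i, s)) \<longleftrightarrow> (\<forall>s. \<not> crossing_param D' (\<pi> i, \<phi> i s))"
        using \<phi>_surj[OF that] by (metis surjD)
      also have "\<dots> \<longleftrightarrow> (\<forall>s. \<not> crossing_param D (i, s))"
        using crossing_param_\<Phi>[of "(i, _)"] that by (simp add: \<Phi>_def old.params_iff)
      finally show ?thesis .
    qed
    have "{..<ncomp D'} = \<pi> ` {..<ncomp D}" using \<pi>_bij by (simp add: bij_betw_def)
    then have "j < ncomp D' \<longleftrightarrow> (\<exists>i<ncomp D. j = \<pi> i)" for j by (auto simp: set_eq_iff)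
    then show ?thesis using c by (auto simp: uncut_def)
  qed
  moreover have "inj_on \<pi> (uncut D ?X)" using \<pi>_inj by (auto simp: inj_on_def uncut_def)
  ultimately have "card (uncut D' ?X') = card (uncut D ?X)" by (simp add: card_image)
  then show ?thesis
    using old.state_sum_marked[OF vs(2,1) marks(1)] new.state_sum_marked[OF vs'(2,1) marks(2)] br cuts
    by simp
qed

end

theorem state_sum_planar_isotopic:
  assumes "planar_isotopic D D'"
  shows "state_sum D' = state_sum D"
proof -
  have ld: "shaded_link_diagram D" "shaded_link_diagram D'" using assms by (auto simp: planar_isotopic_def)
  obtain H \<pi> \<phi> where H: "ambient_isotopy H" "bij_betw \<pi> {..<ncomp D} {..<ncomp D'}"
    "\<And>i. i < ncomp D \<Longrightarrow> reparametrisation (\<phi> i)"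
    "\<And>i s. i < ncomp D \<Longrightarrow> curve D' (\<pi> i) (\<phi> i s) = H 1 (curve D i s)"
    "\<And>i s. i < ncomp D \<Longrightarrow> crossing_param D (i, s) \<Longrightarrow> (\<pi> i, \<phi> i s) \<in> over D' \<longleftrightarrow> (i, s) \<in> over D"
    "shaded D' = H 1 ` shaded D"
    using assms unfolding planar_isotopic_def by blast
  obtain A where A: "\<And>z. (H 1 has_derivative A z) (at z)"
    "\<And>z. \<exists>k>0. \<forall>u w. cdet (A z u) (A z w) = k * cdet u w"
    using ambient_isotopy_orientation[OF H(1)] by blast
  have "\<exists>up. (\<forall>s t. \<phi> i s < \<phi> i t \<longleftrightarrow> (if up then s < t else t < s)) \<and>
      (\<forall>s n. \<phi> i (s + of_int n) = \<phi> i s + of_int (if up then n else - n)) \<and> surj (\<phi> i) \<and>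
      (\<forall>s. \<exists>d>0. (\<phi> i has_real_derivative (if up then d else - d)) (at s))" if "i < ncomp D" for i
    using reparametrisation_monotone[OF H(3)[OF that]] by metis
  then obtain up where up: "\<And>i. i < ncomp D \<Longrightarrow> (\<forall>s t. \<phi> i s < \<phi> i t \<longleftrightarrow> (if up i then s < t else t < s)) \<and>
      (\<forall>s n. \<phi> i (s + of_int n) = \<phi> i s + of_int (if up i then n else - n)) \<and> surj (\<phi> i) \<and>
      (\<forall>s. \<exists>d>0. (\<phi> i has_real_derivative (if up i then d else - d)) (at s))" by metis
  have "bij (H 1)" using H(1) by (simp add: ambient_isotopy_def)
  interpret isotopy D D' "H 1" A \<pi> \<phi> up
    by unfold_locales (use ld H A up \<open>bij (H 1)\<close> in \<open>auto simp: shaded_link_diagram_def\<close>)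
  show ?thesis by (rule state_sum_isotopy)
qed

section \<open>Reidemeister moves in the square\<close>

lemma sim_contract_ctx:
  assumes "a \<noteq> b" "balanced (plabs (Con a b # S @ P))" "b \<notin># plabs P"
  shows "sim (Con a b # S @ P) (map (map_symb (ren b a)) S @ P)"
proof -
  have "map (map_symb (ren b a)) P = P"
    using assms(3) by (auto intro!: map_map_symb_ident_on simp: ren_def)
  then show ?thesis using sim_contract[of a b "S @ P"] assms by simp
qed

text \<open>
  \<open>a\<close>, \<open>b\<close>, \<open>c\<close> are the strands 0, 1, 2 of the local pictures; \<open>a0, a1, a2, a3\<close> are the arcs
  of a strand from left to right, cut at \<open>-1/2, 0, 1/2\<close>.
\<close>

lemma R2_marked:
  assumes d: "distinct [a0, a1, a2, a3, b0, b1, b2, b3]"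
    and bal: "balanced (plabs ([cr a1 b0 a0 b1 (\<not> pover) n, cr b3 a2 b2 a3 pover n, Con a1 a2, Con b1 b2] @ P))"
  shows "sim ([cr a1 b0 a0 b1 (\<not> pover) n, cr b3 a2 b2 a3 pover n, Con a1 a2, Con b1 b2] @ P)
    ([Con a0 a1, Con a1 a2, Con a2 a3, Con b0 b1, Con b1 b2, Con b2 b3] @ P)"
proof -
  let ?S = "[cr a1 b0 a0 b1 (\<not> pover) n, cr b3 a2 b2 a3 pover n]"
  have notin: "a1 \<notin># plabs P" "a2 \<notin># plabs P" "b1 \<notin># plabs P" "b2 \<notin># plabs P"
    using balanced_count_0[of "plabs (?S @ [Con a1 a2, Con b1 b2])" "plabs P"] bal d by auto
  have "sim ([cr a1 b0 a0 b1 (\<not> pover) n, cr b3 a2 b2 a3 pover n, Con a1 a2, Con b1 b2] @ P)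
      ([Con a1 a2, Con b1 b2] @ ?S @ P)"
    using bal by (intro sim_mset) auto
  also have "sim \<dots> (map (map_symb (ren b2 b1 \<circ> ren a2 a1)) ?S @ P)"
    using calculation d notin by (intro sim_contract2) (auto simp: sim_def)
  also have "map (map_symb (ren b2 b1 \<circ> ren a2 a1)) ?S =
      [cr a1 b0 a0 b1 (\<not> pover) n, cr b3 a1 b1 a3 pover n]"
    using d by (auto simp: ren_def)
  \<comment> \<open>A quarter turn of each crossing brings the bigon into the form of
    \<open>sim_R2\<close>.\<close>
  also have "sim (\<dots> @ P) ([cr b0 a0 b1 a1 pover (\<not> n), cr a3 b3 a1 b1 (\<not> pover) (\<not> n)] @ P)"
    using calculation req_cr1[of a1 b0 a0 b1 "\<not> pover" n]
      req_sym[OF req_cr1[of a3 b3 a1 b1 "\<not> pover" "\<not> n"]]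
    by (intro sim_req) (auto simp: sim_def list_all2_refl)
  also have "sim \<dots> ([Con b0 b3, Con a0 a3] @ P)"
    using calculation d by (intro sim_R2) (auto simp: sim_def)
  finally have 1: "sim ([cr a1 b0 a0 b1 (\<not> pover) n, cr b3 a2 b2 a3 pover n, Con a1 a2, Con b1 b2] @ P)
      ([Con b0 b3, Con a0 a3] @ P)" .
  \<comment> \<open>The picture without crossings contracts to the same pair of arcs.\<close>
  have bal': "balanced (plabs ([Con a0 a1, Con a1 a2, Con a2 a3, Con b0 b1, Con b1 b2, Con b2 b3] @ P))"
    using bal by (simp add: add_mset_commute)
  have "sim ([Con a0 a1, Con a1 a2, Con a2 a3, Con b0 b1, Con b1 b2, Con b2 b3] @ P)
      ([Con b0 b1, Con a0 a1] @ [Con a1 a2, Con a2 a3, Con b1 b2, Con b2 b3] @ P)"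
    using bal' by (intro sim_mset) auto
  also have "sim \<dots> (map (map_symb (ren a1 a0 \<circ> ren b1 b0)) [Con a1 a2, Con a2 a3, Con b1 b2, Con b2 b3] @ P)"
    using calculation d notin by (intro sim_contract2) (auto simp: sim_def)
  also have "map (map_symb (ren a1 a0 \<circ> ren b1 b0)) [Con a1 a2, Con a2 a3, Con b1 b2, Con b2 b3] =
      [Con a0 a2, Con a2 a3, Con b0 b2, Con b2 b3]"
    using d by (auto simp: ren_def)
  also have "sim (\<dots> @ P) ([Con b0 b2, Con a0 a2] @ [Con b2 b3, Con a2 a3] @ P)"
    using calculation by (intro sim_mset) (auto simp: sim_def)
  also have "sim \<dots> (map (map_symb (ren a2 a0 \<circ> ren b2 b0)) [Con b2 b3, Con a2 a3] @ P)"
    using calculation d notin by (intro sim_contract2) (auto simp: sim_def)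
  also have "map (map_symb (ren a2 a0 \<circ> ren b2 b0)) [Con b2 b3, Con a2 a3] = [Con b0 b3, Con a0 a3]"
    using d by (auto simp: ren_def)
  finally show ?thesis using 1 sim_sym sim_trans by blast
qed

text \<open>Counterclockwise from the right, the ends of the strands are c3, a3, b0, c0, a0, b3; so
  the first, second and third strand of the triangles are \<open>c\<close>, \<open>a\<close>,
  \<open>b\<close>. Contracting the marks leaves different inner labels on the two sides, for which
  \<open>sim_R3\<close> allows.\<close>

lemma R3_marked:
  fixes a0 a1 a2 a3 b0 b1 b2 b3 c0 c1 c2 c3 :: 'l
  assumes d: "distinct [a0, a1, a2, a3, b0, b1, b2, b3, c0, c1, c2, c3]"
    and o: "\<not> (o12 = o31 \<and> o31 = o23)"
    and bal: "balanced (plabs ([cr a3 c2 a2 c3 (\<not> o12) n, cr c1 b0 c0 b1 (\<not> o31) n,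
        cr a1 b2 a2 b1 o23 (\<not> n), Con a0 a1, Con b2 b3, Con c1 c2] @ P))"
  shows "sim ([cr a3 c2 a2 c3 (\<not> o12) n, cr c1 b0 c0 b1 (\<not> o31) n,
        cr a1 b2 a2 b1 o23 (\<not> n), Con a0 a1, Con b2 b3, Con c1 c2] @ P)
     ([cr c2 b3 c3 b2 (\<not> o31) (\<not> n), cr a2 b1 a1 b2 o23 n,
        cr a0 c1 a1 c0 (\<not> o12) (\<not> n), Con a2 a3, Con b0 b1, Con c1 c2] @ P)"
proof -
  let ?S = "[cr a3 c2 a2 c3 (\<not> o12) n, cr c1 b0 c0 b1 (\<not> o31) n, cr a1 b2 a2 b1 o23 (\<not> n)]"
  let ?L = "?S @ [Con a0 a1, Con b2 b3, Con c1 c2]"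
  let ?S' = "[cr c2 b3 c3 b2 (\<not> o31) (\<not> n), cr a2 b1 a1 b2 o23 n, cr a0 c1 a1 c0 (\<not> o12) (\<not> n)]"
  let ?R = "?S' @ [Con a2 a3, Con b0 b1, Con c1 c2]"
  have lab: "plabs ?L = plabs ?R" by (simp add: add_mset_commute)
  have bL: "balanced (plabs (?L @ P))" using bal by simp
  then have bR: "balanced (plabs (?R @ P))" unfolding plabs_simps(3)[of _ P] lab .
  have notin: "a1 \<notin># plabs P" "a2 \<notin># plabs P" "b1 \<notin># plabs P" "b2 \<notin># plabs P"
    "c1 \<notin># plabs P" "c2 \<notin># plabs P"
    using balanced_count_0[of "plabs ?L" "plabs P"] bL d by auto
  have "sim (?L @ P) ([Con c1 c2, Con a0 a1] @ (Con b2 b3 # ?S) @ P)"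
    using bL by (intro sim_mset) auto
  also have "sim \<dots> (map (map_symb (ren a1 a0 \<circ> ren c2 c1)) (Con b2 b3 # ?S) @ P)"
    using calculation d notin by (intro sim_contract2) (auto simp: sim_def)
  also have "map (map_symb (ren a1 a0 \<circ> ren c2 c1)) (Con b2 b3 # ?S) =
      Con b2 b3 # [cr a3 c1 a2 c3 (\<not> o12) n, cr c1 b0 c0 b1 (\<not> o31) n, cr a0 b2 a2 b1 o23 (\<not> n)]"
    using d by (auto simp: ren_def)
  also have "sim ((Con b2 b3 # [cr a3 c1 a2 c3 (\<not> o12) n, cr c1 b0 c0 b1 (\<not> o31) n, cr a0 b2 a2 b1 o23 (\<not> n)]) @ P)
      (Con b3 b2 # [cr c3 a3 c1 a2 o12 (\<not> n), cr b0 c0 b1 c1 o31 (\<not> n), cr a0 b2 a2 b1 o23 (\<not> n)] @ P)"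
    using calculation req_sym[OF req_cr1[of c3 a3 c1 a2 o12 "\<not> n"]] req_cr1[of c1 b0 c0 b1 "\<not> o31" n]
      req_rot2(1)[of "Con b2 b3"]
    by (intro sim_req) (auto simp: sim_def list_all2_refl)
  also have "sim \<dots> (map (map_symb (ren b2 b3)) [cr c3 a3 c1 a2 o12 (\<not> n), cr b0 c0 b1 c1 o31 (\<not> n),
      cr a0 b2 a2 b1 o23 (\<not> n)] @ P)"
    using calculation d notin by (intro sim_contract_ctx) (auto simp: sim_def)
  also have "map (map_symb (ren b2 b3)) [cr c3 a3 c1 a2 o12 (\<not> n), cr b0 c0 b1 c1 o31 (\<not> n),
      cr a0 b2 a2 b1 o23 (\<not> n)] = triangle_L c3 a3 b0 c0 a0 b3 a2 c1 b1 o12 o31 o23 (\<not> n)"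
    using d by (auto simp: ren_def triangle_L_def)
  finally have 1: "sim (?L @ P) (triangle_L c3 a3 b0 c0 a0 b3 a2 c1 b1 o12 o31 o23 (\<not> n) @ P)" .
  have "sim (?R @ P) ([Con c1 c2, Con b0 b1] @ (Con a2 a3 # ?S') @ P)"
    using bR by (intro sim_mset) auto
  also have "sim \<dots> (map (map_symb (ren b1 b0 \<circ> ren c2 c1)) (Con a2 a3 # ?S') @ P)"
    using calculation d notin by (intro sim_contract2) (auto simp: sim_def)
  also have "map (map_symb (ren b1 b0 \<circ> ren c2 c1)) (Con a2 a3 # ?S') =
      Con a2 a3 # [cr c1 b3 c3 b2 (\<not> o31) (\<not> n), cr a2 b0 a1 b2 o23 n, cr a0 c1 a1 c0 (\<not> o12) (\<not> n)]"
    using d by (auto simp: ren_def)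
  also have "sim ((Con a2 a3 # [cr c1 b3 c3 b2 (\<not> o31) (\<not> n), cr a2 b0 a1 b2 o23 n, cr a0 c1 a1 c0 (\<not> o12) (\<not> n)]) @ P)
      (Con a3 a2 # [cr b3 c3 b2 c1 o31 n, cr a2 b0 a1 b2 o23 n, cr c0 a0 c1 a1 o12 n] @ P)"
    using calculation req_cr1[of c1 b3 c3 b2 "\<not> o31" "\<not> n"] req_sym[OF req_cr1[of c0 a0 c1 a1 o12 n]]
      req_rot2(1)[of "Con a2 a3"]
    by (intro sim_req) (auto simp: sim_def list_all2_refl)
  also have "sim \<dots> (map (map_symb (ren a2 a3)) [cr b3 c3 b2 c1 o31 n, cr a2 b0 a1 b2 o23 n,
      cr c0 a0 c1 a1 o12 n] @ P)"
    using calculation d notin by (intro sim_contract_ctx) (auto simp: sim_def)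
  also have "map (map_symb (ren a2 a3)) [cr b3 c3 b2 c1 o31 n, cr a2 b0 a1 b2 o23 n,
      cr c0 a0 c1 a1 o12 n] = triangle_R c3 a3 b0 c0 a0 b3 a1 c1 b2 o12 o31 o23 (\<not> n)"
    using d by (auto simp: ren_def triangle_R_def)
  finally have 2: "sim (?R @ P) (triangle_R c3 a3 b0 c0 a0 b3 a1 c1 b2 o12 o31 o23 (\<not> n) @ P)" .
  have "sim (triangle_L c3 a3 b0 c0 a0 b3 a2 c1 b1 o12 o31 o23 (\<not> n) @ P)
      (triangle_R c3 a3 b0 c0 a0 b3 a1 c1 b2 o12 o31 o23 (\<not> n) @ P)"
    using 1 2 d by (intro sim_R3 o) (auto simp: sim_def)
  with 1 2 have "sim (?L @ P) (?R @ P)" using sim_trans sim_sym by meson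
  then show ?thesis by simp
qed

lemma Complex_in_square: "Complex x y \<in> square \<longleftrightarrow> \<bar>x\<bar> \<le> 1 \<and> \<bar>y\<bar> \<le> 1"
  by (simp add: square_def)

lemma closed_square: "closed square"
  unfolding square_def by (intro closed_Collect_conj closed_Collect_le continuous_intros)

text \<open>One of the two pictures of a move. By \<open>f_meet\<close> strands can meet only at the
  abscissas -1/2, 0, 1/2, the same for all pictures.\<close>

locale strands = checkered D for D +
  fixes m :: nat and K :: "nat \<Rightarrow> nat \<times> real \<times> real" and ht :: "nat \<Rightarrow> nat"
    and f f' :: "nat \<Rightarrow> real \<Rightarrow> real"
  assumes inj_ht: "inj_on ht {..<m}"
    and strands: "strands_in_square m K ht f D"
    and outside: "p \<in> params D \<Longrightarrow>
      (\<exists>k<m. \<exists>x\<in>{-1..1}. same_param p (strand_param (K k) x)) \<or> pt D p \<notin> square"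
    and f_bound: "k < m \<Longrightarrow> \<bar>x\<bar> \<le> 1 \<Longrightarrow> \<bar>f k x\<bar> < 1"
    and f_deriv: "k < m \<Longrightarrow> \<bar>x\<bar> < 1 \<Longrightarrow> (f k has_real_derivative f' k x) (at x)"
    and f_meet: "k < m \<Longrightarrow> l < m \<Longrightarrow> k \<noteq> l \<Longrightarrow> \<bar>x\<bar> \<le> 1 \<Longrightarrow> f k x = f l x \<Longrightarrow> x \<in> {-1/2, 0, 1/2}"
begin

abbreviation sp :: "nat \<Rightarrow> real \<Rightarrow> nat \<times> real" where
  "sp k x \<equiv> strand_param (K k) x"

definition ix :: "nat \<Rightarrow> nat" where "ix k = fst (K k)"
definition slope :: "nat \<Rightarrow> real" where "slope k = snd (snd (K k))"
definition start :: "nat \<Rightarrow> real" where "start k = fst (snd (K k))"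

lemma sp_eq: "sp k x = (ix k, start k + slope k * x)"
  by (simp add: strand_param_def ix_def slope_def start_def split: prod.splits)

lemma ix_less: "k < m \<Longrightarrow> ix k < ncomp D"
  and slope_nz: "k < m \<Longrightarrow> slope k \<noteq> 0"
  and pt_sp: "k < m \<Longrightarrow> \<bar>x\<bar> \<le> 1 \<Longrightarrow> pt D (sp k x) = Complex x (f k x)"
  and sp_over: "k < m \<Longrightarrow> l < m \<Longrightarrow> \<bar>x\<bar> \<le> 1 \<Longrightarrow> k \<noteq> l \<Longrightarrow> f k x = f l x \<Longrightarrow> sp k x \<in> over D \<longleftrightarrow> ht l < ht k"
proof -
  have I: "x \<in> {-1..1}" if "\<bar>x\<bar> \<le> 1" for x :: real using that by auto
  note st = strands[unfolded strands_in_square_def]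
  show "k < m \<Longrightarrow> ix k < ncomp D" "k < m \<Longrightarrow> slope k \<noteq> 0"
    using st unfolding ix_def slope_def by blast+
  show "k < m \<Longrightarrow> \<bar>x\<bar> \<le> 1 \<Longrightarrow> pt D (sp k x) = Complex x (f k x)" using st I by blast
  show "k < m \<Longrightarrow> l < m \<Longrightarrow> \<bar>x\<bar> \<le> 1 \<Longrightarrow> k \<noteq> l \<Longrightarrow> f k x = f l x \<Longrightarrow> sp k x \<in> over D \<longleftrightarrow> ht l < ht k"
    using st I by blast
qed

lemma ht_neq: "k < m \<Longrightarrow> l < m \<Longrightarrow> k \<noteq> l \<Longrightarrow> ht k \<noteq> ht l"
  using inj_ht by (auto simp: inj_on_def)

lemma sp_params: "k < m \<Longrightarrow> sp k x \<in> params D"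
  by (simp add: params_iff sp_eq ix_less)

lemma pt_sp_square: "k < m \<Longrightarrow> \<bar>x\<bar> \<le> 1 \<Longrightarrow> pt D (sp k x) \<in> square"
  using f_bound[of k x] by (simp add: pt_sp Complex_in_square)

definition on_strand :: "nat \<times> real \<Rightarrow> bool" where
  "on_strand p \<longleftrightarrow> (\<exists>k<m. \<exists>x. \<bar>x\<bar> \<le> 1 \<and> same_param p (sp k x))"

lemma on_strand_iff:
  assumes "p \<in> params D"
  shows "on_strand p \<longleftrightarrow> pt D p \<in> square"
proof
  assume "on_strand p"
  then obtain k x where "k < m" "\<bar>x\<bar> \<le> 1" "same_param p (sp k x)" by (auto simp: on_strand_def)
  then show "pt D p \<in> square" using pt_same[OF assms, of "sp k x"] pt_sp_square by metis
next
  assume "pt D p \<in> square"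
  then show "on_strand p" using outside[OF assms] by (force simp: on_strand_def)
qed

text \<open>A parameter shared by two strands would belong to a meeting point at which, the heights
  being different, it would have to lie on the overpass and not lie on it.\<close>

lemma sp_same:
  assumes kl: "k < m" "l < m" and xy: "\<bar>x\<bar> \<le> 1" "\<bar>y\<bar> \<le> 1" and s: "same_param (sp k x) (sp l y)"
  shows "k = l" "x = y"
proof -
  have "pt D (sp l y) = pt D (sp k x)" using pt_same[OF sp_params[OF kl(1)] s] .
  then have *: "x = y" "f k x = f l x" using pt_sp kl xy by auto
  then show "x = y" by blast
  show "k = l"
  proof (rule ccontr)
    assume ne: "k \<noteq> l"
    have "ht k < ht l \<longleftrightarrow> ht l < ht k"
      using over_same[OF s] sp_over[of k l x] sp_over[of l k x] kl xy ne * by simp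
    then show False using ht_neq[OF kl ne] by linarith
  qed
qed

lemma double_point_sp:
  assumes "k < m" "l < m" "\<bar>x\<bar> \<le> 1" "k \<noteq> l" "f k x = f l x"
  shows "double_point D (sp k x) (sp l x)"
  using assms sp_same[of k l x x] by (auto simp: double_point_def sp_params pt_sp)

lemma crossing_sp_iff:
  assumes "k < m" "\<bar>x\<bar> \<le> 1"
  shows "crossing_param D (sp k x) \<longleftrightarrow> (\<exists>l<m. l \<noteq> k \<and> f k x = f l x)"
proof
  assume "crossing_param D (sp k x)"
  then obtain q where q: "double_point D (sp k x) q" by (auto simp: crossing_param_def)
  then have qp: "q \<in> params D" "pt D q = pt D (sp k x)" "\<not> same_param (sp k x) q"
    by (auto simp: double_point_def)
  then have "on_strand q" using on_strand_iff pt_sp_square assms by simp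
  then obtain l y where l: "l < m" "\<bar>y\<bar> \<le> 1" "same_param q (sp l y)" by (auto simp: on_strand_def)
  have "pt D (sp l y) = pt D (sp k x)" using pt_same[OF qp(1) l(3)] qp(2) by simp
  then have "x = y" "f k x = f l x" using pt_sp assms l by auto
  moreover have "l \<noteq> k" using qp(3) l(3) \<open>x = y\<close> same_param_sym by blast
  ultimately show "\<exists>l<m. l \<noteq> k \<and> f k x = f l x" using l(1) by blast
next
  assume "\<exists>l<m. l \<noteq> k \<and> f k x = f l x"
  then show "crossing_param D (sp k x)"
    using double_point_sp assms unfolding crossing_param_def by blast
qed

lemma crossing_square:
  "crossings D \<inter> square = {Complex x (f k x) | k l x. k < m \<and> l < m \<and> k \<noteq> l \<and> \<bar>x\<bar> \<le> 1 \<and> f k x = f l x}"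
proof (intro equalityI subsetI)
  fix v assume v: "v \<in> crossings D \<inter> square"
  then obtain p where p: "crossing_param D p" "v = pt D p" by (auto simp: crossings_def)
  have pp: "p \<in> params D" using crossing_paramD[OF p(1)] .
  then have "on_strand p" using on_strand_iff v p(2) by simp
  then obtain k x where k: "k < m" "\<bar>x\<bar> \<le> 1" "same_param p (sp k x)" by (auto simp: on_strand_def)
  have "crossing_param D (sp k x)" using crossing_param_same[OF k(3)] p(1) by simp
  moreover have "v = Complex x (f k x)" using pt_same[OF pp k(3)] p(2) pt_sp k by simp
  ultimately show "v \<in> {Complex x (f k x) | k l x. k < m \<and> l < m \<and> k \<noteq> l \<and> \<bar>x\<bar> \<le> 1 \<and> f k x = f l x}"
    using crossing_sp_iff k by blast
next
  fix v assume "v \<in> {Complex x (f k x) | k l x. k < m \<and> l < m \<and> k \<noteq> l \<and> \<bar>x\<bar> \<le> 1 \<and> f k x = f l x}"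
  then obtain k l x where k: "v = Complex x (f k x)" "k < m" "l < m" "k \<noteq> l" "\<bar>x\<bar> \<le> 1" "f k x = f l x"
    by blast
  have "crossing_param D (sp k x)" "v = pt D (sp k x)" using k crossing_sp_iff pt_sp by auto
  then show "v \<in> crossings D \<inter> square" using pt_sp_square k unfolding crossings_def by blast
qed

lemma drawing_square:
  assumes "\<bar>x\<bar> \<le> 1" "\<bar>y\<bar> \<le> 1"
  shows "Complex x y \<in> drawing D \<longleftrightarrow> (\<exists>k<m. y = f k x)"
proof
  assume "Complex x y \<in> drawing D"
  then obtain p where p: "p \<in> params D" "Complex x y = pt D p" by (auto simp: drawing_def)
  then have "on_strand p" using on_strand_iff[OF p(1)] assms by (simp flip: p(2) add: Complex_in_square)
  then obtain k z where k: "k < m" "\<bar>z\<bar> \<le> 1" "same_param p (sp k z)" by (auto simp: on_strand_def)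
  then have "Complex x y = Complex z (f k z)" using pt_same[OF p(1) k(3)] p(2) pt_sp by simp
  then show "\<exists>k<m. y = f k x" using k(1) by auto
next
  assume "\<exists>k<m. y = f k x"
  then obtain k where "k < m" "Complex x y = pt D (sp k x)" using pt_sp assms by auto
  then show "Complex x y \<in> drawing D" using sp_params unfolding drawing_def by blast
qed

definition right :: "nat \<Rightarrow> bool" where
  "right k \<longleftrightarrow> slope k > 0"

text \<open>Inside the square a strand is a graph, so its tangent towards the right is (1, f' k x)
  whichever way the curve runs.\<close>

lemma dir_sp:
  assumes k: "k < m" and x: "\<bar>x\<bar> < 1"
  shows "\<bar>slope k\<bar> *\<^sub>R dir D (right k) (sp k x) = Complex 1 (f' k x)"
proof -
  let ?t = "start k + slope k * x"
  have "((\<lambda>x. start k + slope k * x) has_vector_derivative slope k) (at x)"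
    by (auto intro!: derivative_eq_intros simp: has_real_derivative_iff_has_vector_derivative[symmetric])
  from vector_diff_chain_at[OF this has_vel[OF ix_less[OF k], of ?t]]
  have 1: "((curve D (ix k) \<circ> (\<lambda>x. start k + slope k * x)) has_vector_derivative slope k *\<^sub>R vel D (sp k x)) (at x)"
    by (simp add: sp_eq)
  have "((\<lambda>x. Complex x (f k x)) has_vector_derivative Complex 1 (f' k x)) (at x)"
  proof -

    have "((\<lambda>x. of_real x + \<i> * of_real (f k x)) has_vector_derivative of_real 1 + \<i> * of_real (f' k x)) (at x)"
      by (intro has_vector_derivative_add has_vector_derivative_mult_right has_vector_derivative_of_real
        DERIV_ident f_deriv[OF k x])
    then show ?thesis by (simp add: Complex_eq)
  qed
  then have "((curve D (ix k) \<circ> (\<lambda>x. start k + slope k * x)) has_vector_derivative Complex 1 (f' k x)) (at x)"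
  proof (rule has_vector_derivative_transform_within_open[of _ _ _ "{-1<..<1}"])
    fix y :: real assume "y \<in> {-1<..<1}"
    then have "\<bar>y\<bar> \<le> 1" by auto
    then show "Complex y (f k y) = (curve D (ix k) \<circ> (\<lambda>x. start k + slope k * x)) y"
      using pt_sp[OF k, of y] by (simp add: pt_def sp_eq)
  qed (use x in auto)
  then have "slope k *\<^sub>R vel D (sp k x) = Complex 1 (f' k x)"
    using 1 vector_derivative_unique_at by blast
  then show ?thesis using slope_nz[OF k] by (auto simp: dir_def right_def)
qed

lemma dir_sp_neg:
  assumes "k < m" "\<bar>x\<bar> < 1"
  shows "\<bar>slope k\<bar> *\<^sub>R dir D (\<not> right k) (sp k x) = - Complex 1 (f' k x)"
proof -
  have "dir D (\<not> right k) (sp k x) = - dir D (right k) (sp k x)" by (simp add: dir_def)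
  then show ?thesis using dir_sp[OF assms] by simp
qed

text \<open>A vertical segment that meets no strand stays in one face.\<close>

lemma dsh_up:
  assumes "\<bar>x\<bar> \<le> 1" "- 1 \<le> y1" "y1 < y2" "y2 \<le> 1" "\<And>k y. k < m \<Longrightarrow> y1 < y \<Longrightarrow> y \<le> y2 \<Longrightarrow> f k x \<noteq> y"
  shows "dsh D (Complex x y1) \<i> \<longleftrightarrow> Complex x y2 \<in> shaded D"
proof -
  let ?S = "Complex x ` {y1<..y2}"
  have "connected ?S"
    by (intro connected_continuous_image) (auto simp: Complex_eq intro!: continuous_intros)
  moreover have "?S \<inter> drawing D = {}" using drawing_square assms by fastforce
  ultimately have S: "Complex x y \<in> shaded D \<longleftrightarrow> Complex x y2 \<in> shaded D" if "y1 < y" "y \<le> y2" for y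
    using shaded_connected[of ?S "Complex x y" "Complex x y2"] that assms(3) by auto
  have "Complex x y1 + of_real \<epsilon> * \<i> \<in> shaded D \<longleftrightarrow> Complex x y2 \<in> shaded D" if "0 < \<epsilon>" "\<epsilon> < y2 - y1" for \<epsilon>
    using S[of "y1 + \<epsilon>"] that by (simp add: Complex_eq algebra_simps)
  then have "\<forall>\<^sub>F \<epsilon> in at_right 0. Complex x y1 + of_real \<epsilon> * \<i> \<in> shaded D \<longleftrightarrow> Complex x y2 \<in> shaded D"
    unfolding eventually_at_right_field using assms(3) by (intro exI[of _ "y2 - y1"]) auto
  then have "dsh D (Complex x y1) \<i> \<longleftrightarrow> (\<forall>\<^sub>F \<epsilon> in at_right (0::real). Complex x y2 \<in> shaded D)"
    unfolding dsh_def by (rule eventually_subst)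
  then show ?thesis by (simp add: eventually_const_iff)
qed

lemma dsh_down:
  assumes "\<bar>x\<bar> \<le> 1" "- 1 \<le> y2" "y2 < y1" "y1 \<le> 1" "\<And>k y. k < m \<Longrightarrow> y2 \<le> y \<Longrightarrow> y < y1 \<Longrightarrow> f k x \<noteq> y"
  shows "dsh D (Complex x y1) (- \<i>) \<longleftrightarrow> Complex x y2 \<in> shaded D"
proof -
  let ?S = "Complex x ` {y2..<y1}"
  have "connected ?S"
    by (intro connected_continuous_image) (auto simp: Complex_eq intro!: continuous_intros)
  moreover have "?S \<inter> drawing D = {}" using drawing_square assms by fastforce
  ultimately have S: "Complex x y \<in> shaded D \<longleftrightarrow> Complex x y2 \<in> shaded D" if "y2 \<le> y" "y < y1" for y
    using shaded_connected[of ?S "Complex x y" "Complex x y2"] that assms(3) by auto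
  have "Complex x y1 + of_real \<epsilon> * (- \<i>) \<in> shaded D \<longleftrightarrow> Complex x y2 \<in> shaded D" if "0 < \<epsilon>" "\<epsilon> < y1 - y2" for \<epsilon>
    using S[of "y1 - \<epsilon>"] that by (simp add: Complex_eq algebra_simps)
  then have "\<forall>\<^sub>F \<epsilon> in at_right 0. Complex x y1 + of_real \<epsilon> * (- \<i>) \<in> shaded D \<longleftrightarrow> Complex x y2 \<in> shaded D"
    unfolding eventually_at_right_field using assms(3) by (intro exI[of _ "y1 - y2"]) auto
  then have "dsh D (Complex x y1) (- \<i>) \<longleftrightarrow> (\<forall>\<^sub>F \<epsilon> in at_right (0::real). Complex x y2 \<in> shaded D)"
    unfolding dsh_def by (rule eventually_subst)
  then show ?thesis by (simp add: eventually_const_iff)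
qed

text \<open>The graphs stay strictly between the horizontal sides of the square, so each of these
  sides lies in a single face.\<close>

lemma shaded_horizontal:
  assumes "y = 1 \<or> y = - 1" "\<bar>x\<bar> \<le> 1"
  shows "Complex x y \<in> shaded D \<longleftrightarrow> Complex 0 y \<in> shaded D"
proof (rule shaded_connected)
  let ?S = "(\<lambda>x. Complex x y) ` {-1..1}"
  show "connected ?S"
    by (intro connected_continuous_image) (auto simp: Complex_eq intro!: continuous_intros)
  show "?S \<inter> drawing D = {}"
  proof -
    have "Complex z y \<notin> drawing D" if "\<bar>z\<bar> \<le> 1" for z
      using that assms(1) drawing_square[of z y] f_bound[OF _ that] by fastforce
    then show ?thesis by auto
  qed
  show "Complex x y \<in> ?S" "Complex 0 y \<in> ?S" using assms(2) by (auto intro!: image_eqI)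
qed

lemma dsh_top:
  assumes "\<bar>x\<bar> \<le> 1" "k < m" "\<And>l. l < m \<Longrightarrow> f l x \<le> f k x"
  shows "dsh D (Complex x (f k x)) \<i> \<longleftrightarrow> Complex 0 1 \<in> shaded D"
  using dsh_up[of x "f k x" 1] shaded_horizontal[of 1 x] assms f_bound[of k x] by fastforce

lemma dsh_bottom:
  assumes "\<bar>x\<bar> \<le> 1" "k < m" "\<And>l. l < m \<Longrightarrow> f k x \<le> f l x"
  shows "dsh D (Complex x (f k x)) (- \<i>) \<longleftrightarrow> Complex 0 (- 1) \<in> shaded D"
  using dsh_down[of x "- 1" "f k x"] shaded_horizontal[of "- 1" x] assms f_bound[of k x] by fastforce

text \<open>The points (0, 1) and (0, -1) are off the closed drawing, so their shade continues to
  points just outside the square, where the shadings of the two pictures are known to agree.\<close>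

lemma shaded_beyond:
  assumes y: "y = 1 \<or> y = - 1"
  shows "\<exists>e>0. \<forall>\<epsilon>. 0 < \<epsilon> \<longrightarrow> \<epsilon> < e \<longrightarrow>
    (Complex 0 (y * (1 + \<epsilon>)) \<in> shaded D \<longleftrightarrow> Complex 0 y \<in> shaded D)"
proof -
  have "Complex 0 y \<notin> drawing D"
    using y drawing_square[of 0 y] f_bound[of _ 0] by fastforce
  then obtain e where e: "e > 0" "ball (Complex 0 y) e \<inter> drawing D = {}"
    using closed_drawing unfolding closed_def open_contains_ball by blast
  have "Complex 0 (y * (1 + \<epsilon>)) \<in> shaded D \<longleftrightarrow> Complex 0 y \<in> shaded D" if "0 < \<epsilon>" "\<epsilon> < e" for \<epsilon>
  proof (rule shaded_connected[OF _ e(2)])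
    have "dist (Complex 0 y) (Complex 0 (y * (1 + \<epsilon>))) = \<epsilon>"
      using y that(1) by (auto simp: dist_norm cmod_def)
    then show "Complex 0 (y * (1 + \<epsilon>)) \<in> ball (Complex 0 y) e" using that by simp
  qed (use e(1) in auto)
  then show ?thesis using e(1) by blast
qed

text \<open>At a meeting point the strand \<open>l\<close> of larger slope is on top to the right.
  So the ends are, counterclockwise, east of \<open>l\<close>, west of \<open>k\<close>, west of
  \<open>l\<close>, east of \<open>k\<close>, starting at the sector above; the second form starts
  at the sector below.\<close>

lemma gsymb_sp:
  assumes kl: "k < m" "l < m" "k \<noteq> l" and x: "\<bar>x\<bar> < 1" and eq: "f k x = f l x" and less: "f' k x < f' l x"
    and lab: "\<And>\<sigma> r r'. crossing_param D r \<Longrightarrow> same_param r r' \<Longrightarrow> lab \<sigma> r' = lab \<sigma> r"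
  shows "req (gsymb D lab (Complex x (f k x)))
      (cr (lab (right l) (sp l x)) (lab (\<not> right k) (sp k x)) (lab (\<not> right l) (sp l x)) (lab (right k) (sp k x))
        (ht k < ht l) (dsh D (Complex x (f k x)) \<i>))"
    and "req (gsymb D lab (Complex x (f k x)))
      (cr (lab (\<not> right l) (sp l x)) (lab (right k) (sp k x)) (lab (right l) (sp l x)) (lab (\<not> right k) (sp k x))
        (ht k < ht l) (dsh D (Complex x (f k x)) (- \<i>)))"
proof -
  have x1: "\<bar>x\<bar> \<le> 1" using x by simp
  have dp: "double_point D (sp l x) (sp k x)" using double_point_sp kl x1 eq by metis
  have v: "pt D (sp l x) = Complex x (f k x)" using pt_sp[OF kl(2) x1] eq by simp
  have ov: "sp l x \<in> over D \<longleftrightarrow> ht k < ht l" using sp_over[of l k x] kl x1 eq by simp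
  let ?d = "f' l x - f' k x"
  have sl: "\<bar>slope k\<bar> > 0" "\<bar>slope l\<bar> > 0" using slope_nz kl by auto
  note dl = dir_sp[OF kl(2) x] dir_sp_neg[OF kl(2) x] and dk = dir_sp[OF kl(1) x] dir_sp_neg[OF kl(1) x]
  have c: "cdet (Complex 1 (f' l x)) (Complex 1 (f' k x)) = - ?d" by (simp add: cdet_def)
  have i: "Complex 1 (f' l x) - Complex 1 (f' k x) = of_real ?d * \<i>" by (simp add: complex_eq_iff)
  have "\<bar>slope l\<bar> * \<bar>slope k\<bar> * cdet (dir D (right l) (sp l x)) (dir D (\<not> right k) (sp k x)) =
      cdet (\<bar>slope l\<bar> *\<^sub>R dir D (right l) (sp l x)) (\<bar>slope k\<bar> *\<^sub>R dir D (\<not> right k) (sp k x))" by simp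
  also have "\<dots> = ?d" unfolding dl dk by (simp add: c)
  finally have p1: "cdet (dir D (right l) (sp l x)) (dir D (\<not> right k) (sp k x)) > 0"
    using less mult_pos_pos[OF sl(2,1)] by (metis diff_gt_0_iff_gt zero_less_mult_pos)
  have "\<bar>slope l\<bar> * \<bar>slope k\<bar> * cdet (dir D (\<not> right l) (sp l x)) (dir D (right k) (sp k x)) =
      cdet (\<bar>slope l\<bar> *\<^sub>R dir D (\<not> right l) (sp l x)) (\<bar>slope k\<bar> *\<^sub>R dir D (right k) (sp k x))" by simp
  also have "\<dots> = ?d" unfolding dl dk by (simp add: c)
  finally have p2: "cdet (dir D (\<not> right l) (sp l x)) (dir D (right k) (sp k x)) > 0"
    using less mult_pos_pos[OF sl(2,1)] by (metis diff_gt_0_iff_gt zero_less_mult_pos)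
  have s: "(\<bar>slope l\<bar> / ?d) *\<^sub>R u + (\<bar>slope k\<bar> / ?d) *\<^sub>R w = (1 / ?d) *\<^sub>R (\<bar>slope l\<bar> *\<^sub>R u + \<bar>slope k\<bar> *\<^sub>R w)" for u w :: complex
    by (simp add: scaleR_add_right)
  have i1: "\<i> = (\<bar>slope l\<bar> / ?d) *\<^sub>R dir D (right l) (sp l x) + (\<bar>slope k\<bar> / ?d) *\<^sub>R dir D (\<not> right k) (sp k x)"
    unfolding s dl dk using less i by (simp add: scaleR_conv_of_real)
  have i2: "- \<i> = (\<bar>slope l\<bar> / ?d) *\<^sub>R dir D (\<not> right l) (sp l x) + (\<bar>slope k\<bar> / ?d) *\<^sub>R dir D (right k) (sp k x)"
  proof -
    have "- Complex 1 (f' l x) + Complex 1 (f' k x) = - (of_real ?d * \<i>)" unfolding i[symmetric] by simp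
    then show ?thesis unfolding s dl dk using less by (simp add: scaleR_conv_of_real)
  qed
  have q: "\<bar>slope l\<bar> / ?d > 0" "\<bar>slope k\<bar> / ?d > 0" using sl less by simp_all
  show "req (gsymb D lab (Complex x (f k x)))
      (cr (lab (right l) (sp l x)) (lab (\<not> right k) (sp k x)) (lab (\<not> right l) (sp l x)) (lab (right k) (sp k x))
        (ht k < ht l) (dsh D (Complex x (f k x)) \<i>))"
    using gsymb_cr[OF dp lab p1 q i1] v ov by simp
  show "req (gsymb D lab (Complex x (f k x)))
      (cr (lab (\<not> right l) (sp l x)) (lab (right k) (sp k x)) (lab (right l) (sp l x)) (lab (\<not> right k) (sp k x))
        (ht k < ht l) (dsh D (Complex x (f k x)) (- \<i>)))"
    using gsymb_cr[OF dp lab p2 q i2] v ov by simp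
qed

text \<open>The sectors above and below a meeting point are opposite.\<close>

lemma dsh_up_eq_down:
  assumes kl: "k < m" "l < m" "k \<noteq> l" and x: "\<bar>x\<bar> < 1" and eq: "f k x = f l x" and less: "f' k x < f' l x"
  shows "dsh D (Complex x (f k x)) \<i> \<longleftrightarrow> dsh D (Complex x (f k x)) (- \<i>)"
proof -
  have x1: "\<bar>x\<bar> \<le> 1" using x by simp
  have dp: "double_point D (sp l x) (sp k x)" using double_point_sp kl x1 eq by metis
  have v: "pt D (sp l x) = Complex x (f k x)" using pt_sp[OF kl(2) x1] eq by simp
  let ?d = "f' l x - f' k x"
  let ?sg = "\<lambda>k. (if right k then 1 else - 1) * \<bar>slope k\<bar>"
  have sg: "?sg k *\<^sub>R vel D (sp k x) = Complex 1 (f' k x)" if "k < m" for k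
    using dir_sp[OF that x] by (auto simp: dir_def)
  have "(?sg l / ?d) *\<^sub>R vel D (sp l x) + (- ?sg k / ?d) *\<^sub>R vel D (sp k x) =
      (1 / ?d) *\<^sub>R (?sg l *\<^sub>R vel D (sp l x) - ?sg k *\<^sub>R vel D (sp k x))"
    by (simp add: scaleR_diff_right)
  also have "\<dots> = (1 / ?d) *\<^sub>R (of_real ?d * \<i>)"
    unfolding sg[OF kl(1)] sg[OF kl(2)] by (simp add: complex_eq_iff)
  also have "\<dots> = \<i>" using less by (simp add: scaleR_conv_of_real)
  finally have i: "(?sg l / ?d) *\<^sub>R vel D (sp l x) + (- ?sg k / ?d) *\<^sub>R vel D (sp k x) = \<i>" .
  then have i': "(- (?sg l / ?d)) *\<^sub>R vel D (sp l x) + (- (- ?sg k / ?d)) *\<^sub>R vel D (sp k x) = - \<i>"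
    unfolding scaleR_minus_left by (metis add.commute minus_add)
  have "?sg k \<noteq> 0" if "k < m" for k using slope_nz[OF that] by simp
  then have nz: "?sg l / ?d \<noteq> 0" "- ?sg k / ?d \<noteq> 0" using kl less by simp_all
  then have nz': "- (?sg l / ?d) \<noteq> 0" "- (- ?sg k / ?d) \<noteq> 0" by simp_all
  show ?thesis
    using dsh_sector[OF dp nz] dsh_sector[OF dp nz'] unfolding i i' v minus_mult_minus by blast
qed

subsection \<open>Arcs of the strands\<close>

text \<open>The two ends of a strand and the three abscissas at which strands can cross in any of
  the four pictures.\<close>

definition cut_points :: "real set" where
  "cut_points = {-1, -1/2, 0, 1/2, 1}"

text \<open>Described without mention of crossings inside the square, so that both pictures of a
  move yield the same set: a cut point of a strand belongs to it whether it is a crossing or has to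
  be marked.\<close>

definition strand_cuts :: "(nat \<times> real) set" where
  "strand_cuts = {p. crossing_param D p \<and> \<not> on_strand p} \<union>
     {p. \<exists>k<m. \<exists>x\<in>cut_points. same_param (sp k x) p}"

lemma cuts_eq_strand_cuts:
  assumes ks: "\<And>k x. (k, x) \<in> set ks \<Longrightarrow> k < m \<and> x \<in> cut_points"
    and all: "\<And>k x. k < m \<Longrightarrow> x \<in> cut_points \<Longrightarrow> (k, x) \<in> set ks \<or> (\<exists>l<m. l \<noteq> k \<and> f k x = f l x)"
  shows "cuts D (map (\<lambda>(k, x). sp k x) ks) = strand_cuts"
proof (intro equalityI subsetI)
  fix p assume "p \<in> cuts D (map (\<lambda>(k, x). sp k x) ks)"
  then consider "crossing_param D p" | k x where "(k, x) \<in> set ks" "same_param (sp k x) p"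
    by (auto simp: cuts_def param_class_def)
  then show "p \<in> strand_cuts"
  proof cases
    case 1
    show ?thesis
    proof (cases "on_strand p")
      case True
      then obtain k x where k: "k < m" "\<bar>x\<bar> \<le> 1" "same_param p (sp k x)" by (auto simp: on_strand_def)
      then have "crossing_param D (sp k x)" using 1 crossing_param_same by blast
      then obtain l where "l < m" "l \<noteq> k" "f k x = f l x" using crossing_sp_iff k by blast
      then have "x \<in> cut_points" using f_meet[of k l x] k by (auto simp: cut_points_def)
      then show ?thesis using k same_param_sym unfolding strand_cuts_def by blast
    qed (use 1 in \<open>simp add: strand_cuts_def\<close>)
  next
    case 2
    then show ?thesis using ks unfolding strand_cuts_def by blast
  qed
next
  fix p assume "p \<in> strand_cuts"
  then consider "crossing_param D p" | k x where "k < m" "x \<in> cut_points" "same_param (sp k x) p"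
    by (auto simp: strand_cuts_def)
  then show "p \<in> cuts D (map (\<lambda>(k, x). sp k x) ks)"
  proof cases
    case 1
    then show ?thesis by (simp add: cuts_def)
  next
    case 2
    have x: "\<bar>x\<bar> \<le> 1" using 2(2) by (auto simp: cut_points_def)
    from all[OF 2(1,2)] show ?thesis
    proof
      assume "(k, x) \<in> set ks"
      then show ?thesis using 2(3) by (force simp: cuts_def param_class_def)
    next
      assume "\<exists>l<m. l \<noteq> k \<and> f k x = f l x"
      then have "crossing_param D p" using crossing_sp_iff[OF 2(1) x] crossing_param_same[OF 2(3)] by blast
      then show ?thesis by (simp add: cuts_def)
    qed
  qed
qed

lemma marks_strand:
  assumes "distinct ks" and ks: "\<And>k x. (k, x) \<in> set ks \<Longrightarrow> k < m \<and> x \<in> cut_points \<and> (\<forall>l<m. l \<noteq> k \<longrightarrow> f k x \<noteq> f l x)"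
  shows "marks D (map (\<lambda>(k, x). sp k x) ks)"
proof -
  have x: "\<bar>x\<bar> \<le> 1" if "(k, x) \<in> set ks" for k x using ks[OF that] by (auto simp: cut_points_def)
  have same: "a = b" if "a \<in> set ks" "b \<in> set ks" "same_param (case a of (k, x) \<Rightarrow> sp k x) (case b of (k, x) \<Rightarrow> sp k x)" for a b
  proof -
    obtain k y l z where ab: "a = (k, y)" "b = (l, z)" by (cases a, cases b)
    have "same_param (sp k y) (sp l z)" "(k, y) \<in> set ks" "(l, z) \<in> set ks" using that ab by simp_all
    then show ?thesis
      using sp_same[of k l y z] ks[of k y] ks[of l z] x[of k y] x[of l z] ab by blast
  qed
  have "inj_on (\<lambda>(k, x). sp k x) (set ks)"
    by (rule inj_onI) (metis same same_param_refl)
  moreover have "(case a of (k, x) \<Rightarrow> sp k x) \<in> params D \<and> \<not> crossing_param D (case a of (k, x) \<Rightarrow> sp k x)" if "a \<in> set ks" for a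
  proof -
    obtain k y where a: "a = (k, y)" by (cases a)
    then have "(k, y) \<in> set ks" using that by simp
    then show ?thesis using ks[of k y] x[of k y] crossing_sp_iff[of k y] sp_params[of k] a by auto
  qed
  ultimately show ?thesis
  proof -
    assume inj: "inj_on (\<lambda>(k, x). sp k x) (set ks)"
      and nc: "\<And>a. a \<in> set ks \<Longrightarrow> (case a of (k, x) \<Rightarrow> sp k x) \<in> params D \<and> \<not> crossing_param D (case a of (k, x) \<Rightarrow> sp k x)"
    have "p = q" if pq: "p \<in> set (map (\<lambda>(k, x). sp k x) ks)" "q \<in> set (map (\<lambda>(k, x). sp k x) ks)"
      "same_param p q" for p q
    proof -
      obtain a b where "a \<in> set ks" "b \<in> set ks" "p = (\<lambda>(k, x). sp k x) a" "q = (\<lambda>(k, x). sp k x) b"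
        using pq(1,2) by (auto simp del: split_paired_Ex)
      with same[of a b] pq(3) show ?thesis by blast
    qed
    then show ?thesis
      unfolding marks_def distinct_map using inj nc assms(1) by (simp only: set_map) blast
  qed
qed

context
  assumes cut_set_strand: "cut_set strand_cuts"
begin

interpretation cut_set strand_cuts by (rule cut_set_strand)

text \<open>Arcs at a cut are named after the side on which they lie in the picture, independently
  of the direction of the curve.\<close>

definition east :: "nat \<Rightarrow> real \<Rightarrow> (nat \<times> real) set" where
  "east k x = arc strand_cuts (right k) (sp k x)"

definition west :: "nat \<Rightarrow> real \<Rightarrow> (nat \<times> real) set" where
  "west k x = arc strand_cuts (\<not> right k) (sp k x)"

lemma sp_cut_iff:
  assumes "k < m" "\<bar>x\<bar> \<le> 1"
  shows "sp k x \<in> strand_cuts \<longleftrightarrow> x \<in> cut_points"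
proof
  assume "sp k x \<in> strand_cuts"
  moreover have "on_strand (sp k x)" using assms same_param_refl unfolding on_strand_def by blast
  ultimately obtain l y where l: "l < m" "y \<in> cut_points" "same_param (sp l y) (sp k x)"
    by (auto simp: strand_cuts_def)
  have "\<bar>y\<bar> \<le> 1" using l(2) by (auto simp: cut_points_def)
  then show "x \<in> cut_points" using sp_same[OF l(1) assms(1) _ assms(2) l(3)] l(2) by simp
qed (use assms same_param_refl in \<open>unfold strand_cuts_def, blast\<close>)

lemma east_eq_west:
  assumes k: "k < m" and xy: "x \<in> cut_points" "y \<in> cut_points" "x < y"
    and none: "\<And>z. x < z \<Longrightarrow> z < y \<Longrightarrow> z \<notin> cut_points"
  shows "east k x = west k y"
proof -
  have b: "\<bar>x\<bar> \<le> 1" "\<bar>y\<bar> \<le> 1" using xy by (auto simp: cut_points_def)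
  have c: "sp k x \<in> strand_cuts" "sp k y \<in> strand_cuts" using sp_cut_iff k b xy by auto
  have r: "slope k \<noteq> 0" using slope_nz[OF k] .
  have free: "(ix k, u) \<notin> strand_cuts" if "x < (u - start k) / slope k" "(u - start k) / slope k < y" for u
  proof -
    let ?z = "(u - start k) / slope k"
    have "sp k ?z = (ix k, u)" using r by (simp add: sp_eq)
    moreover have "\<bar>?z\<bar> \<le> 1" using that b by linarith
    ultimately show ?thesis using sp_cut_iff[OF k, of ?z] none[OF that] by simp
  qed
  show ?thesis
  proof (cases "slope k > 0")
    case True
    have "consecutive (ix k) (start k + slope k * x) (start k + slope k * y)"
      unfolding consecutive_def using c free True xy(3)
      by (auto simp: sp_eq field_simps)
    from arc_consecutive[OF this] show ?thesis using True by (simp add: east_def west_def right_def sp_eq)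
  next
    case False
    then have neg: "slope k < 0" using r by simp
    have "consecutive (ix k) (start k + slope k * y) (start k + slope k * x)"
      unfolding consecutive_def using c free neg xy(3)
      by (auto simp: sp_eq field_simps)
    from arc_consecutive[OF this] show ?thesis using False by (simp add: east_def west_def right_def sp_eq)
  qed
qed

text \<open>The cut points are \<open>j / 2 - 1\<close> for \<open>j\<close> from 0 to 4, and a
  piece of a strand is numbered by its left end.\<close>

definition quarter :: "nat \<Rightarrow> nat \<Rightarrow> (nat \<times> real) set" where
  "quarter k j = east k (real j / 2 - 1)"

lemma quarter_east:
  "east k (- 1) = quarter k 0" "east k (- (1 / 2)) = quarter k 1" "east k 0 = quarter k 2" "east k (1 / 2) = quarter k 3"
  by (simp_all add: quarter_def)

lemma quarter_west:
  assumes "k < m"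
  shows "west k (- (1 / 2)) = quarter k 0" "west k 0 = quarter k 1" "west k (1 / 2) = quarter k 2" "west k 1 = quarter k 3"
  using east_eq_west[OF assms, of "- 1" "- (1 / 2)"] east_eq_west[OF assms, of "- (1 / 2)" 0]
    east_eq_west[OF assms, of 0 "1 / 2"] east_eq_west[OF assms, of "1 / 2" 1]
  by (auto simp: quarter_def cut_points_def)

lemma cut_points_real: "j < 5 \<Longrightarrow> real j / 2 - 1 \<in> cut_points"
proof -
  assume "j < 5"
  then have "j = 0 \<or> j = 1 \<or> j = 2 \<or> j = 3 \<or> j = 4" by linarith
  then show ?thesis by (auto simp: cut_points_def)
qed

lemma quarter_west':
  assumes "k < m" "j < 4"
  shows "quarter k j = west k (real (Suc j) / 2 - 1)"
proof -
  have "j = 0 \<or> j = 1 \<or> j = 2 \<or> j = 3" using assms(2) by linarith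
  then show ?thesis using quarter_west[OF assms(1)] by auto
qed

text \<open>If both curves run in the same sense, equal arcs have the same cut at their left ends.
  If they run in opposite senses, the left end of one piece is the right end of the other; this
  forces a single strand, contradicting the different senses.\<close>

lemma quarter_inj:
  assumes k: "k < m" "l < m" and j: "i < 4" "j < 4" and eq: "quarter k i = quarter l j"
  shows "k = l" "i = j"
proof -
  have sc: "sp k (real j / 2 - 1) \<in> strand_cuts" "\<bar>real j / 2 - 1\<bar> \<le> 1" if "k < m" "j < 5" for k j
    using sp_cut_iff[OF that(1)] cut_points_real[OF that(2)] that(2) by (auto simp: abs_le_iff)
  have "k = l \<and> i = j"
  proof (cases "right k = right l")
    case True
    have s: "sp k (real i / 2 - 1) \<in> strand_cuts" "sp l (real j / 2 - 1) \<in> strand_cuts"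
      "\<bar>real i / 2 - 1\<bar> \<le> 1" "\<bar>real j / 2 - 1\<bar> \<le> 1"
      using sc[OF k(1), of i] sc[OF k(2), of j] j by simp_all
    have "arc strand_cuts (right k) (sp k (real i / 2 - 1)) = arc strand_cuts (right k) (sp l (real j / 2 - 1))"
      using eq True by (simp add: quarter_def east_def)
    from sp_same[OF k s(3,4) arc_eqD[OF s(1,2) this]] show ?thesis by simp
  next
    case False
    have e: "arc strand_cuts (right k) (sp k (real i / 2 - 1)) =
        arc strand_cuts (right k) (sp l (real (Suc j) / 2 - 1))"
      using eq quarter_west'[OF k(2) j(2)] False by (simp add: quarter_def east_def west_def)
    have i5: "i < 5" "Suc j < 5" using j by simp_all
    have "k = l"
      by (rule sp_same(1)[OF k sc(2)[OF k(1) i5(1)] sc(2)[OF k(2) i5(2)]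
        arc_eqD[OF sc(1)[OF k(1) i5(1)] sc(1)[OF k(2) i5(2)] e]])
    then show ?thesis using False by simp
  qed
  then show "k = l" "i = j" by auto
qed

lemma distinct_quarters: "distinct (map (\<lambda>(k, j). quarter k j) (List.product [0..<m] [0..<4]))"
  unfolding distinct_map
proof
  show "inj_on (\<lambda>(k, j). quarter k j) (set (List.product [0..<m] [0..<4]))"
    using quarter_inj by (auto intro!: inj_onI)
qed (simp add: distinct_product)

lemma gsymb_east_west:
  assumes kl: "k < m" "l < m" "k \<noteq> l" and x: "\<bar>x\<bar> < 1" and eq: "f k x = f l x" and less: "f' k x < f' l x"
  shows "req (gsymb D (arc strand_cuts) (Complex x (f k x)))
      (cr (east l x) (west k x) (west l x) (east k x) (ht k < ht l) (dsh D (Complex x (f k x)) \<i>))"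
    and "req (gsymb D (arc strand_cuts) (Complex x (f k x)))
      (cr (west l x) (east k x) (east l x) (west k x) (ht k < ht l) (dsh D (Complex x (f k x)) (- \<i>)))"
proof -
  have lab: "arc strand_cuts \<sigma> r' = arc strand_cuts \<sigma> r" if r: "crossing_param D r" "same_param r r'" for \<sigma> r r'
  proof (rule arc_same[OF _ r(2)])
    show "r \<in> strand_cuts"
    proof (cases "on_strand r")
      case True
      then obtain k x where k: "k < m" "\<bar>x\<bar> \<le> 1" "same_param r (sp k x)" by (auto simp: on_strand_def)
      then have "crossing_param D (sp k x)" using r(1) crossing_param_same by blast
      then obtain l where "l < m" "l \<noteq> k" "f k x = f l x" using crossing_sp_iff k by blast
      then have "x \<in> cut_points" using f_meet[of k l x] k by (auto simp: cut_points_def)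
      then show ?thesis using k same_param_sym unfolding strand_cuts_def by blast
    qed (use r in \<open>simp add: strand_cuts_def\<close>)
  qed
  show "req (gsymb D (arc strand_cuts) (Complex x (f k x)))
      (cr (east l x) (west k x) (west l x) (east k x) (ht k < ht l) (dsh D (Complex x (f k x)) \<i>))"
    and "req (gsymb D (arc strand_cuts) (Complex x (f k x)))
      (cr (west l x) (east k x) (east l x) (west k x) (ht k < ht l) (dsh D (Complex x (f k x)) (- \<i>)))"
    using gsymb_sp[OF kl x eq less, of "arc strand_cuts", OF lab] by (simp_all add: east_def west_def)
qed

lemma req_mark: "req (Con (arc strand_cuts False (sp k x)) (arc strand_cuts True (sp k x))) (Con (west k x) (east k x))"
  by (cases "right k") (auto simp: east_def west_def req_def)

end

end

text \<open>Both pictures use the same strand data \<open>K\<close> and heights \<open>ht\<close>,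
  which makes their parameters, arcs and overpasses comparable.\<close>

locale square_move = old: strands D m K ht f f' + new: strands D' m K ht g g'
  for D D' m K ht f f' g g' +
  assumes ncomp_eq: "ncomp D' = ncomp D"
    and off: "p \<in> params D \<Longrightarrow> (\<exists>k<m. \<exists>x\<in>{-1..1}. same_param p (strand_param (K k) x)) \<or>
      (pt D p \<notin> square \<and> pt D' p = pt D p \<and> (p \<in> over D' \<longleftrightarrow> p \<in> over D))"
    and shaded_off: "shaded D' - square = shaded D - square"
begin

lemma params_eq: "params D' = params D"
  by (simp add: params_def ncomp_eq)

lemma off_strand:
  assumes "p \<in> params D" "\<not> old.on_strand p"
  shows "pt D' p = pt D p" "p \<in> over D' \<longleftrightarrow> p \<in> over D"
  using off[OF assms(1)] assms(2) by (force simp: old.on_strand_def)+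

lemma pt_eq_off_square:
  assumes "p \<in> params D" "v \<notin> square"
  shows "pt D' p = v \<longleftrightarrow> pt D p = v"
proof (cases "old.on_strand p")
  case True
  then have "pt D p \<in> square" "pt D' p \<in> square"
    using old.on_strand_iff[OF assms(1)] new.on_strand_iff[of p] assms(1) by (simp_all add: params_eq)
  then show ?thesis using assms(2) by blast
next
  case False
  then show ?thesis using off_strand(1)[OF assms(1)] by simp
qed

lemma double_point_off:
  assumes "p \<in> params D" "\<not> old.on_strand p"
  shows "double_point D' p q \<longleftrightarrow> double_point D p q"
proof (cases "q \<in> params D")
  case True
  have "pt D p \<notin> square" using old.on_strand_iff[OF assms(1)] assms(2) by simp
  then have "pt D' q = pt D p \<longleftrightarrow> pt D q = pt D p" using pt_eq_off_square[OF True] by blast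
  then have "(pt D' p = pt D' q) = (pt D p = pt D q)" using off_strand(1)[OF assms] by metis
  then show ?thesis unfolding double_point_def params_eq by blast
qed (simp add: double_point_def params_eq)

lemma crossing_param_off:
  "p \<in> params D \<Longrightarrow> \<not> old.on_strand p \<Longrightarrow> crossing_param D' p \<longleftrightarrow> crossing_param D p"
  by (simp add: crossing_param_def double_point_off)

lemma strand_cuts_eq: "new.strand_cuts = old.strand_cuts"
proof -
  have "crossing_param D' p \<and> \<not> old.on_strand p \<longleftrightarrow> crossing_param D p \<and> \<not> old.on_strand p" for p
    using crossing_param_off old.crossing_paramD new.crossing_paramD params_eq by blast
  then show ?thesis unfolding old.strand_cuts_def new.strand_cuts_def old.cut_points_def new.cut_points_def by simp
qed

lemma crossings_off: "crossings D' - square = crossings D - square"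
proof -
  have *: "v \<in> crossings E - square \<longleftrightarrow> (\<exists>p. crossing_param E p \<and> pt E p = v \<and> v \<notin> square)" for E v
    by (auto simp: crossings_def)
  have "crossing_param D' p \<and> pt D' p = v \<longleftrightarrow> crossing_param D p \<and> pt D p = v" if "v \<notin> square" for p v
  proof (cases "p \<in> params D")
    case True
    have "pt D' p = v \<longleftrightarrow> pt D p = v" by (rule pt_eq_off_square[OF True that])
    moreover have "\<not> old.on_strand p" if "pt D p = v"
      using old.on_strand_iff[OF True] that \<open>v \<notin> square\<close> by simp
    ultimately show ?thesis using crossing_param_off[OF True] by blast
  next
    case False
    then show ?thesis using old.crossing_paramD new.crossing_paramD params_eq by blast
  qed
  then show ?thesis unfolding set_eq_iff * by blast
qed

text \<open>Velocities depend on a neighbourhood. The square is closed, so a parameter mapped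
  outside it has a neighbourhood on which both curves agree.\<close>

lemma vel_off:
  assumes p: "p \<in> params D" "\<not> old.on_strand p"
  shows "vel D' p = vel D p"
proof -
  have i: "fst p < ncomp D" "fst p < ncomp D'" using p(1) by (simp_all add: old.params_iff ncomp_eq)
  let ?U = "(\<lambda>t. pt D (fst p, t)) -` (- square)"
  have "open ?U"
    using closed_square by (intro open_vimage old.continuous_pt i) (simp add: open_Compl)
  moreover have "snd p \<in> ?U" using old.on_strand_iff[OF p(1)] p(2) by simp
  moreover have "pt D (fst p, t) = pt D' (fst p, t)" if "t \<in> ?U" for t
    using off_strand(1)[of "(fst p, t)"] old.on_strand_iff[of "(fst p, t)"] that i by (simp add: old.params_iff)
  ultimately have "((\<lambda>t. pt D' (fst p, t)) has_vector_derivative vel D (fst p, snd p)) (at (snd p))"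
    by (rule has_vector_derivative_transform_within_open[OF old.has_vel_pt[OF i(1), of "snd p"]])
  moreover have "((\<lambda>t. pt D' (fst p, t)) has_vector_derivative vel D' (fst p, snd p)) (at (snd p))"
    by (rule new.has_vel_pt[OF i(2)])
  ultimately show ?thesis using vector_derivative_unique_at by (metis prod.collapse)
qed

text \<open>At a crossing outside the closed square the branches, their velocities and the shades
  nearby are the same in both diagrams.\<close>

lemma gsymb_off:
  assumes v: "v \<in> crossings D - square"
  shows "gsymb D' lab v = gsymb D lab v"
proof -
  have v': "v \<in> crossings D" "v \<notin> square" using v by auto
  have over: "p \<in> over D' \<longleftrightarrow> p \<in> over D" if "p \<in> params D" "pt D p = v" for p
    using off_strand(2)[OF that(1)] old.on_strand_iff[OF that(1)] that(2) v'(2) by simp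
  have "(p \<in> params D' \<and> pt D' p = v \<and> p \<notin> over D') = (p \<in> params D \<and> pt D p = v \<and> p \<notin> over D)"
    "(p \<in> params D' \<and> pt D' p = v \<and> p \<in> over D') = (p \<in> params D \<and> pt D p = v \<and> p \<in> over D)" for p
    using pt_eq_off_square[of p v] v'(2) over[of p] params_eq by auto
  then have uo: "underpass D' v = underpass D v" "overpass D' v = overpass D v"
    by (simp_all add: underpass_def overpass_def)
  note r = old.crossing_reps[OF v'(1)]
  have par: "underpass D v \<in> params D" "overpass D v \<in> params D" "pt D (overpass D v) = v"
    using r by (auto simp: double_point_def)
  then have "\<not> old.on_strand (underpass D v)" "\<not> old.on_strand (overpass D v)"
    using old.on_strand_iff r(2) v'(2) by auto
  then have vel: "vel D' (underpass D v) = vel D (underpass D v)" "vel D' (overpass D v) = vel D (overpass D v)"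
    using vel_off par by blast+
  have sh: "(\<forall>\<^sub>F \<epsilon> in at_right 0. v + of_real \<epsilon> * d \<in> shaded D') \<longleftrightarrow>
      (\<forall>\<^sub>F \<epsilon> in at_right 0. v + of_real \<epsilon> * d \<in> shaded D)" for d
  proof (rule eventually_subst)
    have "((\<lambda>\<epsilon>. v + of_real \<epsilon> * d) \<longlongrightarrow> v + of_real 0 * d) (at_right 0)"
      by (intro tendsto_intros)
    moreover have "open (- square)" "v + of_real 0 * d \<in> - square" using closed_square v'(2) by auto
    ultimately have "\<forall>\<^sub>F \<epsilon> in at_right 0. v + of_real \<epsilon> * d \<in> - square"
      by (rule topological_tendstoD)
    then show "\<forall>\<^sub>F \<epsilon> in at_right 0. v + of_real \<epsilon> * d \<in> shaded D' \<longleftrightarrow> v + of_real \<epsilon> * d \<in> shaded D"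
      by (rule eventually_mono) (use shaded_off in blast)
  qed
  show ?thesis unfolding gsymb_def Let_def uo vel sh ..
qed

text \<open>The shadings are given to agree only outside the closed square; the values on its
  boundary are compared through nearby outside points.\<close>

lemma shaded_boundary:
  assumes "y = 1 \<or> y = - 1"
  shows "Complex 0 y \<in> shaded D' \<longleftrightarrow> Complex 0 y \<in> shaded D"
proof -
  obtain e where e: "e > 0" "\<And>\<epsilon>. 0 < \<epsilon> \<Longrightarrow> \<epsilon> < e \<Longrightarrow>
      Complex 0 (y * (1 + \<epsilon>)) \<in> shaded D \<longleftrightarrow> Complex 0 y \<in> shaded D"
    using old.shaded_beyond[OF assms] by blast
  obtain e' where e': "e' > 0" "\<And>\<epsilon>. 0 < \<epsilon> \<Longrightarrow> \<epsilon> < e' \<Longrightarrow>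
      Complex 0 (y * (1 + \<epsilon>)) \<in> shaded D' \<longleftrightarrow> Complex 0 y \<in> shaded D'"
    using new.shaded_beyond[OF assms] by blast
  let ?\<epsilon> = "min e e' / 2"
  have "Complex 0 (y * (1 + ?\<epsilon>)) \<notin> square"
    using assms e(1) e'(1) by (auto simp: Complex_in_square)
  then have "Complex 0 (y * (1 + ?\<epsilon>)) \<in> shaded D' \<longleftrightarrow> Complex 0 (y * (1 + ?\<epsilon>)) \<in> shaded D"
    using shaded_off by blast
  then show ?thesis using e(2)[of ?\<epsilon>] e'(2)[of ?\<epsilon>] e(1) e'(1) by simp
qed

lemma
  assumes "cut_set new.strand_cuts" "cut_set old.strand_cuts"
  shows east_eq: "new.east k x = old.east k x" and west_eq: "new.west k x = old.west k x"
  by (simp_all add: new.east_def[OF assms(1)] old.east_def[OF assms(2)]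
      new.west_def[OF assms(1)] old.west_def[OF assms(2)] strand_cuts_eq)

definition mark :: "nat \<Rightarrow> real \<Rightarrow> (nat \<times> real) set symb" where
  "mark k x = Con (arc old.strand_cuts False (old.sp k x)) (arc old.strand_cuts True (old.sp k x))"

text \<open>Both diagrams are cut at \<open>strand_cuts\<close>: in either picture an inner cut
  point is a crossing or a mark. The symbols of the crossings outside the square and of the marks at
  the strand ends are common to both and form the context \<open>P\<close>.\<close>

lemma state_sum_move:
  assumes inner: "distinct vs" "set vs = crossings D \<inter> square" "distinct vs'" "set vs' = crossings D' \<inter> square"
    and ks: "distinct ks" "\<And>k x. (k, x) \<in> set ks \<longleftrightarrow>
      k < m \<and> x \<in> {-1/2, 0, 1/2} \<and> (\<forall>l<m. l \<noteq> k \<longrightarrow> f k x \<noteq> f l x)"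
    and ks': "distinct ks'" "\<And>k x. (k, x) \<in> set ks' \<longleftrightarrow>
      k < m \<and> x \<in> {-1/2, 0, 1/2} \<and> (\<forall>l<m. l \<noteq> k \<longrightarrow> g k x \<noteq> g l x)"
    and sim: "\<And>P. cut_set old.strand_cuts \<Longrightarrow>
      balanced (plabs ((map (gsymb D (arc old.strand_cuts)) vs @ map (\<lambda>(k, x). mark k x) ks) @ P)) \<Longrightarrow>
      sim ((map (gsymb D (arc old.strand_cuts)) vs @ map (\<lambda>(k, x). mark k x) ks) @ P)
        ((map (gsymb D' (arc old.strand_cuts)) vs' @ map (\<lambda>(k, x). mark k x) ks') @ P)"
  shows "veq (state_sum D) (state_sum D')"
proof -
  let ?C = "old.strand_cuts"
  \<comment> \<open>The ends of the strands are marked in both pictures. This keeps the boundary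
    labels distinct even if an edge outside the square joins two strand ends.\<close>
  define es where "es = List.product [0..<m] [-1, 1 :: real]"
  have es: "(k, x) \<in> set es \<longleftrightarrow> k < m \<and> (x = - 1 \<or> x = 1)" for k x by (auto simp: es_def)
  have des: "distinct es" by (simp add: es_def distinct_product)
  have dks: "distinct (ks @ es)" "distinct (ks' @ es)"
    using ks ks' es des by auto
  have f_end: "f k x \<noteq> f l x" if "k < m" "l < m" "k \<noteq> l" "x = - 1 \<or> x = 1" for k l x
    using old.f_meet[of k l x] that by auto
  have g_end: "g k x \<noteq> g l x" if "k < m" "l < m" "k \<noteq> l" "x = - 1 \<or> x = 1" for k l x
    using new.f_meet[of k l x] that by auto
  have cp: "x \<in> old.cut_points \<longleftrightarrow> x \<in> {-1/2, 0, 1/2} \<or> x = - 1 \<or> x = 1" for x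
    by (auto simp: old.cut_points_def)
  have cp': "x \<in> new.cut_points \<longleftrightarrow> x \<in> {-1/2, 0, 1/2} \<or> x = - 1 \<or> x = 1" for x
    by (auto simp: new.cut_points_def)
  define qs where "qs = map (\<lambda>(k, x). old.sp k x) (ks @ es)"
  define qs' where "qs' = map (\<lambda>(k, x). old.sp k x) (ks' @ es)"
  have m1: "marks D qs"
    unfolding qs_def using dks(1) ks(2) es f_end by (intro old.marks_strand) (auto simp: cp)
  have m2: "marks D' qs'"
    unfolding qs'_def using dks(2) ks'(2) es g_end by (intro new.marks_strand) (auto simp: cp')
  have c1: "cuts D qs = ?C"
    unfolding qs_def
  proof (rule old.cuts_eq_strand_cuts)
    show "k < m \<and> x \<in> old.cut_points" if "(k, x) \<in> set (ks @ es)" for k x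
      using that ks(2) es cp by auto
    show "(k, x) \<in> set (ks @ es) \<or> (\<exists>l<m. l \<noteq> k \<and> f k x = f l x)" if "k < m" "x \<in> old.cut_points" for k x
      using that ks(2)[of k x] es[of k x] cp[of x] by auto
  qed
  have c2: "cuts D' qs' = ?C"
    unfolding qs'_def strand_cuts_eq[symmetric]
  proof (rule new.cuts_eq_strand_cuts)
    show "k < m \<and> x \<in> new.cut_points" if "(k, x) \<in> set (ks' @ es)" for k x
      using that ks'(2) es cp' by auto
    show "(k, x) \<in> set (ks' @ es) \<or> (\<exists>l<m. l \<noteq> k \<and> g k x = g l x)" if "k < m" "x \<in> new.cut_points" for k x
      using that ks'(2)[of k x] es[of k x] cp'[of x] by auto
  qed
  obtain ws where ws: "set ws = crossings D - square" "distinct ws"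
    using finite_distinct_list[of "crossings D - square"] old.finite_crossings by blast
  have all: "distinct (vs @ ws)" "set (vs @ ws) = crossings D"
    "distinct (vs' @ ws)" "set (vs' @ ws) = crossings D'"
    using inner ws crossings_off by auto
  let ?S = "map (gsymb D (arc ?C)) vs @ map (\<lambda>(k, x). mark k x) ks"
  let ?S' = "map (gsymb D' (arc ?C)) vs' @ map (\<lambda>(k, x). mark k x) ks'"
  let ?P = "map (gsymb D (arc ?C)) ws @ map (\<lambda>(k, x). mark k x) es"
  have mk: "map (\<lambda>q. Con (arc ?C False q) (arc ?C True q)) (map (\<lambda>(k, x). old.sp k x) xs) =
      map (\<lambda>(k, x). mark k x) xs" for xs
    by (auto simp: mark_def)
  have out: "map (gsymb D' (arc ?C)) ws = map (gsymb D (arc ?C)) ws"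
    using ws(1) gsymb_off by (intro map_cong) auto
  have "mset (marked_symbols D (vs @ ws) qs) = mset (?S @ ?P)"
    unfolding marked_symbols_def c1 unfolding qs_def mk by simp
  moreover note b1 = old.balanced_marked_symbols[OF all(1,2) m1]
  ultimately have e1: "bracket (marked_symbols D (vs @ ws) qs) = bracket (?S @ ?P)"
      "balanced (plabs (?S @ ?P))"
    using bracket_cong_mset plabs_cong_mset by metis+
  have "mset (marked_symbols D' (vs' @ ws) qs') = mset (?S' @ ?P)"
    unfolding marked_symbols_def c2 unfolding qs'_def mk by (simp add: out)
  moreover note b2 = new.balanced_marked_symbols[OF all(3,4) m2]
  ultimately have e2: "bracket (marked_symbols D' (vs' @ ws) qs') = bracket (?S' @ ?P)"
    using bracket_cong_mset by metis
  have "cut_set ?C" using old.cut_set_cuts[of qs] c1 by simp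
  then have "sim (?S @ ?P) (?S' @ ?P)" using e1(2) by (rule sim)
  then have "veq (bracket (?S @ ?P)) (bracket (?S' @ ?P))" by (simp add: sim_def)
  moreover have "uncut D' (cuts D' qs') = uncut D (cuts D qs)"
    unfolding c1 c2 uncut_def ncomp_eq ..
  ultimately show ?thesis
    using old.state_sum_marked[OF all(1,2) m1] new.state_sum_marked[OF all(3,4) m2] e1(1) e2
    by (simp add: veq_mult)
qed

end

lemma square_moveI:
  assumes lm: "shaded_link_diagram D" "shaded_link_diagram D'" "ncomp D' = ncomp D"
    "inj_on ht {..<m}" "strands_in_square m K ht f D" "strands_in_square m K ht g D'"
    "\<forall>p\<in>params D. (\<exists>k<m. \<exists>x\<in>{-1..1}. same_param p (strand_param (K k) x)) \<or>
       (pt D p \<notin> square \<and> pt D' p = pt D p \<and> (p \<in> over D' \<longleftrightarrow> p \<in> over D))"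
    "shaded D' - square = shaded D - square"
    and f: "\<And>k x. k < m \<Longrightarrow> \<bar>x\<bar> \<le> 1 \<Longrightarrow> \<bar>f k x\<bar> < 1"
      "\<And>k x. k < m \<Longrightarrow> \<bar>x\<bar> < 1 \<Longrightarrow> (f k has_real_derivative f' k x) (at x)"
      "\<And>k l x. k < m \<Longrightarrow> l < m \<Longrightarrow> k \<noteq> l \<Longrightarrow> \<bar>x\<bar> \<le> 1 \<Longrightarrow> f k x = f l x \<Longrightarrow> x \<in> {-1/2, 0, 1/2}"
    and g: "\<And>k x. k < m \<Longrightarrow> \<bar>x\<bar> \<le> 1 \<Longrightarrow> \<bar>g k x\<bar> < 1"
      "\<And>k x. k < m \<Longrightarrow> \<bar>x\<bar> < 1 \<Longrightarrow> (g k has_real_derivative g' k x) (at x)"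
      "\<And>k l x. k < m \<Longrightarrow> l < m \<Longrightarrow> k \<noteq> l \<Longrightarrow> \<bar>x\<bar> \<le> 1 \<Longrightarrow> g k x = g l x \<Longrightarrow> x \<in> {-1/2, 0, 1/2}"
  shows "square_move D D' m K ht f f' g g'"
proof -
  have p: "params D' = params D" using lm(3) by (simp add: params_def)
  show ?thesis
  proof
    show "link_diagram D" "checkerboard D" "link_diagram D'" "checkerboard D'"
      using lm(1,2) by (simp_all add: shaded_link_diagram_def)
    show "(\<exists>k<m. \<exists>x\<in>{-1..1}. same_param q (strand_param (K k) x)) \<or> pt D q \<notin> square"
      if "q \<in> params D" for q
      using lm(7) that by blast
    show "(\<exists>k<m. \<exists>x\<in>{-1..1}. same_param q (strand_param (K k) x)) \<or> pt D' q \<notin> square"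
      if "q \<in> params D'" for q
      using lm(7) that p by fastforce
    show "(\<exists>k<m. \<exists>x\<in>{-1..1}. same_param q (strand_param (K k) x)) \<or>
       (pt D q \<notin> square \<and> pt D' q = pt D q \<and> (q \<in> over D' \<longleftrightarrow> q \<in> over D))"
      if "q \<in> params D" for q
      using lm(7) that by blast
  qed (fact lm f g)+
qed

section \<open>The graphs of the two moves\<close>

lemma bump_bounds: "\<bar>x\<bar> \<le> 1 \<Longrightarrow> 0 \<le> bump x" "\<bar>x\<bar> \<le> 1 \<Longrightarrow> bump x \<le> 1"
proof -
  assume "\<bar>x\<bar> \<le> 1"
  then have "x\<^sup>2 \<le> 1" by (simp add: abs_square_le_1)
  then show "0 \<le> bump x" "bump x \<le> 1" by (simp_all add: bump_def power_le_one)
qed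

lemma bump_less:
  assumes "\<bar>x\<bar> < \<bar>y\<bar>" "\<bar>y\<bar> \<le> 1"
  shows "bump y < bump x"
proof -
  have "x\<^sup>2 < y\<^sup>2" using assms(1) by (metis abs_ge_zero power2_abs power_strict_mono zero_less_numeral)
  moreover have "y\<^sup>2 \<le> 1" using assms(2) by (simp add: abs_square_le_1)
  ultimately show ?thesis unfolding bump_def by (intro power_strict_mono) auto
qed

lemma bump_values [simp]: "bump 0 = 1" "bump (1 / 2) = 9 / 16" "bump (- (1 / 2)) = 9 / 16"
  by (simp_all add: bump_def power2_eq_square)

text \<open>\<open>bump\<close> decreases strictly in \<open>\<bar>x\<bar>\<close> and takes the
  value 9/16 at 1/2.\<close>

lemma bump_eqD:
  assumes "\<bar>x\<bar> \<le> 1" "bump x = 9 / 16"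
  shows "x = 1 / 2 \<or> x = - (1 / 2)"
  using bump_less[of x "1 / 2"] bump_less[of "1 / 2" x] assms by (cases "\<bar>x\<bar>" "1 / 2 :: real" rule: linorder_cases) auto

text \<open>At \<open>\<bar>x\<bar> = 1/2\<close> both sides are 1/4; the left one decreases in
  \<open>\<bar>x\<bar>\<close> and the right one increases.\<close>

lemma bump_meets_line:
  assumes "\<bar>x\<bar> \<le> 1" "4 / 9 * bump x = \<bar>x\<bar> / 2"
  shows "\<bar>x\<bar> = 1 / 2"
  using bump_less[of x "1 / 2"] bump_less[of "1 / 2" x] assms by (cases "\<bar>x\<bar>" "1 / 2 :: real" rule: linorder_cases) auto

lemma bump_deriv: "(bump has_real_derivative - (4 * x * (1 - x\<^sup>2))) (at x)"
  unfolding bump_def[abs_def] by (auto intro!: derivative_eq_intros simp: algebra_simps power2_eq_square)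

lemma meet_none_of_two:
  assumes "k < 2" "u 0 x = u (Suc 0) x \<longleftrightarrow> Q"
  shows "(\<forall>l<2. l \<noteq> k \<longrightarrow> u k x \<noteq> u l x) \<longleftrightarrow> \<not> Q"
proof -
  have "(\<forall>l<2. P l) \<longleftrightarrow> P 0 \<and> P (Suc 0)" for P by (auto simp: less_Suc_eq numeral_2_eq_2)
  moreover have "k = 0 \<or> k = Suc 0" using assms(1) by auto
  ultimately show ?thesis using assms(2) by (elim disjE) (simp_all, metis)
qed

theorem veq_reidemeister2:
  assumes "reidemeister2 D D'"
  shows "veq (state_sum D) (state_sum D')"
proof -
  let ?f = "\<lambda>k x. if k = (0::nat) then 0 else 9/16 - bump x"
  let ?g = "\<lambda>k (x::real). if k = (0::nat) then 0 else 9/16 :: real"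
  let ?f' = "\<lambda>k x. if k = (0::nat) then 0 else 4 * x * (1 - x\<^sup>2)"
  let ?g' = "\<lambda>k x. 0"
  have two: "k < 2 \<longleftrightarrow> k = 0 \<or> k = Suc 0" for k :: nat by auto
  obtain K and ht :: "nat \<Rightarrow> nat" where K: "shaded_link_diagram D" "shaded_link_diagram D'" "ncomp D' = ncomp D"
    "inj_on ht {..<2}" "strands_in_square 2 K ht ?f D" "strands_in_square 2 K ht ?g D'"
    "\<forall>p\<in>params D. (\<exists>k<2. \<exists>x\<in>{-1..1}. same_param p (strand_param (K k) x)) \<or>
       (pt D p \<notin> square \<and> pt D' p = pt D p \<and> (p \<in> over D' \<longleftrightarrow> p \<in> over D))"
    "shaded D' - square = shaded D - square"
    using assms unfolding reidemeister2_def local_move_def by blast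
  have meet: "x = 1 / 2 \<or> x = - (1 / 2)" if "\<bar>x\<bar> \<le> 1" "?f k x = ?f l x" "k < 2" "l < 2" "k \<noteq> l" for k l x
    using that bump_eqD[of x] by (auto simp: two)
  interpret M: square_move D D' 2 K ht ?f ?f' ?g ?g'
  proof (rule square_moveI[OF K])
    show "\<bar>?f k x\<bar> < 1" if "\<bar>x\<bar> \<le> 1" for k x
      using bump_bounds[OF that] by auto
    show "(?f k has_real_derivative ?f' k x) (at x)" for k x
      using DERIV_diff[OF DERIV_const bump_deriv, of "9/16" x] by (cases "k = 0") simp_all
    show "x \<in> {-1/2, 0, 1/2}" if "k < 2" "l < 2" "k \<noteq> l" "\<bar>x\<bar> \<le> 1" "?f k x = ?f l x" for k l x
      using meet[OF that(4,5,1,2,3)] by auto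
    show "(?g k has_real_derivative 0) (at x)" for k x by (cases "k = 0") simp_all
  qed (auto simp: two)
  let ?q = M.old.quarter and ?C = M.old.strand_cuts
  \<comment> \<open>The shade above all strands; the upper sectors of both crossings reach the top
    side of the square.\<close>
  define n where "n \<longleftrightarrow> Complex 0 1 \<in> shaded D"
  define ov where "ov \<longleftrightarrow> ht 0 < ht (Suc 0)"
  have not_ov: "(ht (Suc 0) < ht 0) = (\<not> ov)" using M.old.ht_neq[of 0 "Suc 0"] by (auto simp: ov_def)
  show ?thesis
  proof (rule M.state_sum_move[of "[Complex (- (1/2)) 0, Complex (1/2) 0]" "[]" "[(0, 0), (Suc 0, 0)]"
        "[(0, - (1/2)), (0, 0), (0, 1/2), (Suc 0, - (1/2)), (Suc 0, 0), (Suc 0, 1/2)]"])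
    show "set [Complex (- (1/2)) 0, Complex (1/2) 0] = crossings D \<inter> square"
    proof (intro equalityI subsetI)
      fix v assume "v \<in> set [Complex (- (1/2)) 0, Complex (1/2) 0]"
      then have "\<exists>x. v = Complex x (?f 0 x) \<and> ?f 0 x = ?f 1 x \<and> \<bar>x\<bar> \<le> 1"
        by (auto intro: exI[of _ "1/2"] exI[of _ "- (1/2)"])
      then obtain x where "v = Complex x (?f 0 x)" "?f 0 x = ?f 1 x" "\<bar>x\<bar> \<le> 1" by blast
      then show "v \<in> crossings D \<inter> square" unfolding M.old.crossing_square
        by (intro CollectI exI[of _ 0] exI[of _ 1] exI[of _ x]) auto
    next
      fix v assume "v \<in> crossings D \<inter> square"
      then obtain k l x where v: "v = Complex x (?f k x)" "k < 2" "l < 2" "k \<noteq> l" "\<bar>x\<bar> \<le> 1" "?f k x = ?f l x"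
        unfolding M.old.crossing_square by blast
      then show "v \<in> set [Complex (- (1/2)) 0, Complex (1/2) 0]" using meet[OF v(5,6,2,3,4)] by auto
    qed
    show "set [] = crossings D' \<inter> square"
    proof -
      have *: "False" if "k < 2" "l < 2" "k \<noteq> l" "?g k x = ?g l x" for k l x
        using that by (auto simp: two)
      have "v \<notin> crossings D' \<inter> square" for v
      proof
        assume "v \<in> crossings D' \<inter> square"
        then obtain k l x where "k < 2" "l < 2" "k \<noteq> l" "?g k x = ?g l x"
          unfolding M.new.crossing_square by blast
        then show False by (rule *)
      qed
      then show ?thesis by auto
    qed
    show "(k, x) \<in> set [(0, 0), (Suc 0, 0)] \<longleftrightarrow>
        k < 2 \<and> x \<in> {-1/2, 0, 1/2} \<and> (\<forall>l<2. l \<noteq> k \<longrightarrow> ?f k x \<noteq> ?f l x)" for k x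
    proof (cases "k < 2 \<and> x \<in> {-1/2, 0, 1/2}")
      case True
      then have x1: "\<bar>x\<bar> \<le> 1" by auto
      have fm: "?f 0 x = ?f (Suc 0) x \<longleftrightarrow> x = 1/2 \<or> x = - (1/2)"
      proof
        assume "?f 0 x = ?f (Suc 0) x"
        then show "x = 1/2 \<or> x = - (1/2)" by (intro bump_eqD[OF x1]) simp
      next
        assume "x = 1/2 \<or> x = - (1/2)"
        then have "bump x = 9/16" using bump_values(2,3) by blast
        then show "?f 0 x = ?f (Suc 0) x" by simp
      qed
      have k: "k < 2" using True by blast
      have "x = - (1/2) \<or> x = 0 \<or> x = 1/2" using True by simp
      then have "(k, x) \<in> set [(0, 0), (Suc 0, 0)] \<longleftrightarrow> \<not> (x = 1/2 \<or> x = - (1/2))"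
        using k[unfolded two] by (elim disjE; hypsubst; simp)
      then show ?thesis using True meet_none_of_two[where u = ?f, OF k fm] by blast
    next
      case False
      then have "(k, x) \<notin> set [(0, 0), (Suc 0, 0)]" by auto
      then show ?thesis using False by blast
    qed
    show "(k, x) \<in> set [(0, - (1/2)), (0, 0), (0, 1/2), (Suc 0, - (1/2)), (Suc 0, 0), (Suc 0, 1/2)] \<longleftrightarrow>
        k < 2 \<and> x \<in> {-1/2, 0, 1/2} \<and> (\<forall>l<2. l \<noteq> k \<longrightarrow> ?g k x \<noteq> ?g l x)" for k x
    proof (cases "k < 2 \<and> x \<in> {-1/2, 0, 1/2}")
      case True
      have gm: "?g 0 x = ?g (Suc 0) x \<longleftrightarrow> False" by simp
      have k: "k < 2" using True by blast
      have "x = - (1/2) \<or> x = 0 \<or> x = 1/2" using True by simp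
      then have "(k, x) \<in> set [(0, - (1/2)), (0, 0), (0, 1/2), (Suc 0, - (1/2)), (Suc 0, 0), (Suc 0, 1/2)] \<longleftrightarrow> \<not> False"
        using k[unfolded two] by (elim disjE; hypsubst; simp)
      then show ?thesis using True meet_none_of_two[where u = ?g, OF k gm] by blast
    next
      case False
      then have "(k, x) \<notin> set [(0, - (1/2)), (0, 0), (0, 1/2), (Suc 0, - (1/2)), (Suc 0, 0), (Suc 0, 1/2)]" by auto
      then show ?thesis using False by blast
    qed
    fix P
    assume cs: "cut_set ?C" and bal: "balanced (plabs ((map (gsymb D (arc ?C)) [Complex (- (1/2)) 0, Complex (1/2) 0] @
      map (\<lambda>(k, x). M.mark k x) [(0, 0), (Suc 0, 0)]) @ P))"
    have qd: "distinct [?q 0 0, ?q 0 1, ?q 0 2, ?q 0 3, ?q (Suc 0) 0, ?q (Suc 0) 1, ?q (Suc 0) 2, ?q (Suc 0) 3]"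
      using M.old.distinct_quarters[OF cs] by (simp add: upt_rec numeral_nat)
    note qw = M.old.quarter_west[OF cs, of 0] M.old.quarter_west[OF cs, of "Suc 0"]
    note qe = M.old.quarter_east[OF cs]
    have mk: "req (M.mark k x) (Con (M.old.west k x) (M.old.east k x))" for k x
      unfolding M.mark_def by (rule M.old.req_mark[OF cs])
    \<comment> \<open>At -1/2 strand 1 descends with slope -3/2, so strand 0 has the larger slope;
      at 1/2 the roles are exchanged.\<close>
    have g1: "req (gsymb D (arc ?C) (Complex (- (1/2)) 0)) (cr (?q 0 1) (?q (Suc 0) 0) (?q 0 0) (?q (Suc 0) 1) (\<not> ov) n)"
      using M.old.gsymb_east_west(1)[OF cs, of "Suc 0" 0 "- (1/2)"]
        M.old.dsh_top[of "- (1/2)" 0]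
      by (simp add: qw qe power2_eq_square not_ov n_def two)
    have g2: "req (gsymb D (arc ?C) (Complex (1/2) 0)) (cr (?q (Suc 0) 3) (?q 0 2) (?q (Suc 0) 2) (?q 0 3) ov n)"
      using M.old.gsymb_east_west(1)[OF cs, of 0 "Suc 0" "1/2"]
        M.old.dsh_top[of "1/2" 0]
      by (simp add: qw qe power2_eq_square ov_def n_def two)
    let ?A = "[cr (?q 0 1) (?q (Suc 0) 0) (?q 0 0) (?q (Suc 0) 1) (\<not> ov) n, cr (?q (Suc 0) 3) (?q 0 2) (?q (Suc 0) 2) (?q 0 3) ov n,
      Con (?q 0 1) (?q 0 2), Con (?q (Suc 0) 1) (?q (Suc 0) 2)]"
    let ?B = "[Con (?q 0 0) (?q 0 1), Con (?q 0 1) (?q 0 2), Con (?q 0 2) (?q 0 3),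
      Con (?q (Suc 0) 0) (?q (Suc 0) 1), Con (?q (Suc 0) 1) (?q (Suc 0) 2), Con (?q (Suc 0) 2) (?q (Suc 0) 3)]"
    have m1: "req (M.mark 0 0) (Con (?q 0 1) (?q 0 2))" "req (M.mark (Suc 0) 0) (Con (?q (Suc 0) 1) (?q (Suc 0) 2))"
      "req (M.mark 0 (- (1/2))) (Con (?q 0 0) (?q 0 1))" "req (M.mark (Suc 0) (- (1/2))) (Con (?q (Suc 0) 0) (?q (Suc 0) 1))"
      "req (M.mark 0 (1/2)) (Con (?q 0 2) (?q 0 3))" "req (M.mark (Suc 0) (1/2)) (Con (?q (Suc 0) 2) (?q (Suc 0) 3))"
      using mk[of 0 0] mk[of "Suc 0" 0] mk[of 0 "- (1/2)"] mk[of "Suc 0" "- (1/2)"] mk[of 0 "1/2"] mk[of "Suc 0" "1/2"]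
      by (simp_all add: qw qe)
    have "sim ((map (gsymb D (arc ?C)) [Complex (- (1/2)) 0, Complex (1/2) 0] @
      map (\<lambda>(k, x). M.mark k x) [(0, 0), (Suc 0, 0)]) @ P) (?A @ P)"
      using bal g1 g2 m1 by (intro sim_req) (auto simp: list_all2_refl)
    also have "sim (?A @ P) (?B @ P)"
      using calculation qd by (intro R2_marked) (auto simp: sim_def)
    also have "sim (?B @ P) ((map (gsymb D' (arc ?C)) [] @ map (\<lambda>(k, x). M.mark k x)
        [(0, - (1/2)), (0, 0), (0, 1/2), (Suc 0, - (1/2)), (Suc 0, 0), (Suc 0, 1/2)]) @ P)"
      using calculation m1[THEN req_sym] by (intro sim_req) (auto simp: sim_def list_all2_refl)
    finally show "sim ((map (gsymb D (arc ?C)) [Complex (- (1/2)) 0, Complex (1/2) 0] @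
      map (\<lambda>(k, x). M.mark k x) [(0, 0), (Suc 0, 0)]) @ P) ((map (gsymb D' (arc ?C)) [] @ map (\<lambda>(k, x). M.mark k x)
        [(0, - (1/2)), (0, 0), (0, 1/2), (Suc 0, - (1/2)), (Suc 0, 0), (Suc 0, 1/2)]) @ P)" .
  qed simp_all
qed

lemma meet_of_three:
  fixes u :: "nat \<Rightarrow> 'a \<Rightarrow> 'b"
  assumes "k < 3" "l < 3" "k \<noteq> l" "u k x = u l x"
    and "u 0 x = u (Suc 0) x \<longleftrightarrow> x = a" "u 0 x = u 2 x \<longleftrightarrow> x = b" "u (Suc 0) x = u 2 x \<longleftrightarrow> x = c"
  shows "(k = 0 \<and> l = Suc 0 \<or> k = Suc 0 \<and> l = 0) \<and> x = a \<or> (k = 0 \<and> l = 2 \<or> k = 2 \<and> l = 0) \<and> x = b \<or>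
    (k = Suc 0 \<and> l = 2 \<or> k = 2 \<and> l = Suc 0) \<and> x = c"
proof -
  have "k = 0 \<or> k = Suc 0 \<or> k = 2" "l = 0 \<or> l = Suc 0 \<or> l = 2" using assms(1,2) by auto
  then show ?thesis using assms(3-) assms(4)[symmetric] by (elim disjE) simp_all
qed

lemma meet_none_of_three:
  fixes u :: "nat \<Rightarrow> 'a \<Rightarrow> 'b"
  assumes "k < 3"
    and "u 0 x = u (Suc 0) x \<longleftrightarrow> x = a" "u 0 x = u 2 x \<longleftrightarrow> x = b" "u (Suc 0) x = u 2 x \<longleftrightarrow> x = c"
  shows "(\<forall>l<3. l \<noteq> k \<longrightarrow> u k x \<noteq> u l x) \<longleftrightarrow>
    k = 0 \<and> x \<noteq> a \<and> x \<noteq> b \<or> k = Suc 0 \<and> x \<noteq> a \<and> x \<noteq> c \<or> k = 2 \<and> x \<noteq> b \<and> x \<noteq> c"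
proof -
  have "(\<forall>l<3. P l) \<longleftrightarrow> P 0 \<and> P (Suc 0) \<and> P 2" for P by (auto simp: less_Suc_eq numeral_3_eq_3 numeral_2_eq_2)
  moreover have "k = 0 \<or> k = Suc 0 \<or> k = 2" using assms(1) by auto
  moreover have "u (Suc 0) x = u 0 x \<longleftrightarrow> x = a" "u 2 x = u 0 x \<longleftrightarrow> x = b" "u 2 x = u (Suc 0) x \<longleftrightarrow> x = c"
    using assms(2-4) by metis+
  ultimately show ?thesis using assms(2-4) by (elim disjE) simp_all
qed

theorem veq_reidemeister3:
  assumes "reidemeister3 D D'"
  shows "veq (state_sum D) (state_sum D')"
proof -
  let ?f = "\<lambda>k x. if k = (0::nat) then x / 2 else if k = 1 then - (x / 2) else 4/9 * bump x"
  let ?g = "\<lambda>k x. if k = (0::nat) then x / 2 else if k = 1 then - (x / 2) else - (4/9 * bump x)"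
  let ?f' = "\<lambda>k x. if k = (0::nat) then 1 / 2 else if k = 1 then - (1 / 2) else - (16/9 * x * (1 - x\<^sup>2))"
  let ?g' = "\<lambda>k x. if k = (0::nat) then 1 / 2 else if k = 1 then - (1 / 2) else 16/9 * x * (1 - x\<^sup>2)"
  have three: "k < 3 \<longleftrightarrow> k = 0 \<or> k = Suc 0 \<or> k = 2" for k :: nat by auto
  obtain K and ht :: "nat \<Rightarrow> nat" where K: "shaded_link_diagram D" "shaded_link_diagram D'" "ncomp D' = ncomp D"
    "inj_on ht {..<3}" "strands_in_square 3 K ht ?f D" "strands_in_square 3 K ht ?g D'"
    "\<forall>p\<in>params D. (\<exists>k<3. \<exists>x\<in>{-1..1}. same_param p (strand_param (K k) x)) \<or>
       (pt D p \<notin> square \<and> pt D' p = pt D p \<and> (p \<in> over D' \<longleftrightarrow> p \<in> over D))"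
    "shaded D' - square = shaded D - square"
    using assms unfolding reidemeister3_def local_move_def by blast
  have line: "4/9 * bump x = x / 2 \<longleftrightarrow> x = 1/2" "4/9 * bump x = - (x / 2) \<longleftrightarrow> x = - (1/2)" if "\<bar>x\<bar> \<le> 1" for x
  proof -
    note b = bump_bounds(1)[OF that]
    show "4/9 * bump x = x / 2 \<longleftrightarrow> x = 1/2"
    proof
      assume eq: "4/9 * bump x = x / 2"
      then have "0 \<le> x" using b by linarith
      then show "x = 1/2" using bump_meets_line[OF that] eq by simp
    next
      assume "x = 1/2"
      then show "4/9 * bump x = x / 2" by (simp only: bump_values; simp)
    qed
    show "4/9 * bump x = - (x / 2) \<longleftrightarrow> x = - (1/2)"
    proof
      assume eq: "4/9 * bump x = - (x / 2)"
      then have "x \<le> 0" using b by linarith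
      then show "x = - (1/2)" using bump_meets_line[OF that] eq by simp
    next
      assume "x = - (1/2)"
      then show "4/9 * bump x = - (x / 2)" by (simp only: bump_values; simp)
    qed
  qed
  have fmeet: "?f 0 x = ?f (Suc 0) x \<longleftrightarrow> x = 0" "?f 0 x = ?f 2 x \<longleftrightarrow> x = 1/2" "?f (Suc 0) x = ?f 2 x \<longleftrightarrow> x = - (1/2)"
    and gmeet: "?g 0 x = ?g (Suc 0) x \<longleftrightarrow> x = 0" "?g 0 x = ?g 2 x \<longleftrightarrow> x = - (1/2)" "?g (Suc 0) x = ?g 2 x \<longleftrightarrow> x = 1/2"
    if "\<bar>x\<bar> \<le> 1" for x
    using line[OF that] by auto

  have fpair: "(k = 0 \<and> l = Suc 0 \<or> k = Suc 0 \<and> l = 0) \<and> x = 0 \<or> (k = 0 \<and> l = 2 \<or> k = 2 \<and> l = 0) \<and> x = 1/2 \<or>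
      (k = Suc 0 \<and> l = 2 \<or> k = 2 \<and> l = Suc 0) \<and> x = - (1/2)"
    if "k < 3" "l < 3" "k \<noteq> l" "\<bar>x\<bar> \<le> 1" "?f k x = ?f l x" for k l x
    by (rule meet_of_three[where u = ?f, OF that(1,2,3,5) fmeet[OF that(4)]])
  have gpair: "(k = 0 \<and> l = Suc 0 \<or> k = Suc 0 \<and> l = 0) \<and> x = 0 \<or> (k = 0 \<and> l = 2 \<or> k = 2 \<and> l = 0) \<and> x = - (1/2) \<or>
      (k = Suc 0 \<and> l = 2 \<or> k = 2 \<and> l = Suc 0) \<and> x = 1/2"
    if "k < 3" "l < 3" "k \<noteq> l" "\<bar>x\<bar> \<le> 1" "?g k x = ?g l x" for k l x
    by (rule meet_of_three[where u = ?g, OF that(1,2,3,5) gmeet[OF that(4)]])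
  interpret M: square_move D D' 3 K ht ?f ?f' ?g ?g'
  proof (rule square_moveI[OF K])
    show "\<bar>?f k x\<bar> < 1" "\<bar>?g k x\<bar> < 1" if "\<bar>x\<bar> \<le> 1" for k x
      using bump_bounds[OF that] that by auto
    have b: "((\<lambda>x. c * bump x) has_real_derivative c * - (4 * x * (1 - x\<^sup>2))) (at x)" for c x
      by (rule DERIV_cmult[OF bump_deriv])
    have l: "((\<lambda>x. x / 2) has_real_derivative 1 / 2) (at x)" "((\<lambda>x. - (x / 2)) has_real_derivative - (1 / 2)) (at x)" for x :: real
      by (auto intro!: derivative_eq_intros)
    show "(?f k has_real_derivative ?f' k x) (at x)" for k x
      using b[of "4/9" x] l by (cases "k = 0"; cases "k = 1") (simp_all add: mult.assoc)
    show "(?g k has_real_derivative ?g' k x) (at x)" for k x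
      using b[of "- (4/9)" x] l by (cases "k = 0"; cases "k = 1") (simp_all add: mult.assoc)
    show "x \<in> {-1/2, 0, 1/2}" if "k < 3" "l < 3" "k \<noteq> l" "\<bar>x\<bar> \<le> 1" "?f k x = ?f l x" for k l x
      using fpair[OF that] by auto
    show "x \<in> {-1/2, 0, 1/2}" if "k < 3" "l < 3" "k \<noteq> l" "\<bar>x\<bar> \<le> 1" "?g k x = ?g l x" for k l x
      using gpair[OF that] by auto
  qed
  let ?q = M.old.quarter and ?C = M.old.strand_cuts
  define n where "n \<longleftrightarrow> Complex 0 1 \<in> shaded D"
  define s where "s \<longleftrightarrow> Complex 0 (- 1) \<in> shaded D"
  have n': "Complex 0 1 \<in> shaded D' \<longleftrightarrow> n" and s': "Complex 0 (- 1) \<in> shaded D' \<longleftrightarrow> s"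
    using M.shaded_boundary by (simp_all add: n_def s_def)
  \<comment> \<open>Down the line \<open>x = 0\<close>, the shade changes once at strand 2, and then
    passes through the crossing at 0 between opposite sectors, where it stays the same.\<close>
  have sn: "s = (\<not> n)"
  proof -
    let ?p = "M.old.sp 2 0"
    have p: "?p \<in> params D" "\<not> crossing_param D ?p" "pt D ?p = Complex 0 (4/9)"
      using M.old.sp_params[of 2 0] M.old.crossing_sp_iff[of 2 0] M.old.pt_sp[of 2 0] by (auto simp: three)
    have "\<bar>M.old.slope 2\<bar> *\<^sub>R dir D (M.old.right 2) ?p = Complex 1 0"
      using M.old.dir_sp[of 2 0] by simp
    then have "\<bar>M.old.slope 2\<bar> * cdet (dir D (M.old.right 2) ?p) \<i> = cdet (Complex 1 0) \<i>"
      by (metis cdet_simps(12))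
    also have "\<dots> = 1" by (simp add: cdet_def)
    finally have "cdet (dir D (M.old.right 2) ?p) \<i> > 0"
      by (metis abs_ge_zero mult_nonneg_nonpos not_less not_one_le_zero)
    then have "dsh D (Complex 0 (4/9)) \<i> \<longleftrightarrow> \<not> dsh D (Complex 0 (4/9)) (- \<i>)"
      using M.old.side_shade[OF p(1,2), of \<i> "- \<i>"] M.old.side_shade[OF p(1,2), of "- \<i>" \<i>] p(3)
      by (cases "M.old.right 2") (auto simp: dir_def)
    moreover have "dsh D (Complex 0 (4/9)) \<i> \<longleftrightarrow> n"
      using M.old.dsh_top[of 0 2] by (simp add: n_def three)
    moreover have "dsh D (Complex 0 (4/9)) (- \<i>) \<longleftrightarrow> Complex 0 (2/9) \<in> shaded D"
      by (rule M.old.dsh_down) (auto simp: three)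
    moreover have "dsh D (Complex 0 0) \<i> \<longleftrightarrow> Complex 0 (2/9) \<in> shaded D"
      by (rule M.old.dsh_up) (auto simp: three)
    moreover have "dsh D (Complex 0 0) \<i> \<longleftrightarrow> dsh D (Complex 0 0) (- \<i>)"
      using M.old.dsh_up_eq_down[of 1 0 0] by simp
    moreover have "dsh D (Complex 0 0) (- \<i>) \<longleftrightarrow> s"
      using M.old.dsh_bottom[of 0 0] by (simp add: s_def three)
    ultimately show ?thesis by blast
  qed
  \<comment> \<open>The first, second and third strand of the triangles are the strands 2, 0 and
    1.\<close>
  define o12 where "o12 \<longleftrightarrow> ht 0 < ht 2"
  define o31 where "o31 \<longleftrightarrow> ht 2 < ht (Suc 0)"
  define o23 where "o23 \<longleftrightarrow> ht (Suc 0) < ht 0"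
  have not: "(ht 2 < ht 0) = (\<not> o12)" "(ht (Suc 0) < ht 2) = (\<not> o31)"
    using M.old.ht_neq[of 0 2] M.old.ht_neq[of "Suc 0" 2] by (auto simp: o12_def o31_def)
  \<comment> \<open>Heights are linearly ordered, which excludes the cyclic patterns.\<close>
  have cyc: "\<not> (o12 = o31 \<and> o31 = o23)"
    using M.old.ht_neq[of 0 2] M.old.ht_neq[of "Suc 0" 2] M.old.ht_neq[of 0 "Suc 0"]
    unfolding o12_def o31_def o23_def by auto
  \<comment> \<open>The ordinates 1/4 and -1/4 are the values of the lines at the abscissas 1/2 and
    -1/2.\<close>
  let ?vs = "[Complex (1/2) (1/4), Complex (- (1/2)) (1/4), Complex 0 0]"
  let ?vs' = "[Complex (1/2) (- (1/4)), Complex 0 0, Complex (- (1/2)) (- (1/4))]"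
  let ?ks = "[(0, - (1/2)), (Suc 0, 1/2), (2, 0)]" and ?ks' = "[(0, 1/2), (Suc 0, - (1/2)), (2, 0)]"
  show ?thesis
  proof (rule M.state_sum_move[of ?vs ?vs' ?ks ?ks'])
    show "set ?vs = crossings D \<inter> square"
    proof (intro equalityI subsetI)
      fix v assume "v \<in> set ?vs"
      then have disj: "v = Complex (1/2) (1/4) \<or> v = Complex (- (1/2)) (1/4) \<or> v = Complex 0 0" by simp
      have I: "v \<in> crossings D \<inter> square"
        if "k < 3" "l < 3" "k \<noteq> l" "\<bar>x\<bar> \<le> 1" "?f k x = ?f l x" "v = Complex x (?f k x)" for k l x
        unfolding M.old.crossing_square using that by blast
      from disj show "v \<in> crossings D \<inter> square"
      proof (elim disjE)
        assume "v = Complex (1/2) (1/4)"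
        then show ?thesis by (intro I[of 0 2 "1/2"]) simp_all
      next
        assume "v = Complex (- (1/2)) (1/4)"
        then show ?thesis by (intro I[of "Suc 0" 2 "- (1/2)"]) simp_all
      next
        assume "v = Complex 0 0"
        then show ?thesis by (intro I[of 0 "Suc 0" 0]) simp_all
      qed
    next
      fix v assume "v \<in> crossings D \<inter> square"
      then obtain k l x where v: "v = Complex x (?f k x)" "k < 3" "l < 3" "k \<noteq> l" "\<bar>x\<bar> \<le> 1" "?f k x = ?f l x"
        unfolding M.old.crossing_square by blast
      then show "v \<in> set ?vs" using fpair[OF v(2-6)] by auto
    qed
    show "set ?vs' = crossings D' \<inter> square"
    proof (intro equalityI subsetI)
      fix v assume "v \<in> set ?vs'"
      then have disj: "v = Complex (1/2) (- (1/4)) \<or> v = Complex 0 0 \<or> v = Complex (- (1/2)) (- (1/4))" by simp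
      have I: "v \<in> crossings D' \<inter> square"
        if "k < 3" "l < 3" "k \<noteq> l" "\<bar>x\<bar> \<le> 1" "?g k x = ?g l x" "v = Complex x (?g k x)" for k l x
        unfolding M.new.crossing_square using that by blast
      from disj show "v \<in> crossings D' \<inter> square"
      proof (elim disjE)
        assume "v = Complex (1/2) (- (1/4))"
        then show ?thesis by (intro I[of "Suc 0" 2 "1/2"]) simp_all
      next
        assume "v = Complex 0 0"
        then show ?thesis by (intro I[of 0 "Suc 0" 0]) simp_all
      next
        assume "v = Complex (- (1/2)) (- (1/4))"
        then show ?thesis by (intro I[of 0 2 "- (1/2)"]) simp_all
      qed
    next
      fix v assume "v \<in> crossings D' \<inter> square"
      then obtain k l x where v: "v = Complex x (?g k x)" "k < 3" "l < 3" "k \<noteq> l" "\<bar>x\<bar> \<le> 1" "?g k x = ?g l x"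
        unfolding M.new.crossing_square by blast
      then show "v \<in> set ?vs'" using gpair[OF v(2-6)] by auto
    qed
    show "(k, x) \<in> set ?ks \<longleftrightarrow>
        k < 3 \<and> x \<in> {-1/2, 0, 1/2} \<and> (\<forall>l<3. l \<noteq> k \<longrightarrow> ?f k x \<noteq> ?f l x)" for k x
    proof (cases "k < 3 \<and> x \<in> {-1/2, 0, 1/2}")
      case True
      then have "\<bar>x\<bar> \<le> 1" and k: "k < 3" by auto
      have "x = - (1/2) \<or> x = 0 \<or> x = 1/2" using True by simp
      then have "(k, x) \<in> set ?ks \<longleftrightarrow>
          k = 0 \<and> x \<noteq> 0 \<and> x \<noteq> 1/2 \<or> k = Suc 0 \<and> x \<noteq> 0 \<and> x \<noteq> - (1/2) \<or> k = 2 \<and> x \<noteq> 1/2 \<and> x \<noteq> - (1/2)"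
        using k[unfolded three] by (elim disjE; hypsubst; simp)
      then show ?thesis using True meet_none_of_three[where u = ?f, OF k fmeet[OF \<open>\<bar>x\<bar> \<le> 1\<close>]] by blast
    next
      case False
      then have "(k, x) \<notin> set ?ks" by auto
      then show ?thesis using False by blast
    qed
    show "(k, x) \<in> set ?ks' \<longleftrightarrow>
        k < 3 \<and> x \<in> {-1/2, 0, 1/2} \<and> (\<forall>l<3. l \<noteq> k \<longrightarrow> ?g k x \<noteq> ?g l x)" for k x
    proof (cases "k < 3 \<and> x \<in> {-1/2, 0, 1/2}")
      case True
      then have "\<bar>x\<bar> \<le> 1" and k: "k < 3" by auto
      have "x = - (1/2) \<or> x = 0 \<or> x = 1/2" using True by simp
      then have "(k, x) \<in> set ?ks' \<longleftrightarrow>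
          k = 0 \<and> x \<noteq> 0 \<and> x \<noteq> - (1/2) \<or> k = Suc 0 \<and> x \<noteq> 0 \<and> x \<noteq> 1/2 \<or> k = 2 \<and> x \<noteq> - (1/2) \<and> x \<noteq> 1/2"
        using k[unfolded three] by (elim disjE; hypsubst; simp)
      then show ?thesis using True meet_none_of_three[where u = ?g, OF k gmeet[OF \<open>\<bar>x\<bar> \<le> 1\<close>]] by blast
    next
      case False
      then have "(k, x) \<notin> set ?ks'" by auto
      then show ?thesis using False by blast
    qed
    fix P
    assume cs: "cut_set ?C" and bal: "balanced (plabs ((map (gsymb D (arc ?C)) ?vs @ map (\<lambda>(k, x). M.mark k x) ?ks) @ P))"
    have cs': "cut_set M.new.strand_cuts" using cs by (simp add: M.strand_cuts_eq)
    have qd: "distinct [?q 0 0, ?q 0 1, ?q 0 2, ?q 0 3, ?q (Suc 0) 0, ?q (Suc 0) 1, ?q (Suc 0) 2, ?q (Suc 0) 3,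
        ?q 2 0, ?q 2 1, ?q 2 2, ?q 2 3]"
      using M.old.distinct_quarters[OF cs] by (simp add: upt_rec numeral_nat)
    note qw = M.old.quarter_west[OF cs, of 0] M.old.quarter_west[OF cs, of "Suc 0"] M.old.quarter_west[OF cs, of 2]
    note qe = M.old.quarter_east[OF cs]
    have mk: "req (M.mark k x) (Con (M.old.west k x) (M.old.east k x))" for k x
      unfolding M.mark_def by (rule M.old.req_mark[OF cs])
    have m1: "req (M.mark 0 (- (1/2))) (Con (?q 0 0) (?q 0 1))" "req (M.mark (Suc 0) (1/2)) (Con (?q (Suc 0) 2) (?q (Suc 0) 3))"
      "req (M.mark 2 0) (Con (?q 2 1) (?q 2 2))"
      "req (M.mark 0 (1/2)) (Con (?q 0 2) (?q 0 3))" "req (M.mark (Suc 0) (- (1/2))) (Con (?q (Suc 0) 0) (?q (Suc 0) 1))"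
      using mk[of 0 "- (1/2)"] mk[of "Suc 0" "1/2"] mk[of 2 0] mk[of 0 "1/2"] mk[of "Suc 0" "- (1/2)"]
      by (simp_all add: qw qe)
    have g1: "req (gsymb D (arc ?C) (Complex (1/2) (1/4))) (cr (?q 0 3) (?q 2 2) (?q 0 2) (?q 2 3) (\<not> o12) n)"
      using M.old.gsymb_east_west(1)[OF cs, of 2 0 "1/2"] M.old.dsh_top[of "1/2" 2]
      by (simp add: qw qe power2_eq_square not n_def three)
    have g2: "req (gsymb D (arc ?C) (Complex (- (1/2)) (1/4))) (cr (?q 2 1) (?q (Suc 0) 0) (?q 2 0) (?q (Suc 0) 1) (\<not> o31) n)"
      using M.old.gsymb_east_west(1)[OF cs, of "Suc 0" 2 "- (1/2)"] M.old.dsh_top[of "- (1/2)" "Suc 0"]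
      by (simp add: qw qe power2_eq_square not n_def three)
    \<comment> \<open>Strand 2 lies above this crossing, so the shade is taken from the sector
      below, which reaches the bottom side.\<close>
    have g3: "req (gsymb D (arc ?C) (Complex 0 0)) (cr (?q 0 1) (?q (Suc 0) 2) (?q 0 2) (?q (Suc 0) 1) o23 (\<not> n))"
      using M.old.gsymb_east_west(2)[OF cs, of "Suc 0" 0 0] M.old.dsh_bottom[of 0 0]
      by (simp add: qw qe o23_def s_def[symmetric] sn three)
    \<comment> \<open>The cuts agree in both diagrams, so the quarters of the first also name the
      arcs of the second.\<close>
    note ew = M.east_eq[OF cs' cs] M.west_eq[OF cs' cs]
    have h1: "req (gsymb D' (arc ?C) (Complex (1/2) (- (1/4)))) (cr (?q 2 2) (?q (Suc 0) 3) (?q 2 3) (?q (Suc 0) 2) (\<not> o31) (\<not> n))"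
      using M.new.gsymb_east_west(2)[OF cs', of "Suc 0" 2 "1/2"] M.new.dsh_bottom[of "1/2" "Suc 0"]
      by (simp add: ew M.strand_cuts_eq qw qe power2_eq_square not s' sn three)
    have h2: "req (gsymb D' (arc ?C) (Complex 0 0)) (cr (?q 0 2) (?q (Suc 0) 1) (?q 0 1) (?q (Suc 0) 2) o23 n)"
      using M.new.gsymb_east_west(1)[OF cs', of "Suc 0" 0 0] M.new.dsh_top[of 0 0]
      by (simp add: ew M.strand_cuts_eq qw qe o23_def n' three)
    have h3: "req (gsymb D' (arc ?C) (Complex (- (1/2)) (- (1/4)))) (cr (?q 0 0) (?q 2 1) (?q 0 1) (?q 2 0) (\<not> o12) (\<not> n))"
      using M.new.gsymb_east_west(2)[OF cs', of 2 0 "- (1/2)"] M.new.dsh_bottom[of "- (1/2)" 2]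
      by (simp add: ew M.strand_cuts_eq qw qe power2_eq_square not s' sn three)
    let ?A = "[cr (?q 0 3) (?q 2 2) (?q 0 2) (?q 2 3) (\<not> o12) n, cr (?q 2 1) (?q (Suc 0) 0) (?q 2 0) (?q (Suc 0) 1) (\<not> o31) n,
      cr (?q 0 1) (?q (Suc 0) 2) (?q 0 2) (?q (Suc 0) 1) o23 (\<not> n),
      Con (?q 0 0) (?q 0 1), Con (?q (Suc 0) 2) (?q (Suc 0) 3), Con (?q 2 1) (?q 2 2)]"
    let ?B = "[cr (?q 2 2) (?q (Suc 0) 3) (?q 2 3) (?q (Suc 0) 2) (\<not> o31) (\<not> n), cr (?q 0 2) (?q (Suc 0) 1) (?q 0 1) (?q (Suc 0) 2) o23 n,
      cr (?q 0 0) (?q 2 1) (?q 0 1) (?q 2 0) (\<not> o12) (\<not> n),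
      Con (?q 0 2) (?q 0 3), Con (?q (Suc 0) 0) (?q (Suc 0) 1), Con (?q 2 1) (?q 2 2)]"
    have "sim ((map (gsymb D (arc ?C)) ?vs @ map (\<lambda>(k, x). M.mark k x) ?ks) @ P) (?A @ P)"
      using bal g1 g2 g3 m1 by (intro sim_req) (auto simp: list_all2_refl)
    also have "sim (?A @ P) (?B @ P)"
      using calculation by (intro R3_marked[OF qd cyc]) (simp only: sim_def)
    also have "sim (?B @ P) ((map (gsymb D' (arc ?C)) ?vs' @ map (\<lambda>(k, x). M.mark k x) ?ks') @ P)"
      using calculation h1[THEN req_sym] h2[THEN req_sym] h3[THEN req_sym] m1[THEN req_sym]
      by (intro sim_req) (auto simp: sim_def list_all2_refl)
    finally show "sim ((map (gsymb D (arc ?C)) ?vs @ map (\<lambda>(k, x). M.mark k x) ?ks) @ P)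
      ((map (gsymb D' (arc ?C)) ?vs' @ map (\<lambda>(k, x). M.mark k x) ?ks') @ P)" .
  qed simp_all
qed

text \<open>A step of the generated equivalence may run either way, which symmetry of
  \<open>veq\<close> accommodates.\<close>

theorem veq_regular_isotopic:
  assumes "regular_isotopic D D'"
  shows "veq (state_sum D) (state_sum D')"
  using assms unfolding regular_isotopic_def
proof (induction rule: equivclp_induct)
  case (step y z)
  have "veq (state_sum a) (state_sum b)" if "planar_isotopic a b \<or> reidemeister2 a b \<or> reidemeister3 a b" for a b
    using that veq_reidemeister2 veq_reidemeister3 state_sum_planar_isotopic by fastforce
  then have "veq (state_sum y) (state_sum z)" using step.hyps veq_sym by blast
  with step.IH show ?case by (rule veq_trans)
qed simp

theorem mainTheorem1:
  fixes Dp Dq :: shaded_diagram and p q :: "int vse_poly"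
  assumes "shaded_link_diagram Dp" and "shaded_link_diagram Dq"
    and "p = state_sum Dp" and "q = state_sum Dq"
    and "regular_isotopic Dp Dq"
  shows "eta_inf p = eta_inf q"
proof (rule eta_inf_eqI)
  show "rat_poly p - rat_poly q \<in> vse_ideal"
    using veq_regular_isotopic[OF assms(5)] assms(3,4) by (simp add: veq_def)
qed

end
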